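(* Let $N_1=\begin{pmatrix}0&1\\1&0\end{pmatrix}$ and $N_2=\begin{pmatrix}1&-1\\0&-1\end{pmatrix}$, so that $N_1N_2=\begin{pmatrix}0&-1\\1&-1\end{pmatrix}$, let $I_2$ be the $2\times 2$ identity matrix, and let $G_6$ be the subgroup of $SL_2(\mathbb{Z})$ generated by $N_1N_2$ and $-I_2$. Let $G$ be the subgroup consisting of the matrices $N=\begin{pmatrix} n_1&n_2\\ n_3&n_4\end{pmatrix}\in SL_2(\mathbb{Z})$ such that for all triples $(\lambda_1,\lambda_2,\lambda_3)$ and $(\mu_1,\mu_2,\mu_3)$ of complex numbers for which there are integers $m_1,m_2\in\mathbb{Z}$ with $$(-\lambda_1+\lambda_3)n_1+(-\lambda_2+\lambda_3)n_2=m_1+(-\mu_1+\mu_3),$$ $$(-\lambda_1+\lambda_3)n_3+(-\lambda_2+\lambda_3)n_4=m_2+(-\mu_2+\mu_3),$$ the algebras $A(a)$ and $A(b)$ are Morita equivalent, where $a=(h-\lambda_1)(h-\lambda_2)(h-\lambda_3)$ and $b=(h-\mu_1)(h-\mu_2)(h-\mu_3)$. Then the matrices $N_1N_2$ and $-I_2$ generate $G$; that is, $G=G_6$.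
   Context: The base field is $\mathbb{C}$. For $a\in\mathbb{C}[h]$, $A(a)$ denotes the (classical) generalized Weyl algebra: the $\mathbb{C}$-algebra generated over $\mathbb{C}[h]$ by two generators $x,y$ subject to $xh=(h-1)x$, $yh=(h+1)y$, $yx=a(h)$, $xy=a(h-1)$. Morita equivalence is understood as $\mathbb{C}$-linear.
   Formalization: In the definition of G only pairs with A(a) and A(b) both simple are considered; without this G is empty (λ=(0,0,0), μ=(0,1,2)). Morita equivalence is taken between categories of modules inside any fixed universe of at least continuum size. *)

theory Defs
  imports
    "HOL-Analysis.Analysis"
    "HOL-Algebra.QuotRing"
    "HOL-Algebra.Module"
    "HOL-Algebra.Generated_Groups"
    "HOL-Computational_Algebra.Polynomial"
    "HOL-Library.Poly_Mapping"
begin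

section \<open>The free complex algebra on three letters\<close>

datatype gwa_letter = Letter_h | Letter_x | Letter_y

datatype gwa_word = Word "gwa_letter list"

instantiation gwa_word :: monoid_add
begin

definition zero_gwa_word :: gwa_word where "0 = Word []"

fun plus_gwa_word :: "gwa_word \<Rightarrow> gwa_word \<Rightarrow> gwa_word" where
  "Word u + Word v = Word (u @ v)"

instance
proof
  fix a b c :: gwa_word
  show "a + b + c = a + (b + c)" by (cases a; cases b; cases c) simp
  show "0 + a = a" by (cases a) (simp add: zero_gwa_word_def)
  show "a + 0 = a" by (cases a) (simp add: zero_gwa_word_def)
qed

end

text \<open>
  The product of \<^typ>\<open>gwa_word \<Rightarrow>\<^sub>0 complex\<close> is convolution along
  concatenation of words, so this type is the free algebra on the letters
  \<open>h\<close>, \<open>x\<close>, \<open>y\<close>.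
\<close>

type_synonym free_alg = "gwa_word \<Rightarrow>\<^sub>0 complex"

definition free_const :: "complex \<Rightarrow> free_alg" where
  "free_const c = Poly_Mapping.single 0 c"

definition free_gen :: "gwa_letter \<Rightarrow> free_alg" where
  "free_gen l = Poly_Mapping.single (Word [l]) 1"

definition free_eval :: "complex poly \<Rightarrow> free_alg \<Rightarrow> free_alg" where
  "free_eval p z = (\<Sum>i\<le>degree p. free_const (coeff p i) * z ^ i)"

definition free_ring :: "free_alg ring" where
  "free_ring = \<lparr>carrier = UNIV, mult = (*), one = 1, zero = 0, add = (+)\<rparr>"


section \<open>Classical generalized Weyl algebras\<close>

definition gwa_relations :: "complex poly \<Rightarrow> free_alg set" where
  "gwa_relations a =
     (let h = free_gen Letter_h; x = free_gen Letter_x; y = free_gen Letter_y in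
       {x * h - (h - 1) * x, y * h - (h + 1) * y,
        y * x - free_eval a h, x * y - free_eval a (h - 1)})"

definition gwa_ideal :: "complex poly \<Rightarrow> free_alg set" where
  "gwa_ideal a = genideal free_ring (gwa_relations a)"

text \<open>
  A complex algebra is a (not necessarily commutative) ring together with an action
  of the complex numbers, packed into the record type \<^typ>\<open>(complex, 'a) module\<close>.
\<close>

definition gwa :: "complex poly \<Rightarrow> (complex, free_alg set) module" where
  "gwa a = (let Q = free_ring Quot gwa_ideal a in
     ring.extend Q (module.fields
       (\<lambda>c u. (gwa_ideal a +>\<^bsub>free_ring\<^esub> free_const c) \<otimes>\<^bsub>Q\<^esub> u)))"

definition simple_algebra :: "(complex, 'a) module \<Rightarrow> bool" where
  "simple_algebra A \<longleftrightarrow> ring A \<and> \<one>\<^bsub>A\<^esub> \<noteq> \<zero>\<^bsub>A\<^esub> \<and>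
     (\<forall>I. ideal I A \<longrightarrow> I = {\<zero>\<^bsub>A\<^esub>} \<or> I = carrier A)"


section \<open>Modules over noncommutative algebras and Morita equivalence\<close>

text \<open>
  The axioms are those of the library locale \<^locale>\<open>module\<close>, except that the base
  ring need not be commutative.  The multiplication and unit fields of a module \<open>M\<close>
  carry no information.
\<close>

definition left_module :: "(complex, 'a) module \<Rightarrow> ('a, 'u) module \<Rightarrow> bool" where
  "left_module A M \<longleftrightarrow> ring A \<and> abelian_group M \<and>
     (\<forall>r\<in>carrier A. \<forall>m\<in>carrier M. r \<odot>\<^bsub>M\<^esub> m \<in> carrier M) \<and>
     (\<forall>r\<in>carrier A. \<forall>s\<in>carrier A. \<forall>m\<in>carrier M.
        (r \<oplus>\<^bsub>A\<^esub> s) \<odot>\<^bsub>M\<^esub> m = r \<odot>\<^bsub>M\<^esub> m \<oplus>\<^bsub>M\<^esub> s \<odot>\<^bsub>M\<^esub> m) \<and>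
     (\<forall>r\<in>carrier A. \<forall>m\<in>carrier M. \<forall>n\<in>carrier M.
        r \<odot>\<^bsub>M\<^esub> (m \<oplus>\<^bsub>M\<^esub> n) = r \<odot>\<^bsub>M\<^esub> m \<oplus>\<^bsub>M\<^esub> r \<odot>\<^bsub>M\<^esub> n) \<and>
     (\<forall>r\<in>carrier A. \<forall>s\<in>carrier A. \<forall>m\<in>carrier M.
        (r \<otimes>\<^bsub>A\<^esub> s) \<odot>\<^bsub>M\<^esub> m = r \<odot>\<^bsub>M\<^esub> (s \<odot>\<^bsub>M\<^esub> m)) \<and>
     (\<forall>m\<in>carrier M. \<one>\<^bsub>A\<^esub> \<odot>\<^bsub>M\<^esub> m = m)"

text \<open>
  Morphisms are extensional functions, so that equality of morphisms is equality of
  functions.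
\<close>

definition lmod_hom ::
  "(complex, 'a) module \<Rightarrow> ('a, 'u) module \<Rightarrow> ('a, 'u) module \<Rightarrow> ('u \<Rightarrow> 'u) set" where
  "lmod_hom A M N = {f \<in> carrier M \<rightarrow>\<^sub>E carrier N.
     (\<forall>m\<in>carrier M. \<forall>n\<in>carrier M. f (m \<oplus>\<^bsub>M\<^esub> n) = f m \<oplus>\<^bsub>N\<^esub> f n) \<and>
     (\<forall>r\<in>carrier A. \<forall>m\<in>carrier M. f (r \<odot>\<^bsub>M\<^esub> m) = r \<odot>\<^bsub>N\<^esub> f m)}"

definition lmod_id :: "('a, 'u) module \<Rightarrow> 'u \<Rightarrow> 'u" where
  "lmod_id M = (\<lambda>m\<in>carrier M. m)"

definition lmod_add ::
  "('a, 'u) module \<Rightarrow> ('a, 'u) module \<Rightarrow> ('u \<Rightarrow> 'u) \<Rightarrow> ('u \<Rightarrow> 'u) \<Rightarrow> 'u \<Rightarrow> 'u" where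
  "lmod_add M N f g = (\<lambda>m\<in>carrier M. f m \<oplus>\<^bsub>N\<^esub> g m)"

definition lmod_scale ::
  "(complex, 'a) module \<Rightarrow> ('a, 'u) module \<Rightarrow> ('a, 'u) module \<Rightarrow> complex \<Rightarrow> ('u \<Rightarrow> 'u) \<Rightarrow> 'u \<Rightarrow> 'u"
  where
  "lmod_scale A M N c f = (\<lambda>m\<in>carrier M. (c \<odot>\<^bsub>A\<^esub> \<one>\<^bsub>A\<^esub>) \<odot>\<^bsub>N\<^esub> f m)"

definition lmod_iso ::
  "(complex, 'a) module \<Rightarrow> ('a, 'u) module \<Rightarrow> ('a, 'u) module \<Rightarrow> ('u \<Rightarrow> 'u) \<Rightarrow> bool" where
  "lmod_iso A M N f \<longleftrightarrow> f \<in> lmod_hom A M N \<and>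
     (\<exists>g\<in>lmod_hom A N M. compose (carrier M) g f = lmod_id M \<and>
                          compose (carrier N) f g = lmod_id N)"

text \<open>
  A functor consists of an object map \<open>F\<close> and a map \<open>F'\<close> on morphisms; the latter
  takes source and target as arguments because a function does not determine its
  codomain.  The target algebra is the second one.
\<close>

definition linear_functor ::
  "(complex, 'a) module \<Rightarrow> (complex, 'b) module \<Rightarrow>
   (('a, 'u) module \<Rightarrow> ('b, 'u) module) \<Rightarrow>
   (('a, 'u) module \<Rightarrow> ('a, 'u) module \<Rightarrow> ('u \<Rightarrow> 'u) \<Rightarrow> ('u \<Rightarrow> 'u)) \<Rightarrow> bool" where
  "linear_functor A B F F' \<longleftrightarrow>
     (\<forall>M. left_module A M \<longrightarrow> left_module B (F M)) \<and>
     (\<forall>M N f. left_module A M \<and> left_module A N \<and> f \<in> lmod_hom A M N \<longrightarrow>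
        F' M N f \<in> lmod_hom B (F M) (F N)) \<and>
     (\<forall>M. left_module A M \<longrightarrow> F' M M (lmod_id M) = lmod_id (F M)) \<and>
     (\<forall>L M N f g. left_module A L \<and> left_module A M \<and> left_module A N \<and>
        f \<in> lmod_hom A L M \<and> g \<in> lmod_hom A M N \<longrightarrow>
        F' L N (compose (carrier L) g f) = compose (carrier (F L)) (F' M N g) (F' L M f)) \<and>
     (\<forall>M N f g. left_module A M \<and> left_module A N \<and>
        f \<in> lmod_hom A M N \<and> g \<in> lmod_hom A M N \<longrightarrow>
        F' M N (lmod_add M N f g) = lmod_add (F M) (F N) (F' M N f) (F' M N g)) \<and>
     (\<forall>M N f c. left_module A M \<and> left_module A N \<and> f \<in> lmod_hom A M N \<longrightarrow>
        F' M N (lmod_scale A M N c f) = lmod_scale B (F M) (F N) c (F' M N f))"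

text \<open>\<open>G \<circ> F\<close> is naturally isomorphic to the identity functor on modules over \<open>A\<close>.\<close>

definition inverse_up_to_iso ::
  "(complex, 'a) module \<Rightarrow>
   (('a, 'u) module \<Rightarrow> ('b, 'u) module) \<Rightarrow>
   (('a, 'u) module \<Rightarrow> ('a, 'u) module \<Rightarrow> ('u \<Rightarrow> 'u) \<Rightarrow> ('u \<Rightarrow> 'u)) \<Rightarrow>
   (('b, 'u) module \<Rightarrow> ('a, 'u) module) \<Rightarrow>
   (('b, 'u) module \<Rightarrow> ('b, 'u) module \<Rightarrow> ('u \<Rightarrow> 'u) \<Rightarrow> ('u \<Rightarrow> 'u)) \<Rightarrow> bool" where
  "inverse_up_to_iso A F F' G G' \<longleftrightarrow>
     (\<exists>t. (\<forall>M. left_module A M \<longrightarrow> lmod_iso A M (G (F M)) (t M)) \<and>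
          (\<forall>M N f. left_module A M \<and> left_module A N \<and> f \<in> lmod_hom A M N \<longrightarrow>
             compose (carrier M) (t N) f =
             compose (carrier M) (G' (F M) (F N) (F' M N f)) (t M)))"

text \<open>
  Complex-linear equivalence of the categories of left modules.  The type
  \<^typ>\<open>'u\<close> is the universe: the objects are the modules whose carrier is a subset
  of it.  It has to be at least as large as the algebras, otherwise
  it may not contain enough modules to tell algebras apart.
\<close>

definition morita_equivalent ::
  "'u itself \<Rightarrow> (complex, 'a) module \<Rightarrow> (complex, 'b) module \<Rightarrow> bool" where
  "morita_equivalent U A B \<longleftrightarrow>
     (\<exists>(F :: ('a, 'u) module \<Rightarrow> ('b, 'u) module) F' G G'.
        linear_functor A B F F' \<and> linear_functor B A G G' \<and>
        inverse_up_to_iso A F F' G G' \<and> inverse_up_to_iso B G G' F F')"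


section \<open>The special linear group of degree two over the integers\<close>

definition SL2Z :: "(int ^ 2 ^ 2) monoid" where
  "SL2Z = \<lparr>carrier = {N. det N = 1}, mult = (**), one = mat 1\<rparr>"


section \<open>Basic facts\<close>

lemma free_ring_simps [simp]:
  "carrier free_ring = UNIV" "mult free_ring = (*)" "one free_ring = 1"
  "zero free_ring = 0" "add free_ring = (+)"
  by (simp_all add: free_ring_def)

lemma ring_free_ring: "ring free_ring"
proof (rule ringI)
  show "abelian_group free_ring"
  proof (rule abelian_groupI)
    fix z :: free_alg
    show "\<exists>w\<in>carrier free_ring. w \<oplus>\<^bsub>free_ring\<^esub> z = \<zero>\<^bsub>free_ring\<^esub>"
      by (rule bexI[of _ "- z"]) simp_all
  qed (simp_all add: algebra_simps)
  show "monoid free_ring"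
    by (rule monoidI) (simp_all add: algebra_simps)
qed (simp_all add: algebra_simps)

lemma ideal_gwa_ideal: "ideal (gwa_ideal a) free_ring"
  unfolding gwa_ideal_def by (rule ring.genideal_ideal[OF ring_free_ring]) simp

lemma gwa_simps [simp]:
  "carrier (gwa a) = carrier (free_ring Quot gwa_ideal a)"
  "mult (gwa a) = mult (free_ring Quot gwa_ideal a)"
  "one (gwa a) = one (free_ring Quot gwa_ideal a)"
  "zero (gwa a) = zero (free_ring Quot gwa_ideal a)"
  "add (gwa a) = add (free_ring Quot gwa_ideal a)"
  "smult (gwa a) = (\<lambda>c u. (gwa_ideal a +>\<^bsub>free_ring\<^esub> free_const c)
     \<otimes>\<^bsub>free_ring Quot gwa_ideal a\<^esub> u)"
  by (simp_all add: gwa_def Let_def ring.defs monoid.defs partial_object.defs module.defs)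

lemma ring_gwa: "ring (gwa a)"
proof -
  interpret Q: ring "free_ring Quot gwa_ideal a"
    by (rule ideal.quotient_is_ring[OF ideal_gwa_ideal])
  show ?thesis
  proof (rule ringI)
    show "abelian_group (gwa a)"
    proof (rule abelian_groupI)
      fix z assume "z \<in> carrier (gwa a)"
      then show "\<exists>w\<in>carrier (gwa a). w \<oplus>\<^bsub>gwa a\<^esub> z = \<zero>\<^bsub>gwa a\<^esub>"
        using Q.l_neg by (auto intro!: bexI[of _ "\<ominus>\<^bsub>free_ring Quot gwa_ideal a\<^esub> z"])
    qed (simp_all add: Q.a_ac)
    show "monoid (gwa a)"
      by (rule monoidI) (simp_all add: Q.m_assoc)
  qed (simp_all add: Q.l_distr Q.r_distr)
qed

lemma free_const_central: "free_const c * z = z * free_const c"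
proof (induction z rule: update_induct)
  case const
  then show ?case by simp
next
  case (update f k v)
  have "Poly_Mapping.update k v f = f + Poly_Mapping.single k v"
    using update.hyps by (intro poly_mapping_eqI)
      (auto simp: lookup_update lookup_add lookup_single in_keys_iff)
  then show ?case
    using update.IH
    by (simp add: distrib_left distrib_right free_const_def mult_single mult.commute)
qed

lemma N1_N2_product:
  "(vector [vector [0, 1], vector [1, 0]] :: int ^ 2 ^ 2) **
   (vector [vector [1, -1], vector [0, -1]] :: int ^ 2 ^ 2)
     = (vector [vector [0, -1], vector [1, -1]] :: int ^ 2 ^ 2)"
  by (simp add: vec_eq_iff forall_2 matrix_matrix_mult_def sum_2)

lemma group_SL2Z: "group SL2Z"
proof (rule groupI)
  fix N assume N: "N \<in> carrier SL2Z"
  define M :: "int ^ 2 ^ 2"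
    where "M = vector [vector [N$2$2, - N$1$2], vector [- N$2$1, N$1$1]]"
  have "det N = 1" using N by (simp add: SL2Z_def)
  then have d: "N$1$1 * N$2$2 - N$1$2 * N$2$1 = 1" by (simp add: det_2)
  have "det M = 1" using d by (simp add: M_def det_2 algebra_simps)
  moreover have "M ** N = mat 1"
    using d by (simp add: M_def vec_eq_iff forall_2 matrix_matrix_mult_def sum_2 mat_def
        algebra_simps)
  ultimately show "\<exists>y\<in>carrier SL2Z. y \<otimes>\<^bsub>SL2Z\<^esub> N = \<one>\<^bsub>SL2Z\<^esub>"
    by (auto simp: SL2Z_def)
qed (auto simp: SL2Z_def det_mul matrix_mul_assoc)

end

theory Submission
  imports Defs "HOL-Computational_Algebra.Fundamental_Theorem_Algebra"
begin

text \<open>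
  Put \<open>u = \<lambda>\<^sub>3 - \<lambda>\<^sub>1\<close> and \<open>v = \<lambda>\<^sub>3 - \<lambda>\<^sub>2\<close>.  The matrix acts on the vector \<open>(u, v)\<close>, and the
  integers \<open>m\<^sub>1\<close>, \<open>m\<^sub>2\<close> amount to moving roots of \<open>b\<close> by integers.  The polynomial \<open>a\<close> has
  a multiple root exactly when \<open>(u, v)\<close> lies on one of the three walls \<open>u = 0\<close>, \<open>v = 0\<close>, \<open>u = v\<close>.
  The group \<open>G\<^sub>6\<close> consists of the six matrices \<open>\<plusminus>1\<close>, \<open>\<plusminus>M\<close>, \<open>\<plusminus>M\<^sup>2\<close> with \<open>M = N\<^sub>1 N\<^sub>2\<close>, and these are exactly the
  matrices of determinant one that map each wall to a wall (\<open>wall_preserving_six\<close>).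

  If \<open>N\<close> is not one of the six, some integer vector \<open>w\<close> on a wall has an image off the walls.
  Taking \<open>-\<i> w\<close> and \<open>-\<i> (N w)\<close> as parameters gives an \<open>a\<close> with a double root and a \<open>b\<close> with
  distinct roots; all differences of roots are imaginary, so no two roots differ by a nonzero
  integer and both algebras are simple (\<open>gwa_simple\<close>).  They are told apart by heredity,
  in the form of the existence of a projective separator all of whose subobjects are projective,
  which is a property of the category (\<open>hereditary_separator_morita\<close>).  For simple roots
  the regular module is such a separator: every left ideal has a finite dual basis
  (\<open>left_ideal_dual_basis\<close>), because it is isomorphic to one that contains a nonzero polynomial,
  and such ideals are reduced to those containing some \<open>h - \<alpha>\<close>, which are explicit.  At a double
  root \<open>\<mu>\<close> there are weight modules \<open>S\<close> and \<open>K\<close> and nonsplit extensions of \<open>S\<close> by \<open>K\<close> and of \<open>K\<close>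
  by \<open>S\<close>, glued at the weights \<open>\<mu>\<close> and \<open>\<mu> + 1\<close>, whose product in \<open>Ext\<^sup>2(S, S)\<close> does not vanish,
  so that heredity fails (\<open>double_root_no_hereditary_separator\<close>).

  If \<open>N\<close> is one of the six, then up to integers an affine map \<open>z \<mapsto> z + c\<close> or \<open>z \<mapsto> c - z\<close> turns
  the roots of \<open>b\<close> into the roots of \<open>a\<close> (\<open>six_entries_affine\<close>).  Translations of \<open>h\<close> and the
  reflection of \<open>h\<close> that exchanges \<open>x\<close> and \<open>y\<close> are isomorphisms, so what remains is to move roots by
  integers.  All these algebras act by difference operators on functions of one complex variable,
  and each is the ring of all difference operators that respect a prescribed order of vanishing at
  every point (\<open>shift_alg_latt\<close>).  The operators that respect a pair of such prescriptions form
  bimodules, moving roots by integers changes the prescription at finitely many points only, and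
  therefore the products of the bimodules are nonzero two-sided ideals.  Simplicity makes these
  ideals equal to the whole algebras, which is a Morita context (\<open>affine_roots_morita\<close>).
\<close>

section \<open>The category of modules in a universe\<close>

lemma left_moduleD:
  assumes "left_module A M"
  shows "ring A" "abelian_group M"
    "\<And>r m. r \<in> carrier A \<Longrightarrow> m \<in> carrier M \<Longrightarrow> r \<odot>\<^bsub>M\<^esub> m \<in> carrier M"
    "\<And>r s m. r \<in> carrier A \<Longrightarrow> s \<in> carrier A \<Longrightarrow> m \<in> carrier M \<Longrightarrow>
       (r \<oplus>\<^bsub>A\<^esub> s) \<odot>\<^bsub>M\<^esub> m = r \<odot>\<^bsub>M\<^esub> m \<oplus>\<^bsub>M\<^esub> s \<odot>\<^bsub>M\<^esub> m"
    "\<And>r m n. r \<in> carrier A \<Longrightarrow> m \<in> carrier M \<Longrightarrow> n \<in> carrier M \<Longrightarrow>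
       r \<odot>\<^bsub>M\<^esub> (m \<oplus>\<^bsub>M\<^esub> n) = r \<odot>\<^bsub>M\<^esub> m \<oplus>\<^bsub>M\<^esub> r \<odot>\<^bsub>M\<^esub> n"
    "\<And>r s m. r \<in> carrier A \<Longrightarrow> s \<in> carrier A \<Longrightarrow> m \<in> carrier M \<Longrightarrow>
       (r \<otimes>\<^bsub>A\<^esub> s) \<odot>\<^bsub>M\<^esub> m = r \<odot>\<^bsub>M\<^esub> (s \<odot>\<^bsub>M\<^esub> m)"
    "\<And>m. m \<in> carrier M \<Longrightarrow> \<one>\<^bsub>A\<^esub> \<odot>\<^bsub>M\<^esub> m = m"
  using assms unfolding left_module_def by blast+

lemma (in abelian_group) add_idem_zero:
  assumes "x \<in> carrier G" "x \<oplus> x = x"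
  shows "x = \<zero>"
proof -
  have "x = x \<oplus> x \<oplus> \<ominus> x" using assms(1) by (simp add: a_assoc r_neg)
  then show ?thesis using assms by (simp add: r_neg)
qed

lemma left_module_smult_zero:
  assumes "left_module A M" "r \<in> carrier A"
  shows "r \<odot>\<^bsub>M\<^esub> \<zero>\<^bsub>M\<^esub> = \<zero>\<^bsub>M\<^esub>"
proof -
  interpret M: abelian_group M by (rule left_moduleD(2)[OF assms(1)])
  have "r \<odot>\<^bsub>M\<^esub> \<zero>\<^bsub>M\<^esub> \<oplus>\<^bsub>M\<^esub> r \<odot>\<^bsub>M\<^esub> \<zero>\<^bsub>M\<^esub> = r \<odot>\<^bsub>M\<^esub> \<zero>\<^bsub>M\<^esub>"
    using left_moduleD(5)[OF assms(1,2), of "\<zero>\<^bsub>M\<^esub>" "\<zero>\<^bsub>M\<^esub>"] by simp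
  then show ?thesis
    by (intro M.add_idem_zero left_moduleD(3)[OF assms]) auto
qed

lemma left_module_zero_smult:
  assumes "left_module A M" "m \<in> carrier M"
  shows "\<zero>\<^bsub>A\<^esub> \<odot>\<^bsub>M\<^esub> m = \<zero>\<^bsub>M\<^esub>"
proof -
  interpret M: abelian_group M by (rule left_moduleD(2)[OF assms(1)])
  interpret A: ring A by (rule left_moduleD(1)[OF assms(1)])
  have "\<zero>\<^bsub>A\<^esub> \<odot>\<^bsub>M\<^esub> m \<oplus>\<^bsub>M\<^esub> \<zero>\<^bsub>A\<^esub> \<odot>\<^bsub>M\<^esub> m = \<zero>\<^bsub>A\<^esub> \<odot>\<^bsub>M\<^esub> m"
    using left_moduleD(4)[OF assms(1) A.zero_closed A.zero_closed assms(2)] by simp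
  then show ?thesis
    by (intro M.add_idem_zero left_moduleD(3)[OF assms(1) A.zero_closed assms(2)])
qed

lemma lmod_homD:
  assumes "f \<in> lmod_hom A M N"
  shows "m \<in> carrier M \<Longrightarrow> f m \<in> carrier N"
    "m \<in> carrier M \<Longrightarrow> n \<in> carrier M \<Longrightarrow> f (m \<oplus>\<^bsub>M\<^esub> n) = f m \<oplus>\<^bsub>N\<^esub> f n"
    "r \<in> carrier A \<Longrightarrow> m \<in> carrier M \<Longrightarrow> f (r \<odot>\<^bsub>M\<^esub> m) = r \<odot>\<^bsub>N\<^esub> f m"
    "f \<in> extensional (carrier M)"
  using assms unfolding lmod_hom_def by (auto simp: PiE_iff)

lemma lmod_homI:
  assumes "\<And>m. m \<in> carrier M \<Longrightarrow> f m \<in> carrier N"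
    "\<And>m n. m \<in> carrier M \<Longrightarrow> n \<in> carrier M \<Longrightarrow> f (m \<oplus>\<^bsub>M\<^esub> n) = f m \<oplus>\<^bsub>N\<^esub> f n"
    "\<And>r m. r \<in> carrier A \<Longrightarrow> m \<in> carrier M \<Longrightarrow> f (r \<odot>\<^bsub>M\<^esub> m) = r \<odot>\<^bsub>N\<^esub> f m"
    "f \<in> extensional (carrier M)"
  shows "f \<in> lmod_hom A M N"
  using assms unfolding lmod_hom_def by (auto simp: PiE_iff)

lemma lmod_hom_restrictI:
  assumes "left_module A M"
    "\<And>m. m \<in> carrier M \<Longrightarrow> f m \<in> carrier N"
    "\<And>m n. m \<in> carrier M \<Longrightarrow> n \<in> carrier M \<Longrightarrow> f (m \<oplus>\<^bsub>M\<^esub> n) = f m \<oplus>\<^bsub>N\<^esub> f n"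
    "\<And>r m. r \<in> carrier A \<Longrightarrow> m \<in> carrier M \<Longrightarrow> f (r \<odot>\<^bsub>M\<^esub> m) = r \<odot>\<^bsub>N\<^esub> f m"
  shows "restrict f (carrier M) \<in> lmod_hom A M N"
proof -
  interpret M: abelian_group M by (rule left_moduleD(2)[OF assms(1)])
  show ?thesis
    using assms left_moduleD(3)[OF assms(1)] by (intro lmod_homI) auto
qed

lemma lmod_hom_zero:
  assumes "f \<in> lmod_hom A M N" "left_module A M" "left_module A N"
  shows "f \<zero>\<^bsub>M\<^esub> = \<zero>\<^bsub>N\<^esub>"
proof -
  interpret M: abelian_group M by (rule left_moduleD(2)[OF assms(2)])
  interpret N: abelian_group N by (rule left_moduleD(2)[OF assms(3)])
  have "f \<zero>\<^bsub>M\<^esub> \<oplus>\<^bsub>N\<^esub> f \<zero>\<^bsub>M\<^esub> = f \<zero>\<^bsub>M\<^esub>"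
    using lmod_homD(2)[OF assms(1), of "\<zero>\<^bsub>M\<^esub>" "\<zero>\<^bsub>M\<^esub>"] by simp
  then show ?thesis
    by (intro N.add_idem_zero lmod_homD(1)[OF assms(1)]) auto
qed

lemma lmod_hom_ext:
  assumes "f \<in> lmod_hom A M N" "g \<in> lmod_hom A M N'" "\<And>m. m \<in> carrier M \<Longrightarrow> f m = g m"
  shows "f = g"
  by (rule extensionalityI[of _ "carrier M"]) (use assms lmod_homD(4) in auto)

lemma lmod_hom_compose:
  assumes "left_module A L" "f \<in> lmod_hom A L M" "g \<in> lmod_hom A M N"
  shows "compose (carrier L) g f \<in> lmod_hom A L N"
  unfolding compose_def
  by (rule lmod_hom_restrictI[OF assms(1)]) (use lmod_homD[OF assms(2)] lmod_homD[OF assms(3)] in auto)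

lemma lmod_id_hom: "left_module A M \<Longrightarrow> lmod_id M \<in> lmod_hom A M M"
  unfolding lmod_id_def by (rule lmod_hom_restrictI) auto

lemma lmod_compose_assoc:
  assumes "f \<in> lmod_hom A K L"
  shows "compose (carrier K) h (compose (carrier K) g f)
       = compose (carrier K) (compose (carrier L) h g) f"
  using lmod_homD(1)[OF assms] by (auto simp: compose_def)

lemma lmod_id_left: "f \<in> lmod_hom A M N \<Longrightarrow> compose (carrier M) (lmod_id N) f = f"
  by (rule extensionalityI[of _ "carrier M"]) (auto simp: lmod_id_def compose_def lmod_homD)

lemma lmod_id_right: "f \<in> lmod_hom A M N \<Longrightarrow> compose (carrier M) f (lmod_id M) = f"
  by (rule extensionalityI[of _ "carrier M"]) (auto simp: lmod_id_def compose_def lmod_homD)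

lemma lmod_isoI_bij:
  assumes "left_module A M" "left_module A N" "f \<in> lmod_hom A M N"
    and "bij_betw f (carrier M) (carrier N)"
  shows "lmod_iso A M N f"
proof -
  interpret M: abelian_group M by (rule left_moduleD(2)[OF assms(1)])
  define g where "g = restrict (inv_into (carrier M) f) (carrier N)"
  note bij = assms(4)
  have gf: "g (f m) = m" if "m \<in> carrier M" for m
    using that bij lmod_homD(1)[OF assms(3)] by (simp add: g_def bij_betw_inv_into_left)
  have fg: "f (g n) = n" and gin: "g n \<in> carrier M" if "n \<in> carrier N" for n
    using that bij by (auto simp: g_def bij_betw_inv_into_right bij_betw_def inv_into_into)
  have "g \<in> lmod_hom A N M"
  proof (rule lmod_homI)
    fix m n assume mn: "m \<in> carrier N" "n \<in> carrier N"
    have "g (m \<oplus>\<^bsub>N\<^esub> n) = g (f (g m \<oplus>\<^bsub>M\<^esub> g n))"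
      using mn by (simp add: lmod_homD(2)[OF assms(3)] gin fg)
    then show "g (m \<oplus>\<^bsub>N\<^esub> n) = g m \<oplus>\<^bsub>M\<^esub> g n" using mn by (simp add: gf gin)
  next
    fix r n assume rn: "r \<in> carrier A" "n \<in> carrier N"
    have "g (r \<odot>\<^bsub>N\<^esub> n) = g (f (r \<odot>\<^bsub>M\<^esub> g n))"
      using rn by (simp add: lmod_homD(3)[OF assms(3)] gin fg)
    then show "g (r \<odot>\<^bsub>N\<^esub> n) = r \<odot>\<^bsub>M\<^esub> g n" using rn left_moduleD(3)[OF assms(1)]
      by (simp add: gf gin)
  qed (auto simp: gin, simp add: g_def)
  moreover have "compose (carrier M) g f = lmod_id M" "compose (carrier N) f g = lmod_id N"
    by (auto simp: compose_def lmod_id_def gf fg intro!: restrict_ext)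
  ultimately show ?thesis using assms(3) unfolding lmod_iso_def by blast
qed

lemma lmod_isoE:
  assumes "lmod_iso A M N f"
  obtains g where "f \<in> lmod_hom A M N" "g \<in> lmod_hom A N M"
    "compose (carrier M) g f = lmod_id M" "compose (carrier N) f g = lmod_id N"
  using assms unfolding lmod_iso_def by blast

lemma lmod_iso_cancel_left:
  assumes "lmod_iso A M N t" "f \<in> lmod_hom A L M" "g \<in> lmod_hom A L M"
    and "compose (carrier L) t f = compose (carrier L) t g"
  shows "f = g"
proof -
  obtain s where s: "compose (carrier M) s t = lmod_id M" using lmod_isoE[OF assms(1)] by metis
  have "compose (carrier L) s (compose (carrier L) t f) = f"
    by (simp add: lmod_compose_assoc[OF assms(2)] s lmod_id_left[OF assms(2)])
  moreover have "compose (carrier L) s (compose (carrier L) t g) = g"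
    by (simp add: lmod_compose_assoc[OF assms(3)] s lmod_id_left[OF assms(3)])
  ultimately show ?thesis using assms(4) by metis
qed

lemma lmod_iso_cancel_right:
  assumes "lmod_iso A L M t" "f \<in> lmod_hom A M N" "g \<in> lmod_hom A M N"
    and "compose (carrier L) f t = compose (carrier L) g t"
  shows "f = g"
proof -
  obtain s where s: "compose (carrier M) t s = lmod_id M" "s \<in> lmod_hom A M L"
    using lmod_isoE[OF assms(1)] by metis
  have "compose (carrier M) (compose (carrier L) f t) s = f"
    by (simp add: lmod_compose_assoc[OF s(2), symmetric] s lmod_id_right[OF assms(2)])
  moreover have "compose (carrier M) (compose (carrier L) g t) s = g"
    by (simp add: lmod_compose_assoc[OF s(2), symmetric] s lmod_id_right[OF assms(3)])
  ultimately show ?thesis using assms(4) by metis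
qed

section \<open>Transport of structure along a map\<close>

text \<open>With \<open>f\<close> injective this copies a module into another universe; with \<open>f\<close> choosing a representative
  of every coset it is a quotient whose carrier stays inside the universe.\<close>

definition image_module :: "('a, 'v) module \<Rightarrow> ('v \<Rightarrow> 'u) \<Rightarrow> ('a, 'u) module" where
  "image_module M f = (let g = inv_into (carrier M) f in
     \<lparr>carrier = f ` carrier M, mult = undefined, one = undefined, zero = f \<zero>\<^bsub>M\<^esub>,
      add = (\<lambda>u v. f (g u \<oplus>\<^bsub>M\<^esub> g v)), smult = (\<lambda>r u. f (r \<odot>\<^bsub>M\<^esub> g u))\<rparr>)"

definition lmod_congruence :: "(complex, 'a) module \<Rightarrow> ('a, 'v) module \<Rightarrow> ('v \<Rightarrow> 'u) \<Rightarrow> bool" where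
  "lmod_congruence A M f \<longleftrightarrow>
     (\<forall>m\<in>carrier M. \<forall>m'\<in>carrier M. \<forall>n\<in>carrier M. \<forall>n'\<in>carrier M.
        f m = f m' \<longrightarrow> f n = f n' \<longrightarrow> f (m \<oplus>\<^bsub>M\<^esub> n) = f (m' \<oplus>\<^bsub>M\<^esub> n')) \<and>
     (\<forall>r\<in>carrier A. \<forall>m\<in>carrier M. \<forall>m'\<in>carrier M. f m = f m' \<longrightarrow> f (r \<odot>\<^bsub>M\<^esub> m) = f (r \<odot>\<^bsub>M\<^esub> m'))"

lemma lmod_congruence_inj: "inj_on f (carrier M) \<Longrightarrow> lmod_congruence A M f"
  unfolding lmod_congruence_def inj_on_def by blast

lemma image_module:
  assumes M: "left_module A M" and f: "lmod_congruence A M f"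
  shows "left_module A (image_module M f)"
    and "carrier (image_module M f) = f ` carrier M"
    and "\<zero>\<^bsub>image_module M f\<^esub> = f \<zero>\<^bsub>M\<^esub>"
    and "\<And>m n. m \<in> carrier M \<Longrightarrow> n \<in> carrier M \<Longrightarrow>
      f m \<oplus>\<^bsub>image_module M f\<^esub> f n = f (m \<oplus>\<^bsub>M\<^esub> n)"
    and "\<And>r m. r \<in> carrier A \<Longrightarrow> m \<in> carrier M \<Longrightarrow> r \<odot>\<^bsub>image_module M f\<^esub> f m = f (r \<odot>\<^bsub>M\<^esub> m)"
proof -
  interpret M: abelian_group M by (rule left_moduleD(2)[OF M])
  interpret A: ring A by (rule left_moduleD(1)[OF M])
  let ?I = "image_module M f"
  note sm = left_moduleD(3)[OF M]
  show car: "carrier ?I = f ` carrier M" by (simp add: image_module_def Let_def)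
  show zer: "\<zero>\<^bsub>?I\<^esub> = f \<zero>\<^bsub>M\<^esub>" by (simp add: image_module_def Let_def)
  have inv: "inv_into (carrier M) f (f m) \<in> carrier M" "f (inv_into (carrier M) f (f m)) = f m"
    if "m \<in> carrier M" for m
    using that by (auto simp: inv_into_into f_inv_into_f)
  show add: "f m \<oplus>\<^bsub>?I\<^esub> f n = f (m \<oplus>\<^bsub>M\<^esub> n)" if "m \<in> carrier M" "n \<in> carrier M" for m n
  proof -
    have "f (inv_into (carrier M) f (f m) \<oplus>\<^bsub>M\<^esub> inv_into (carrier M) f (f n)) = f (m \<oplus>\<^bsub>M\<^esub> n)"
      using f inv[OF that(1)] inv[OF that(2)] that unfolding lmod_congruence_def by blast
    then show ?thesis by (simp add: image_module_def Let_def)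
  qed
  show smu: "r \<odot>\<^bsub>?I\<^esub> f m = f (r \<odot>\<^bsub>M\<^esub> m)" if "r \<in> carrier A" "m \<in> carrier M" for m r
  proof -
    have "f (r \<odot>\<^bsub>M\<^esub> inv_into (carrier M) f (f m)) = f (r \<odot>\<^bsub>M\<^esub> m)"
      using f inv[OF that(2)] that unfolding lmod_congruence_def by blast
    then show ?thesis by (simp add: image_module_def Let_def)
  qed
  have "abelian_group ?I"
  proof (rule abelian_groupI)
    fix x assume "x \<in> carrier ?I"
    then obtain m where m: "m \<in> carrier M" "x = f m" using car by auto
    then show "\<exists>y\<in>carrier ?I. y \<oplus>\<^bsub>?I\<^esub> x = \<zero>\<^bsub>?I\<^esub>"
      by (intro bexI[of _ "f (\<ominus>\<^bsub>M\<^esub> m)"]) (auto simp: add zer car M.l_neg)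
  qed (auto simp: car add zer M.a_ac)
  then show "left_module A ?I"
    unfolding left_module_def using A.ring_axioms
    by (auto simp: car add smu sm left_moduleD(4-7)[OF M])
qed

definition submodule_on :: "('a, 'v) module \<Rightarrow> 'v set \<Rightarrow> ('a, 'v) module" where
  "submodule_on M S = M\<lparr>carrier := S\<rparr>"

lemma submodule_on:
  assumes M: "left_module A M" and S: "S \<subseteq> carrier M" "\<zero>\<^bsub>M\<^esub> \<in> S"
    "\<And>m n. m \<in> S \<Longrightarrow> n \<in> S \<Longrightarrow> m \<oplus>\<^bsub>M\<^esub> n \<in> S"
    "\<And>r m. r \<in> carrier A \<Longrightarrow> m \<in> S \<Longrightarrow> r \<odot>\<^bsub>M\<^esub> m \<in> S"
  shows "left_module A (submodule_on M S)"
    and "restrict (\<lambda>m. m) S \<in> lmod_hom A (submodule_on M S) M"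
proof -
  interpret M: abelian_group M by (rule left_moduleD(2)[OF M])
  interpret A: ring A by (rule left_moduleD(1)[OF M])
  let ?S = "submodule_on M S"
  have sub: "m \<in> carrier M" if "m \<in> S" for m using S(1) that by auto
  have neg: "\<ominus>\<^bsub>M\<^esub> m \<in> S" if "m \<in> S" for m
  proof -
    have "(\<ominus>\<^bsub>A\<^esub> \<one>\<^bsub>A\<^esub>) \<odot>\<^bsub>M\<^esub> m \<oplus>\<^bsub>M\<^esub> m = ((\<ominus>\<^bsub>A\<^esub> \<one>\<^bsub>A\<^esub>) \<oplus>\<^bsub>A\<^esub> \<one>\<^bsub>A\<^esub>) \<odot>\<^bsub>M\<^esub> m"
      using sub[OF that] left_moduleD(4,7)[OF M] by simp
    also have "\<dots> = \<zero>\<^bsub>M\<^esub>" using left_module_zero_smult[OF M sub[OF that]] by (simp add: A.l_neg)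
    finally have "(\<ominus>\<^bsub>A\<^esub> \<one>\<^bsub>A\<^esub>) \<odot>\<^bsub>M\<^esub> m = \<ominus>\<^bsub>M\<^esub> m"
      using sub[OF that] left_moduleD(3)[OF M] M.minus_equality by simp
    then show ?thesis using S(4)[OF _ that, of "\<ominus>\<^bsub>A\<^esub> \<one>\<^bsub>A\<^esub>"] by simp
  qed
  have "abelian_group ?S"
  proof (rule abelian_groupI)
    fix x assume "x \<in> carrier ?S"
    then show "\<exists>y\<in>carrier ?S. y \<oplus>\<^bsub>?S\<^esub> x = \<zero>\<^bsub>?S\<^esub>"
      using neg sub by (auto simp: submodule_on_def M.l_neg intro!: bexI[of _ "\<ominus>\<^bsub>M\<^esub> x"])
  qed (use S(2,3) sub in \<open>simp_all add: submodule_on_def M.a_ac\<close>)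
  then show L: "left_module A ?S"
    unfolding left_module_def using A.ring_axioms sub S(4)
    by (auto simp: submodule_on_def left_moduleD(4-7)[OF M])
  have "restrict (\<lambda>m. m) (carrier ?S) \<in> lmod_hom A ?S M"
    by (rule lmod_hom_restrictI[OF L]) (use sub in \<open>auto simp: submodule_on_def\<close>)
  then show "restrict (\<lambda>m. m) S \<in> lmod_hom A ?S M" by (simp add: submodule_on_def)
qed

section \<open>A categorical form of heredity\<close>

text \<open>All notions are phrased by morphisms and composition, with test objects from the same universe, so
  that any equivalence of categories preserves them.\<close>

definition lmod_mono ::
  "(complex, 'a) module \<Rightarrow> ('a, 'u) module \<Rightarrow> ('a, 'u) module \<Rightarrow> ('u \<Rightarrow> 'u) \<Rightarrow> bool" where
  "lmod_mono A M N j \<longleftrightarrow> j \<in> lmod_hom A M N \<and>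
     (\<forall>(L :: ('a, 'u) module) u v. left_module A L \<and> u \<in> lmod_hom A L M \<and> v \<in> lmod_hom A L M \<and>
        compose (carrier L) j u = compose (carrier L) j v \<longrightarrow> u = v)"

definition lmod_epi ::
  "(complex, 'a) module \<Rightarrow> ('a, 'u) module \<Rightarrow> ('a, 'u) module \<Rightarrow> ('u \<Rightarrow> 'u) \<Rightarrow> bool" where
  "lmod_epi A M N g \<longleftrightarrow> g \<in> lmod_hom A M N \<and>
     (\<forall>(L :: ('a, 'u) module) u v. left_module A L \<and> u \<in> lmod_hom A N L \<and> v \<in> lmod_hom A N L \<and>
        compose (carrier M) u g = compose (carrier M) v g \<longrightarrow> u = v)"

definition lmod_projective :: "(complex, 'a) module \<Rightarrow> ('a, 'u) module \<Rightarrow> bool" where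
  "lmod_projective A P \<longleftrightarrow> left_module A P \<and>
     (\<forall>(M :: ('a, 'u) module) (N :: ('a, 'u) module) g f.
        left_module A M \<and> left_module A N \<and> lmod_epi A M N g \<and> f \<in> lmod_hom A P N \<longrightarrow>
        (\<exists>l\<in>lmod_hom A P M. compose (carrier P) g l = f))"

definition lmod_separator :: "(complex, 'a) module \<Rightarrow> ('a, 'u) module \<Rightarrow> bool" where
  "lmod_separator A P \<longleftrightarrow>
     (\<forall>(M :: ('a, 'u) module) (N :: ('a, 'u) module) u v.
        left_module A M \<and> left_module A N \<and> u \<in> lmod_hom A M N \<and> v \<in> lmod_hom A M N \<and> u \<noteq> v \<longrightarrow>
        (\<exists>p\<in>lmod_hom A P M. compose (carrier P) u p \<noteq> compose (carrier P) v p))"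

text \<open>For the regular module the subobjects are the left ideals, so this is left heredity of \<open>A\<close> in a
  form that does not refer to the forgetful functor.\<close>

definition hereditary_separator :: "(complex, 'a) module \<Rightarrow> ('a, 'u) module \<Rightarrow> bool" where
  "hereditary_separator A P \<longleftrightarrow> lmod_projective A P \<and> lmod_separator A P \<and>
     (\<forall>(Q :: ('a, 'u) module) j. left_module A Q \<and> lmod_mono A Q P j \<longrightarrow> lmod_projective A Q)"

lemma surj_imp_lmod_epi:
  fixes M N :: "('a, 'u) module"
  assumes "g \<in> lmod_hom A M N" "g ` carrier M = carrier N"
  shows "lmod_epi A M N g"
  unfolding lmod_epi_def
proof (intro conjI allI impI assms(1), elim conjE)
  fix L :: "('a, 'u) module" and u v
  assume u: "u \<in> lmod_hom A N L" and v: "v \<in> lmod_hom A N L"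
    and eq: "compose (carrier M) u g = compose (carrier M) v g"
  show "u = v"
  proof (rule lmod_hom_ext[OF u v])
    fix n assume "n \<in> carrier N"
    then obtain m where "m \<in> carrier M" "n = g m" using assms(2) by blast
    then show "u n = v n" using fun_cong[OF eq, of m] by (simp add: compose_def)
  qed
qed

lemma inj_imp_lmod_mono:
  fixes M N :: "('a, 'u) module"
  assumes "j \<in> lmod_hom A M N" "inj_on j (carrier M)"
  shows "lmod_mono A M N j"
  unfolding lmod_mono_def
proof (intro conjI allI impI assms(1), elim conjE)
  fix L :: "('a, 'u) module" and u v
  assume u: "u \<in> lmod_hom A L M" and v: "v \<in> lmod_hom A L M"
    and eq: "compose (carrier L) j u = compose (carrier L) j v"
  show "u = v"
  proof (rule lmod_hom_ext[OF u v])
    fix n assume n: "n \<in> carrier L"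
    then have "j (u n) = j (v n)" using fun_cong[OF eq, of n] by (simp add: compose_def)
    then show "u n = v n" using assms(2) n lmod_homD(1)[OF u] lmod_homD(1)[OF v]
      by (simp add: inj_on_eq_iff)
  qed
qed

text \<open>Two maps from the kernel, the inclusion and zero, detect injectivity.\<close>

lemma lmod_mono_inj:
  assumes j: "lmod_mono A M N j" and M: "left_module A M" and N: "left_module A N"
  shows "inj_on j (carrier M)"
proof -
  interpret M: abelian_group M by (rule left_moduleD(2)[OF M])
  interpret N: abelian_group N by (rule left_moduleD(2)[OF N])
  have jh: "j \<in> lmod_hom A M N" using j by (simp add: lmod_mono_def)
  let ?S = "{m \<in> carrier M. j m = \<zero>\<^bsub>N\<^esub>}"
  have S: "left_module A (submodule_on M ?S)"
    "restrict (\<lambda>m. m) ?S \<in> lmod_hom A (submodule_on M ?S) M"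
    using submodule_on[OF M, of ?S] lmod_homD[OF jh] lmod_hom_zero[OF jh M N]
      left_moduleD(3)[OF M] left_module_smult_zero[OF N] by auto
  have z: "restrict (\<lambda>m. \<zero>\<^bsub>M\<^esub>) (carrier (submodule_on M ?S)) \<in> lmod_hom A (submodule_on M ?S) M"
    by (rule lmod_hom_restrictI[OF S(1)]) (auto simp: left_module_smult_zero[OF M])
  have "compose (carrier (submodule_on M ?S)) j (restrict (\<lambda>m. m) ?S)
      = compose (carrier (submodule_on M ?S)) j (restrict (\<lambda>m. \<zero>\<^bsub>M\<^esub>) (carrier (submodule_on M ?S)))"
    by (auto simp: compose_def submodule_on_def lmod_hom_zero[OF jh M N] intro!: restrict_ext)
  then have eq: "restrict (\<lambda>m. m) ?S = restrict (\<lambda>m. \<zero>\<^bsub>M\<^esub>) (carrier (submodule_on M ?S))"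
    using j S z unfolding lmod_mono_def by blast
  have ker: "m = \<zero>\<^bsub>M\<^esub>" if "m \<in> carrier M" "j m = \<zero>\<^bsub>N\<^esub>" for m
    using fun_cong[OF eq, of m] that by (simp add: submodule_on_def)
  show ?thesis
  proof (rule inj_onI)
    fix m n assume mn: "m \<in> carrier M" "n \<in> carrier M" "j m = j n"
    have "j (m \<oplus>\<^bsub>M\<^esub> \<ominus>\<^bsub>M\<^esub> n) = j n \<oplus>\<^bsub>N\<^esub> j (\<ominus>\<^bsub>M\<^esub> n)"
      using mn lmod_homD(2)[OF jh] by simp
    also have "\<dots> = j (n \<oplus>\<^bsub>M\<^esub> \<ominus>\<^bsub>M\<^esub> n)" using mn lmod_homD(2)[OF jh] by simp
    also have "\<dots> = \<zero>\<^bsub>N\<^esub>" using mn lmod_hom_zero[OF jh M N] by (simp add: M.r_neg)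
    finally have "m \<oplus>\<^bsub>M\<^esub> \<ominus>\<^bsub>M\<^esub> n = \<zero>\<^bsub>M\<^esub>" using ker mn by simp
    then show "m = n" using mn M.minus_equality M.minus_minus M.a_inv_closed by metis
  qed
qed

text \<open>Two maps to the cokernel, the projection and zero, detect surjectivity.\<close>

lemma lmod_epi_surj:
  assumes g: "lmod_epi A M N g" and M: "left_module A M" and N: "left_module A N"
  shows "g ` carrier M = carrier N"
proof -
  interpret M: abelian_group M by (rule left_moduleD(2)[OF M])
  interpret N: abelian_group N by (rule left_moduleD(2)[OF N])
  have gh: "g \<in> lmod_hom A M N" using g by (simp add: lmod_epi_def)
  define rel where "rel n n' \<longleftrightarrow> n' \<in> carrier N \<and> (\<exists>m\<in>carrier M. n' = n \<oplus>\<^bsub>N\<^esub> g m)" for n n'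
  have rel_refl: "rel n n" if "n \<in> carrier N" for n
    unfolding rel_def using that lmod_hom_zero[OF gh M N] by (auto intro!: bexI[of _ "\<zero>\<^bsub>M\<^esub>"])
  have neg: "\<ominus>\<^bsub>N\<^esub> g m = g (\<ominus>\<^bsub>M\<^esub> m)" if "m \<in> carrier M" for m
  proof (rule N.minus_equality)
    show "g (\<ominus>\<^bsub>M\<^esub> m) \<oplus>\<^bsub>N\<^esub> g m = \<zero>\<^bsub>N\<^esub>"
      using that lmod_homD(2)[OF gh, of "\<ominus>\<^bsub>M\<^esub> m" m] lmod_hom_zero[OF gh M N] by (simp add: M.l_neg)
  qed (use that lmod_homD(1)[OF gh] in auto)
  have rel_sym: "rel n' n" if r: "rel n n'" "n \<in> carrier N" for n n'
  proof -
    obtain m where m: "m \<in> carrier M" "n' = n \<oplus>\<^bsub>N\<^esub> g m"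
      using r unfolding rel_def by blast
    have "n \<oplus>\<^bsub>N\<^esub> g m \<oplus>\<^bsub>N\<^esub> g (\<ominus>\<^bsub>M\<^esub> m) = n"
      using r(2) lmod_homD(1)[OF gh m(1)]
      by (simp only: neg[OF m(1), symmetric] N.a_assoc N.a_inv_closed N.r_neg N.r_zero)
    then show ?thesis unfolding rel_def m(2) using m(1) r(2) by (metis M.a_inv_closed)
  qed
  have rel_trans: "rel n n''" if r: "rel n n'" "rel n' n''" "n \<in> carrier N" for n n' n''
  proof -
    obtain m m' where m: "m \<in> carrier M" "n' = n \<oplus>\<^bsub>N\<^esub> g m" "m' \<in> carrier M" "n'' = n' \<oplus>\<^bsub>N\<^esub> g m'"
      using r unfolding rel_def by blast
    then have "n'' = n \<oplus>\<^bsub>N\<^esub> g (m \<oplus>\<^bsub>M\<^esub> m')"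
      using that lmod_homD(1,2)[OF gh] by (simp add: N.a_assoc)
    then show ?thesis unfolding rel_def using m that by (auto simp: rel_def)
  qed
  \<comment> \<open>A transversal of the cosets of the image of \<open>g\<close> realises the cokernel inside \<open>N\<close>.\<close>
  define f where "f n = (SOME n'. rel n n')" for n
  have f_rel: "rel n (f n)" if "n \<in> carrier N" for n
    unfolding f_def by (rule someI[of "rel n"], rule rel_refl[OF that])
  have f_in: "f n \<in> carrier N" if "n \<in> carrier N" for n
    using f_rel[OF that] by (simp add: rel_def)
  have f_eq: "f n = f n' \<longleftrightarrow> rel n n'" if n: "n \<in> carrier N" "n' \<in> carrier N" for n n'
  proof
    assume "f n = f n'"
    then show "rel n n'" using f_rel[OF n(1)] f_rel[OF n(2)] rel_sym rel_trans n by metis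
  next
    assume r: "rel n n'"
    then have "rel n = rel n'" using rel_sym rel_trans n by (intro ext) metis
    then show "f n = f n'" by (simp add: f_def)
  qed
  have cong: "lmod_congruence A N f"
    unfolding lmod_congruence_def
  proof (intro conjI ballI impI)
    fix m m' n n' assume c: "m \<in> carrier N" "m' \<in> carrier N" "n \<in> carrier N" "n' \<in> carrier N"
      and "f m = f m'" "f n = f n'"
    then obtain k l where kl: "k \<in> carrier M" "m' = m \<oplus>\<^bsub>N\<^esub> g k" "l \<in> carrier M" "n' = n \<oplus>\<^bsub>N\<^esub> g l"
      by (auto simp: f_eq rel_def)
    then have "m' \<oplus>\<^bsub>N\<^esub> n' = (m \<oplus>\<^bsub>N\<^esub> n) \<oplus>\<^bsub>N\<^esub> g (k \<oplus>\<^bsub>M\<^esub> l)"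
      using c lmod_homD(1,2)[OF gh] by (simp add: N.a_ac)
    then show "f (m \<oplus>\<^bsub>N\<^esub> n) = f (m' \<oplus>\<^bsub>N\<^esub> n')"
      using c kl lmod_homD(1)[OF gh] by (auto simp: f_eq rel_def)
  next
    fix r m m' assume c: "r \<in> carrier A" "m \<in> carrier N" "m' \<in> carrier N" and "f m = f m'"
    then obtain k where kl: "k \<in> carrier M" "m' = m \<oplus>\<^bsub>N\<^esub> g k"
      by (auto simp: f_eq rel_def)
    then have "r \<odot>\<^bsub>N\<^esub> m' = r \<odot>\<^bsub>N\<^esub> m \<oplus>\<^bsub>N\<^esub> g (r \<odot>\<^bsub>M\<^esub> k)"
      using c lmod_homD(1,3)[OF gh] left_moduleD(5)[OF N] by simp
    then show "f (r \<odot>\<^bsub>N\<^esub> m) = f (r \<odot>\<^bsub>N\<^esub> m')"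
      using c kl left_moduleD(3)[OF N] left_moduleD(3)[OF M] lmod_homD(1)[OF gh] by (auto simp: f_eq rel_def)
  qed
  let ?Q = "image_module N f"
  note Q = image_module[OF N cong]
  interpret Q: abelian_group ?Q by (rule left_moduleD(2)[OF Q(1)])
  have zero: "f \<zero>\<^bsub>N\<^esub> = \<zero>\<^bsub>?Q\<^esub>" using Q(3) by simp
  have proj: "restrict f (carrier N) \<in> lmod_hom A N ?Q"
    by (rule lmod_hom_restrictI[OF N]) (simp_all add: Q(2,4,5))
  have z: "restrict (\<lambda>m. \<zero>\<^bsub>?Q\<^esub>) (carrier N) \<in> lmod_hom A N ?Q"
    by (rule lmod_hom_restrictI[OF N]) (auto simp: left_module_smult_zero[OF Q(1)])
  have "f (g m) = \<zero>\<^bsub>?Q\<^esub>" if "m \<in> carrier M" for m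
    using that lmod_homD(1)[OF gh] unfolding zero[symmetric]
    by (subst f_eq) (auto simp: rel_def neg N.r_neg intro!: bexI[of _ "\<ominus>\<^bsub>M\<^esub> m"] simp flip: neg)
  then have "compose (carrier M) (restrict f (carrier N)) g
      = compose (carrier M) (restrict (\<lambda>m. \<zero>\<^bsub>?Q\<^esub>) (carrier N)) g"
    using lmod_homD(1)[OF gh] by (auto simp: compose_def intro!: restrict_ext)
  then have eq: "restrict f (carrier N) = restrict (\<lambda>m. \<zero>\<^bsub>?Q\<^esub>) (carrier N)"
    using g Q(1) proj z unfolding lmod_epi_def by blast
  have "n \<in> g ` carrier M" if n: "n \<in> carrier N" for n
  proof -
    have "f \<zero>\<^bsub>N\<^esub> = f n" using fun_cong[OF eq, of n] n zero by simp
    then show ?thesis using n lmod_homD(1)[OF gh] by (auto simp: f_eq rel_def)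
  qed
  then show ?thesis using lmod_homD(1)[OF gh] by auto
qed

section \<open>Invariance under equivalences\<close>

text \<open>A fully faithful and essentially surjective functor.  Transport of categorical properties along an
  equivalence uses only this half of it.\<close>

locale lmod_equivalence =
  fixes A :: "(complex, 'a) module" and B :: "(complex, 'b) module"
    and F :: "('a, 'u) module \<Rightarrow> ('b, 'u) module"
    and F' :: "('a, 'u) module \<Rightarrow> ('a, 'u) module \<Rightarrow> ('u \<Rightarrow> 'u) \<Rightarrow> ('u \<Rightarrow> 'u)"
  assumes obj: "left_module A M \<Longrightarrow> left_module B (F M)"
    and mor: "left_module A M \<Longrightarrow> left_module A N \<Longrightarrow> f \<in> lmod_hom A M N \<Longrightarrow>
       F' M N f \<in> lmod_hom B (F M) (F N)"
    and comp: "left_module A L \<Longrightarrow> left_module A M \<Longrightarrow> left_module A N \<Longrightarrow>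
       f \<in> lmod_hom A L M \<Longrightarrow> g \<in> lmod_hom A M N \<Longrightarrow>
       F' L N (compose (carrier L) g f) = compose (carrier (F L)) (F' M N g) (F' L M f)"
    and faithful: "left_module A M \<Longrightarrow> left_module A N \<Longrightarrow> f \<in> lmod_hom A M N \<Longrightarrow>
       g \<in> lmod_hom A M N \<Longrightarrow> F' M N f = F' M N g \<Longrightarrow> f = g"
    and full: "left_module A M \<Longrightarrow> left_module A N \<Longrightarrow> h \<in> lmod_hom B (F M) (F N) \<Longrightarrow>
       \<exists>f\<in>lmod_hom A M N. F' M N f = h"
    and dense: "left_module B Y \<Longrightarrow> \<exists>M s. left_module A M \<and> lmod_iso B Y (F M) s"

text \<open>The natural isomorphism \<open>t\<close> conjugates \<open>G (F f)\<close> to \<open>f\<close>, so \<open>F\<close> is faithful; the same argument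
  on the other side makes \<open>G\<close> faithful.  For fullness, \<open>h\<close> is hit by the conjugate of \<open>G h\<close>.\<close>

lemma morita_equivalent_imp_lmod_equivalence:
  assumes "morita_equivalent (U :: 'u itself) A B"
  obtains F :: "('a, 'u) module \<Rightarrow> ('b, 'u) module" and F' where "lmod_equivalence A B F F'"
proof -
  obtain F :: "('a, 'u) module \<Rightarrow> ('b, 'u) module" and F' G G' where
    F: "linear_functor A B F F'" and G: "linear_functor B A G G'" and
    FG: "inverse_up_to_iso A F F' G G'" and GF: "inverse_up_to_iso B G G' F F'"
    using assms unfolding morita_equivalent_def by blast
  obtain t where t: "\<And>M. left_module A M \<Longrightarrow> lmod_iso A M (G (F M)) (t M)"
    "\<And>M N f. left_module A M \<Longrightarrow> left_module A N \<Longrightarrow> f \<in> lmod_hom A M N \<Longrightarrow>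
       compose (carrier M) (t N) f = compose (carrier M) (G' (F M) (F N) (F' M N f)) (t M)"
    using FG unfolding inverse_up_to_iso_def by metis
  obtain s where s: "\<And>M. left_module B M \<Longrightarrow> lmod_iso B M (F (G M)) (s M)"
    "\<And>M N f. left_module B M \<Longrightarrow> left_module B N \<Longrightarrow> f \<in> lmod_hom B M N \<Longrightarrow>
       compose (carrier M) (s N) f = compose (carrier M) (F' (G M) (G N) (G' M N f)) (s M)"
    using GF unfolding inverse_up_to_iso_def by metis
  have Fobj: "\<And>M. left_module A M \<Longrightarrow> left_module B (F M)"
    and Fmor: "\<And>M N f. left_module A M \<Longrightarrow> left_module A N \<Longrightarrow> f \<in> lmod_hom A M N \<Longrightarrow>
       F' M N f \<in> lmod_hom B (F M) (F N)"
    using F unfolding linear_functor_def by simp_all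
  have Gobj: "\<And>M. left_module B M \<Longrightarrow> left_module A (G M)"
    and Gmor: "\<And>M N f. left_module B M \<Longrightarrow> left_module B N \<Longrightarrow> f \<in> lmod_hom B M N \<Longrightarrow>
       G' M N f \<in> lmod_hom A (G M) (G N)"
    using G unfolding linear_functor_def by simp_all
  have Gfaith: "f = g" if "left_module B M" "left_module B N" "f \<in> lmod_hom B M N"
    "g \<in> lmod_hom B M N" "G' M N f = G' M N g" for M N f g
    by (rule lmod_iso_cancel_left[OF s(1)[OF that(2)] that(3,4)])
       (simp add: s(2)[OF that(1,2)] that(3-5))
  have "lmod_equivalence A B F F'"
  proof
    fix M N f g assume M: "left_module A M" and N: "left_module A N" and f: "f \<in> lmod_hom A M N"
      and g: "g \<in> lmod_hom A M N" and "F' M N f = F' M N g"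
    then show "f = g"
      by (intro lmod_iso_cancel_left[OF t(1)[OF N] f g]) (simp add: t(2)[OF M N])
  next
    fix M N h assume M: "left_module A M" and N: "left_module A N" and h: "h \<in> lmod_hom B (F M) (F N)"
    obtain t' where t': "t' \<in> lmod_hom A (G (F N)) N"
      "compose (carrier (G (F N))) (t N) t' = lmod_id (G (F N))" and
      tN: "t N \<in> lmod_hom A N (G (F N))"
      using lmod_isoE[OF t(1)[OF N]] by metis
    have tM: "t M \<in> lmod_hom A M (G (F M))" using t(1)[OF M] by (simp add: lmod_iso_def)
    have Gh: "G' (F M) (F N) h \<in> lmod_hom A (G (F M)) (G (F N))"
      using Gmor Fobj M N h by blast
    let ?k = "compose (carrier M) (G' (F M) (F N) h) (t M)"
    have k: "?k \<in> lmod_hom A M (G (F N))" by (rule lmod_hom_compose[OF M tM Gh])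
    let ?f = "compose (carrier M) t' ?k"
    have f: "?f \<in> lmod_hom A M N" by (rule lmod_hom_compose[OF M k t'(1)])
    have "compose (carrier M) (t N) ?f = ?k"
      by (simp add: lmod_compose_assoc[OF k] t'(2) lmod_id_left[OF k])
    then have "compose (carrier M) (G' (F M) (F N) (F' M N ?f)) (t M) = ?k"
      using t(2)[OF M N f] by simp
    then have "G' (F M) (F N) (F' M N ?f) = G' (F M) (F N) h"
      using lmod_iso_cancel_right[OF t(1)[OF M] _ Gh] Gmor Fobj Fmor M N f by blast
    then have "F' M N ?f = h" using Gfaith Fobj Fmor M N f h by blast
    then show "\<exists>f\<in>lmod_hom A M N. F' M N f = h" using f by blast
  next
    show "\<And>Y. left_module B Y \<Longrightarrow> \<exists>M s. left_module A M \<and> lmod_iso B Y (F M) s"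
      using Gobj s(1) by blast
  qed (use F in \<open>simp_all add: linear_functor_def\<close>)
  then show thesis using that by blast
qed

context lmod_equivalence
begin

text \<open>A lifting problem in the target category is replaced by an isomorphic one between objects in the image
  of \<open>F\<close>, pulled back along \<open>F\<close>, solved there and mapped forward.\<close>

lemma projective_image:
  assumes P: "lmod_projective A P"
  shows "lmod_projective B (F P)"
  unfolding lmod_projective_def
proof (intro conjI allI impI, goal_cases)
  case 1
  show ?case using P obj by (simp add: lmod_projective_def)
next
  case (2 Y Z g f)
  then have Y: "left_module B Y" and Z: "left_module B Z" and g: "lmod_epi B Y Z g"
    and f: "f \<in> lmod_hom B (F P) Z" by auto
  have Pm: "left_module A P" using P by (simp add: lmod_projective_def)
  have gh: "g \<in> lmod_hom B Y Z" using g by (simp add: lmod_epi_def)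
  obtain M s0 where M: "left_module A M" "lmod_iso B Y (F M) s0" using dense[OF Y] by blast
  obtain N t where N: "left_module A N" "lmod_iso B Z (F N) t" using dense[OF Z] by blast
  obtain s where s: "s \<in> lmod_hom B (F M) Y" "s0 \<in> lmod_hom B Y (F M)"
    "compose (carrier Y) s s0 = lmod_id Y"
    using lmod_isoE[OF M(2)] by metis
  have t: "t \<in> lmod_hom B Z (F N)" using N(2) by (simp add: lmod_iso_def)
  have gs: "compose (carrier (F M)) g s \<in> lmod_hom B (F M) Z"
    by (rule lmod_hom_compose[OF obj[OF M(1)] s(1) gh])
  have tgs: "compose (carrier (F M)) t (compose (carrier (F M)) g s) \<in> lmod_hom B (F M) (F N)"
    by (rule lmod_hom_compose[OF obj[OF M(1)] gs t])
  obtain g' where g': "g' \<in> lmod_hom A M N"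
    "F' M N g' = compose (carrier (F M)) t (compose (carrier (F M)) g s)"
    using full[OF M(1) N(1) tgs] by blast
  have tf: "compose (carrier (F P)) t f \<in> lmod_hom B (F P) (F N)"
    by (rule lmod_hom_compose[OF obj[OF Pm] f t])
  obtain f' where f': "f' \<in> lmod_hom A P N" "F' P N f' = compose (carrier (F P)) t f"
    using full[OF Pm N(1) tf] by blast
  have "lmod_epi A M N g'"
    unfolding lmod_epi_def
  proof (intro conjI allI impI g'(1), elim conjE)
    fix L :: "('a, 'u) module" and u v
    assume L: "left_module A L" and u: "u \<in> lmod_hom A N L" and v: "v \<in> lmod_hom A N L"
      and eq: "compose (carrier M) u g' = compose (carrier M) v g'"
    have Fu: "F' N L u \<in> lmod_hom B (F N) (F L)" and Fv: "F' N L v \<in> lmod_hom B (F N) (F L)"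
      using mor N(1) L u v by auto
    have key: "compose (carrier Y) (compose (carrier (F M)) (F' N L w) (F' M N g')) s0
        = compose (carrier Y) (compose (carrier Z) (F' N L w) t) g" for w
    proof -
      have "compose (carrier Y) (compose (carrier (F M)) (F' N L w) (F' M N g')) s0
          = compose (carrier Y) (F' N L w) (compose (carrier Y) (F' M N g') s0)"
        by (rule lmod_compose_assoc[OF s(2), symmetric])
      also have "compose (carrier Y) (F' M N g') s0
          = compose (carrier Y) t (compose (carrier Y) (compose (carrier (F M)) g s) s0)"
        unfolding g'(2) by (rule lmod_compose_assoc[OF s(2), symmetric])
      also have "compose (carrier Y) (compose (carrier (F M)) g s) s0 = g"
        by (simp add: lmod_compose_assoc[OF s(2), symmetric] s(3) lmod_id_right[OF gh])
      also have "compose (carrier Y) (F' N L w) (compose (carrier Y) t g)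
          = compose (carrier Y) (compose (carrier Z) (F' N L w) t) g"
        by (rule lmod_compose_assoc[OF gh])
      finally show ?thesis .
    qed
    have "compose (carrier (F M)) (F' N L u) (F' M N g') = compose (carrier (F M)) (F' N L v) (F' M N g')"
      using comp[OF M(1) N(1) L g'(1) u] comp[OF M(1) N(1) L g'(1) v] eq by simp
    then have "compose (carrier Y) (compose (carrier Z) (F' N L u) t) g
        = compose (carrier Y) (compose (carrier Z) (F' N L v) t) g"
      using key[of u] key[of v] by simp
    then have "compose (carrier Z) (F' N L u) t = compose (carrier Z) (F' N L v) t"
      using g obj[OF L] lmod_hom_compose[OF Z t Fu] lmod_hom_compose[OF Z t Fv]
      unfolding lmod_epi_def by blast
    then have "F' N L u = F' N L v" by (rule lmod_iso_cancel_right[OF N(2) Fu Fv])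
    then show "u = v" by (rule faithful[OF N(1) L u v])
  qed
  then obtain l where l: "l \<in> lmod_hom A P M" "compose (carrier P) g' l = f'"
    using P M(1) N(1) f'(1) unfolding lmod_projective_def by blast
  have Fl: "F' P M l \<in> lmod_hom B (F P) (F M)" using mor Pm M(1) l(1) by blast
  let ?l = "compose (carrier (F P)) s (F' P M l)"
  have l': "?l \<in> lmod_hom B (F P) Y" by (rule lmod_hom_compose[OF obj[OF Pm] Fl s(1)])
  have "compose (carrier (F P)) t (compose (carrier (F P)) g ?l)
      = compose (carrier (F P)) t (compose (carrier (F P)) (compose (carrier (F M)) g s) (F' P M l))"
    by (simp add: lmod_compose_assoc[OF Fl])
  also have "\<dots> = compose (carrier (F P)) (F' M N g') (F' P M l)"
    unfolding g'(2) by (rule lmod_compose_assoc[OF Fl])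
  also have "\<dots> = compose (carrier (F P)) t f"
    using comp[OF Pm M(1) N(1) l(1) g'(1)] l(2) f'(2) by simp
  finally have "compose (carrier (F P)) g ?l = f"
    by (rule lmod_iso_cancel_left[OF N(2) lmod_hom_compose[OF obj[OF Pm] l' gh] f])
  then show ?case using l' by blast
qed

lemma separator_image:
  assumes P: "lmod_separator A P" and Pm: "left_module A P"
  shows "lmod_separator B (F P)"
  unfolding lmod_separator_def
proof (intro allI impI, elim conjE)
  fix Y Z :: "('b, 'u) module" and u v
  assume Y: "left_module B Y" and Z: "left_module B Z" and u: "u \<in> lmod_hom B Y Z"
    and v: "v \<in> lmod_hom B Y Z" and uv: "u \<noteq> v"
  obtain M s0 where M: "left_module A M" "lmod_iso B Y (F M) s0" using dense[OF Y] by blast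
  obtain N t where N: "left_module A N" "lmod_iso B Z (F N) t" using dense[OF Z] by blast
  obtain s where s: "s \<in> lmod_hom B (F M) Y" "s0 \<in> lmod_hom B Y (F M)"
    "compose (carrier Y) s s0 = lmod_id Y"
    using lmod_isoE[OF M(2)] by metis
  have t: "t \<in> lmod_hom B Z (F N)" using N(2) by (simp add: lmod_iso_def)
  have ex: "\<exists>w'\<in>lmod_hom A M N. F' M N w' = compose (carrier (F M)) t (compose (carrier (F M)) w s)"
    if "w \<in> lmod_hom B Y Z" for w
    by (rule full[OF M(1) N(1)])
       (rule lmod_hom_compose[OF obj[OF M(1)] lmod_hom_compose[OF obj[OF M(1)] s(1) that] t])
  obtain u' where u': "u' \<in> lmod_hom A M N"
    "F' M N u' = compose (carrier (F M)) t (compose (carrier (F M)) u s)" using ex[OF u] by blast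
  obtain v' where v': "v' \<in> lmod_hom A M N"
    "F' M N v' = compose (carrier (F M)) t (compose (carrier (F M)) v s)" using ex[OF v] by blast
  have "u' \<noteq> v'"
  proof
    assume "u' = v'"
    then have "compose (carrier (F M)) u s = compose (carrier (F M)) v s"
      using u'(2) v'(2)
      by (intro lmod_iso_cancel_left[OF N(2) lmod_hom_compose[OF obj[OF M(1)] s(1) u]
            lmod_hom_compose[OF obj[OF M(1)] s(1) v]]) simp
    then have "compose (carrier Y) u (compose (carrier Y) s s0)
        = compose (carrier Y) v (compose (carrier Y) s s0)"
      by (simp add: lmod_compose_assoc[OF s(2)])
    then show False using uv s(3) lmod_id_right[OF u] lmod_id_right[OF v] by simp
  qed
  then obtain p where p: "p \<in> lmod_hom A P M" "compose (carrier P) u' p \<noteq> compose (carrier P) v' p"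
    using P M(1) N(1) u'(1) v'(1) unfolding lmod_separator_def by blast
  have Fp: "F' P M p \<in> lmod_hom B (F P) (F M)" using mor Pm M(1) p(1) by blast
  let ?p = "compose (carrier (F P)) s (F' P M p)"
  have p': "?p \<in> lmod_hom B (F P) Y" by (rule lmod_hom_compose[OF obj[OF Pm] Fp s(1)])
  have key: "compose (carrier (F P)) t (compose (carrier (F P)) w ?p) = F' P N (compose (carrier P) w' p)"
    if "w' \<in> lmod_hom A M N" "F' M N w' = compose (carrier (F M)) t (compose (carrier (F M)) w s)"
    for w w'
    using comp[OF Pm M(1) N(1) p(1) that(1)] that(2) by (simp add: lmod_compose_assoc[OF Fp])
  have "compose (carrier (F P)) u ?p \<noteq> compose (carrier (F P)) v ?p"
  proof
    assume "compose (carrier (F P)) u ?p = compose (carrier (F P)) v ?p"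
    then have "F' P N (compose (carrier P) u' p) = F' P N (compose (carrier P) v' p)"
      using key[OF u'] key[OF v'] by simp
    then show False
      using faithful[OF Pm N(1)] lmod_hom_compose[OF Pm p(1)] u'(1) v'(1) p(2) by blast
  qed
  then show "\<exists>p\<in>lmod_hom B (F P) Y. compose (carrier (F P)) u p \<noteq> compose (carrier (F P)) v p"
    using p' by blast
qed

end

lemma lmod_projective_iso:
  assumes P: "lmod_projective A P" and Q: "left_module A Q" and s: "lmod_iso A Q P s"
  shows "lmod_projective A Q"
  unfolding lmod_projective_def
proof (intro conjI allI impI Q, elim conjE)
  fix M N :: "('a, 'b) module" and g f
  assume M: "left_module A M" and N: "left_module A N" and g: "lmod_epi A M N g"
    and f: "f \<in> lmod_hom A Q N"
  have Pm: "left_module A P" using P by (simp add: lmod_projective_def)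
  obtain s' where s': "s \<in> lmod_hom A Q P" "s' \<in> lmod_hom A P Q" "compose (carrier Q) s' s = lmod_id Q"
    using lmod_isoE[OF s] by metis
  obtain l where l: "l \<in> lmod_hom A P M" "compose (carrier P) g l = compose (carrier P) f s'"
    using P M N g lmod_hom_compose[OF Pm s'(2) f] unfolding lmod_projective_def by blast
  have "compose (carrier Q) g (compose (carrier Q) l s) = f"
    by (simp add: lmod_compose_assoc[OF s'(1)] l(2))
       (simp add: lmod_compose_assoc[OF s'(1), symmetric] s'(3) lmod_id_right[OF f])
  then show "\<exists>l\<in>lmod_hom A Q M. compose (carrier Q) g l = f"
    using lmod_hom_compose[OF Q s'(1) l(1)] by blast
qed

theorem hereditary_separator_morita:
  assumes "morita_equivalent (U :: 'u itself) A B" "hereditary_separator A (P :: ('a, 'u) module)"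
  shows "\<exists>P :: ('b, 'u) module. hereditary_separator B P"
proof -
  obtain F :: "('a, 'u) module \<Rightarrow> ('b, 'u) module" and F' where "lmod_equivalence A B F F'"
    using morita_equivalent_imp_lmod_equivalence[OF assms(1)] by blast
  then interpret lmod_equivalence A B F F' .
  have P: "lmod_projective A P" "lmod_separator A P" "left_module A P"
    using assms(2) by (auto simp: hereditary_separator_def lmod_projective_def)
  have "lmod_projective B Q" if Q: "left_module B Q" and j: "lmod_mono B Q (F P) j"
    for Q :: "('b, 'u) module" and j
  proof -
    obtain M t where M: "left_module A M" and t: "lmod_iso B Q (F M) t" using dense[OF Q] by blast
    obtain s where s: "s \<in> lmod_hom B (F M) Q" "t \<in> lmod_hom B Q (F M)"
      "compose (carrier Q) s t = lmod_id Q" "compose (carrier (F M)) t s = lmod_id (F M)"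
      using lmod_isoE[OF t] by metis
    have jh: "j \<in> lmod_hom B Q (F P)" using j by (simp add: lmod_mono_def)
    obtain j' where j': "j' \<in> lmod_hom A M P" "F' M P j' = compose (carrier (F M)) j s"
      using full[OF M P(3) lmod_hom_compose[OF obj[OF M] s(1) jh]] by blast
    have "lmod_mono A M P j'"
      unfolding lmod_mono_def
    proof (intro conjI allI impI j'(1), elim conjE)
      fix L :: "('a, 'u) module" and u v
      assume L: "left_module A L" and u: "u \<in> lmod_hom A L M" and v: "v \<in> lmod_hom A L M"
        and eq: "compose (carrier L) j' u = compose (carrier L) j' v"
      have Fu: "F' L M u \<in> lmod_hom B (F L) (F M)" and Fv: "F' L M v \<in> lmod_hom B (F L) (F M)"
        using mor L M u v by auto
      have "compose (carrier (F L)) j (compose (carrier (F L)) s (F' L M u))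
          = compose (carrier (F L)) j (compose (carrier (F L)) s (F' L M v))"
        using comp[OF L M P(3) u j'(1)] comp[OF L M P(3) v j'(1)] eq j'(2)
        by (simp add: lmod_compose_assoc[OF Fu] lmod_compose_assoc[OF Fv])
      then have "compose (carrier (F L)) s (F' L M u) = compose (carrier (F L)) s (F' L M v)"
        using j obj[OF L] lmod_hom_compose[OF obj[OF L] Fu s(1)] lmod_hom_compose[OF obj[OF L] Fv s(1)]
        unfolding lmod_mono_def by blast
      moreover have "lmod_iso B (F M) Q s" using s unfolding lmod_iso_def by blast
      ultimately have "F' L M u = F' L M v" using lmod_iso_cancel_left Fu Fv by blast
      then show "u = v" by (rule faithful[OF L M u v])
    qed
    then have "lmod_projective A M" using assms(2) M unfolding hereditary_separator_def by blast
    then show ?thesis using lmod_projective_iso[OF projective_image Q t] by blast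
  qed
  then have "hereditary_separator B (F P)"
    using projective_image[OF P(1)] separator_image[OF P(2,3)]
    unfolding hereditary_separator_def by blast
  then show ?thesis by blast
qed

section \<open>Morita contexts\<close>

text \<open>An infinite set is equinumerous with its square; this is what keeps \<open>Hom\<close> modules out of a finitely
  generated module inside the universe.\<close>

lemma infinite_lists_encoding:
  assumes "infinite S"
  shows "\<exists>e. inj_on e {xs. set xs \<subseteq> S \<and> length xs = n} \<and> (\<forall>xs. set xs \<subseteq> S \<and> length xs = n \<longrightarrow> e xs \<in> S)"
proof (induction n)
  case 0
  obtain s where "s \<in> S" using assms by (metis finite.emptyI equals0I)
  then show ?case by (intro exI[of _ "\<lambda>_. s"]) (auto simp: inj_on_def)
next
  case (Suc n)
  then obtain e where e: "inj_on e {xs. set xs \<subseteq> S \<and> length xs = n}"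
    "\<And>xs. set xs \<subseteq> S \<Longrightarrow> length xs = n \<Longrightarrow> e xs \<in> S" by blast
  obtain p where p: "bij_betw p (S \<times> S) S"
    using card_of_Times_same_infinite[OF assms] card_of_ordIso by blast
  let ?e = "\<lambda>xs. p (hd xs, e (tl xs))"
  have "inj_on ?e {xs. set xs \<subseteq> S \<and> length xs = Suc n}"
  proof (rule inj_onI, clarsimp)
    fix xs ys assume x: "set xs \<subseteq> S" "length xs = Suc n" and y: "set ys \<subseteq> S" "length ys = Suc n"
      and eq: "p (hd xs, e (tl xs)) = p (hd ys, e (tl ys))"
    obtain a as b bs where ab: "xs = a # as" "ys = b # bs" using x y by (metis length_Suc_conv)
    have "(a, e as) = (b, e bs)"
      using p eq x y ab e(2) by (auto simp: bij_betw_def dest!: inj_onD)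
    then show "xs = ys" using e(1) x y ab by (auto simp: inj_on_def)
  qed
  moreover have "?e xs \<in> S" if "set xs \<subseteq> S" "length xs = Suc n" for xs
  proof -
    obtain a as where "xs = a # as" using \<open>length xs = Suc n\<close> by (metis length_Suc_conv)
    then show ?thesis using that p e(2) by (auto simp: bij_betw_def)
  qed
  ultimately show ?case by blast
qed

text \<open>\<open>Hom\<^sub>A(P, M)\<close> for a left \<open>A\<close>-submodule \<open>P\<close> of an ambient ring in which \<open>A\<close> is embedded by \<open>iA\<close>.
  The right action of \<open>B\<close> on \<open>P\<close> makes it a left \<open>B\<close>-module.\<close>

definition hom_set :: "(complex, 'a) module \<Rightarrow> ('a \<Rightarrow> 'r::ring_1) \<Rightarrow> 'r set \<Rightarrow> ('a, 'u) module \<Rightarrow> ('r \<Rightarrow> 'u) set"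
  where "hom_set A iA P M = {\<phi> \<in> P \<rightarrow>\<^sub>E carrier M.
    (\<forall>p\<in>P. \<forall>p'\<in>P. \<phi> (p + p') = \<phi> p \<oplus>\<^bsub>M\<^esub> \<phi> p') \<and>
    (\<forall>a\<in>carrier A. \<forall>p\<in>P. \<phi> (iA a * p) = a \<odot>\<^bsub>M\<^esub> \<phi> p)}"

definition hom_module ::
  "(complex, 'a) module \<Rightarrow> ('a \<Rightarrow> 'r::ring_1) \<Rightarrow> ('b \<Rightarrow> 'r) \<Rightarrow> 'r set \<Rightarrow> ('a, 'u) module \<Rightarrow> ('b, 'r \<Rightarrow> 'u) module"
  where "hom_module A iA iB P M =
    \<lparr>carrier = hom_set A iA P M, mult = undefined, one = undefined,
     zero = (\<lambda>p\<in>P. \<zero>\<^bsub>M\<^esub>), add = (\<lambda>\<phi> \<psi>. \<lambda>p\<in>P. \<phi> p \<oplus>\<^bsub>M\<^esub> \<psi> p),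
     smult = (\<lambda>b \<phi>. \<lambda>p\<in>P. \<phi> (p * iB b))\<rparr>"

text \<open>\<open>Hom\<^sub>A(P, M)\<close> consists of functions and so does not have its elements in the universe;
  it is copied there along a chosen injection.\<close>

definition hom_enc :: "(complex, 'a) module \<Rightarrow> ('a \<Rightarrow> 'r::ring_1) \<Rightarrow> 'r set \<Rightarrow> ('a, 'u) module \<Rightarrow> ('r \<Rightarrow> 'u) \<Rightarrow> 'u"
  where "hom_enc A iA P M = (SOME e. inj_on e (hom_set A iA P M))"

definition hom_obj ::
  "(complex, 'a) module \<Rightarrow> ('a \<Rightarrow> 'r::ring_1) \<Rightarrow> ('b \<Rightarrow> 'r) \<Rightarrow> 'r set \<Rightarrow> ('a, 'u) module \<Rightarrow> ('b, 'u) module"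
  where "hom_obj A iA iB P M = image_module (hom_module A iA iB P M) (hom_enc A iA P M)"

definition hom_mor ::
  "(complex, 'a) module \<Rightarrow> ('a \<Rightarrow> 'r::ring_1) \<Rightarrow> 'r set \<Rightarrow>
   ('a, 'u) module \<Rightarrow> ('a, 'u) module \<Rightarrow> ('u \<Rightarrow> 'u) \<Rightarrow> 'u \<Rightarrow> 'u"
  where "hom_mor A iA P M N f =
    (\<lambda>u \<in> hom_enc A iA P M ` hom_set A iA P M.
       hom_enc A iA P N (compose P f (inv_into (hom_set A iA P M) (hom_enc A iA P M) u)))"

text \<open>Both algebras and both bimodules live in one ambient ring.  The pairings \<open>P \<otimes> Q \<rightarrow> A\<close> and
  \<open>Q \<otimes> P \<rightarrow> B\<close> are multiplication there, so their bilinearity and the associativity laws between them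
  come for free, and only surjectivity of the pairings remains as a condition.\<close>

locale morita_context =
  fixes A :: "(complex, 'a) module" and B :: "(complex, 'b) module"
    and iA :: "'a \<Rightarrow> 'r::ring_1" and iB :: "'b \<Rightarrow> 'r" and P Q :: "'r set"
  assumes ring_A: "ring A" and ring_B: "ring B"
    and iA_inj: "inj_on iA (carrier A)" and iB_inj: "inj_on iB (carrier B)"
    and iA_add: "\<And>a a'. a \<in> carrier A \<Longrightarrow> a' \<in> carrier A \<Longrightarrow> iA (a \<oplus>\<^bsub>A\<^esub> a') = iA a + iA a'"
    and iA_mult: "\<And>a a'. a \<in> carrier A \<Longrightarrow> a' \<in> carrier A \<Longrightarrow> iA (a \<otimes>\<^bsub>A\<^esub> a') = iA a * iA a'"
    and iA_one: "iA \<one>\<^bsub>A\<^esub> = 1"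
    and iB_add: "\<And>a a'. a \<in> carrier B \<Longrightarrow> a' \<in> carrier B \<Longrightarrow> iB (a \<oplus>\<^bsub>B\<^esub> a') = iB a + iB a'"
    and iB_mult: "\<And>a a'. a \<in> carrier B \<Longrightarrow> a' \<in> carrier B \<Longrightarrow> iB (a \<otimes>\<^bsub>B\<^esub> a') = iB a * iB a'"
    and iB_one: "iB \<one>\<^bsub>B\<^esub> = 1"
    and scal_A: "\<And>c. c \<odot>\<^bsub>A\<^esub> \<one>\<^bsub>A\<^esub> \<in> carrier A" and scal_B: "\<And>c. c \<odot>\<^bsub>B\<^esub> \<one>\<^bsub>B\<^esub> \<in> carrier B"
    and scal_eq: "\<And>c. iA (c \<odot>\<^bsub>A\<^esub> \<one>\<^bsub>A\<^esub>) = iB (c \<odot>\<^bsub>B\<^esub> \<one>\<^bsub>B\<^esub>)"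
    and scal_add: "\<And>c d. iA ((c + d) \<odot>\<^bsub>A\<^esub> \<one>\<^bsub>A\<^esub>) = iA (c \<odot>\<^bsub>A\<^esub> \<one>\<^bsub>A\<^esub>) + iA (d \<odot>\<^bsub>A\<^esub> \<one>\<^bsub>A\<^esub>)"
    and scal_mult: "\<And>c d. iA ((c * d) \<odot>\<^bsub>A\<^esub> \<one>\<^bsub>A\<^esub>) = iA (c \<odot>\<^bsub>A\<^esub> \<one>\<^bsub>A\<^esub>) * iA (d \<odot>\<^bsub>A\<^esub> \<one>\<^bsub>A\<^esub>)"
    and scal_one: "iA (1 \<odot>\<^bsub>A\<^esub> \<one>\<^bsub>A\<^esub>) = 1"
    and scal_central: "\<And>c r. r \<in> P \<union> Q \<Longrightarrow> iA (c \<odot>\<^bsub>A\<^esub> \<one>\<^bsub>A\<^esub>) * r = r * iA (c \<odot>\<^bsub>A\<^esub> \<one>\<^bsub>A\<^esub>)"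
    and P_zero: "0 \<in> P" and Q_zero: "0 \<in> Q"
    and P_add: "\<And>p p'. p \<in> P \<Longrightarrow> p' \<in> P \<Longrightarrow> p + p' \<in> P"
    and Q_add: "\<And>q q'. q \<in> Q \<Longrightarrow> q' \<in> Q \<Longrightarrow> q + q' \<in> Q"
    and P_left: "\<And>a p. a \<in> carrier A \<Longrightarrow> p \<in> P \<Longrightarrow> iA a * p \<in> P"
    and P_right: "\<And>b p. b \<in> carrier B \<Longrightarrow> p \<in> P \<Longrightarrow> p * iB b \<in> P"
    and Q_left: "\<And>b q. b \<in> carrier B \<Longrightarrow> q \<in> Q \<Longrightarrow> iB b * q \<in> Q"
    and Q_right: "\<And>a q. a \<in> carrier A \<Longrightarrow> q \<in> Q \<Longrightarrow> q * iA a \<in> Q"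
    and PQ: "\<And>p q. p \<in> P \<Longrightarrow> q \<in> Q \<Longrightarrow> p * q \<in> iA ` carrier A"
    and QP: "\<And>p q. p \<in> P \<Longrightarrow> q \<in> Q \<Longrightarrow> q * p \<in> iB ` carrier B"
    and PQ_one: "\<exists>L. set L \<subseteq> P \<times> Q \<and> (\<Sum>(p, q)\<leftarrow>L. p * q) = 1"
    and QP_one: "\<exists>L. set L \<subseteq> Q \<times> P \<and> (\<Sum>(q, p)\<leftarrow>L. q * p) = 1"
begin

lemma swap: "morita_context B A iB iA Q P"
  by (rule morita_context.intro)
    (use ring_A ring_B iA_inj iB_inj iA_add iA_mult iA_one iB_add iB_mult iB_one scal_A scal_B
      scal_add scal_mult scal_one scal_central P_zero Q_zero P_add Q_add P_left P_right Q_left Q_right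
      PQ QP PQ_one QP_one in \<open>simp_all add: scal_eq[symmetric] Un_commute\<close>)

abbreviation "K c \<equiv> c \<odot>\<^bsub>A\<^esub> \<one>\<^bsub>A\<^esub>"

definition "jA r = inv_into (carrier A) iA r"

lemma jA_in: "r \<in> iA ` carrier A \<Longrightarrow> jA r \<in> carrier A" "r \<in> iA ` carrier A \<Longrightarrow> iA (jA r) = r"
  unfolding jA_def by (auto simp: inv_into_into f_inv_into_f)

lemma jA_iA: "a \<in> carrier A \<Longrightarrow> jA (iA a) = a"
  unfolding jA_def using iA_inj by simp

lemma jA_add: "r \<in> iA ` carrier A \<Longrightarrow> s \<in> iA ` carrier A \<Longrightarrow>
    r + s \<in> iA ` carrier A \<and> jA (r + s) = jA r \<oplus>\<^bsub>A\<^esub> jA s"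
proof -
  interpret A: ring A by (rule ring_A)
  assume rs: "r \<in> iA ` carrier A" "s \<in> iA ` carrier A"
  then have "iA (jA r \<oplus>\<^bsub>A\<^esub> jA s) = r + s" by (simp add: iA_add jA_in)
  then show ?thesis using jA_iA[of "jA r \<oplus>\<^bsub>A\<^esub> jA s"] rs jA_in(1)
    by (metis A.a_closed image_eqI)
qed

lemma jA_mult: "r \<in> iA ` carrier A \<Longrightarrow> s \<in> iA ` carrier A \<Longrightarrow>
    r * s \<in> iA ` carrier A \<and> jA (r * s) = jA r \<otimes>\<^bsub>A\<^esub> jA s"
proof -
  interpret A: ring A by (rule ring_A)
  assume rs: "r \<in> iA ` carrier A" "s \<in> iA ` carrier A"
  then have "iA (jA r \<otimes>\<^bsub>A\<^esub> jA s) = r * s" by (simp add: iA_mult jA_in)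
  then show ?thesis using jA_iA[of "jA r \<otimes>\<^bsub>A\<^esub> jA s"] rs jA_in(1)
    by (metis A.m_closed image_eqI)
qed

lemma iA_zero: "iA \<zero>\<^bsub>A\<^esub> = 0"
proof -
  interpret A: ring A by (rule ring_A)
  have "iA \<zero>\<^bsub>A\<^esub> + iA \<zero>\<^bsub>A\<^esub> = iA \<zero>\<^bsub>A\<^esub>" using iA_add[of "\<zero>\<^bsub>A\<^esub>" "\<zero>\<^bsub>A\<^esub>"] by simp
  then show ?thesis by simp
qed

lemma hom_setD:
  assumes "\<phi> \<in> hom_set A iA P M"
  shows "p \<in> P \<Longrightarrow> \<phi> p \<in> carrier M" "p \<in> P \<Longrightarrow> p' \<in> P \<Longrightarrow> \<phi> (p + p') = \<phi> p \<oplus>\<^bsub>M\<^esub> \<phi> p'"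
    "a \<in> carrier A \<Longrightarrow> p \<in> P \<Longrightarrow> \<phi> (iA a * p) = a \<odot>\<^bsub>M\<^esub> \<phi> p" "\<phi> \<in> extensional P"
  using assms by (auto simp: hom_set_def PiE_iff)

lemma hom_set_restrictI:
  assumes "\<And>p. p \<in> P \<Longrightarrow> \<phi> p \<in> carrier M"
    "\<And>p p'. p \<in> P \<Longrightarrow> p' \<in> P \<Longrightarrow> \<phi> (p + p') = \<phi> p \<oplus>\<^bsub>M\<^esub> \<phi> p'"
    "\<And>a p. a \<in> carrier A \<Longrightarrow> p \<in> P \<Longrightarrow> \<phi> (iA a * p) = a \<odot>\<^bsub>M\<^esub> \<phi> p"
  shows "restrict \<phi> P \<in> hom_set A iA P M"
  using assms P_add P_left by (auto simp: hom_set_def)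

lemma hom_set_zero:
  assumes "\<phi> \<in> hom_set A iA P M" "left_module A M"
  shows "\<phi> 0 = \<zero>\<^bsub>M\<^esub>"
proof -
  interpret M: abelian_group M by (rule left_moduleD(2)[OF assms(2)])
  show ?thesis
    using hom_setD(1,2)[OF assms(1) P_zero] P_zero by (intro M.add_idem_zero) force+
qed

text \<open>If \<open>1 = \<Sum> q\<^sub>i p\<^sub>i\<close> then \<open>\<phi>(p) = \<Sum> (p q\<^sub>i) \<phi>(p\<^sub>i)\<close> since \<open>p q\<^sub>i\<close> lies in \<open>A\<close>; so \<open>\<phi>\<close> is
  determined by its finitely many values at the \<open>p\<^sub>i\<close>.\<close>

lemma hom_set_determined:
  assumes \<phi>: "\<phi> \<in> hom_set A iA P M" and \<psi>: "\<psi> \<in> hom_set A iA P M" and M: "left_module A M"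
    and L: "set L \<subseteq> Q \<times> P" "\<And>q p. (q, p) \<in> set L \<Longrightarrow> \<phi> p = \<psi> p" and p: "p \<in> P"
  shows "p * (\<Sum>(q, p)\<leftarrow>L. q * p) \<in> P \<and> \<phi> (p * (\<Sum>(q, p)\<leftarrow>L. q * p)) = \<psi> (p * (\<Sum>(q, p)\<leftarrow>L. q * p))"
  using L
proof (induction L)
  case Nil
  then show ?case using hom_set_zero[OF \<phi> M] hom_set_zero[OF \<psi> M] P_zero by simp
next
  case (Cons x L)
  obtain q p' where x: "x = (q, p')" by (cases x)
  have q: "q \<in> Q" "p' \<in> P" "\<phi> p' = \<psi> p'" using Cons.prems x by auto
  obtain a where a: "a \<in> carrier A" "p * q = iA a" using PQ[OF p q(1)] by blast
  have e: "p * (q * p') = iA a * p'" using a by (simp add: mult.assoc[symmetric])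
  have IH: "p * (\<Sum>(q, p)\<leftarrow>L. q * p) \<in> P \<and> \<phi> (p * (\<Sum>(q, p)\<leftarrow>L. q * p)) = \<psi> (p * (\<Sum>(q, p)\<leftarrow>L. q * p))"
    using Cons by auto
  then show ?case
    using q a P_left[OF a(1) q(2)] hom_setD(2,3)[OF \<phi>] hom_setD(2,3)[OF \<psi>] P_add
    by (simp add: x distrib_left e)
qed

text \<open>A nonzero module is an infinite set, because it is a complex vector space.\<close>

lemma infinite_carrier:
  assumes M: "left_module A M" and m: "m \<in> carrier M" "m \<noteq> \<zero>\<^bsub>M\<^esub>"
  shows "infinite (carrier M)"
proof -
  interpret M: abelian_group M by (rule left_moduleD(2)[OF M])
  have K0: "K 0 = \<zero>\<^bsub>A\<^esub>"
  proof -
    interpret A: ring A by (rule ring_A)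
    have "iA (K 0) = iA \<zero>\<^bsub>A\<^esub>" using scal_add[of 0 0] iA_zero by simp
    then show ?thesis using iA_inj scal_A by (simp add: inj_on_eq_iff)
  qed
  have K1: "K 1 = \<one>\<^bsub>A\<^esub>"
  proof -
    interpret A: ring A by (rule ring_A)
    have "iA (K 1) = iA \<one>\<^bsub>A\<^esub>" using scal_one iA_one by simp
    then show ?thesis using iA_inj scal_A by (simp add: inj_on_eq_iff)
  qed
  interpret A: ring A by (rule ring_A)
  have Kadd: "K (c + d) = K c \<oplus>\<^bsub>A\<^esub> K d" for c d
  proof -
    have "iA (K (c + d)) = iA (K c \<oplus>\<^bsub>A\<^esub> K d)" using scal_add iA_add scal_A by simp
    then show ?thesis using iA_inj scal_A by (simp add: inj_on_eq_iff)
  qed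
  have Kmult: "K (c * d) = K c \<otimes>\<^bsub>A\<^esub> K d" for c d
  proof -
    have "iA (K (c * d)) = iA (K c \<otimes>\<^bsub>A\<^esub> K d)" using scal_mult iA_mult scal_A by simp
    then show ?thesis using iA_inj scal_A by (simp add: inj_on_eq_iff)
  qed
  have "inj (\<lambda>c. K c \<odot>\<^bsub>M\<^esub> m)"
  proof (rule injI, rule ccontr)
    fix c d assume eq: "K c \<odot>\<^bsub>M\<^esub> m = K d \<odot>\<^bsub>M\<^esub> m" and cd: "c \<noteq> d"
    have km: "K e \<odot>\<^bsub>M\<^esub> m \<in> carrier M" for e using left_moduleD(3)[OF M scal_A m(1)] .
    have "K (c - d) \<odot>\<^bsub>M\<^esub> m \<oplus>\<^bsub>M\<^esub> K d \<odot>\<^bsub>M\<^esub> m = K c \<odot>\<^bsub>M\<^esub> m"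
      using left_moduleD(4)[OF M scal_A[of "c - d"] scal_A[of d] m(1)] by (simp flip: Kadd)
    also have "\<dots> = \<zero>\<^bsub>M\<^esub> \<oplus>\<^bsub>M\<^esub> K d \<odot>\<^bsub>M\<^esub> m" using eq km by simp
    finally have "K (c - d) \<odot>\<^bsub>M\<^esub> m = \<zero>\<^bsub>M\<^esub>"
      using km by (metis M.a_assoc M.a_inv_closed M.r_neg M.r_zero M.l_zero)
    then have "K (inverse (c - d)) \<odot>\<^bsub>M\<^esub> (K (c - d) \<odot>\<^bsub>M\<^esub> m) = \<zero>\<^bsub>M\<^esub>"
      using left_module_smult_zero[OF M scal_A] by simp
    moreover have "K (inverse (c - d)) \<odot>\<^bsub>M\<^esub> (K (c - d) \<odot>\<^bsub>M\<^esub> m) = m"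
      using left_moduleD(6)[OF M scal_A[of "inverse (c - d)"] scal_A[of "c - d"] m(1)] cd left_moduleD(7)[OF M m(1)]
      by (simp flip: Kmult add: K1)
    ultimately show False using m(2) by simp
  qed
  moreover have "range (\<lambda>c. K c \<odot>\<^bsub>M\<^esub> m) \<subseteq> carrier M" using left_moduleD(3)[OF M scal_A m(1)] by blast
  ultimately show ?thesis using infinite_UNIV_char_0[where 'a = complex] finite_subset finite_imageD
    by blast
qed

text \<open>By the previous two facts a homomorphism is a finite list of elements of \<open>M\<close>, and such lists can be
  coded by elements of \<open>M\<close> unless \<open>M\<close> is zero.\<close>

lemma hom_enc_inj:
  assumes M: "left_module A (M :: ('a, 'u) module)"
  shows "inj_on (hom_enc A iA P M) (hom_set A iA P M)"
proof -
  interpret M: abelian_group M by (rule left_moduleD(2)[OF M])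
  have "\<exists>e :: ('r \<Rightarrow> 'u) \<Rightarrow> 'u. inj_on e (hom_set A iA P M)"
  proof (cases "carrier M = {\<zero>\<^bsub>M\<^esub>}")
    case True
    have "\<phi> = \<psi>" if "\<phi> \<in> hom_set A iA P M" "\<psi> \<in> hom_set A iA P M" for \<phi> \<psi>
      using hom_setD(1,4)[OF that(1)] hom_setD(1,4)[OF that(2)] True
      by (intro extensionalityI[of _ P]) auto
    then show ?thesis by (auto simp: inj_on_def)
  next
    case False
    then have inf: "infinite (carrier M)" using infinite_carrier[OF M] M.zero_closed by blast
    obtain L where L: "set L \<subseteq> Q \<times> P" "(\<Sum>(q, p)\<leftarrow>L. q * p) = 1" using QP_one by blast
    obtain e :: "'u list \<Rightarrow> 'u" where e: "inj_on e {xs. set xs \<subseteq> carrier M \<and> length xs = length L}"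
      using infinite_lists_encoding[OF inf] by blast
    have "inj_on (\<lambda>\<phi>. e (map (\<lambda>(q, p). \<phi> p) L)) (hom_set A iA P M)"
    proof (rule inj_onI)
      fix \<phi> \<psi> assume \<phi>: "\<phi> \<in> hom_set A iA P M" and \<psi>: "\<psi> \<in> hom_set A iA P M"
        and eq: "e (map (\<lambda>(q, p). \<phi> p) L) = e (map (\<lambda>(q, p). \<psi> p) L)"
      have "set (map (\<lambda>(q, p). \<phi> p) L) \<subseteq> carrier M" "set (map (\<lambda>(q, p). \<psi> p) L) \<subseteq> carrier M"
        using L(1) hom_setD(1)[OF \<phi>] hom_setD(1)[OF \<psi>] by auto
      then have "map (\<lambda>(q, p). \<phi> p) L = map (\<lambda>(q, p). \<psi> p) L"
        by (intro inj_onD[OF e eq]) auto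
      then have ag: "\<phi> p = \<psi> p" if "(q, p) \<in> set L" for q p using that by (auto simp: map_eq_conv)
      show "\<phi> = \<psi>"
      proof (rule extensionalityI[OF hom_setD(4)[OF \<phi>] hom_setD(4)[OF \<psi>]])
        fix p assume "p \<in> P"
        from hom_set_determined[OF \<phi> \<psi> M L(1) ag this] show "\<phi> p = \<psi> p" by (simp add: L(2))
      qed
    qed
    then show ?thesis by blast
  qed
  then show ?thesis unfolding hom_enc_def by (rule someI_ex)
qed

lemma hom_module:
  assumes M: "left_module A M"
  shows "left_module B (hom_module A iA iB P M)"
proof -
  interpret M: abelian_group M by (rule left_moduleD(2)[OF M])
  interpret B: ring B by (rule ring_B)
  let ?H = "hom_module A iA iB P M"
  have [simp]: "carrier ?H = hom_set A iA P M" "\<zero>\<^bsub>?H\<^esub> = (\<lambda>p\<in>P. \<zero>\<^bsub>M\<^esub>)"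
    "\<And>\<phi> \<psi>. \<phi> \<oplus>\<^bsub>?H\<^esub> \<psi> = (\<lambda>p\<in>P. \<phi> p \<oplus>\<^bsub>M\<^esub> \<psi> p)" "\<And>b \<phi>. b \<odot>\<^bsub>?H\<^esub> \<phi> = (\<lambda>p\<in>P. \<phi> (p * iB b))"
    by (simp_all add: hom_module_def)
  have zero: "(\<lambda>p\<in>P. \<zero>\<^bsub>M\<^esub>) \<in> hom_set A iA P M"
    by (rule hom_set_restrictI) (auto simp: left_module_smult_zero[OF M])
  have add: "(\<lambda>p\<in>P. \<phi> p \<oplus>\<^bsub>M\<^esub> \<psi> p) \<in> hom_set A iA P M"
    if "\<phi> \<in> hom_set A iA P M" "\<psi> \<in> hom_set A iA P M" for \<phi> \<psi>
    by (rule hom_set_restrictI)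
       (simp_all add: hom_setD[OF that(1)] hom_setD[OF that(2)] left_moduleD(5)[OF M] M.a_ac)
  have smult: "(\<lambda>p\<in>P. \<phi> (p * iB b)) \<in> hom_set A iA P M"
    if "\<phi> \<in> hom_set A iA P M" "b \<in> carrier B" for \<phi> b
    by (rule hom_set_restrictI)
       (simp_all add: hom_setD[OF that(1)] P_right[OF that(2)] distrib_right mult.assoc)
  have "abelian_group ?H"
  proof (rule abelian_groupI)
    fix \<phi> assume "\<phi> \<in> carrier ?H"
    then have \<phi>: "\<phi> \<in> hom_set A iA P M" by simp
    have "(\<lambda>p\<in>P. \<ominus>\<^bsub>M\<^esub> \<phi> p) \<in> hom_set A iA P M"
    proof (rule hom_set_restrictI)
      fix a p assume a: "a \<in> carrier A" and p: "p \<in> P"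
      have "a \<odot>\<^bsub>M\<^esub> (\<ominus>\<^bsub>M\<^esub> \<phi> p) \<oplus>\<^bsub>M\<^esub> a \<odot>\<^bsub>M\<^esub> \<phi> p = \<zero>\<^bsub>M\<^esub>"
        using left_moduleD(5)[OF M a, of "\<ominus>\<^bsub>M\<^esub> \<phi> p" "\<phi> p"] hom_setD(1)[OF \<phi> p]
          left_module_smult_zero[OF M a] by (simp add: M.l_neg)
      then show "\<ominus>\<^bsub>M\<^esub> \<phi> (iA a * p) = a \<odot>\<^bsub>M\<^esub> (\<ominus>\<^bsub>M\<^esub> \<phi> p)"
        using left_moduleD(3)[OF M a] hom_setD(1)[OF \<phi> p] hom_setD(3)[OF \<phi> a p]
        by (simp add: M.minus_equality)
    qed (auto simp: hom_setD[OF \<phi>] M.minus_add)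
    then show "\<exists>\<psi>\<in>carrier ?H. \<psi> \<oplus>\<^bsub>?H\<^esub> \<phi> = \<zero>\<^bsub>?H\<^esub>"
      by (intro bexI[of _ "\<lambda>p\<in>P. \<ominus>\<^bsub>M\<^esub> \<phi> p"])
         (auto simp: hom_setD[OF \<phi>] M.l_neg intro!: restrict_ext)
  next
    fix \<phi> \<psi> \<theta> assume "\<phi> \<in> carrier ?H" "\<psi> \<in> carrier ?H" "\<theta> \<in> carrier ?H"
    then show "\<phi> \<oplus>\<^bsub>?H\<^esub> \<psi> \<oplus>\<^bsub>?H\<^esub> \<theta> = \<phi> \<oplus>\<^bsub>?H\<^esub> (\<psi> \<oplus>\<^bsub>?H\<^esub> \<theta>)"
      by (auto simp: hom_setD M.a_assoc intro!: restrict_ext)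
  next
    fix \<phi> \<psi> assume "\<phi> \<in> carrier ?H" "\<psi> \<in> carrier ?H"
    then show "\<phi> \<oplus>\<^bsub>?H\<^esub> \<psi> = \<psi> \<oplus>\<^bsub>?H\<^esub> \<phi>"
      by (auto simp: hom_setD M.a_comm intro!: restrict_ext)
  next
    fix \<phi> assume "\<phi> \<in> carrier ?H"
    then have \<phi>: "\<phi> \<in> hom_set A iA P M" by simp
    show "\<zero>\<^bsub>?H\<^esub> \<oplus>\<^bsub>?H\<^esub> \<phi> = \<phi>"
      by (rule extensionalityI[of _ P]) (auto simp: hom_setD[OF \<phi>])
  qed (simp_all add: zero add)
  moreover have "b \<odot>\<^bsub>?H\<^esub> \<phi> \<in> carrier ?H" if "b \<in> carrier B" "\<phi> \<in> carrier ?H" for b \<phi>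
    using smult that by simp
  moreover have "(b \<oplus>\<^bsub>B\<^esub> c) \<odot>\<^bsub>?H\<^esub> \<phi> = b \<odot>\<^bsub>?H\<^esub> \<phi> \<oplus>\<^bsub>?H\<^esub> c \<odot>\<^bsub>?H\<^esub> \<phi>"
    if "b \<in> carrier B" "c \<in> carrier B" "\<phi> \<in> carrier ?H" for b c \<phi>
    using that by (auto simp: hom_setD iB_add distrib_left P_right intro!: restrict_ext)
  moreover have "b \<odot>\<^bsub>?H\<^esub> (\<phi> \<oplus>\<^bsub>?H\<^esub> \<psi>) = b \<odot>\<^bsub>?H\<^esub> \<phi> \<oplus>\<^bsub>?H\<^esub> b \<odot>\<^bsub>?H\<^esub> \<psi>"
    if "b \<in> carrier B" "\<phi> \<in> carrier ?H" "\<psi> \<in> carrier ?H" for b \<phi> \<psi>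
    using that by (auto simp: P_right intro!: restrict_ext)
  moreover have "(b \<otimes>\<^bsub>B\<^esub> c) \<odot>\<^bsub>?H\<^esub> \<phi> = b \<odot>\<^bsub>?H\<^esub> (c \<odot>\<^bsub>?H\<^esub> \<phi>)"
    if "b \<in> carrier B" "c \<in> carrier B" for b c \<phi>
    using that by (auto simp: iB_mult mult.assoc P_right intro!: restrict_ext)
  moreover have "\<one>\<^bsub>B\<^esub> \<odot>\<^bsub>?H\<^esub> \<phi> = \<phi>" if "\<phi> \<in> carrier ?H" for \<phi>
    using that by (intro extensionalityI[of _ P]) (auto simp: hom_setD iB_one)
  ultimately show ?thesis unfolding left_module_def using ring_B by simp
qed

abbreviation "HS M \<equiv> hom_set A iA P M"
abbreviation "enc M \<equiv> hom_enc A iA P M"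
abbreviation "F M \<equiv> hom_obj A iA iB P M"
abbreviation "F' \<equiv> hom_mor A iA P"

lemma F_obj:
  assumes M: "left_module A M"
  shows "left_module B (F M)" "carrier (F M) = enc M ` HS M"
    "\<zero>\<^bsub>F M\<^esub> = enc M (\<lambda>p\<in>P. \<zero>\<^bsub>M\<^esub>)"
    "\<And>\<phi> \<psi>. \<phi> \<in> HS M \<Longrightarrow> \<psi> \<in> HS M \<Longrightarrow> (\<lambda>p\<in>P. \<phi> p \<oplus>\<^bsub>M\<^esub> \<psi> p) \<in> HS M"
    "\<And>\<phi> \<psi>. \<phi> \<in> HS M \<Longrightarrow> \<psi> \<in> HS M \<Longrightarrow> enc M \<phi> \<oplus>\<^bsub>F M\<^esub> enc M \<psi> = enc M (\<lambda>p\<in>P. \<phi> p \<oplus>\<^bsub>M\<^esub> \<psi> p)"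
    "\<And>b \<phi>. b \<in> carrier B \<Longrightarrow> \<phi> \<in> HS M \<Longrightarrow> (\<lambda>p\<in>P. \<phi> (p * iB b)) \<in> HS M"
    "\<And>b \<phi>. b \<in> carrier B \<Longrightarrow> \<phi> \<in> HS M \<Longrightarrow> b \<odot>\<^bsub>F M\<^esub> enc M \<phi> = enc M (\<lambda>p\<in>P. \<phi> (p * iB b))"
proof -
  let ?H = "hom_module A iA iB P M"
  have H[simp]: "carrier ?H = hom_set A iA P M" "\<zero>\<^bsub>?H\<^esub> = (\<lambda>p\<in>P. \<zero>\<^bsub>M\<^esub>)"
    "\<And>\<phi> \<psi>. \<phi> \<oplus>\<^bsub>?H\<^esub> \<psi> = (\<lambda>p\<in>P. \<phi> p \<oplus>\<^bsub>M\<^esub> \<psi> p)" "\<And>b \<phi>. b \<odot>\<^bsub>?H\<^esub> \<phi> = (\<lambda>p\<in>P. \<phi> (p * iB b))"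
    by (simp_all add: hom_module_def)
  note Hm = hom_module[OF M]
  interpret H: abelian_group ?H by (rule left_moduleD(2)[OF Hm])
  have inj: "inj_on (enc M) (carrier ?H)" using hom_enc_inj[OF M] by simp
  note im = image_module[OF Hm lmod_congruence_inj[OF inj], folded hom_obj_def]
  show F: "left_module B (F M)" "carrier (F M) = enc M ` HS M" "\<zero>\<^bsub>F M\<^esub> = enc M (\<lambda>p\<in>P. \<zero>\<^bsub>M\<^esub>)"
    using im by simp_all
  show a: "(\<lambda>p\<in>P. \<phi> p \<oplus>\<^bsub>M\<^esub> \<psi> p) \<in> HS M" if "\<phi> \<in> HS M" "\<psi> \<in> HS M" for \<phi> \<psi>
    using H.a_closed[of \<phi> \<psi>] that by simp
  show "enc M \<phi> \<oplus>\<^bsub>F M\<^esub> enc M \<psi> = enc M (\<lambda>p\<in>P. \<phi> p \<oplus>\<^bsub>M\<^esub> \<psi> p)" if "\<phi> \<in> HS M" "\<psi> \<in> HS M" for \<phi> \<psi>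
    using im(4)[of \<phi> \<psi>] that by simp
  show s: "(\<lambda>p\<in>P. \<phi> (p * iB b)) \<in> HS M" if "b \<in> carrier B" "\<phi> \<in> HS M" for b \<phi>
    using left_moduleD(3)[OF Hm, of b \<phi>] that by simp
  show "b \<odot>\<^bsub>F M\<^esub> enc M \<phi> = enc M (\<lambda>p\<in>P. \<phi> (p * iB b))" if "b \<in> carrier B" "\<phi> \<in> HS M" for b \<phi>
    using im(5)[of b \<phi>] that by simp
qed

lemma enc_eq_iff:
  "left_module A M \<Longrightarrow> \<phi> \<in> HS M \<Longrightarrow> \<psi> \<in> HS M \<Longrightarrow> enc M \<phi> = enc M \<psi> \<longleftrightarrow> \<phi> = \<psi>"
  by (rule inj_on_eq_iff[OF hom_enc_inj])

lemma compose_hom_set: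
  assumes "f \<in> lmod_hom A M N" "\<phi> \<in> HS M"
  shows "compose P f \<phi> \<in> HS N"
  unfolding compose_def
  by (rule hom_set_restrictI) (simp_all add: hom_setD[OF assms(2)] lmod_homD[OF assms(1)])

lemma F'_enc:
  assumes "left_module A M" "\<phi> \<in> HS M"
  shows "F' M N f (enc M \<phi>) = enc N (compose P f \<phi>)"
  using assms hom_enc_inj[OF assms(1)] by (simp add: hom_mor_def)

lemma F_mor:
  assumes M: "left_module A M" and N: "left_module A N" and f: "f \<in> lmod_hom A M N"
  shows "F' M N f \<in> lmod_hom B (F M) (F N)"
proof (rule lmod_homI)
  fix u assume "u \<in> carrier (F M)"
  then obtain \<phi> where \<phi>: "\<phi> \<in> HS M" "u = enc M \<phi>" using F_obj(2)[OF M] by blast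
  then show "F' M N f u \<in> carrier (F N)"
    using compose_hom_set[OF f] by (simp add: F'_enc[OF M] F_obj(2)[OF N])
  fix b assume b: "b \<in> carrier B"
  have "compose P f (\<lambda>p\<in>P. \<phi> (p * iB b)) = (\<lambda>p\<in>P. compose P f \<phi> (p * iB b))"
    using b by (auto simp: compose_def P_right intro!: restrict_ext)
  then show "F' M N f (b \<odot>\<^bsub>F M\<^esub> u) = b \<odot>\<^bsub>F N\<^esub> F' M N f u"
    using \<phi> b compose_hom_set[OF f] by (simp add: F'_enc[OF M] F_obj(6,7)[OF M] F_obj(7)[OF N])
next
  fix u v assume "u \<in> carrier (F M)" "v \<in> carrier (F M)"
  then obtain \<phi> \<psi> where \<phi>: "\<phi> \<in> HS M" "u = enc M \<phi>" and \<psi>: "\<psi> \<in> HS M" "v = enc M \<psi>"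
    using F_obj(2)[OF M] by blast
  have "compose P f (\<lambda>p\<in>P. \<phi> p \<oplus>\<^bsub>M\<^esub> \<psi> p) = (\<lambda>p\<in>P. compose P f \<phi> p \<oplus>\<^bsub>N\<^esub> compose P f \<psi> p)"
    using \<phi> \<psi> by (auto simp: compose_def hom_setD lmod_homD(2)[OF f] intro!: restrict_ext)
  then show "F' M N f (u \<oplus>\<^bsub>F M\<^esub> v) = F' M N f u \<oplus>\<^bsub>F N\<^esub> F' M N f v"
    using \<phi> \<psi> compose_hom_set[OF f] by (simp add: F'_enc[OF M] F_obj(4,5)[OF M] F_obj(5)[OF N])
qed (simp add: hom_mor_def F_obj(2)[OF M])

lemma F_linear_functor: "linear_functor A B (F :: ('a, 'u) module \<Rightarrow> _) F'"
  unfolding linear_functor_def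
proof (intro conjI allI impI; (elim conjE)?)
  fix M :: "('a, 'u) module" assume M: "left_module A M"
  show "left_module B (F M)" by (rule F_obj(1)[OF M])
  show "F' M M (lmod_id M) = lmod_id (F M)"
  proof (rule lmod_hom_ext[OF F_mor[OF M M lmod_id_hom[OF M]] lmod_id_hom[OF F_obj(1)[OF M]]])
    fix u assume u: "u \<in> carrier (F M)"
    then obtain \<phi> where \<phi>: "\<phi> \<in> HS M" "u = enc M \<phi>" using F_obj(2)[OF M] by blast
    have "compose P (lmod_id M) \<phi> = \<phi>"
      by (rule extensionalityI[of _ P]) (auto simp: compose_def lmod_id_def hom_setD[OF \<phi>(1)])
    then show "F' M M (lmod_id M) u = lmod_id (F M) u"
      using \<phi> u by (simp add: F'_enc[OF M] lmod_id_def)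
  qed
next
  fix M N :: "('a, 'u) module" and f
  assume M: "left_module A M" and N: "left_module A N" and f: "f \<in> lmod_hom A M N"
  show "F' M N f \<in> lmod_hom B (F M) (F N)" by (rule F_mor[OF M N f])
next
  fix L M N :: "('a, 'u) module" and f g
  assume L: "left_module A L" and M: "left_module A M" and N: "left_module A N"
    and f: "f \<in> lmod_hom A L M" and g: "g \<in> lmod_hom A M N"
  show "F' L N (compose (carrier L) g f) = compose (carrier (F L)) (F' M N g) (F' L M f)"
  proof (rule lmod_hom_ext[OF F_mor[OF L N lmod_hom_compose[OF L f g]]
        lmod_hom_compose[OF F_obj(1)[OF L] F_mor[OF L M f] F_mor[OF M N g]]])
    fix u assume u: "u \<in> carrier (F L)"
    then obtain \<phi> where \<phi>: "\<phi> \<in> HS L" "u = enc L \<phi>" using F_obj(2)[OF L] by blast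
    have "compose P (compose (carrier L) g f) \<phi> = compose P g (compose P f \<phi>)"
      by (auto simp: compose_def hom_setD[OF \<phi>(1)] intro!: restrict_ext)
    then show "F' L N (compose (carrier L) g f) u = compose (carrier (F L)) (F' M N g) (F' L M f) u"
      using \<phi> u compose_hom_set[OF f \<phi>(1)]
      by (simp add: F'_enc[OF L] F'_enc[OF M] compose_eq)
  qed
next
  fix M N :: "('a, 'u) module" and f g
  assume M: "left_module A M" and N: "left_module A N" and f: "f \<in> lmod_hom A M N"
    and g: "g \<in> lmod_hom A M N"
  have ext: "F' M N (lmod_add M N f g) \<in> extensional (carrier (F M))"
    "lmod_add (F M) (F N) (F' M N f) (F' M N g) \<in> extensional (carrier (F M))"
    by (simp_all add: hom_mor_def F_obj(2)[OF M] lmod_add_def)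
  show "F' M N (lmod_add M N f g) = lmod_add (F M) (F N) (F' M N f) (F' M N g)"
  proof (rule extensionalityI[OF ext])
    fix u assume u: "u \<in> carrier (F M)"
    then obtain \<phi> where \<phi>: "\<phi> \<in> HS M" "u = enc M \<phi>" using F_obj(2)[OF M] by blast
    have "compose P (lmod_add M N f g) \<phi> = (\<lambda>p\<in>P. compose P f \<phi> p \<oplus>\<^bsub>N\<^esub> compose P g \<phi> p)"
      by (auto simp: compose_def lmod_add_def hom_setD[OF \<phi>(1)] intro!: restrict_ext)
    then show "F' M N (lmod_add M N f g) u = lmod_add (F M) (F N) (F' M N f) (F' M N g) u"
      using \<phi> u compose_hom_set[OF f \<phi>(1)] compose_hom_set[OF g \<phi>(1)]
      by (simp add: F'_enc[OF M] lmod_add_def F_obj(5)[OF N])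
  qed
next
  fix M N :: "('a, 'u) module" and f c
  assume M: "left_module A M" and N: "left_module A N" and f: "f \<in> lmod_hom A M N"
  have ext: "F' M N (lmod_scale A M N c f) \<in> extensional (carrier (F M))"
    "lmod_scale B (F M) (F N) c (F' M N f) \<in> extensional (carrier (F M))"
    by (simp_all add: hom_mor_def F_obj(2)[OF M] lmod_scale_def)
  show "F' M N (lmod_scale A M N c f) = lmod_scale B (F M) (F N) c (F' M N f)"
  proof (rule extensionalityI[OF ext])
    fix u assume u: "u \<in> carrier (F M)"
    then obtain \<phi> where \<phi>: "\<phi> \<in> HS M" "u = enc M \<phi>" using F_obj(2)[OF M] by blast
    have "compose P (lmod_scale A M N c f) \<phi> = (\<lambda>p\<in>P. compose P f \<phi> (p * iB (c \<odot>\<^bsub>B\<^esub> \<one>\<^bsub>B\<^esub>)))"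
    proof (unfold compose_def[of P "lmod_scale A M N c f"], rule restrict_ext)
      fix p assume p: "p \<in> P"
      have c: "p * iB (c \<odot>\<^bsub>B\<^esub> \<one>\<^bsub>B\<^esub>) = iA (K c) * p"
        using scal_central[of p c] p by (simp add: scal_eq)
      show "lmod_scale A M N c f (\<phi> p) = compose P f \<phi> (p * iB (c \<odot>\<^bsub>B\<^esub> \<one>\<^bsub>B\<^esub>))"
        unfolding c using p
        by (simp add: lmod_scale_def compose_eq P_left[OF scal_A] hom_setD[OF \<phi>(1)] scal_A
            lmod_homD[OF f])
    qed
    then show "F' M N (lmod_scale A M N c f) u = lmod_scale B (F M) (F N) c (F' M N f) u"
      using \<phi> u compose_hom_set[OF f \<phi>(1)]
      by (simp add: F'_enc[OF M] lmod_scale_def F_obj(7)[OF N] scal_B)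
  qed
qed

text \<open>The natural map \<open>M \<rightarrow> Hom\<^sub>B(Q, Hom\<^sub>A(P, M))\<close> sends \<open>m\<close> to \<open>q \<mapsto> (p \<mapsto> (p q) m)\<close>.\<close>

definition ev :: "('a, 'u) module \<Rightarrow> 'u \<Rightarrow> 'r \<Rightarrow> 'r \<Rightarrow> 'u" where
  "ev M m q = (\<lambda>p\<in>P. jA (p * q) \<odot>\<^bsub>M\<^esub> m)"

lemma ev_hom:
  assumes M: "left_module A M" and m: "m \<in> carrier M" and q: "q \<in> Q"
  shows "ev M m q \<in> HS M"
  unfolding ev_def
proof (rule hom_set_restrictI)
  fix p assume p: "p \<in> P"
  show "jA (p * q) \<odot>\<^bsub>M\<^esub> m \<in> carrier M" by (rule left_moduleD(3)[OF M jA_in(1)[OF PQ[OF p q]] m])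
  fix p' assume p': "p' \<in> P"
  show "jA ((p + p') * q) \<odot>\<^bsub>M\<^esub> m = jA (p * q) \<odot>\<^bsub>M\<^esub> m \<oplus>\<^bsub>M\<^esub> jA (p' * q) \<odot>\<^bsub>M\<^esub> m"
    using left_moduleD(4)[OF M _ _ m] jA_in PQ p p' q jA_add by (simp add: distrib_right)
next
  fix a p assume a: "a \<in> carrier A" and p: "p \<in> P"
  show "jA (iA a * p * q) \<odot>\<^bsub>M\<^esub> m = a \<odot>\<^bsub>M\<^esub> (jA (p * q) \<odot>\<^bsub>M\<^esub> m)"
    using left_moduleD(6)[OF M a _ m] jA_in PQ[OF p q] jA_mult[of "iA a" "p * q"] a
    by (simp add: mult.assoc jA_iA)
qed

lemma ev_add:
  assumes M: "left_module A M" and m: "m \<in> carrier M" "n \<in> carrier M" and q: "q \<in> Q"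
  shows "ev M (m \<oplus>\<^bsub>M\<^esub> n) q = (\<lambda>p\<in>P. ev M m q p \<oplus>\<^bsub>M\<^esub> ev M n q p)"
  unfolding ev_def using left_moduleD(5)[OF M _ m] jA_in PQ q
  by (auto intro!: restrict_ext)

lemma ev_smult:
  assumes M: "left_module A M" and m: "m \<in> carrier M" and a: "a \<in> carrier A" and q: "q \<in> Q"
  shows "ev M (a \<odot>\<^bsub>M\<^esub> m) q = ev M m (q * iA a)"
  unfolding ev_def
proof (rule restrict_ext)
  fix p assume p: "p \<in> P"
  show "jA (p * q) \<odot>\<^bsub>M\<^esub> (a \<odot>\<^bsub>M\<^esub> m) = jA (p * (q * iA a)) \<odot>\<^bsub>M\<^esub> m"
    using left_moduleD(6)[OF M _ a m] jA_in PQ[OF p q] jA_mult[of "p * q" "iA a"] a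
    by (simp add: mult.assoc[symmetric] jA_iA)
qed

lemma ev_q_add:
  assumes M: "left_module A M" and m: "m \<in> carrier M" and q: "q \<in> Q" "q' \<in> Q"
  shows "ev M m (q + q') = (\<lambda>p\<in>P. ev M m q p \<oplus>\<^bsub>M\<^esub> ev M m q' p)"
  unfolding ev_def using left_moduleD(4)[OF M _ _ m] jA_in PQ q jA_add
  by (auto simp: distrib_left intro!: restrict_ext)

lemma ev_q_mult:
  assumes b: "b \<in> carrier B"
  shows "ev M m (iB b * q) = (\<lambda>p\<in>P. ev M m q (p * iB b))"
  unfolding ev_def using P_right[OF b] by (auto simp: mult.assoc intro!: restrict_ext)

abbreviation "GHS \<equiv> hom_set B iB Q"
abbreviation "Genc \<equiv> hom_enc B iB Q"
abbreviation "G \<equiv> hom_obj B iB iA Q"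
abbreviation "G' \<equiv> hom_mor B iB Q"

definition unit_map :: "('a, 'u) module \<Rightarrow> 'u \<Rightarrow> 'u" where
  "unit_map M = (\<lambda>m\<in>carrier M. Genc (F M) (\<lambda>q\<in>Q. enc M (ev M m q)))"

lemma ev_enc_hom:
  assumes M: "left_module A M" and m: "m \<in> carrier M"
  shows "(\<lambda>q\<in>Q. enc M (ev M m q)) \<in> GHS (F M)"
proof -
  interpret S: morita_context B A iB iA Q P by (rule swap)
  show ?thesis
    by (rule S.hom_set_restrictI)
       (simp_all add: F_obj[OF M] ev_hom[OF M m] ev_q_add[OF M m] ev_q_mult Q_left)
qed

lemma unit_hom:
  assumes M: "left_module A M"
  shows "unit_map M \<in> lmod_hom A M (G (F M))"
  unfolding unit_map_def
proof (rule lmod_hom_restrictI[OF M])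
  interpret S: morita_context B A iB iA Q P by (rule swap)
  note FM = F_obj(1)[OF M]
  fix m assume m: "m \<in> carrier M"
  show "Genc (F M) (\<lambda>q\<in>Q. enc M (ev M m q)) \<in> carrier (G (F M))"
    using ev_enc_hom[OF M m] by (simp add: S.F_obj(2)[OF FM])
  fix n assume n: "n \<in> carrier M"
  have "(\<lambda>q\<in>Q. enc M (ev M (m \<oplus>\<^bsub>M\<^esub> n) q))
      = (\<lambda>q\<in>Q. (\<lambda>q\<in>Q. enc M (ev M m q)) q \<oplus>\<^bsub>F M\<^esub> (\<lambda>q\<in>Q. enc M (ev M n q)) q)"
    by (rule restrict_ext) (simp add: F_obj(5)[OF M] ev_hom[OF M] m n ev_add[OF M])
  then show "Genc (F M) (\<lambda>q\<in>Q. enc M (ev M (m \<oplus>\<^bsub>M\<^esub> n) q))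
      = Genc (F M) (\<lambda>q\<in>Q. enc M (ev M m q)) \<oplus>\<^bsub>G (F M)\<^esub> Genc (F M) (\<lambda>q\<in>Q. enc M (ev M n q))"
    by (simp add: S.F_obj(5)[OF FM] ev_enc_hom[OF M] m n)
next
  interpret S: morita_context B A iB iA Q P by (rule swap)
  note FM = F_obj(1)[OF M]
  fix a m assume a: "a \<in> carrier A" and m: "m \<in> carrier M"
  have "(\<lambda>q\<in>Q. enc M (ev M (a \<odot>\<^bsub>M\<^esub> m) q)) = (\<lambda>q\<in>Q. (\<lambda>q\<in>Q. enc M (ev M m q)) (q * iA a))"
    by (rule restrict_ext) (simp add: ev_smult[OF M m a] Q_right[OF a])
  then show "Genc (F M) (\<lambda>q\<in>Q. enc M (ev M (a \<odot>\<^bsub>M\<^esub> m) q))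
      = a \<odot>\<^bsub>G (F M)\<^esub> Genc (F M) (\<lambda>q\<in>Q. enc M (ev M m q))"
    by (simp add: S.F_obj(7)[OF FM a] ev_enc_hom[OF M] m)
qed

text \<open>If \<open>(p q) m = (p q) n\<close> for all \<open>p\<close> and \<open>q\<close>, then \<open>m = n\<close> because \<open>1\<close> is a sum of products \<open>p q\<close>.\<close>

lemma unit_inj:
  assumes M: "left_module A M"
  shows "inj_on (unit_map M) (carrier M)"
proof (rule inj_onI)
  interpret S: morita_context B A iB iA Q P by (rule swap)
  interpret A: ring A by (rule ring_A)
  note FM = F_obj(1)[OF M]
  fix m n assume m: "m \<in> carrier M" and n: "n \<in> carrier M" and eq: "unit_map M m = unit_map M n"
  have e: "(\<lambda>q\<in>Q. enc M (ev M m q)) = (\<lambda>q\<in>Q. enc M (ev M n q))"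
    using eq m n by (simp add: unit_map_def S.enc_eq_iff[OF FM] ev_enc_hom[OF M])
  have ev_eq: "ev M m q = ev M n q" if q: "q \<in> Q" for q
    using fun_cong[OF e, of q] q by (simp add: enc_eq_iff[OF M] ev_hom[OF M] m n)
  have j: "jA (p * q) \<odot>\<^bsub>M\<^esub> m = jA (p * q) \<odot>\<^bsub>M\<^esub> n" if "p \<in> P" "q \<in> Q" for p q
    using fun_cong[OF ev_eq[OF that(2)], of p] that(1) by (simp add: ev_def)
  have sum: "(\<Sum>(p, q)\<leftarrow>L. p * q) \<in> iA ` carrier A \<and>
      jA (\<Sum>(p, q)\<leftarrow>L. p * q) \<odot>\<^bsub>M\<^esub> m = jA (\<Sum>(p, q)\<leftarrow>L. p * q) \<odot>\<^bsub>M\<^esub> n" if "set L \<subseteq> P \<times> Q" for L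
    using that
  proof (induction L)
    case Nil
    have "(0::'r) = iA \<zero>\<^bsub>A\<^esub>" by (simp add: iA_zero)
    then have "(0::'r) \<in> iA ` carrier A" "jA 0 = \<zero>\<^bsub>A\<^esub>" using jA_iA[OF A.zero_closed] by auto
    then show ?case using left_module_zero_smult[OF M] m n by simp
  next
    case (Cons x L)
    obtain p q where x: "x = (p, q)" by (cases x)
    have pq: "p \<in> P" "q \<in> Q" using Cons.prems x by auto
    show ?case
      using Cons PQ[OF pq] jA_add jA_in left_moduleD(4)[OF M] m n j[OF pq]
      by (simp add: x)
  qed
  obtain L where L: "set L \<subseteq> P \<times> Q" "(\<Sum>(p, q)\<leftarrow>L. p * q) = 1" using PQ_one by blast
  have "jA 1 = \<one>\<^bsub>A\<^esub>" using jA_iA[OF A.one_closed] by (simp add: iA_one)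
  then show "m = n" using sum[OF L(1)] left_moduleD(7)[OF M] m n by (simp add: L(2))
qed

text \<open>With \<open>1 = \<Sum> p\<^sub>i q\<^sub>i\<close>, an element \<open>\<Phi>\<close> of the double dual is the image of \<open>\<Sum> \<Phi>(q\<^sub>i)(p\<^sub>i)\<close>.\<close>

lemma unit_surj:
  assumes M: "left_module A M"
  shows "unit_map M ` carrier M = carrier (G (F M))"
proof (rule subset_antisym)
  interpret S: morita_context B A iB iA Q P by (rule swap)
  interpret M: abelian_group M by (rule left_moduleD(2)[OF M])
  note FM = F_obj(1)[OF M]
  show "unit_map M ` carrier M \<subseteq> carrier (G (F M))" using lmod_homD(1)[OF unit_hom[OF M]] by blast
  show "carrier (G (F M)) \<subseteq> unit_map M ` carrier M"
  proof
    fix u assume "u \<in> carrier (G (F M))"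
    then obtain \<Phi> where \<Phi>: "\<Phi> \<in> GHS (F M)" "u = Genc (F M) \<Phi>" using S.F_obj(2)[OF FM] by blast
    \<comment> \<open>\<open>D\<close> is \<open>\<Phi>\<close> with the inner coding undone.\<close>
    define D where "D q = inv_into (HS M) (enc M) (\<Phi> q)" for q
    have D: "D q \<in> HS M" "enc M (D q) = \<Phi> q" if "q \<in> Q" for q
      using S.hom_setD(1)[OF \<Phi>(1) that] unfolding D_def
      by (auto simp: F_obj(2)[OF M] inv_into_into f_inv_into_f)
    have D_uniq: "D q = \<phi>" if "q \<in> Q" "\<phi> \<in> HS M" "\<Phi> q = enc M \<phi>" for q \<phi>
      using D[OF that(1)] that enc_eq_iff[OF M] by metis
    have D_add: "D (q + q') = (\<lambda>p\<in>P. D q p \<oplus>\<^bsub>M\<^esub> D q' p)" if "q \<in> Q" "q' \<in> Q" for q q'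
    proof (rule D_uniq)
      show "\<Phi> (q + q') = enc M (\<lambda>p\<in>P. D q p \<oplus>\<^bsub>M\<^esub> D q' p)"
        unfolding F_obj(5)[OF M D(1)[OF that(1)] D(1)[OF that(2)], symmetric] D(2)[OF that(1)] D(2)[OF that(2)]
        by (rule S.hom_setD(2)[OF \<Phi>(1) that])
    qed (use that D F_obj(4)[OF M] Q_add in auto)
    have D_mult: "D (iB b * q) = (\<lambda>p\<in>P. D q (p * iB b))" if "q \<in> Q" "b \<in> carrier B" for q b
    proof (rule D_uniq)
      show "\<Phi> (iB b * q) = enc M (\<lambda>p\<in>P. D q (p * iB b))"
        unfolding F_obj(7)[OF M that(2) D(1)[OF that(1)], symmetric] D(2)[OF that(1)]
        by (rule S.hom_setD(3)[OF \<Phi>(1) that(2,1)])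
    qed (use that D F_obj(6)[OF M] Q_left in auto)
    have D_zero: "D 0 = (\<lambda>p\<in>P. \<zero>\<^bsub>M\<^esub>)"
    proof (rule D_uniq[OF Q_zero])
      show "(\<lambda>p\<in>P. \<zero>\<^bsub>M\<^esub>) \<in> HS M"
        by (rule hom_set_restrictI) (auto simp: left_module_smult_zero[OF M])
      show "\<Phi> 0 = enc M (\<lambda>p\<in>P. \<zero>\<^bsub>M\<^esub>)"
        using S.hom_set_zero[OF \<Phi>(1) FM] by (simp add: F_obj(3)[OF M])
    qed
    define msum where "msum L = foldr (\<lambda>(p, q) s. D q p \<oplus>\<^bsub>M\<^esub> s) L \<zero>\<^bsub>M\<^esub>" for L :: "('r \<times> 'r) list"
    have msum: "msum L \<in> carrier M \<and> q * (\<Sum>(p, q)\<leftarrow>L. p * q) \<in> Q \<and>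
        jA (p * q) \<odot>\<^bsub>M\<^esub> msum L = D (q * (\<Sum>(p, q)\<leftarrow>L. p * q)) p"
      if "set L \<subseteq> P \<times> Q" and p: "p \<in> P" and q: "q \<in> Q" for L p q
      using that(1)
    proof (induction L)
      case Nil
      then show ?case
        using left_module_smult_zero[OF M jA_in(1)[OF PQ[OF p q]]] D_zero p Q_zero
        by (simp add: msum_def)
    next
      case (Cons x L)
      obtain p' q' where x: "x = (p', q')" by (cases x)
      have pq: "p' \<in> P" "q' \<in> Q" using Cons.prems x by auto
      have IH: "msum L \<in> carrier M" "q * (\<Sum>(p, q)\<leftarrow>L. p * q) \<in> Q"
        "jA (p * q) \<odot>\<^bsub>M\<^esub> msum L = D (q * (\<Sum>(p, q)\<leftarrow>L. p * q)) p" using Cons by auto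
      obtain b where b: "b \<in> carrier B" "q * p' = iB b" using QP[OF pq(1) q] by blast
      have e: "q * (p' * q') = iB b * q'" using b by (simp add: mult.assoc[symmetric])
      have Dc: "D q' p' \<in> carrier M" using hom_setD(1)[OF D(1)[OF pq(2)] pq(1)] .
      have "jA (p * q) \<odot>\<^bsub>M\<^esub> D q' p' = D q' (iA (jA (p * q)) * p')"
        using hom_setD(3)[OF D(1)[OF pq(2)] jA_in(1)[OF PQ[OF p q]] pq(1)] by simp
      also have "iA (jA (p * q)) * p' = p * iB b"
        using jA_in(2)[OF PQ[OF p q]] b by (simp add: mult.assoc)
      also have "D q' (p * iB b) = D (iB b * q') p" using D_mult[OF pq(2) b(1)] p by simp
      finally have f: "jA (p * q) \<odot>\<^bsub>M\<^esub> D q' p' = D (iB b * q') p" .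
      have Qb: "iB b * q' \<in> Q" using Q_left b pq by blast
      have "msum (x # L) = D q' p' \<oplus>\<^bsub>M\<^esub> msum L" by (simp add: msum_def x)
      then show ?case
        using IH Dc f Qb left_moduleD(5)[OF M jA_in(1)[OF PQ[OF p q]] Dc IH(1)] Q_add D_add[OF Qb IH(2)] p
        by (simp add: x distrib_left e)
    qed
    obtain L where L: "set L \<subseteq> P \<times> Q" "(\<Sum>(p, q)\<leftarrow>L. p * q) = 1" using PQ_one by blast
    let ?m = "msum L"
    have m: "?m \<in> carrier M" using msum[OF L(1) P_zero Q_zero] by blast
    have "ev M ?m q = D q" if "q \<in> Q" for q
    proof (rule extensionalityI[of _ P])
      show "D q \<in> extensional P" using hom_setD(4)[OF D(1)[OF that]] .
    qed (use msum[OF L(1) _ that] in \<open>simp_all add: ev_def L(2)\<close>)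
    then have "(\<lambda>q\<in>Q. enc M (ev M ?m q)) = \<Phi>"
      using S.hom_setD(4)[OF \<Phi>(1)] D(2) by (intro extensionalityI[of _ Q]) auto
    then have "unit_map M ?m = u" using m \<Phi>(2) by (simp add: unit_map_def)
    then show "u \<in> unit_map M ` carrier M" using m by blast
  qed
qed

lemma unit_inverse: "inverse_up_to_iso A (F :: ('a, 'u) module \<Rightarrow> _) F' G G'"
  unfolding inverse_up_to_iso_def
proof (intro exI[of _ unit_map] conjI allI impI; (elim conjE)?)
  interpret S: morita_context B A iB iA Q P by (rule swap)
  fix M :: "('a, 'u) module" assume M: "left_module A M"
  show "lmod_iso A M (G (F M)) (unit_map M)"
    by (rule lmod_isoI_bij[OF M S.F_obj(1)[OF F_obj(1)[OF M]] unit_hom[OF M]])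
       (simp add: bij_betw_def unit_inj[OF M] unit_surj[OF M])
next
  interpret S: morita_context B A iB iA Q P by (rule swap)
  fix M N :: "('a, 'u) module" and f
  assume M: "left_module A M" and N: "left_module A N" and f: "f \<in> lmod_hom A M N"
  show "compose (carrier M) (unit_map N) f = compose (carrier M) (G' (F M) (F N) (F' M N f)) (unit_map M)"
    unfolding compose_def
  proof (rule restrict_ext)
    fix m assume m: "m \<in> carrier M"
    have fe: "compose P f (ev M m q) = ev N (f m) q" if "q \<in> Q" for q
      unfolding compose_def ev_def
      by (rule restrict_ext) (simp add: lmod_homD(3)[OF f] jA_in PQ that m)
    have "compose Q (F' M N f) (\<lambda>q\<in>Q. enc M (ev M m q)) = (\<lambda>q\<in>Q. enc N (ev N (f m) q))"
      unfolding compose_def by (rule restrict_ext) (simp add: F'_enc[OF M] ev_hom[OF M m] fe)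
    then show "unit_map N (f m) = G' (F M) (F N) (F' M N f) (unit_map M m)"
      using m lmod_homD(1)[OF f m]
      by (simp add: unit_map_def S.F'_enc[OF F_obj(1)[OF M]] ev_enc_hom[OF M m])
  qed
qed

theorem morita: "morita_equivalent (U :: 'u itself) A B"
proof -
  interpret S: morita_context B A iB iA Q P by (rule swap)
  show ?thesis
    unfolding morita_equivalent_def
    using F_linear_functor S.F_linear_functor unit_inverse S.unit_inverse by blast
qed

end

section \<open>Shifted polynomials\<close>

definition shift_poly :: "complex \<Rightarrow> complex poly \<Rightarrow> complex poly" where
  "shift_poly c p = pcompose p [:c, 1:]"

lemma poly_shift_poly [simp]: "poly (shift_poly c p) z = poly p (z + c)"
  by (simp add: shift_poly_def poly_pcompose add.commute)

lemma complex_poly_eqI: "(\<And>z. poly p z = poly q z) \<Longrightarrow> p = (q :: complex poly)"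
  by (metis poly_eq_poly_eq_iff ext)

lemma shift_poly_simps [simp]:
  "shift_poly c (p + q) = shift_poly c p + shift_poly c q"
  "shift_poly c (p - q) = shift_poly c p - shift_poly c q"
  "shift_poly c (p * q) = shift_poly c p * shift_poly c q"
  "shift_poly c 0 = 0" "shift_poly c 1 = 1" "shift_poly c [:d:] = [:d:]"
  "shift_poly 0 p = p" "shift_poly c (shift_poly d p) = shift_poly (c + d) p"
  by (rule complex_poly_eqI; simp add: add.assoc)+

lemma shift_poly_eq_0 [simp]: "shift_poly c p = 0 \<longleftrightarrow> p = 0"
  by (metis add.right_inverse shift_poly_simps(4,7,8))

lemma degree_shift_poly [simp]: "degree (shift_poly c p) = degree p"
  by (simp add: shift_poly_def degree_pcompose)

section \<open>The quotient presentation\<close>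

definition gwa_pi :: "complex poly \<Rightarrow> free_alg \<Rightarrow> free_alg set" where
  "gwa_pi a f = gwa_ideal a +>\<^bsub>free_ring\<^esub> f"

lemma gwa_ideal_closed:
  shows "0 \<in> gwa_ideal a" "f \<in> gwa_ideal a \<Longrightarrow> g \<in> gwa_ideal a \<Longrightarrow> f + g \<in> gwa_ideal a"
    "f \<in> gwa_ideal a \<Longrightarrow> g * f \<in> gwa_ideal a" "f \<in> gwa_ideal a \<Longrightarrow> f * g \<in> gwa_ideal a"
    "f \<in> gwa_ideal a \<Longrightarrow> - f \<in> gwa_ideal a" "f \<in> gwa_ideal a \<Longrightarrow> g \<in> gwa_ideal a \<Longrightarrow> f - g \<in> gwa_ideal a"
proof -
  interpret I: ideal "gwa_ideal a" free_ring by (rule ideal_gwa_ideal)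
  show z: "0 \<in> gwa_ideal a" using additive_subgroup.zero_closed[OF I.additive_subgroup_axioms] by simp
  show ad: "f + g \<in> gwa_ideal a" if "f \<in> gwa_ideal a" "g \<in> gwa_ideal a" for f g
    using additive_subgroup.a_closed[OF I.additive_subgroup_axioms that] by simp
  show ml: "g * f \<in> gwa_ideal a" if "f \<in> gwa_ideal a" for f g
    using I.I_l_closed[OF that, of g] by simp
  show "f * g \<in> gwa_ideal a" if "f \<in> gwa_ideal a" for f g
    using I.I_r_closed[OF that, of g] by simp
  show m: "- f \<in> gwa_ideal a" if "f \<in> gwa_ideal a" for f
    using ml[OF that, of "-1"] by simp
  show "f - g \<in> gwa_ideal a" if "f \<in> gwa_ideal a" "g \<in> gwa_ideal a" for f g
    using ad[OF that(1) m[OF that(2)]] by simp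
qed

lemma gwa_pi_eq_iff: "gwa_pi a f = gwa_pi a g \<longleftrightarrow> f - g \<in> gwa_ideal a"
proof -
  have car: "gwa_pi a f = {i + f | i. i \<in> gwa_ideal a}" for f
    by (auto simp: gwa_pi_def a_r_coset_def' )
  show ?thesis
  proof
    assume "gwa_pi a f = gwa_pi a g"
    moreover have "f \<in> gwa_pi a f" using gwa_ideal_closed(1) by (force simp: car)
    ultimately show "f - g \<in> gwa_ideal a" by (auto simp: car)
  next
    assume fg: "f - g \<in> gwa_ideal a"
    have "i + f = (i + (f - g)) + g" "i + g = (i - (f - g)) + f" for i by simp_all
    then show "gwa_pi a f = gwa_pi a g"
      unfolding car using gwa_ideal_closed(2,6)[OF _ fg] by blast
  qed
qed

lemma gwa_pi_simps:
  "carrier (gwa a) = range (gwa_pi a)" "gwa_pi a f \<in> carrier (gwa a)"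
  "gwa_pi a f \<oplus>\<^bsub>gwa a\<^esub> gwa_pi a g = gwa_pi a (f + g)"
  "gwa_pi a f \<otimes>\<^bsub>gwa a\<^esub> gwa_pi a g = gwa_pi a (f * g)"
  "\<one>\<^bsub>gwa a\<^esub> = gwa_pi a 1" "\<zero>\<^bsub>gwa a\<^esub> = gwa_pi a 0"
  "c \<odot>\<^bsub>gwa a\<^esub> gwa_pi a f = gwa_pi a (free_const c * f)"
proof -
  interpret I: ideal "gwa_ideal a" free_ring by (rule ideal_gwa_ideal)
  show "carrier (gwa a) = range (gwa_pi a)" "gwa_pi a f \<in> carrier (gwa a)"
    by (auto simp: FactRing_def A_RCOSETS_def' gwa_pi_def)
  show "gwa_pi a f \<oplus>\<^bsub>gwa a\<^esub> gwa_pi a g = gwa_pi a (f + g)"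
    using I.a_rcos_sum[of f g] by (simp add: FactRing_def gwa_pi_def)
  show m: "gwa_pi a f \<otimes>\<^bsub>gwa a\<^esub> gwa_pi a g = gwa_pi a (f * g)" for f g
    using I.rcoset_mult_add[of f g] by (simp add: FactRing_def gwa_pi_def)
  show "\<one>\<^bsub>gwa a\<^esub> = gwa_pi a 1" by (simp add: FactRing_def gwa_pi_def)
  show "\<zero>\<^bsub>gwa a\<^esub> = gwa_pi a 0"
    by (auto simp: FactRing_def gwa_pi_def a_r_coset_def')
  show "c \<odot>\<^bsub>gwa a\<^esub> gwa_pi a f = gwa_pi a (free_const c * f)"
    using m[of "free_const c" f] by (simp add: gwa_pi_def)
qed

abbreviation "fh \<equiv> free_gen Letter_h"
abbreviation "fx \<equiv> free_gen Letter_x"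
abbreviation "fy \<equiv> free_gen Letter_y"

lemma gwa_relations_in_ideal:
  "fx * fh - (fh - 1) * fx \<in> gwa_ideal a" "fy * fh - (fh + 1) * fy \<in> gwa_ideal a"
  "fy * fx - free_eval a fh \<in> gwa_ideal a" "fx * fy - free_eval a (fh - 1) \<in> gwa_ideal a"
proof -
  have "gwa_relations a \<subseteq> gwa_ideal a"
    unfolding gwa_ideal_def by (rule ring.genideal_self[OF ring_free_ring]) simp
  then show "fx * fh - (fh - 1) * fx \<in> gwa_ideal a" "fy * fh - (fh + 1) * fy \<in> gwa_ideal a"
    "fy * fx - free_eval a fh \<in> gwa_ideal a" "fx * fy - free_eval a (fh - 1) \<in> gwa_ideal a"
    by (auto simp: gwa_relations_def Let_def)
qed

lemma free_const_simps [simp]: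
  "free_const (c + d) = free_const c + free_const d" "free_const (c * d) = free_const c * free_const d"
  "free_const 0 = 0" "free_const 1 = 1"
  by (simp_all add: free_const_def single_add mult_single)

text \<open>The free algebra is spanned by words; peeling off letters from the left gives an
  induction principle.\<close>

lemma free_alg_induct [case_names zero one add const letter]:
  assumes zero: "P 0" and one: "P 1"
    and add: "\<And>f g. P f \<Longrightarrow> P g \<Longrightarrow> P (f + g)"
    and const: "\<And>c f. P f \<Longrightarrow> P (free_const c * f)"
    and letter: "\<And>l f. P f \<Longrightarrow> P (free_gen l * f)"
  shows "P (f :: free_alg)"
proof (induction f rule: update_induct)
  case const
  show ?case by (rule zero)
next
  case (update f k v)
  have w: "P (Poly_Mapping.single (Word ls) 1)" for ls
  proof (induction ls)
    case Nil
    have "Poly_Mapping.single (Word []) (1::complex) = 1"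
      by (simp add: zero_gwa_word_def[symmetric])
    then show ?case using one by simp
  next
    case (Cons l ls)
    have "Poly_Mapping.single (Word (l # ls)) (1::complex) = free_gen l * Poly_Mapping.single (Word ls) 1"
      by (simp add: free_gen_def mult_single)
    then show ?case using letter Cons by simp
  qed
  obtain ls where k: "k = Word ls" by (cases k)
  have "Poly_Mapping.single k v = free_const v * Poly_Mapping.single (Word ls) 1"
    by (simp add: k free_const_def mult_single)
  moreover have "Poly_Mapping.update k v f = f + Poly_Mapping.single k v"
    using update.hyps by (intro poly_mapping_eqI)
      (auto simp: lookup_update lookup_add lookup_single in_keys_iff)
  ultimately show ?case using add[OF update.IH const[OF w]] by simp
qed

lemma free_eval_altdef:
  assumes "degree p \<le> n"
  shows "free_eval p z = (\<Sum>i\<le>n. free_const (coeff p i) * z ^ i)"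
  unfolding free_eval_def using assms
  by (intro sum.mono_neutral_left) (auto simp: coeff_eq_0)

lemma free_eval_0 [simp]: "free_eval 0 z = 0" by (simp add: free_eval_def)

lemma free_eval_const [simp]: "free_eval [:c:] z = free_const c" by (simp add: free_eval_def)

lemma free_eval_add: "free_eval (p + q) z = free_eval p z + free_eval q z"
proof -
  let ?n = "max (degree p) (degree q)"
  show ?thesis
    using degree_add_le_max[of p q]
    by (simp add: free_eval_altdef[of _ ?n] sum.distrib distrib_right)
qed

lemma free_eval_pCons: "free_eval (pCons c p) z = free_const c + z * free_eval p z"
proof -
  have "free_eval (pCons c p) z = (\<Sum>i\<le>Suc (degree p). free_const (coeff (pCons c p) i) * z ^ i)"
    by (rule free_eval_altdef) (simp add: degree_pCons_le)
  also have "\<dots> = free_const c + (\<Sum>i\<le>degree p. free_const (coeff p i) * z ^ Suc i)"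
    by (subst sum.atMost_Suc_shift) simp
  also have "(\<Sum>i\<le>degree p. free_const (coeff p i) * z ^ Suc i)
      = (\<Sum>i\<le>degree p. z * (free_const (coeff p i) * z ^ i))"
    by (intro sum.cong refl) (simp add: mult.assoc free_const_central)
  finally show ?thesis by (simp add: free_eval_def sum_distrib_left)
qed

lemma free_eval_smult: "free_eval (Polynomial.smult c p) z = free_const c * free_eval p z"
proof (induction p)
  case (pCons d p)
  have "z * (free_const c * free_eval p z) = free_const c * (z * free_eval p z)"
    by (simp only: mult.assoc[symmetric] free_const_central[of c z])
  then show ?case using pCons.IH by (simp add: free_eval_pCons distrib_left)
qed simp

lemma free_eval_mult: "free_eval (p * q) z = free_eval p z * free_eval q z"
  by (induction p)
    (simp_all add: free_eval_pCons free_eval_add free_eval_smult distrib_right mult.assoc)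

lemma free_eval_pcompose: "free_eval (pcompose p q) z = free_eval p (free_eval q z)"
  by (induction p) (simp_all add: pcompose_pCons free_eval_add free_eval_pCons free_eval_mult)

lemma free_eval_shift: "free_eval (shift_poly c p) z = free_eval p (free_const c + z)"
proof -
  have "free_eval [:c, 1:] z = free_const c + z * free_const 1" by (simp only: free_eval_pCons free_eval_const free_eval_0 mult_zero_right add_0_right)
  then show ?thesis by (simp add: shift_poly_def free_eval_pcompose)
qed

section \<open>Representations of a generalized Weyl algebra\<close>

text \<open>The images of \<open>C[h]\<close>, \<open>x\<close> and \<open>y\<close> under a ring homomorphism from \<open>A(a)\<close> to an arbitrary
  ring.\<close>

locale gwa_rep =
  fixes E :: "complex poly \<Rightarrow> 'r::ring_1" and X Y :: 'r and a :: "complex poly"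
  assumes E_add: "E (p + q) = E p + E q" and E_mult: "E (p * q) = E p * E q" and E_one: "E 1 = 1"
    and X_E: "X * E p = E (shift_poly (-1) p) * X" and Y_E: "Y * E p = E (shift_poly 1 p) * Y"
    and YX: "Y * X = E a" and XY: "X * Y = E (shift_poly (-1) a)"
begin

lemma E_zero: "E 0 = 0"
  using E_add[of 0 0] by simp

lemma E_minus: "E (- p) = - E p"
  using E_add[of p "- p"] by (simp add: E_zero eq_neg_iff_add_eq_0 add.commute)

lemma E_diff: "E (p - q) = E p - E q"
  using E_add[of p "- q"] by (simp add: E_minus)

lemma E_commute: "E p * E q = E q * E p"
  by (simp add: E_mult[symmetric] mult.commute)

fun letter :: "gwa_letter \<Rightarrow> 'r" where
  "letter Letter_h = E [:0, 1:]" | "letter Letter_x = X" | "letter Letter_y = Y"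

fun word :: "gwa_word \<Rightarrow> 'r" where
  "word (Word ls) = prod_list (map letter ls)"

definition ev_free :: "free_alg \<Rightarrow> 'r" where
  "ev_free f = (\<Sum>w\<in>Poly_Mapping.keys f. E [:Poly_Mapping.lookup f w:] * word w)"

lemma const_central: "E [:c:] * letter l = letter l * E [:c:]"
  by (cases l) (simp_all add: X_E Y_E E_commute)

lemma ev_free_superset:
  "finite S \<Longrightarrow> Poly_Mapping.keys f \<subseteq> S \<Longrightarrow>
    ev_free f = (\<Sum>w\<in>S. E [:Poly_Mapping.lookup f w:] * word w)"
  unfolding ev_free_def by (rule sum.mono_neutral_left) (auto simp: in_keys_iff E_zero)

lemma ev_free_add: "ev_free (f + g) = ev_free f + ev_free g"
proof -
  let ?S = "Poly_Mapping.keys f \<union> Poly_Mapping.keys g"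
  have k: "Poly_Mapping.keys (f + g) \<subseteq> ?S" by (rule Poly_Mapping.keys_add)
  have e: "E [:c + d:] = E [:c:] + E [:d:]" for c d by (simp add: E_add[symmetric])
  show ?thesis
    by (simp add: ev_free_superset[of ?S] k lookup_add e distrib_right sum.distrib)
qed

lemma ev_free_zero: "ev_free 0 = 0" by (simp add: ev_free_def)

lemma ev_free_minus: "ev_free (- f) = - ev_free f"
  using ev_free_add[of f "- f"] by (simp add: ev_free_zero eq_neg_iff_add_eq_0 add.commute)

lemma ev_free_diff: "ev_free (f - g) = ev_free f - ev_free g"
  using ev_free_add[of f "- g"] by (simp add: ev_free_minus)

lemma ev_free_single: "ev_free (Poly_Mapping.single w c) = E [:c:] * word w"
  by (cases "c = 0") (simp_all add: ev_free_def E_zero)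

lemma ev_free_const: "ev_free (free_const c) = E [:c:]"
  by (simp add: free_const_def ev_free_single zero_gwa_word_def)

lemma ev_free_one: "ev_free 1 = 1"
  using ev_free_const[of 1] by (simp add: E_one one_pCons[symmetric])

lemma ev_free_const_mult: "ev_free (free_const c * f) = E [:c:] * ev_free f"
proof -
  have l: "Poly_Mapping.lookup (free_const c * f) w = c * Poly_Mapping.lookup f w" for w
  proof (induction f rule: update_induct)
    case (update f k v)
    have "Poly_Mapping.update k v f = f + Poly_Mapping.single k v"
      using update.hyps by (intro poly_mapping_eqI)
        (auto simp: lookup_update lookup_add lookup_single in_keys_iff)
    then show ?case using update.IH
      by (simp add: distrib_left lookup_add free_const_def mult_single lookup_single when_def)
  qed simp
  have e: "E [:c * d:] = E [:c:] * E [:d:]" for d by (simp add: E_mult[symmetric] mult.commute)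
  have "Poly_Mapping.keys (free_const c * f) \<subseteq> Poly_Mapping.keys f"
    using l by (auto simp: in_keys_iff)
  then show ?thesis
    by (simp add: ev_free_superset[of "Poly_Mapping.keys f"] l e sum_distrib_left mult.assoc)
qed

lemma ev_free_letter_mult: "ev_free (free_gen l * f) = letter l * ev_free f"
proof (induction f rule: update_induct)
  case (update f k v)
  obtain ls where k: "k = Word ls" by (cases k)
  have "Poly_Mapping.update k v f = f + Poly_Mapping.single k v"
    using update.hyps by (intro poly_mapping_eqI)
      (auto simp: lookup_update lookup_add lookup_single in_keys_iff)
  moreover have "ev_free (free_gen l * Poly_Mapping.single k v) = letter l * ev_free (Poly_Mapping.single k v)"
    by (simp add: k free_gen_def mult_single ev_free_single mult.assoc[symmetric] const_central)
  ultimately show ?case using update.IH by (simp add: distrib_left ev_free_add)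
qed (simp add: ev_free_zero)

lemma ev_free_gen: "ev_free (free_gen l) = letter l"
  using ev_free_letter_mult[of l 1] by (simp add: ev_free_one)

lemma ev_free_mult: "ev_free (f * g) = ev_free f * ev_free g"
proof (induction f rule: free_alg_induct)
  case (add f g)
  then show ?case by (simp add: distrib_right ev_free_add)
qed (simp_all add: ev_free_zero ev_free_one ev_free_const_mult ev_free_letter_mult mult.assoc)

lemma ev_free_eval: "ev_free (free_eval p fh) = E p"
proof (induction p)
  case 0
  then show ?case by (simp add: ev_free_zero E_zero)
next
  case (pCons c p)
  have "pCons c p = [:c:] + [:0, 1:] * p" by simp
  then have "E (pCons c p) = E [:c:] + E [:0, 1:] * E p" by (metis E_add E_mult)
  then show ?case
    using pCons by (simp add: free_eval_pCons ev_free_add ev_free_const ev_free_mult ev_free_gen)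
qed

lemma ev_free_ideal:
  assumes "f \<in> gwa_ideal a"
  shows "ev_free f = 0"
proof -
  let ?K = "{f. ev_free f = 0}"
  have "ideal ?K free_ring"
  proof (rule idealI[OF ring_free_ring])
    show "subgroup ?K (add_monoid free_ring)"
    proof (rule group.subgroupI)
      show "group (add_monoid free_ring)"
        using ring.is_abelian_group[OF ring_free_ring] abelian_group.a_group by blast
    next
      fix g assume "g \<in> ?K"
      moreover have "inv\<^bsub>add_monoid free_ring\<^esub> g = - g"
        using abelian_group.minus_equality[OF ring.is_abelian_group[OF ring_free_ring], of "- g" g]
        by (simp add: a_inv_def)
      ultimately show "inv\<^bsub>add_monoid free_ring\<^esub> g \<in> ?K" by (simp add: ev_free_minus)
    qed (auto simp: ev_free_add intro: exI[of _ 0] ev_free_zero)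
  qed (auto simp: ev_free_mult)
  moreover have "gwa_relations a \<subseteq> ?K"
  proof -
    have s: "fh - 1 = free_eval [:-1, 1:] fh" "fh + 1 = free_eval [:1, 1:] fh"
    proof -
      have c: "free_const (- 1) = - 1" using free_const_simps(1)[of 1 "- 1"]
        by (simp add: eq_neg_iff_add_eq_0 add.commute)
      show "fh - 1 = free_eval [:-1, 1:] fh" "fh + 1 = free_eval [:1, 1:] fh"
        by (simp_all add: free_eval_pCons c)
    qed
    have t: "shift_poly (-1) [:0, 1:] = [:-1, 1:]" "shift_poly 1 [:0, 1:] = [:1, 1:]"
      by (simp_all add: shift_poly_def pcompose_pCons)
    have "free_eval a (fh - 1) = free_eval (shift_poly (-1) a) fh"
      by (simp add: free_eval_shift) (simp add: s(1) free_eval_pCons)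
    then show ?thesis
      by (simp add: gwa_relations_def Let_def ev_free_diff ev_free_mult ev_free_gen ev_free_eval YX XY ev_free_add
          ev_free_one X_E Y_E t)
         (simp add: E_add[symmetric] E_diff[symmetric] E_one[symmetric] one_pCons)
  qed
  ultimately have "gwa_ideal a \<subseteq> ?K"
    unfolding gwa_ideal_def by (rule ring.genideal_minimal[OF ring_free_ring])
  then show ?thesis using assms by blast
qed

text \<open>The homomorphism on the quotient \<open>A(a)\<close> induced by \<open>ev_free\<close>.\<close>

definition rho :: "free_alg set \<Rightarrow> 'r" where
  "rho u = ev_free (SOME f. u = gwa_pi a f)"

lemma rho_pi: "rho (gwa_pi a f) = ev_free f"
proof -
  have "gwa_pi a f = gwa_pi a (SOME g. gwa_pi a f = gwa_pi a g)" by (rule someI) simp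
  then have "f - (SOME g. gwa_pi a f = gwa_pi a g) \<in> gwa_ideal a" by (simp add: gwa_pi_eq_iff)
  then show ?thesis using ev_free_ideal by (fastforce simp: rho_def ev_free_diff)
qed

lemma rho_hom:
  "u \<in> carrier (gwa a) \<Longrightarrow> v \<in> carrier (gwa a) \<Longrightarrow> rho (u \<oplus>\<^bsub>gwa a\<^esub> v) = rho u + rho v"
  "u \<in> carrier (gwa a) \<Longrightarrow> v \<in> carrier (gwa a) \<Longrightarrow> rho (u \<otimes>\<^bsub>gwa a\<^esub> v) = rho u * rho v"
  "rho \<one>\<^bsub>gwa a\<^esub> = 1" "rho \<zero>\<^bsub>gwa a\<^esub> = 0"
  "rho (c \<odot>\<^bsub>gwa a\<^esub> \<one>\<^bsub>gwa a\<^esub>) = E [:c:]" "c \<odot>\<^bsub>gwa a\<^esub> \<one>\<^bsub>gwa a\<^esub> \<in> carrier (gwa a)"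
proof -
  show "rho (c \<odot>\<^bsub>gwa a\<^esub> \<one>\<^bsub>gwa a\<^esub>) = E [:c:]" "c \<odot>\<^bsub>gwa a\<^esub> \<one>\<^bsub>gwa a\<^esub> \<in> carrier (gwa a)"
    unfolding gwa_pi_simps(5,7) by (simp_all add: rho_pi ev_free_const gwa_pi_simps(2) del: gwa_simps)
qed (auto simp: gwa_pi_simps rho_pi ev_free_add ev_free_mult ev_free_one ev_free_zero simp del: gwa_simps)

end

section \<open>The graded basis\<close>

lemma sum_int_interval_extend:
  fixes f :: "'p::zero \<Rightarrow> int \<Rightarrow> 'r::comm_monoid_add"
  assumes "\<And>n. f 0 n = 0" "l' \<le> l" "u \<le> u'"
  shows "(\<Sum>n=l..u. f (p n) n) = (\<Sum>n=l'..u'. f (if n \<in> {l..u} then p n else 0) n)"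
  using assms by (intro sum.mono_neutral_cong_left) auto

context gwa_rep
begin

text \<open>\<open>A(a)\<close> is graded by the integers, with \<open>x\<close> in degree \<open>1\<close> and \<open>y\<close> in degree \<open>-1\<close>; the component of
  degree \<open>n\<close> is the \<open>C[h]\<close>-multiples of \<open>bas n\<close>.  \<open>supp_in l u\<close> collects the elements with support
  in degrees \<open>l\<close> to \<open>u\<close>.\<close>

definition bas :: "int \<Rightarrow> 'r" where
  "bas n = (if n \<ge> 0 then X ^ nat n else Y ^ nat (- n))"

definition comb :: "int \<Rightarrow> int \<Rightarrow> (int \<Rightarrow> complex poly) \<Rightarrow> 'r" where
  "comb l u p = (\<Sum>n=l..u. E (p n) * bas n)"

definition supp_in :: "int \<Rightarrow> int \<Rightarrow> 'r set" where
  "supp_in l u = range (comb l u)"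

definition alg :: "'r set" where
  "alg = (\<Union>l u. supp_in l u)"

lemma bas_0 [simp]: "bas 0 = 1" by (simp add: bas_def)

lemma bas_1 [simp]: "bas 1 = X" "bas (- 1) = Y" by (simp_all add: bas_def)

lemma bas_add_nonneg: "m \<ge> 0 \<Longrightarrow> n \<ge> 0 \<Longrightarrow> bas m * bas n = bas (m + n)"
  by (simp add: bas_def nat_add_distrib power_add)

lemma bas_add_nonpos: "m \<le> 0 \<Longrightarrow> n \<le> 0 \<Longrightarrow> bas m * bas n = bas (m + n)"
proof -
  assume "m \<le> 0" "n \<le> 0"
  then have "bas m = Y ^ nat (- m)" "bas n = Y ^ nat (- n)" "bas (m + n) = Y ^ nat (- m + - n)"
    by (auto simp: bas_def)
  then show ?thesis using \<open>m \<le> 0\<close> \<open>n \<le> 0\<close> by (simp add: power_add[symmetric] nat_add_distrib[symmetric])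
qed

lemma X_pow_E: "X ^ k * E p = E (shift_poly (- of_nat k) p) * X ^ k"
proof (induction k)
  case (Suc k)
  have "X ^ Suc k * E p = X * (X ^ k * E p)" by (simp add: mult.assoc)
  also have "\<dots> = X * E (shift_poly (- of_nat k) p) * X ^ k" by (simp add: Suc mult.assoc)
  finally show ?case by (simp add: X_E mult.assoc)
qed simp

lemma Y_pow_E: "Y ^ k * E p = E (shift_poly (of_nat k) p) * Y ^ k"
proof (induction k)
  case (Suc k)
  have "Y ^ Suc k * E p = Y * (Y ^ k * E p)" by (simp add: mult.assoc)
  also have "\<dots> = Y * E (shift_poly (of_nat k) p) * Y ^ k" by (simp add: Suc mult.assoc)
  finally show ?case by (simp add: Y_E mult.assoc)
qed simp

lemma bas_E: "bas n * E p = E (shift_poly (- of_int n) p) * bas n"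
  using X_pow_E[of "nat n" p] Y_pow_E[of "nat (- n)" p] by (auto simp: bas_def)

lemma E_bas: "E p * bas n = bas n * E (shift_poly (of_int n) p)"
  by (simp add: bas_E)

lemma X_bas: "X * bas n = E (if n \<ge> 0 then 1 else shift_poly (-1) a) * bas (n + 1)"
proof (cases "n \<ge> 0")
  case True
  then show ?thesis using bas_add_nonneg[of 1 n] by (simp add: E_one add.commute)
next
  case False
  then have "bas n = Y * bas (n + 1)" using bas_add_nonpos[of "-1" "n + 1"] by simp
  then show ?thesis using False by (simp add: mult.assoc[symmetric] XY)
qed

lemma Y_bas: "Y * bas n = E (if n \<le> 0 then 1 else a) * bas (n - 1)"
proof (cases "n \<le> 0")
  case True
  then show ?thesis using bas_add_nonpos[of "-1" n] by (simp add: E_one)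
next
  case False
  then have "bas n = X * bas (n - 1)" using bas_add_nonneg[of 1 "n - 1"] by simp
  then show ?thesis using False by (simp add: mult.assoc[symmetric] YX)
qed

text \<open>The polynomial \<open>y\<^sup>n x\<^sup>n\<close> for \<open>n \<ge> 0\<close>, and \<open>x\<^sup>-\<^sup>n y\<^sup>-\<^sup>n\<close> for \<open>n \<le> 0\<close>.\<close>

definition gam :: "int \<Rightarrow> complex poly" where
  "gam n = (if n \<ge> 0 then \<Prod>j<nat n. shift_poly (of_nat j) a
            else \<Prod>j<nat (- n). shift_poly (- of_nat (Suc j)) a)"

lemma Y_X_pow: "Y ^ k * X ^ k = E (\<Prod>j<k. shift_poly (of_nat j) a)"
proof (induction k)
  case (Suc k)
  have sp: "shift_poly 1 (\<Prod>j<k. shift_poly (of_nat j) a) = (\<Prod>j<k. shift_poly (of_nat (Suc j)) a)"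
    by (induction k) simp_all
  have "Y ^ Suc k * X ^ Suc k = Y * (Y ^ k * X ^ k) * X"
    by (simp add: mult.assoc power_commutes)
  also have "\<dots> = E (shift_poly 1 (\<Prod>j<k. shift_poly (of_nat j) a)) * (Y * X)"
    unfolding Suc Y_E by (simp add: mult.assoc)
  finally have t: "Y ^ Suc k * X ^ Suc k = E (\<Prod>j<k. shift_poly (of_nat (Suc j)) a) * E a"
    by (simp only: sp YX)
  show ?case
    unfolding t prod.lessThan_Suc_shift by (simp add: E_mult[symmetric] mult.commute)
qed (simp add: E_one)

lemma X_Y_pow: "X ^ k * Y ^ k = E (\<Prod>j<k. shift_poly (- of_nat (Suc j)) a)"
proof (induction k)
  case (Suc k)
  have sp: "shift_poly (- 1) (\<Prod>j<k. shift_poly (- of_nat (Suc j)) a)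
      = (\<Prod>j<k. shift_poly (- of_nat (Suc (Suc j))) a)"
    by (induction k) simp_all
  have "X ^ Suc k * Y ^ Suc k = X * (X ^ k * Y ^ k) * Y"
    by (simp add: mult.assoc power_commutes)
  also have "\<dots> = E (shift_poly (- 1) (\<Prod>j<k. shift_poly (- of_nat (Suc j)) a)) * (X * Y)"
    unfolding Suc X_E by (simp add: mult.assoc)
  finally have t: "X ^ Suc k * Y ^ Suc k = E (\<Prod>j<k. shift_poly (- of_nat (Suc (Suc j))) a) * E (shift_poly (- 1) a)"
    by (simp only: sp XY)
  show ?case
    unfolding t prod.lessThan_Suc_shift by (simp add: E_mult[symmetric] mult.commute)
qed (simp add: E_one)

lemma bas_gam: "bas (- n) * bas n = E (gam n)"
  using Y_X_pow[of "nat n"] X_Y_pow[of "nat (- n)"] by (auto simp: bas_def gam_def)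

lemma bas_gam': "bas n * bas (- n) = E (shift_poly (- of_int n) (gam n))"
proof -
  have "gam (- n) = shift_poly (- of_int n) (gam n)"
  proof (cases "n \<ge> 0")
    case True
    then obtain k where k: "n = int k" by (metis nonneg_int_cases)
    show ?thesis
    proof (rule complex_poly_eqI)
      fix z
      have "(\<Prod>j<k. poly a (z - of_nat (Suc j))) = (\<Prod>j<k. poly a (z - of_nat (Suc (k - Suc j))))"
        by (rule prod.nat_diff_reindex[symmetric])
      also have "\<dots> = (\<Prod>j<k. poly a (z - of_nat k + of_nat j))"
        by (intro prod.cong refl) (simp add: of_nat_diff algebra_simps)
      finally show "poly (gam (- n)) z = poly (shift_poly (- of_int n) (gam n)) z"
        by (cases "k = 0") (simp_all add: gam_def k poly_prod del: of_nat_Suc)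
    qed
  next
    case False
    then have k: "n = - int (nat (- n))" by simp
    define k where "k = nat (- n)"
    have k: "n = - int k" using k by (simp add: k_def)
    show ?thesis
    proof (rule complex_poly_eqI)
      fix z
      have "(\<Prod>j<k. poly a (z + of_nat k - of_nat (Suc j)))
          = (\<Prod>j<k. poly a (z + of_nat k - of_nat (Suc (k - Suc j))))"
        by (rule prod.nat_diff_reindex[symmetric])
      also have "\<dots> = (\<Prod>j<k. poly a (z + of_nat j))"
        by (intro prod.cong refl) (simp add: of_nat_diff algebra_simps)
      finally show "poly (gam (- n)) z = poly (shift_poly (- of_int n) (gam n)) z"
        by (cases "k = 0") (simp_all add: gam_def k poly_prod algebra_simps)
    qed
  qed
  then show ?thesis using bas_gam[of "- n"] by simp
qed

lemma supp_inI: "comb l u p \<in> supp_in l u" by (simp add: supp_in_def)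

lemma supp_in_mono:
  assumes "l' \<le> l" "u \<le> u'"
  shows "supp_in l u \<subseteq> supp_in l' u'"
proof
  fix r assume "r \<in> supp_in l u"
  then obtain p where "r = comb l u p" by (auto simp: supp_in_def)
  then have "r = comb l' u' (\<lambda>n. if n \<in> {l..u} then p n else 0)"
    unfolding comb_def using sum_int_interval_extend[OF _ assms, of "\<lambda>p n. E p * bas n" p]
    by (simp add: E_zero)
  then show "r \<in> supp_in l' u'" by (simp add: supp_in_def)
qed

lemma comb_add: "comb l u p + comb l u q = comb l u (\<lambda>n. p n + q n)"
  by (simp add: comb_def E_add distrib_right sum.distrib)

lemma comb_diff: "comb l u p - comb l u q = comb l u (\<lambda>n. p n - q n)"
  by (simp add: comb_def E_diff left_diff_distrib sum_subtractf)

lemma E_comb: "E q * comb l u p = comb l u (\<lambda>n. q * p n)"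
  by (simp add: comb_def E_mult sum_distrib_left mult.assoc)

lemma comb_E: "comb l u p * E q = comb l u (\<lambda>n. p n * shift_poly (- of_int n) q)"
  by (simp add: comb_def E_mult sum_distrib_right mult.assoc bas_E)

lemma comb_zero: "comb l u (\<lambda>n. 0) = 0"
  by (simp add: comb_def E_zero)

lemma comb_cong: "(\<And>n. l \<le> n \<Longrightarrow> n \<le> u \<Longrightarrow> p n = q n) \<Longrightarrow> comb l u p = comb l u q"
  by (simp add: comb_def)

lemma comb_top: "l \<le> u \<Longrightarrow> comb l u p = comb l (u - 1) p + E (p u) * bas u"
proof -
  assume "l \<le> u"
  then have "{l..u} = insert u {l..u - 1}" by auto
  then show ?thesis by (simp add: comb_def add.commute)
qed

lemma supp_in_closed:
  shows "0 \<in> supp_in l u" "r \<in> supp_in l u \<Longrightarrow> s \<in> supp_in l u \<Longrightarrow> r + s \<in> supp_in l u"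
    "r \<in> supp_in l u \<Longrightarrow> s \<in> supp_in l u \<Longrightarrow> r - s \<in> supp_in l u"
    "r \<in> supp_in l u \<Longrightarrow> E q * r \<in> supp_in l u" "r \<in> supp_in l u \<Longrightarrow> r * E q \<in> supp_in l u"
  unfolding supp_in_def by (auto simp: comb_add comb_diff E_comb comb_E comb_zero[symmetric, of l u])

lemma supp_in_sum: "(\<And>i. i \<in> I \<Longrightarrow> f i \<in> supp_in l u) \<Longrightarrow> sum f I \<in> supp_in l u"
  by (induction I rule: infinite_finite_induct) (auto intro: supp_in_closed)

lemma supp_in_bas: "l \<le> n \<Longrightarrow> n \<le> u \<Longrightarrow> E p * bas n \<in> supp_in l u"
proof -
  have "E p * bas n = comb n n (\<lambda>_. p)" by (simp add: comb_def)
  then have "E p * bas n \<in> supp_in n n" by (simp add: supp_in_def)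
  then show "l \<le> n \<Longrightarrow> n \<le> u \<Longrightarrow> E p * bas n \<in> supp_in l u" using supp_in_mono[of l n n u] by blast
qed

lemma X_supp_in: "r \<in> supp_in l u \<Longrightarrow> X * r \<in> supp_in (l + 1) (u + 1)"
proof -
  assume "r \<in> supp_in l u"
  then obtain p where "r = comb l u p" by (auto simp: supp_in_def)
  then have "X * r = (\<Sum>n=l..u. E (shift_poly (- 1) (p n)) * (X * bas n))"
    by (simp add: comb_def sum_distrib_left mult.assoc[symmetric] X_E)
  also have "\<dots> = (\<Sum>n=l..u. E (shift_poly (- 1) (p n) * (if n \<ge> 0 then 1 else shift_poly (-1) a)) * bas (n + 1))"
    by (simp add: X_bas E_mult mult.assoc)
  finally show ?thesis by (auto intro!: supp_in_sum supp_in_bas)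
qed

lemma Y_supp_in: "r \<in> supp_in l u \<Longrightarrow> Y * r \<in> supp_in (l - 1) (u - 1)"
proof -
  assume "r \<in> supp_in l u"
  then obtain p where "r = comb l u p" by (auto simp: supp_in_def)
  then have "Y * r = (\<Sum>n=l..u. E (shift_poly 1 (p n)) * (Y * bas n))"
    by (simp add: comb_def sum_distrib_left mult.assoc[symmetric] Y_E)
  also have "\<dots> = (\<Sum>n=l..u. E (shift_poly 1 (p n) * (if n \<le> 0 then 1 else a)) * bas (n - 1))"
    by (simp add: Y_bas E_mult mult.assoc)
  finally show ?thesis by (auto intro!: supp_in_sum supp_in_bas)
qed

lemma bas_supp_in: "r \<in> supp_in l u \<Longrightarrow> bas n * r \<in> supp_in (l + n) (u + n)"
proof -
  assume r: "r \<in> supp_in l u"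
  have x: "X ^ k * r \<in> supp_in (l + int k) (u + int k)" for k
  proof (induction k)
    case (Suc k)
    then show ?case using X_supp_in[OF Suc] by (simp add: mult.assoc algebra_simps)
  qed (simp add: r)
  have y: "Y ^ k * r \<in> supp_in (l - int k) (u - int k)" for k
  proof (induction k)
    case (Suc k)
    then show ?case using Y_supp_in[OF Suc] by (simp add: mult.assoc algebra_simps)
  qed (simp add: r)
  show ?thesis using x[of "nat n"] y[of "nat (- n)"] by (auto simp: bas_def)
qed

lemma supp_in_mult: "r \<in> supp_in l u \<Longrightarrow> s \<in> supp_in l' u' \<Longrightarrow> r * s \<in> supp_in (l + l') (u + u')"
proof -
  assume "r \<in> supp_in l u" and s: "s \<in> supp_in l' u'"
  then obtain p where r: "r = comb l u p" by (auto simp: supp_in_def)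
  have "E (p n) * (bas n * s) \<in> supp_in (l + l') (u + u')" if "n \<in> {l..u}" for n
    using supp_in_closed(4)[OF bas_supp_in[OF s]] supp_in_mono[of "l + l'" "l' + n" "u' + n" "u + u'"] that
    by auto
  then show ?thesis unfolding r comb_def sum_distrib_right mult.assoc by (rule supp_in_sum)
qed

lemma supp_in_alg: "r \<in> supp_in l u \<Longrightarrow> r \<in> alg" by (auto simp: alg_def)

lemma alg_closed:
  shows "0 \<in> alg" "1 \<in> alg" "r \<in> alg \<Longrightarrow> s \<in> alg \<Longrightarrow> r + s \<in> alg" "r \<in> alg \<Longrightarrow> s \<in> alg \<Longrightarrow> r * s \<in> alg"
    "E p \<in> alg" "bas n \<in> alg" "r \<in> alg \<Longrightarrow> s \<in> alg \<Longrightarrow> r - s \<in> alg" "r \<in> alg \<Longrightarrow> - r \<in> alg"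
proof -
  show z: "0 \<in> alg" using supp_in_closed(1) supp_in_alg by blast
  show E: "E p \<in> alg" for p using supp_in_alg[OF supp_in_bas[of 0 0 0 p]] by simp
  show "1 \<in> alg" using E[of 1] by (simp add: E_one)
  show "bas n \<in> alg" using supp_in_alg[OF supp_in_bas[of n n n 1]] by (simp add: E_one)
  have common: "\<exists>l u. r \<in> supp_in l u \<and> s \<in> supp_in l u" if rs: "r \<in> alg" "s \<in> alg" for r s
  proof -
    obtain l u l' u' where "r \<in> supp_in l u" "s \<in> supp_in l' u'" using rs by (auto simp: alg_def)
    then have "r \<in> supp_in (min l l') (max u u')" "s \<in> supp_in (min l l') (max u u')"
      using supp_in_mono[of "min l l'" l u "max u u'"] supp_in_mono[of "min l l'" l' u' "max u u'"]
      by auto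
    then show ?thesis by blast
  qed
  show "r + s \<in> alg" if "r \<in> alg" "s \<in> alg" for r s
    using common[OF that] supp_in_closed(2) supp_in_alg by blast
  show d: "r - s \<in> alg" if "r \<in> alg" "s \<in> alg" for r s
    using common[OF that] supp_in_closed(3) supp_in_alg by blast
  show "- r \<in> alg" if "r \<in> alg" for r using d[OF z that] by simp
  show "r * s \<in> alg" if rs: "r \<in> alg" "s \<in> alg" for r s
  proof -
    obtain l u l' u' where "r \<in> supp_in l u" "s \<in> supp_in l' u'" using rs by (auto simp: alg_def)
    then show ?thesis using supp_in_alg[OF supp_in_mult] by blast
  qed
qed

lemma alg_sum: "(\<And>i. i \<in> I \<Longrightarrow> f i \<in> alg) \<Longrightarrow> sum f I \<in> alg"
  by (induction I rule: infinite_finite_induct) (auto intro: alg_closed)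

lemma range_ev_free: "range ev_free = alg"
proof (rule subset_antisym)
  have "ev_free f \<in> alg" for f
  proof (induction f rule: free_alg_induct)
    case (letter l f)
    have "letter l \<in> alg" using alg_closed(5) alg_closed(6)[of 1] alg_closed(6)[of "-1"] by (cases l) auto
    then show ?case using letter by (simp add: ev_free_letter_mult alg_closed(4))
  qed (simp_all add: ev_free_zero ev_free_one ev_free_add ev_free_const_mult alg_closed)
  then show "range ev_free \<subseteq> alg" by blast
  have ps: "ev_free (f ^ n) = ev_free f ^ n" for f n
    by (induction n) (simp_all add: ev_free_one ev_free_mult)
  have b: "bas n \<in> range ev_free" for n
  proof (cases "n \<ge> 0")
    case True
    then have "bas n = ev_free (fx ^ nat n)" by (simp add: bas_def ps ev_free_gen)
    then show ?thesis by simp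
  next
    case False
    then have "bas n = ev_free (fy ^ nat (- n))" by (simp add: bas_def ps ev_free_gen)
    then show ?thesis by simp
  qed
  have m: "r * s \<in> range ev_free" "r + s \<in> range ev_free"
    if rs: "r \<in> range ev_free" "s \<in> range ev_free" for r s
  proof -
    obtain f g where "r = ev_free f" "s = ev_free g" using rs by blast
    then show "r * s \<in> range ev_free" "r + s \<in> range ev_free"
      by (auto simp only: ev_free_mult[symmetric] ev_free_add[symmetric])
  qed
  have "E p \<in> range ev_free" for p using ev_free_eval[of p] by (metis rangeI)
  moreover have "0 \<in> range ev_free" using ev_free_zero by (metis rangeI)
  ultimately have "(\<Sum>n\<in>S. E (p n) * bas n) \<in> range ev_free" for S and p :: "int \<Rightarrow> complex poly"
    using m b by (induction S rule: infinite_finite_induct) simp_all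
  then have "comb l u p \<in> range ev_free" for l u p
    unfolding comb_def .
  then show "alg \<subseteq> range ev_free" by (auto simp: alg_def supp_in_def)
qed

lemma rho_image: "rho ` carrier (gwa a) = alg"
  using range_ev_free by (auto simp: gwa_pi_simps rho_pi image_iff simp del: gwa_simps) (metis rangeE)

end

section \<open>Normal forms in the presented algebra\<close>

definition free_bas :: "int \<Rightarrow> free_alg" where
  "free_bas n = (if n \<ge> 0 then fx ^ nat n else fy ^ nat (- n))"

definition normal_form :: "int \<Rightarrow> int \<Rightarrow> (int \<Rightarrow> complex poly) \<Rightarrow> free_alg" where
  "normal_form l u p = (\<Sum>n=l..u. free_eval (p n) fh * free_bas n)"

text \<open>This is the spanning half of the normal form theorem; independence of the basis will be read off from
  concrete representations.\<close>

definition has_normal_form :: "complex poly \<Rightarrow> free_alg \<Rightarrow> bool" where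
  "has_normal_form a f \<longleftrightarrow> (\<exists>l u p. f - normal_form l u p \<in> gwa_ideal a)"

lemma has_normal_form_cong:
  assumes "has_normal_form a g" "f - g \<in> gwa_ideal a"
  shows "has_normal_form a f"
proof -
  obtain l u p where "g - normal_form l u p \<in> gwa_ideal a" using assms(1) by (auto simp: has_normal_form_def)
  then have "(f - g) + (g - normal_form l u p) \<in> gwa_ideal a" using gwa_ideal_closed(2) assms(2) by blast
  then show ?thesis by (auto simp: has_normal_form_def)
qed

lemma has_normal_form_bas: "has_normal_form a (free_eval p fh * free_bas n)"
proof -
  have "free_eval p fh * free_bas n - normal_form n n (\<lambda>_. p) = 0" by (simp add: normal_form_def)
  then show ?thesis unfolding has_normal_form_def using gwa_ideal_closed(1) by metis
qed

lemma has_normal_form_zero: "has_normal_form a 0"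
  using has_normal_form_bas[of a 0 0] by simp

lemma has_normal_form_add:
  assumes "has_normal_form a f" "has_normal_form a g"
  shows "has_normal_form a (f + g)"
proof -
  obtain l u p l' u' q where f: "f - normal_form l u p \<in> gwa_ideal a"
    and g: "g - normal_form l' u' q \<in> gwa_ideal a"
    using assms by (auto simp: has_normal_form_def)
  let ?l = "min l l'" and ?u = "max u u'"
  let ?p = "\<lambda>n. if n \<in> {l..u} then p n else 0" and ?q = "\<lambda>n. if n \<in> {l'..u'} then q n else 0"
  have "normal_form l u p = normal_form ?l ?u ?p" "normal_form l' u' q = normal_form ?l ?u ?q"
    unfolding normal_form_def
    by (rule sum_int_interval_extend[of "\<lambda>p n. free_eval p fh * free_bas n"]; simp)+
  moreover have "normal_form ?l ?u ?p + normal_form ?l ?u ?q = normal_form ?l ?u (\<lambda>n. ?p n + ?q n)"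
    unfolding normal_form_def sum.distrib[symmetric] free_eval_add distrib_right ..
  ultimately have eq: "f + g - normal_form ?l ?u (\<lambda>n. ?p n + ?q n)
      = (f - normal_form l u p) + (g - normal_form l' u' q)" by (simp add: algebra_simps)
  have "f + g - normal_form ?l ?u (\<lambda>n. ?p n + ?q n) \<in> gwa_ideal a"
    unfolding eq by (rule gwa_ideal_closed(2)[OF f g])
  then show ?thesis unfolding has_normal_form_def by blast
qed

lemma has_normal_form_sum: "(\<And>i. i \<in> I \<Longrightarrow> has_normal_form a (f i)) \<Longrightarrow> has_normal_form a (sum f I)"
  by (induction I rule: infinite_finite_induct) (auto intro: has_normal_form_zero has_normal_form_add)

lemma has_normal_form_left_mult:
  assumes "\<And>p n. has_normal_form a (g * (free_eval p fh * free_bas n))" "has_normal_form a f"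
  shows "has_normal_form a (g * f)"
proof -
  obtain l u p where f: "f - normal_form l u p \<in> gwa_ideal a"
    using assms(2) by (auto simp: has_normal_form_def)
  have "has_normal_form a (g * normal_form l u p)"
    unfolding normal_form_def sum_distrib_left by (rule has_normal_form_sum[OF assms(1)])
  moreover have "g * f - g * normal_form l u p \<in> gwa_ideal a"
    using gwa_ideal_closed(3)[OF f, of g] by (simp add: right_diff_distrib)
  ultimately show ?thesis by (rule has_normal_form_cong)
qed

lemma free_x_eval: "fx * free_eval p fh - free_eval (shift_poly (- 1) p) fh * fx \<in> gwa_ideal a"
proof (induction p)
  case 0
  then show ?case by (simp add: gwa_ideal_closed)
next
  case (pCons c p)
  have c1: "free_const (- 1) = - 1"
    using free_const_simps(1)[of 1 "- 1"] by (simp add: eq_neg_iff_add_eq_0 add.commute)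
  have s: "shift_poly (- 1) (pCons c p) = [:c:] + [:-1, 1:] * shift_poly (- 1) p"
    by (rule complex_poly_eqI) (simp add: algebra_simps)
  have e: "free_eval (shift_poly (- 1) (pCons c p)) fh
      = free_const c + (fh - 1) * free_eval (shift_poly (- 1) p) fh"
    unfolding s free_eval_add free_eval_mult by (simp add: free_eval_pCons c1)
  have "fx * free_eval (pCons c p) fh - free_eval (shift_poly (- 1) (pCons c p)) fh * fx
      = (fx * fh - (fh - 1) * fx) * free_eval p fh
      + (fh - 1) * (fx * free_eval p fh - free_eval (shift_poly (- 1) p) fh * fx)"
    unfolding e by (simp add: free_eval_pCons free_const_central algebra_simps)
  also have "\<dots> \<in> gwa_ideal a"
    by (intro gwa_ideal_closed(2) gwa_ideal_closed(4)[OF gwa_relations_in_ideal(1)]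
        gwa_ideal_closed(3)[OF pCons(2)])
  finally show ?case .
qed

lemma free_y_eval: "fy * free_eval p fh - free_eval (shift_poly 1 p) fh * fy \<in> gwa_ideal a"
proof (induction p)
  case 0
  then show ?case by (simp add: gwa_ideal_closed)
next
  case (pCons c p)
  have s: "shift_poly 1 (pCons c p) = [:c:] + [:1, 1:] * shift_poly 1 p"
    by (rule complex_poly_eqI) (simp add: algebra_simps)
  have e: "free_eval (shift_poly 1 (pCons c p)) fh
      = free_const c + (fh + 1) * free_eval (shift_poly 1 p) fh"
    unfolding s free_eval_add free_eval_mult by (simp add: free_eval_pCons add.commute)
  have "fy * free_eval (pCons c p) fh - free_eval (shift_poly 1 (pCons c p)) fh * fy
      = (fy * fh - (fh + 1) * fy) * free_eval p fh
      + (fh + 1) * (fy * free_eval p fh - free_eval (shift_poly 1 p) fh * fy)"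
    unfolding e by (simp add: free_eval_pCons free_const_central algebra_simps)
  also have "\<dots> \<in> gwa_ideal a"
    by (intro gwa_ideal_closed(2) gwa_ideal_closed(4)[OF gwa_relations_in_ideal(2)]
        gwa_ideal_closed(3)[OF pCons(2)])
  finally show ?case .
qed

lemma free_bas_step:
  "\<exists>q. fx * free_bas n - free_eval q fh * free_bas (n + 1) \<in> gwa_ideal a"
  "\<exists>q. fy * free_bas n - free_eval q fh * free_bas (n - 1) \<in> gwa_ideal a"
proof -
  have one: "free_eval 1 fh = 1" by (simp add: one_pCons)
  have c1: "free_const (- 1) = - 1"
    using free_const_simps(1)[of 1 "- 1"] by (simp add: eq_neg_iff_add_eq_0 add.commute)
  show "\<exists>q. fx * free_bas n - free_eval q fh * free_bas (n + 1) \<in> gwa_ideal a"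
  proof (cases "n \<ge> 0")
    case True
    then have "fx * free_bas n = free_eval 1 fh * free_bas (n + 1)"
      by (simp add: free_bas_def one nat_add_distrib)
    then show ?thesis using gwa_ideal_closed(1)[of a] by (intro exI[of _ 1]) simp
  next
    case False
    have "nat (- n) = Suc (nat (- (n + 1)))" using False by simp
    then have n: "free_bas n = fy * free_bas (n + 1)"
      using False by (simp add: free_bas_def)
    have e: "free_eval (shift_poly (- 1) a) fh = free_eval a (fh - 1)"
      by (simp add: free_eval_shift c1)
    have "fx * free_bas n - free_eval (shift_poly (- 1) a) fh * free_bas (n + 1)
        = (fx * fy - free_eval a (fh - 1)) * free_bas (n + 1)"
      unfolding n e by (simp add: algebra_simps)
    then show ?thesis using gwa_ideal_closed(4)[OF gwa_relations_in_ideal(4)] by metis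
  qed
  show "\<exists>q. fy * free_bas n - free_eval q fh * free_bas (n - 1) \<in> gwa_ideal a"
  proof (cases "n \<le> 0")
    case True
    have "nat (1 - n) = Suc (nat (- n))" using True by simp
    then have "fy * free_bas n = free_eval 1 fh * free_bas (n - 1)"
      using True by (auto simp: free_bas_def one)
    then show ?thesis using gwa_ideal_closed(1)[of a] by (intro exI[of _ 1]) simp
  next
    case False
    have "nat n = Suc (nat (n - 1))" using False by simp
    then have n: "free_bas n = fx * free_bas (n - 1)"
      using False by (simp add: free_bas_def)
    have "fy * free_bas n - free_eval a fh * free_bas (n - 1)
        = (fy * fx - free_eval a fh) * free_bas (n - 1)"
      unfolding n by (simp add: algebra_simps)
    then show ?thesis using gwa_ideal_closed(4)[OF gwa_relations_in_ideal(3)] by metis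
  qed
qed

lemma all_have_normal_form: "has_normal_form a f"
proof (induction f rule: free_alg_induct)
  case zero
  show ?case by (rule has_normal_form_zero)
next
  case one
  show ?case using has_normal_form_bas[of a 1 0] by (simp add: one_pCons free_bas_def)
next
  case (add f g)
  then show ?case by (rule has_normal_form_add)
next
  case (const c f)
  have "free_const c * (free_eval p fh * free_bas n) = free_eval (Polynomial.smult c p) fh * free_bas n" for p n
    by (simp add: free_eval_smult mult.assoc)
  then show ?case using has_normal_form_left_mult[OF _ const] has_normal_form_bas by simp
next
  case (letter l f)
  have "has_normal_form a (free_gen l * (free_eval p fh * free_bas n))" for p n
  proof (cases l)
    case Letter_h
    have "fh * (free_eval p fh * free_bas n) = free_eval (pCons 0 p) fh * free_bas n"
      by (simp add: free_eval_pCons mult.assoc)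
    then show ?thesis using has_normal_form_bas Letter_h by simp
  next
    case Letter_x
    obtain q where q: "fx * free_bas n - free_eval q fh * free_bas (n + 1) \<in> gwa_ideal a"
      using free_bas_step(1) by blast
    have "fx * (free_eval p fh * free_bas n) - free_eval (shift_poly (- 1) p * q) fh * free_bas (n + 1)
      = (fx * free_eval p fh - free_eval (shift_poly (- 1) p) fh * fx) * free_bas n
      + free_eval (shift_poly (- 1) p) fh * (fx * free_bas n - free_eval q fh * free_bas (n + 1))"
      by (simp add: free_eval_mult mult.assoc left_diff_distrib right_diff_distrib)
    also have "\<dots> \<in> gwa_ideal a"
      by (intro gwa_ideal_closed(2) gwa_ideal_closed(4)[OF free_x_eval] gwa_ideal_closed(3)[OF q])
    finally show ?thesis unfolding Letter_x by (rule has_normal_form_cong[OF has_normal_form_bas])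
  next
    case Letter_y
    obtain q where q: "fy * free_bas n - free_eval q fh * free_bas (n - 1) \<in> gwa_ideal a"
      using free_bas_step(2) by blast
    have "fy * (free_eval p fh * free_bas n) - free_eval (shift_poly 1 p * q) fh * free_bas (n - 1)
      = (fy * free_eval p fh - free_eval (shift_poly 1 p) fh * fy) * free_bas n
      + free_eval (shift_poly 1 p) fh * (fy * free_bas n - free_eval q fh * free_bas (n - 1))"
      by (simp add: free_eval_mult mult.assoc left_diff_distrib right_diff_distrib)
    also have "\<dots> \<in> gwa_ideal a"
      by (intro gwa_ideal_closed(2) gwa_ideal_closed(4)[OF free_y_eval] gwa_ideal_closed(3)[OF q])
    finally show ?thesis unfolding Letter_y by (rule has_normal_form_cong[OF has_normal_form_bas])
  qed
  then show ?case by (rule has_normal_form_left_mult[OF _ letter])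
qed

section \<open>Faithful representations\<close>

text \<open>Independence of the basis in the representation; together with the existence of normal forms in the
  presented algebra it forces \<open>rho\<close> to be injective.\<close>

locale gwa_model = gwa_rep E X Y a for E :: "complex poly \<Rightarrow> 'r::ring_1" and X Y :: 'r and a :: "complex poly" +
  assumes a_nonzero: "a \<noteq> 0"
    and indep: "\<And>l u p n. comb l u p = 0 \<Longrightarrow> l \<le> n \<Longrightarrow> n \<le> u \<Longrightarrow> p n = 0"
begin

lemma rho_inj: "inj_on rho (carrier (gwa a))"
proof (rule inj_onI)
  fix u v assume "u \<in> carrier (gwa a)" "v \<in> carrier (gwa a)" and eq: "rho u = rho v"
  then obtain f g where f: "u = gwa_pi a f" "v = gwa_pi a g"
    by (auto simp: gwa_pi_simps simp del: gwa_simps)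
  then have 0: "ev_free (f - g) = 0" using eq by (simp add: rho_pi ev_free_diff)
  obtain l k p where nf: "f - g - normal_form l k p \<in> gwa_ideal a"
    using all_have_normal_form[of a "f - g"] by (auto simp: has_normal_form_def)
  have ps: "ev_free (f ^ n) = ev_free f ^ n" for f n
    by (induction n) (simp_all add: ev_free_one ev_free_mult)
  have b: "ev_free (free_bas n) = bas n" for n
    by (simp add: free_bas_def bas_def ps ev_free_gen)
  have sm: "ev_free (sum h I) = (\<Sum>i\<in>I. ev_free (h i))" for h and I :: "int set"
    by (induction I rule: infinite_finite_induct) (simp_all add: ev_free_zero ev_free_add)
  have "ev_free (normal_form l k p) = comb l k p"
    by (simp add: normal_form_def comb_def sm ev_free_mult ev_free_eval b)
  then have "comb l k p = 0" using ev_free_ideal[OF nf] 0 by (simp add: ev_free_diff)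
  then have "p n = 0" if "n \<in> {l..k}" for n using indep that by auto
  then have "normal_form l k p = 0" by (simp add: normal_form_def)
  then show "u = v" using nf f by (simp add: gwa_pi_eq_iff)
qed

end

section \<open>Graded pieces and simplicity\<close>

context gwa_rep
begin

lemma ad_comb: "E [:0, 1:] * comb l u p - comb l u p * E [:0, 1:] = comb l u (\<lambda>n. [:of_int n:] * p n)"
proof -
  have "[:0, 1:] * q - q * shift_poly (- of_int n) [:0, 1:] = [:of_int n:] * q" for n q
    by (rule complex_poly_eqI) (simp add: algebra_simps)
  then show ?thesis by (simp add: E_comb comb_E comb_diff)
qed

text \<open>The commutator with \<open>h\<close> multiplies the component of degree \<open>n\<close> by \<open>n\<close>.  Subtracting \<open>u\<close> times
  the element from it removes the top degree \<open>u\<close> and rescales the others by nonzero constants, so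
  the components split off by induction.\<close>

lemma graded_components:
  assumes add: "\<And>r s. r \<in> I \<Longrightarrow> s \<in> I \<Longrightarrow> r + s \<in> I" and zero: "0 \<in> I"
    and scale: "\<And>c r. r \<in> I \<Longrightarrow> E [:c:] * r \<in> I"
    and ad: "\<And>r. r \<in> I \<Longrightarrow> E [:0, 1:] * r - r * E [:0, 1:] \<in> I"
    and r: "comb l u p \<in> I" and n: "l \<le> n" "n \<le> u"
  shows "E (p n) * bas n \<in> I"
proof -
  have minus: "r - s \<in> I" if "r \<in> I" "s \<in> I" for r s
  proof -
    have "E [:-1:] = - 1" using E_minus[of 1] E_one by (simp add: one_pCons)
    then show ?thesis using add[OF that(1) scale[OF that(2), of "-1"]] by simp
  qed
  have sum: "(\<And>i. i \<in> S \<Longrightarrow> f i \<in> I) \<Longrightarrow> sum f S \<in> I" for S :: "int set" and f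
    by (induction S rule: infinite_finite_induct) (auto intro: zero add)
  have "\<forall>p. comb l (l + int k - 1) p \<in> I \<longrightarrow> (\<forall>n. l \<le> n \<and> n \<le> l + int k - 1 \<longrightarrow> E (p n) * bas n \<in> I)" for k
  proof (induction k)
    case (Suc k)
    show ?case
    proof (intro allI impI)
      fix p n assume r: "comb l (l + int (Suc k) - 1) p \<in> I" and n: "l \<le> n \<and> n \<le> l + int (Suc k) - 1"
      define u where "u = l + int k"
      have r: "comb l u p \<in> I" using r by (simp add: u_def)
      let ?q = "\<lambda>n. [:of_int n - of_int u:] * p n"
      have "comb l u ?q = (E [:0, 1:] * comb l u p - comb l u p * E [:0, 1:]) - E [:of_int u:] * comb l u p"
      proof -
        have "[:of_int n:] * p n - [:of_int u:] * p n = ?q n" for n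
          by (simp add: smult_diff_left)
        then show ?thesis by (simp only: ad_comb E_comb[of "[:of_int u:]"] comb_diff)
      qed
      then have "comb l u ?q \<in> I" using minus[OF ad[OF r] scale[OF r]] by simp
      moreover have "comb l u ?q = comb l (u - 1) ?q"
        by (subst comb_top) (simp_all add: u_def E_zero)
      ultimately have q: "E (?q m) * bas m \<in> I" if "l \<le> m" "m < u" for m
        using Suc.IH[rule_format, of ?q m] that by (simp add: u_def)
      have lower: "E (p m) * bas m \<in> I" if m: "l \<le> m" "m < u" for m
      proof -
        have "[:1 / (of_int m - of_int u):] * ?q m = p m" using m by simp
        then have "E [:1 / (of_int m - of_int u):] * (E (?q m) * bas m) = E (p m) * bas m"
          by (simp only: mult.assoc[symmetric] E_mult[symmetric])
        then show ?thesis using scale[OF q[OF m], of "1 / (of_int m - of_int u)"] by simp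
      qed
      have "comb l (u - 1) p \<in> I" unfolding comb_def by (rule sum) (use lower in auto)
      from minus[OF r this] have "E (p u) * bas u \<in> I" using comb_top[of l u p] by (simp add: u_def)
      then show "E (p n) * bas n \<in> I" using lower n by (cases "n = u") (auto simp: u_def)
    qed
  qed auto
  from this[of "nat (u - l + 1)"] show ?thesis using r n by auto
qed

end

lemma poly_nonvanishing_shift:
  assumes "(f :: complex poly) \<noteq> 0" "c \<noteq> 0"
  shows "\<exists>k::nat. poly f (z + c * of_nat k) \<noteq> 0"
proof (rule ccontr)
  assume "\<not> ?thesis"
  then have "range (\<lambda>k::nat. z + c * of_nat k) \<subseteq> {w. poly f w = 0}" by auto
  moreover have "inj (\<lambda>k::nat. z + c * of_nat k)" using assms(2) by (auto simp: inj_def)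
  ultimately show False
    using poly_roots_finite[OF assms(1)] finite_subset finite_imageD infinite_UNIV_nat by metis
qed

text \<open>Distinct roots never differ by an integer; multiple roots are permitted.\<close>

definition integral_gap_free :: "complex poly \<Rightarrow> bool" where
  "integral_gap_free a \<longleftrightarrow> (\<forall>z (k::nat). poly a z = 0 \<longrightarrow> poly a (z + of_nat (Suc k)) \<noteq> 0)"

lemma polynomial_ideal_without_zeros:
  fixes K :: "complex poly set"
  assumes add: "\<And>f g. f \<in> K \<Longrightarrow> g \<in> K \<Longrightarrow> f + g \<in> K" and mult: "\<And>f g. g \<in> K \<Longrightarrow> f * g \<in> K"
    and nz: "f0 \<in> K" "f0 \<noteq> 0" and nov: "\<And>z. \<exists>f\<in>K. poly f z \<noteq> 0"
  shows "1 \<in> K"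
proof -
  obtain g where g: "g \<in> K" "g \<noteq> 0" "\<And>f. f \<in> K \<Longrightarrow> f \<noteq> 0 \<Longrightarrow> degree g \<le> degree f"
    using ex_has_least_nat[of "\<lambda>f. f \<in> K \<and> f \<noteq> 0" f0 degree] nz by auto
  have dv: "g dvd f" if f: "f \<in> K" for f
  proof -
    have "f mod g = f + (- (f div g)) * g" by (simp add: minus_div_mult_eq_mod[symmetric])
    then have "f mod g \<in> K" using add[OF f mult[OF g(1)]] by metis
    then have "f mod g = 0" using g(3)[of "f mod g"] degree_mod_less[OF g(2), of f] by (meson leD)
    then show ?thesis by auto
  qed
  have "degree g = 0"
  proof (rule ccontr)
    assume "degree g \<noteq> 0"
    then obtain z where "poly g z = 0" using alg_closed_imp_poly_has_root[of g] by auto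
    then have "poly f z = 0" if "f \<in> K" for f using dv[OF that] by (auto elim!: dvdE)
    then show False using nov by blast
  qed
  then obtain c where c: "g = [:c:]" by (metis degree_eq_zeroE)
  then have "[:1 / c:] * g = 1" using g(2) by (simp add: one_pCons)
  then show ?thesis using mult[OF g(1)] by metis
qed

context gwa_model
begin

lemma one_neq_zero_alg: "(1::'r) \<noteq> 0"
proof
  assume "(1::'r) = 0"
  then have "comb 0 0 (\<lambda>_. 1) = 0" by (simp add: comb_def E_one)
  then show False using indep[of 0 0 "\<lambda>_. 1" 0] by simp
qed

lemma gam_nonzero: "gam n \<noteq> 0"
  using a_nonzero by (auto simp: gam_def)

text \<open>A nonzero ideal is graded and hence contains a nonzero polynomial \<open>f\<close>.  It also contains
  \<open>x\<^sup>k f y\<^sup>k\<close> and \<open>y\<^sup>m f x\<^sup>m\<close>, which are shifts of \<open>f\<close> times products of shifts of \<open>a\<close>.  If \<open>z\<close>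
  is a common zero of all polynomials in the ideal, then choosing \<open>k\<close> and \<open>m\<close> such that the
  shifts of \<open>f\<close> do not vanish at \<open>z\<close> yields a root of \<open>a\<close> in \<open>z - 1, z - 2, \<dots>\<close> and another one in
  \<open>z, z + 1, \<dots>\<close>, against the absence of integral gaps.\<close>

theorem gwa_simple:
  assumes gap: "integral_gap_free a"
  shows "simple_algebra (gwa a)"
  unfolding simple_algebra_def
proof (intro conjI allI impI ring_gwa)
  interpret G: ring "gwa a" by (rule ring_gwa)
  show "\<one>\<^bsub>gwa a\<^esub> \<noteq> \<zero>\<^bsub>gwa a\<^esub>" using rho_hom(3,4) one_neq_zero_alg by metis
  fix I assume I: "ideal I (gwa a)"
  interpret I: ideal I "gwa a" by (rule I)
  have Isub: "I \<subseteq> carrier (gwa a)" using I.Icarr by blast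
  have zI: "\<zero>\<^bsub>gwa a\<^esub> \<in> I" using additive_subgroup.zero_closed[OF I.additive_subgroup_axioms] .
  define J where "J = rho ` I"
  have Jadd: "r + s \<in> J" if "r \<in> J" "s \<in> J" for r s
  proof -
    obtain i j where ij: "i \<in> I" "j \<in> I" "r = rho i" "s = rho j" using \<open>r \<in> J\<close> \<open>s \<in> J\<close> by (auto simp: J_def)
    then have "rho (i \<oplus>\<^bsub>gwa a\<^esub> j) = r + s" using Isub rho_hom(1) by blast
    moreover have "i \<oplus>\<^bsub>gwa a\<^esub> j \<in> I" using additive_subgroup.a_closed[OF I.additive_subgroup_axioms] ij by blast
    ultimately show ?thesis unfolding J_def by (metis imageI)
  qed
  have Jl: "r * s \<in> J" and Jr: "s * r \<in> J" if "r \<in> alg" "s \<in> J" for r s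
  proof -
    obtain x i where ij: "x \<in> carrier (gwa a)" "i \<in> I" "r = rho x" "s = rho i"
      using \<open>r \<in> alg\<close> \<open>s \<in> J\<close> rho_image unfolding J_def by blast
    have "rho (x \<otimes>\<^bsub>gwa a\<^esub> i) = r * s" "rho (i \<otimes>\<^bsub>gwa a\<^esub> x) = s * r" using ij Isub rho_hom(2) by blast+
    moreover have "x \<otimes>\<^bsub>gwa a\<^esub> i \<in> I" "i \<otimes>\<^bsub>gwa a\<^esub> x \<in> I" using I.I_l_closed I.I_r_closed ij by blast+
    ultimately show "r * s \<in> J" "s * r \<in> J" unfolding J_def by (metis imageI)+
  qed
  have J0: "0 \<in> J" using zI rho_hom(4) unfolding J_def by (metis imageI)
  have Jminus: "r - s \<in> J" if "r \<in> J" "s \<in> J" for r s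
  proof -
    have "E [:-1:] = - 1" using E_minus[of 1] E_one by (simp add: one_pCons)
    then show ?thesis using Jadd[OF that(1) Jl[OF alg_closed(5) that(2), of "[:-1:]"]] by simp
  qed
  show "I = {\<zero>\<^bsub>gwa a\<^esub>} \<or> I = carrier (gwa a)"
  proof (cases "I = {\<zero>\<^bsub>gwa a\<^esub>}")
    case False
    then obtain i where i: "i \<in> I" "i \<noteq> \<zero>\<^bsub>gwa a\<^esub>" using zI by blast
    then have nz: "rho i \<noteq> 0" using rho_hom(4) inj_onD[OF rho_inj, of i "\<zero>\<^bsub>gwa a\<^esub>"] Isub zI by auto
    have "rho i \<in> alg" using rho_image i(1) Isub by blast
    then obtain l u p where p: "rho i = comb l u p" by (auto simp: alg_def supp_in_def)
    have "\<exists>n. l \<le> n \<and> n \<le> u \<and> p n \<noteq> 0"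
    proof (rule ccontr)
      assume "\<not> ?thesis"
      then have "comb l u p = comb l u (\<lambda>_. 0)" by (intro comb_cong) auto
      then show False using nz p comb_zero by simp
    qed
    then obtain n where n: "l \<le> n" "n \<le> u" "p n \<noteq> 0" by blast
    have "comb l u p \<in> J" using p i(1) unfolding J_def by (metis imageI)
    then have "E (p n) * bas n \<in> J"
      by (intro graded_components[OF Jadd J0 _ _ _ n(1,2)] Jminus Jl Jr alg_closed(5)) auto
    then have "E (p n) * bas n * bas (- n) \<in> J" using Jr[OF alg_closed(6)] by blast
    then have f0: "E (p n * shift_poly (- of_int n) (gam n)) \<in> J"
      by (simp add: mult.assoc bas_gam' E_mult)
    define K where "K = {f. E f \<in> J}"
    have "1 \<in> K"
    proof (rule polynomial_ideal_without_zeros)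
      show "p n * shift_poly (- of_int n) (gam n) \<in> K" using f0 by (simp add: K_def)
      show "p n * shift_poly (- of_int n) (gam n) \<noteq> 0" using n(3) gam_nonzero by simp
      show "f + g \<in> K" if "f \<in> K" "g \<in> K" for f g using that Jadd by (simp add: K_def E_add)
      show "f * g \<in> K" if "g \<in> K" for f g using that Jl[OF alg_closed(5)] by (simp add: K_def E_mult)
      fix z
      let ?f = "p n * shift_poly (- of_int n) (gam n)"
      have f: "E ?f \<in> J" "?f \<noteq> 0" using f0 n(3) gam_nonzero by auto
      obtain k :: nat where k: "poly ?f (z + (- 1) * of_nat k) \<noteq> 0"
        using poly_nonvanishing_shift[OF f(2), of "- 1" z] by auto
      obtain m :: nat where m: "poly ?f (z + 1 * of_nat m) \<noteq> 0"
        using poly_nonvanishing_shift[OF f(2), of 1 z] by auto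
      have alg_pow: "X ^ j \<in> alg" "Y ^ j \<in> alg" for j
        using alg_closed(6)[of "int j"] alg_closed(6)[of "- int j"]
        by (auto simp: bas_def split: if_splits)
      have "X ^ k * E ?f * Y ^ k = E (shift_poly (- of_nat k) ?f * (\<Prod>j<k. shift_poly (- of_nat (Suc j)) a))"
        by (simp only: X_pow_E mult.assoc X_Y_pow E_mult[of "shift_poly (- of_nat k) ?f"])
      then have 1: "shift_poly (- of_nat k) ?f * (\<Prod>j<k. shift_poly (- of_nat (Suc j)) a) \<in> K"
        using Jr[OF alg_pow(2) Jl[OF alg_pow(1) f(1)]] unfolding K_def by (metis mem_Collect_eq)
      have "Y ^ m * E ?f * X ^ m = E (shift_poly (of_nat m) ?f * (\<Prod>j<m. shift_poly (of_nat j) a))"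
        by (simp only: Y_pow_E mult.assoc Y_X_pow E_mult[of "shift_poly (of_nat m) ?f"])
      then have 2: "shift_poly (of_nat m) ?f * (\<Prod>j<m. shift_poly (of_nat j) a) \<in> K"
        using Jr[OF alg_pow(1) Jl[OF alg_pow(2) f(1)]] unfolding K_def by (metis mem_Collect_eq)
      show "\<exists>f\<in>K. poly f z \<noteq> 0"
      proof (rule ccontr)
        assume no: "\<not> ?thesis"
        have "poly (\<Prod>j<k. shift_poly (- of_nat (Suc j)) a) z = 0"
          using no 1 k by (metis (no_types, lifting) diff_conv_add_uminus mult_minus1 mult_eq_0_iff poly_mult poly_shift_poly)
        then obtain j where j: "poly a (z - of_nat (Suc j)) = 0"
          by (auto simp: poly_prod simp del: of_nat_Suc)
        have "poly (\<Prod>j<m. shift_poly (of_nat j) a) z = 0"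
          using no 2 m by (metis (no_types, lifting) mult_1 mult_eq_0_iff poly_mult poly_shift_poly)
        then obtain i where i: "poly a (z + of_nat i) = 0" by (auto simp: poly_prod)
        have "z + of_nat i = (z - of_nat (Suc j)) + of_nat (Suc (i + j))" by simp
        then show False using gap i j unfolding integral_gap_free_def by metis
      qed
    qed
    then have "1 \<in> J" by (simp add: K_def E_one)
    then obtain v where v: "v \<in> I" "rho v = 1" by (auto simp: J_def)
    have "v \<in> carrier (gwa a)" using v(1) Isub by blast
    then have "v = \<one>\<^bsub>gwa a\<^esub>" using rho_hom(3) v(2) by (intro inj_onD[OF rho_inj _ _ G.one_closed]) simp_all
    then show ?thesis using I.one_imp_carrier v(1) by blast
  qed simp
qed

section \<open>Leading coefficients\<close>

lemma bas_mult: "\<exists>g. g \<noteq> 0 \<and> bas m * bas n = E g * bas (m + n)"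
proof -
  have x: "\<exists>g. g \<noteq> 0 \<and> X ^ k * bas n = E g * bas (int k + n)" for k
  proof (induction k)
    case 0
    show ?case by (intro exI[of _ 1]) (simp add: E_one)
  next
    case (Suc k)
    then obtain g where g: "g \<noteq> 0" "X ^ k * bas n = E g * bas (int k + n)" by blast
    have "X ^ Suc k * bas n = X * E g * bas (int k + n)" using g(2) by (simp add: mult.assoc)
    also have "\<dots> = E (shift_poly (- 1) g * (if int k + n \<ge> 0 then 1 else shift_poly (-1) a)) * bas (int (Suc k) + n)"
      by (simp add: X_E mult.assoc X_bas E_mult algebra_simps)
    finally show ?case using g(1) a_nonzero
      by (intro exI[of _ "shift_poly (- 1) g * (if int k + n \<ge> 0 then 1 else shift_poly (-1) a)"]) auto
  qed
  have y: "\<exists>g. g \<noteq> 0 \<and> Y ^ k * bas n = E g * bas (n - int k)" for k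
  proof (induction k)
    case 0
    show ?case by (intro exI[of _ 1]) (simp add: E_one)
  next
    case (Suc k)
    then obtain g where g: "g \<noteq> 0" "Y ^ k * bas n = E g * bas (n - int k)" by blast
    have "Y ^ Suc k * bas n = Y * E g * bas (n - int k)" using g(2) by (simp add: mult.assoc)
    also have "\<dots> = E (shift_poly 1 g * (if n - int k \<le> 0 then 1 else a)) * bas (n - int (Suc k))"
      by (simp add: Y_E mult.assoc Y_bas E_mult algebra_simps)
    finally show ?case using g(1) a_nonzero
      by (intro exI[of _ "shift_poly 1 g * (if n - int k \<le> 0 then 1 else a)"]) auto
  qed
  show ?thesis using x[of "nat m"] y[of "nat (- m)"] by (auto simp: bas_def[of m] add.commute)
qed

lemma top_coeff_unique:
  assumes "r \<in> supp_in l (u - 1)" "r + E t * bas u = 0"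
  shows "t = 0"
proof -
  let ?l = "min l u"
  obtain p where p: "r = comb ?l (u - 1) p"
    using assms(1) supp_in_mono[of ?l l "u - 1" "u - 1"] by (auto simp: supp_in_def)
  have "comb ?l u (p(u := t)) = comb ?l (u - 1) (p(u := t)) + E t * bas u"
    using comb_top[of ?l u "p(u := t)"] by simp
  also have "comb ?l (u - 1) (p(u := t)) = r" unfolding p by (rule comb_cong) auto
  finally have "comb ?l u (p(u := t)) = 0" by (simp only: assms(2))
  from indep[OF this, of u] show ?thesis by simp
qed

lemma exact_support:
  assumes "r \<in> supp_in l u" "r \<noteq> 0"
  obtains l' u' p where "l \<le> l'" "l' \<le> u'" "u' \<le> u" "r = comb l' u' p" "p l' \<noteq> 0" "p u' \<noteq> 0"
proof -
  obtain p where p: "r = comb l u p" using assms(1) by (auto simp: supp_in_def)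
  let ?S = "{n \<in> {l..u}. p n \<noteq> 0}"
  have ne: "?S \<noteq> {}"
  proof
    assume S: "?S = {}"
    then have "comb l u p = comb l u (\<lambda>_. 0)" by (intro comb_cong) auto
    then show False using assms(2) p comb_zero by simp
  qed
  have fin: "finite ?S" by (rule finite_subset[of _ "{l..u}"]) auto
  have S: "Min ?S \<in> ?S" "Max ?S \<in> ?S" using Min_in[OF fin ne] Max_in[OF fin ne] by auto
  have mm: "Min ?S \<le> n" "n \<le> Max ?S" if "n \<in> ?S" for n using that fin by auto
  have "r = comb (Min ?S) (Max ?S) p"
    unfolding p comb_def
  proof (rule sum.mono_neutral_right)
    show "{Min ?S..Max ?S} \<subseteq> {l..u}" using S by auto
    show "\<forall>n\<in>{l..u} - {Min ?S..Max ?S}. E (p n) * bas n = 0"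
    proof
      fix n assume n: "n \<in> {l..u} - {Min ?S..Max ?S}"
      then have "n \<notin> ?S" using mm[of n] by auto
      then show "E (p n) * bas n = 0" using n by (simp add: E_zero)
    qed
  qed simp
  then show thesis using that[of "Min ?S" "Max ?S" p] S mm[OF S(1)] by auto
qed

lemma comb_top_split: "l \<le> u \<Longrightarrow> comb l u p - E (p u) * bas u \<in> supp_in l (u - 1)"
  by (simp add: comb_top supp_inI)

lemma bas_top_mult:
  assumes "r - E t * bas u \<in> supp_in l (u - 1)"
  shows "\<exists>g. g \<noteq> 0 \<and> bas m * r - E (shift_poly (- of_int m) t * g) * bas (m + u) \<in> supp_in (l + m) (u + m - 1)"
proof -
  obtain g where g: "g \<noteq> 0" "bas m * bas u = E g * bas (m + u)" using bas_mult by blast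
  have "bas m * (E t * bas u) = E (shift_poly (- of_int m) t * g) * bas (m + u)"
    by (simp add: mult.assoc[symmetric] bas_E) (simp add: mult.assoc g E_mult)
  then have "bas m * r - E (shift_poly (- of_int m) t * g) * bas (m + u) = bas m * (r - E t * bas u)"
    by (simp add: right_diff_distrib)
  then show ?thesis using g bas_supp_in[OF assms, of m] by (intro exI[of _ g]) (simp add: algebra_simps)
qed

text \<open>Leading coefficients multiply up to a shift and a nonzero factor.\<close>

lemma alg_domain:
  assumes "r \<in> alg" "s \<in> alg" "r \<noteq> 0" "s \<noteq> 0"
  shows "r * s \<noteq> 0"
proof
  assume 0: "r * s = 0"
  obtain l u p where r: "l \<le> u" "r = comb l u p" "p u \<noteq> 0"
    using assms(1,3) by (auto simp: alg_def elim!: exact_support)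
  obtain l' u' q where s: "l' \<le> u'" "s = comb l' u' q" "q u' \<noteq> 0"
    using assms(2,4) by (auto simp: alg_def elim!: exact_support)
  have s': "s \<in> supp_in l' u'" using s supp_inI by simp
  have sl: "s - E (q u') * bas u' \<in> supp_in l' (u' - 1)" using comb_top_split s by blast
  obtain g where g: "g \<noteq> 0"
    "bas u * s - E (shift_poly (- of_int u) (q u') * g) * bas (u + u') \<in> supp_in (l' + u) (u' + u - 1)"
    using bas_top_mult[OF sl] by blast
  let ?t = "p u * (shift_poly (- of_int u) (q u') * g)"
  have "r * s - E ?t * bas (u + u') = (r - E (p u) * bas u) * s
      + E (p u) * (bas u * s - E (shift_poly (- of_int u) (q u') * g) * bas (u + u'))"
    by (simp only: E_mult left_diff_distrib right_diff_distrib mult.assoc) simp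
  moreover have "(r - E (p u) * bas u) * s \<in> supp_in (l + l') (u + u' - 1)"
    using supp_in_mult[OF comb_top_split[OF r(1), of p] s'] r(2) by (simp add: algebra_simps)
  moreover have "E (p u) * (bas u * s - E (shift_poly (- of_int u) (q u') * g) * bas (u + u'))
      \<in> supp_in (l + l') (u + u' - 1)"
    using supp_in_closed(4)[OF g(2)] supp_in_mono[of "l + l'" "l' + u" "u' + u - 1" "u + u' - 1"] r(1)
    by (auto simp: algebra_simps)
  ultimately have "r * s - E ?t * bas (u + u') \<in> supp_in (l + l') (u + u' - 1)"
    using supp_in_closed(2) by simp
  then have "E (- ?t) * bas (u + u') \<in> supp_in (l + l') (u + u' - 1)"
    using 0 by (simp add: E_minus)
  from top_coeff_unique[OF this, of ?t] have "?t = 0" by (simp add: E_minus)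
  then show False using r(3) s(3) g(1) by simp
qed

lemma alg_cancel_right: "r \<in> alg \<Longrightarrow> r' \<in> alg \<Longrightarrow> w \<in> alg \<Longrightarrow> w \<noteq> 0 \<Longrightarrow> r * w = r' * w \<Longrightarrow> r = r'"
  using alg_domain[of "r - r'" w] alg_closed(7) by (auto simp: left_diff_distrib)

lemma alg_cancel_left: "r \<in> alg \<Longrightarrow> r' \<in> alg \<Longrightarrow> w \<in> alg \<Longrightarrow> w \<noteq> 0 \<Longrightarrow> w * r = w * r' \<Longrightarrow> r = r'"
  using alg_domain[of w "r - r'"] alg_closed(7) by (auto simp: right_diff_distrib)

lemma E_nonzero: "p \<noteq> 0 \<Longrightarrow> E p \<noteq> 0"
  using indep[of 0 0 "\<lambda>_. p" 0] by (auto simp: comb_def)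

end

section \<open>The symmetry exchanging the generators\<close>

text \<open>Exchanging \<open>x\<close> and \<open>y\<close> and replacing \<open>h\<close> by \<open>-h\<close> presents the same algebra with \<open>a(-1 - h)\<close>
  in place of \<open>a(h)\<close>.\<close>

lemma (in gwa_rep) swap_rep:
  "gwa_rep (\<lambda>p. E (pcompose p [:0, -1:])) Y X (pcompose a [:-1, -1:])"
proof
  have e: "pcompose (shift_poly c p) [:0, -1:] = shift_poly (- c) (pcompose p [:0, -1:])" for c p
    by (rule complex_poly_eqI) (simp add: poly_pcompose)
  show "Y * E (pcompose p [:0, - 1:]) = E (pcompose (shift_poly (- 1) p) [:0, - 1:]) * Y" for p
    by (simp add: e Y_E)
  show "X * E (pcompose p [:0, - 1:]) = E (pcompose (shift_poly 1 p) [:0, - 1:]) * X" for p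
    by (simp add: e X_E)
  have "pcompose (pcompose a [:- 1, - 1:]) [:0, - 1:] = shift_poly (- 1) a"
    by (rule complex_poly_eqI) (simp add: poly_pcompose)
  then show "X * Y = E (pcompose (pcompose a [:- 1, - 1:]) [:0, - 1:])" by (simp add: XY)
  have "pcompose (shift_poly (- 1) (pcompose a [:- 1, - 1:])) [:0, - 1:] = a"
    by (rule complex_poly_eqI) (simp add: poly_pcompose)
  then show "Y * X = E (pcompose (shift_poly (- 1) (pcompose a [:- 1, - 1:])) [:0, - 1:])" by (simp add: YX)
qed (simp_all add: pcompose_add pcompose_mult pcompose_1 E_add E_mult E_one)

lemma (in gwa_rep) swap_comb:
  "gwa_rep.comb (\<lambda>p. E (pcompose p [:0, -1:])) Y X l u p
    = comb (- u) (- l) (\<lambda>n. pcompose (p (- n)) [:0, -1:])"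
proof -
  interpret S: gwa_rep "\<lambda>p. E (pcompose p [:0, -1:])" Y X "pcompose a [:-1, -1:]" by (rule swap_rep)
  have b: "S.bas n = bas (- n)" for n
    by (cases "n = 0") (auto simp: S.bas_def bas_def)
  show ?thesis
    unfolding S.comb_def comb_def b
    by (rule sum.reindex_bij_witness[of _ uminus uminus]) auto
qed

lemma (in gwa_rep) swap_supp_in:
  "gwa_rep.supp_in (\<lambda>p. E (pcompose p [:0, -1:])) Y X l u = supp_in (- u) (- l)"
proof -
  interpret S: gwa_rep "\<lambda>p. E (pcompose p [:0, -1:])" Y X "pcompose a [:-1, -1:]" by (rule swap_rep)
  have "comb (- u) (- l) p \<in> range (S.comb l u)" for p
  proof -
    have "pcompose (pcompose q [:0, -1:]) [:0, -1:] = q" for q :: "complex poly"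
      by (rule complex_poly_eqI) (simp add: poly_pcompose)
    then have "comb (- u) (- l) p = S.comb l u (\<lambda>n. pcompose (p (- n)) [:0, -1:])"
      by (simp add: swap_comb)
    then show ?thesis by blast
  qed
  then show ?thesis unfolding S.supp_in_def supp_in_def by (auto simp: swap_comb)
qed

lemma (in gwa_rep) swap_alg:
  "gwa_rep.alg (\<lambda>p. E (pcompose p [:0, -1:])) Y X = alg"
proof -
  interpret S: gwa_rep "\<lambda>p. E (pcompose p [:0, -1:])" Y X "pcompose a [:-1, -1:]" by (rule swap_rep)
  have "supp_in l u \<subseteq> S.alg" for l u
    using swap_supp_in[of "- u" "- l"] unfolding S.alg_def by auto
  then have "alg \<subseteq> S.alg" unfolding alg_def by blast
  moreover have "S.alg \<subseteq> alg" unfolding S.alg_def alg_def by (auto simp: swap_supp_in)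
  ultimately show ?thesis by simp
qed

lemma (in gwa_model) swap_model:
  "gwa_model (\<lambda>p. E (pcompose p [:0, -1:])) Y X (pcompose a [:-1, -1:])"
proof -
  interpret S: gwa_rep "\<lambda>p. E (pcompose p [:0, -1:])" Y X "pcompose a [:-1, -1:]" by (rule swap_rep)
  show ?thesis
  proof
    show "pcompose a [:- 1, - 1:] \<noteq> 0" using a_nonzero by (simp add: pcompose_eq_0_iff)
    fix l u p n assume "S.comb l u p = 0" "l \<le> n" "n \<le> u"
    then have "pcompose (p n) [:0, -1:] = 0"
      using indep[of "- u" "- l" "\<lambda>n. pcompose (p (- n)) [:0, -1:]" "- n"] by (simp add: swap_comb)
    then show "p n = 0" by (simp add: pcompose_eq_0_iff)
  qed
qed

section \<open>Finite dual bases of left ideals\<close>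

context gwa_rep
begin

definition left_ideal :: "'r set \<Rightarrow> bool" where
  "left_ideal I \<longleftrightarrow> I \<subseteq> alg \<and> 0 \<in> I \<and> (\<forall>r\<in>I. \<forall>s\<in>I. r + s \<in> I) \<and> (\<forall>r\<in>alg. \<forall>s\<in>I. r * s \<in> I)"

text \<open>The coordinate functions and generators that exhibit \<open>I\<close> as a finitely generated projective module.\<close>

definition dual_basis :: "'r set \<Rightarrow> (('r \<Rightarrow> 'r) \<times> 'r) list \<Rightarrow> bool" where
  "dual_basis I L \<longleftrightarrow>
     (\<forall>(\<phi>, e) \<in> set L. e \<in> I \<and> (\<forall>r\<in>I. \<phi> r \<in> alg) \<and> (\<forall>r\<in>I. \<forall>s\<in>I. \<phi> (r + s) = \<phi> r + \<phi> s) \<and>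
        (\<forall>t\<in>alg. \<forall>r\<in>I. \<phi> (t * r) = t * \<phi> r)) \<and>
     (\<forall>r\<in>I. (\<Sum>(\<phi>, e)\<leftarrow>L. \<phi> r * e) = r)"

lemma left_idealD:
  assumes "left_ideal I"
  shows "r \<in> I \<Longrightarrow> r \<in> alg" "0 \<in> I" "r \<in> I \<Longrightarrow> s \<in> I \<Longrightarrow> r + s \<in> I"
    "r \<in> alg \<Longrightarrow> s \<in> I \<Longrightarrow> r * s \<in> I" "r \<in> I \<Longrightarrow> s \<in> I \<Longrightarrow> r - s \<in> I"
proof -
  have "- 1 \<in> alg" using alg_closed(2,8) by blast
  then show "r \<in> I \<Longrightarrow> s \<in> I \<Longrightarrow> r - s \<in> I"
    using assms unfolding left_ideal_def by (metis diff_conv_add_uminus mult_minus1)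
qed (use assms in \<open>auto simp: left_ideal_def\<close>)

lemma dual_basisD:
  assumes "dual_basis I L"
  shows "(\<phi>, e) \<in> set L \<Longrightarrow> e \<in> I" "(\<phi>, e) \<in> set L \<Longrightarrow> r \<in> I \<Longrightarrow> \<phi> r \<in> alg"
    "(\<phi>, e) \<in> set L \<Longrightarrow> r \<in> I \<Longrightarrow> s \<in> I \<Longrightarrow> \<phi> (r + s) = \<phi> r + \<phi> s"
    "(\<phi>, e) \<in> set L \<Longrightarrow> t \<in> alg \<Longrightarrow> r \<in> I \<Longrightarrow> \<phi> (t * r) = t * \<phi> r"
    "r \<in> I \<Longrightarrow> (\<Sum>(\<phi>, e)\<leftarrow>L. \<phi> r * e) = r"
  using assms unfolding dual_basis_def by fast+

text \<open>If \<open>h - \<alpha>\<close> lies in \<open>I\<close>, then \<open>h s - s h = (h - \<alpha>) s - s (h - \<alpha>)\<close> lies in \<open>I\<close> for every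
  \<open>s\<close> in \<open>I\<close>.\<close>

lemma left_ideal_components:
  assumes I: "left_ideal I" and h: "E [:- \<alpha>, 1:] \<in> I"
    and r: "comb l u p \<in> I" and n: "l \<le> n" "n \<le> u"
  shows "E (p n) * bas n \<in> I"
proof (rule graded_components[OF left_idealD(3)[OF I] left_idealD(2)[OF I] _ _ r n])
  show "E [:c:] * s \<in> I" if "s \<in> I" for c s using left_idealD(4)[OF I alg_closed(5) that] .
  fix s assume s: "s \<in> I"
  have e: "E [:0, 1:] = E [:- \<alpha>, 1:] + E [:\<alpha>:]" by (simp add: E_add[symmetric])
  have c: "s * E [:\<alpha>:] = E [:\<alpha>:] * s"
  proof -
    obtain l u p where "s = comb l u p" using left_idealD(1)[OF I s] by (auto simp: alg_def supp_in_def)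
    then show ?thesis by (simp add: comb_E E_comb mult.commute)
  qed
  have "E [:0, 1:] * s - s * E [:0, 1:] = E [:- \<alpha>, 1:] * s - s * E [:- \<alpha>, 1:]"
    by (simp add: e distrib_left distrib_right c)
  moreover have "E [:- \<alpha>, 1:] * s \<in> I" using left_idealD(4)[OF I alg_closed(5) s] .
  moreover have "s * E [:- \<alpha>, 1:] \<in> I" using left_idealD(4)[OF I left_idealD(1)[OF I s] h] .
  ultimately show "E [:0, 1:] * s - s * E [:0, 1:] \<in> I" using left_idealD(5)[OF I] by simp
qed

end

definition simple_roots :: "complex poly \<Rightarrow> bool" where
  "simple_roots a \<longleftrightarrow> (\<forall>z. poly a z = 0 \<longrightarrow> (\<exists>g. a = [:- z, 1:] * g \<and> poly g z \<noteq> 0))"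

lemma poly_split_at: "\<exists>q. (p :: complex poly) = [:poly p z:] + [:- z, 1:] * q"
proof -
  have "[:- z, 1:] dvd p - [:poly p z:]" by (subst poly_eq_0_iff_dvd[symmetric]) simp
  then obtain q where "p - [:poly p z:] = [:- z, 1:] * q" by (auto elim!: dvdE)
  then show ?thesis by (metis add.commute diff_add_cancel)
qed

context gwa_model
begin

text \<open>The left linear map \<open>r \<mapsto> r y w\<^sup>-\<^sup>1\<close>; cancellation makes it well defined and linear.\<close>

lemma right_fraction:
  assumes I: "left_ideal I" and y: "y \<in> alg" and w: "w \<in> alg" "w \<noteq> 0"
    and ex: "\<And>r. r \<in> I \<Longrightarrow> \<exists>s\<in>alg. s * w = r * y"
  obtains \<phi> where "\<And>r. r \<in> I \<Longrightarrow> \<phi> r \<in> alg" "\<And>r. r \<in> I \<Longrightarrow> \<phi> r * w = r * y"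
    "\<And>r s. r \<in> I \<Longrightarrow> s \<in> I \<Longrightarrow> \<phi> (r + s) = \<phi> r + \<phi> s"
    "\<And>t r. t \<in> alg \<Longrightarrow> r \<in> I \<Longrightarrow> \<phi> (t * r) = t * \<phi> r"
proof -
  obtain \<phi> where \<phi>: "\<And>r. r \<in> I \<Longrightarrow> \<phi> r \<in> alg" "\<And>r. r \<in> I \<Longrightarrow> \<phi> r * w = r * y"
    using ex by metis
  have add: "\<phi> (r + s) = \<phi> r + \<phi> s" if "r \<in> I" "s \<in> I" for r s
    by (rule alg_cancel_right[OF _ _ w])
       (use that \<phi> left_idealD(3)[OF I] alg_closed(3) in \<open>auto simp: distrib_right\<close>)
  have mult: "\<phi> (t * r) = t * \<phi> r" if "t \<in> alg" "r \<in> I" for t r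
    by (rule alg_cancel_right[OF _ _ w])
       (use that \<phi> left_idealD(4)[OF I] alg_closed(4) in \<open>auto simp: mult.assoc\<close>)
  show thesis using that[of \<phi>] \<phi> add mult by blast
qed

lemma dual_basis_unit_ideal:
  assumes "left_ideal I" "1 \<in> I"
  shows "dual_basis I [(\<lambda>r. r, 1)]"
  using assms left_idealD(1)[OF assms(1)] by (auto simp: dual_basis_def)

lemma gam_root:
  assumes "poly (gam n) z = 0"
  shows "if n \<ge> 0 then \<exists>j<nat n. poly a (z + of_nat j) = 0
         else \<exists>j<nat (- n). poly a (z - of_nat (Suc j)) = 0"
  using assms by (auto simp: gam_def poly_prod simp del: of_nat_Suc split: if_splits)

text \<open>\<open>gam n\<close> is a product of shifts of \<open>a\<close> by distinct integers, and two of them vanishing at the same point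
  would give an integral gap between roots of \<open>a\<close>; so only one factor contributes.\<close>

lemma gam_simple_zero:
  assumes simple: "simple_roots a" and gap: "integral_gap_free a" and root: "poly (gam n) z = 0"
  shows "\<exists>g. gam n = [:- z, 1:] * g \<and> poly g z \<noteq> 0"
proof -
  define d :: "nat \<Rightarrow> int" where "d j = (if n \<ge> 0 then int j else - int (Suc j))" for j
  define k where "k = (if n \<ge> 0 then nat n else nat (- n))"
  have gam: "gam n = (\<Prod>j<k. shift_poly (of_int (d j)) a)"
    by (simp add: gam_def k_def d_def)
  obtain j where j: "j < k" "poly a (z + of_int (d j)) = 0"
    using root by (auto simp: gam poly_prod)
  obtain g where g: "a = [:- (z + of_int (d j)), 1:] * g" "poly g (z + of_int (d j)) \<noteq> 0"
    using simple j(2) unfolding simple_roots_def by blast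
  have other: "poly a (z + of_int (d i)) \<noteq> 0" if "i \<noteq> j" for i
  proof
    assume i: "poly a (z + of_int (d i)) = 0"
    have ne: "d i \<noteq> d j" using that by (auto simp: d_def)
    show False
    proof (cases "d i < d j")
      case True
      then obtain m where m: "d j = d i + int (Suc m)" using zless_iff_Suc_zadd by blast
      have "z + of_int (d j) = (z + of_int (d i)) + of_nat (Suc m)" unfolding m by simp
      then show False using gap i j(2) unfolding integral_gap_free_def by metis
    next
      case False
      then have "d j < d i" using ne by simp
      then obtain m where m: "d i = d j + int (Suc m)" using zless_iff_Suc_zadd by blast
      have "z + of_int (d i) = (z + of_int (d j)) + of_nat (Suc m)" unfolding m by simp
      then show False using gap i j(2) unfolding integral_gap_free_def by metis
    qed
  qed
  let ?rest = "\<Prod>i\<in>{..<k} - {j}. shift_poly (of_int (d i)) a"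
  have "gam n = shift_poly (of_int (d j)) a * ?rest"
    unfolding gam using j(1) by (simp add: prod.remove)
  also have "shift_poly (of_int (d j)) a = [:- z, 1:] * shift_poly (of_int (d j)) g"
    by (subst g(1), rule complex_poly_eqI) (simp add: algebra_simps)
  finally have "gam n = [:- z, 1:] * (shift_poly (of_int (d j)) g * ?rest)" by (simp only: mult.assoc)
  moreover have "poly (shift_poly (of_int (d j)) g * ?rest) z \<noteq> 0"
    using g(2) other by (auto simp: poly_prod)
  ultimately show ?thesis by blast
qed

text \<open>Modulo left multiples of \<open>h - \<alpha>\<close>, the component of degree \<open>n\<close> is spanned by \<open>bas n\<close>.\<close>

lemma mem_mod_linear:
  assumes I: "left_ideal I" and h: "E [:- \<alpha>, 1:] \<in> I" and m: "E p * bas n \<in> I"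
  shows "\<exists>c q. E p * bas n = E [:c:] * bas n + bas n * E q * E [:- \<alpha>, 1:] \<and> (c = 0 \<or> bas n \<in> I)"
proof -
  obtain q where q: "shift_poly (of_int n) p
      = [:poly (shift_poly (of_int n) p) \<alpha>:] + [:- \<alpha>, 1:] * q"
    using poly_split_at by blast
  define c where "c = poly (shift_poly (of_int n) p) \<alpha>"
  have "E p * bas n = bas n * E (shift_poly (of_int n) p)" by (rule E_bas)
  also have "\<dots> = bas n * E [:c:] + bas n * E ([:- \<alpha>, 1:] * q)"
    by (subst q) (simp only: E_add distrib_left c_def)
  also have "bas n * E [:c:] = E [:c:] * bas n" by (simp add: bas_E)
  also have "bas n * E ([:- \<alpha>, 1:] * q) = bas n * E q * E [:- \<alpha>, 1:]"
    by (simp only: E_mult mult.assoc E_commute[of q])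
  finally have e: "E p * bas n = E [:c:] * bas n + bas n * E q * E [:- \<alpha>, 1:]" .
  have "bas n \<in> I" if "c \<noteq> 0"
  proof -
    have "E [:c:] * bas n \<in> I"
      using left_idealD(5)[OF I m left_idealD(4)[OF I alg_closed(4)[OF alg_closed(6) alg_closed(5)] h, of n q]]
      unfolding e by simp
    from left_idealD(4)[OF I alg_closed(5) this, of "[:1 / c:]"]
    have "E ([:1 / c:] * [:c:]) * bas n \<in> I" by (simp only: E_mult mult.assoc)
    then show ?thesis using that E_one by (simp add: one_pCons)
  qed
  then show ?thesis using e by blast
qed

text \<open>Left ideals containing \<open>h - \<alpha>\<close> are graded, and the quotient of the algebra by
  \<open>h - \<alpha>\<close> has one-dimensional components; so such an ideal is the unit ideal,
  is generated by \<open>h - \<alpha>\<close>, or by \<open>h - \<alpha>\<close> and one basis element.\<close>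

lemma linear_left_ideal_dual_basis:
  assumes simple: "simple_roots a" and gap: "integral_gap_free a"
    and I: "left_ideal I" and h: "E [:- \<alpha>, 1:] \<in> I"
  shows "\<exists>L. dual_basis I L"
proof (cases "1 \<in> I")
  case True
  then show ?thesis using dual_basis_unit_ideal[OF I] by blast
next
  case no1: False
  have hz: "E [:- \<alpha>, 1:] \<noteq> 0" by (rule E_nonzero) simp
  have root: "poly (gam n) \<alpha> = 0" if "bas n \<in> I" for n
  proof (rule ccontr)
    assume nz: "poly (gam n) \<alpha> \<noteq> 0"
    have "E (gam n) * bas 0 \<in> I" using left_idealD(4)[OF I alg_closed(6) that, of "- n"] by (simp add: bas_gam)
    obtain q where q: "gam n = [:poly (gam n) \<alpha>:] + [:- \<alpha>, 1:] * q" using poly_split_at by blast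
    have "E (gam n) - E q * E [:- \<alpha>, 1:] \<in> I"
      using left_idealD(5)[OF I] \<open>E (gam n) * bas 0 \<in> I\<close> left_idealD(4)[OF I alg_closed(5) h] by simp
    moreover have "E (gam n) - E q * E [:- \<alpha>, 1:] = E [:poly (gam n) \<alpha>:]"
      by (subst q) (simp add: E_mult[symmetric] E_add[symmetric] E_diff[symmetric] mult.commute)
    ultimately have "E [:1 / poly (gam n) \<alpha>:] * E [:poly (gam n) \<alpha>:] \<in> I"
      using left_idealD(4)[OF I alg_closed(5)] by simp
    then show False using nz no1 E_one by (simp add: E_mult[symmetric] one_pCons)
  qed
  have in_I: "\<exists>r1 c. r1 \<in> alg \<and> E (p n) * bas n = r1 * E [:- \<alpha>, 1:] + E [:c:] * bas n \<and> (c = 0 \<or> bas n \<in> I)"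
    if m: "comb l u p \<in> I" "l \<le> n" "n \<le> u" for l u p n
  proof -
    obtain c q where "E (p n) * bas n = E [:c:] * bas n + bas n * E q * E [:- \<alpha>, 1:]" "c = 0 \<or> bas n \<in> I"
      using mem_mod_linear[OF I h left_ideal_components[OF I h m]] by blast
    then show ?thesis using alg_closed(4)[OF alg_closed(6) alg_closed(5), of n q]
      by (intro exI[of _ "bas n * E q"] exI[of _ c]) (simp add: add.commute)
  qed
  show ?thesis
  proof (cases "\<exists>n. bas n \<in> I")
    case False
    have ex: "\<exists>s\<in>alg. s * E [:- \<alpha>, 1:] = r * 1" if rI: "r \<in> I" for r
    proof -
      obtain l u p where r: "r = comb l u p" using left_idealD(1)[OF I rI] by (auto simp: alg_def supp_in_def)
      have "\<forall>n\<in>{l..u}. \<exists>r1. r1 \<in> alg \<and> E (p n) * bas n = r1 * E [:- \<alpha>, 1:]"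
        using in_I[of l u p] rI r False by (fastforce simp: E_zero)
      then obtain s where s: "\<And>n. n \<in> {l..u} \<Longrightarrow> s n \<in> alg \<and> E (p n) * bas n = s n * E [:- \<alpha>, 1:]"
        by metis
      have "(\<Sum>n=l..u. s n) * E [:- \<alpha>, 1:] = r"
        unfolding r comb_def sum_distrib_right by (rule sum.cong) (use s in auto)
      then show ?thesis using alg_sum[of "{l..u}" s] s by (metis mult_1_right)
    qed
    obtain \<phi> where \<phi>: "\<And>r. r \<in> I \<Longrightarrow> \<phi> r \<in> alg" "\<And>r. r \<in> I \<Longrightarrow> \<phi> r * E [:- \<alpha>, 1:] = r * 1"
      "\<And>r s. r \<in> I \<Longrightarrow> s \<in> I \<Longrightarrow> \<phi> (r + s) = \<phi> r + \<phi> s"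
      "\<And>t r. t \<in> alg \<Longrightarrow> r \<in> I \<Longrightarrow> \<phi> (t * r) = t * \<phi> r"
      using right_fraction[OF I alg_closed(2) alg_closed(5) hz ex] by metis
    then have "dual_basis I [(\<phi>, E [:- \<alpha>, 1:])]" using h by (auto simp: dual_basis_def)
    then show ?thesis by blast
  next
    case True
    then obtain n where n: "bas n \<in> I" "\<And>m. bas m \<in> I \<Longrightarrow> nat \<bar>n\<bar> \<le> nat \<bar>m\<bar>"
      using ex_has_least_nat[of "\<lambda>n. bas n \<in> I" _ "\<lambda>n. nat \<bar>n\<bar>"] by blast
    \<comment> \<open>Both signs would produce roots of \<open>a\<close> on both sides of \<open>\<alpha>\<close>, hence an integral gap.\<close>
    have sgn: False if mk: "bas m \<in> I" "bas k \<in> I" "m \<ge> 0" "k < 0" for m k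
    proof -
      obtain j where j: "poly a (\<alpha> + of_nat j) = 0" using gam_root[OF root[OF mk(1)]] mk(3) by auto
      obtain i where i: "poly a (\<alpha> - of_nat (Suc i)) = 0"
        using gam_root[OF root[OF mk(2)]] mk(4) by (auto simp del: of_nat_Suc)
      have "\<alpha> + of_nat j = (\<alpha> - of_nat (Suc i)) + of_nat (Suc (i + j))" by simp
      then show False using gap i j unfolding integral_gap_free_def by metis
    qed
    have bas_mult_n: "\<exists>t\<in>alg. bas m = t * bas n" if m: "bas m \<in> I" for m
    proof (cases "n \<ge> 0")
      case True
      then have "m \<ge> 0" using sgn[OF n(1) m] by (meson not_le)
      then have "bas m = bas (m - n) * bas n" using n(2)[OF m] True by (simp add: bas_add_nonneg)
      then show ?thesis using alg_closed(6) by blast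
    next
      case False
      then have "m < 0" using sgn[OF m n(1)] by (meson not_le)
      then have "bas m = bas (m - n) * bas n" using n(2)[OF m] False by (simp add: bas_add_nonpos)
      then show ?thesis using alg_closed(6) by blast
    qed
    have gen: "\<exists>r1\<in>alg. \<exists>r2\<in>alg. r = r1 * E [:- \<alpha>, 1:] + r2 * bas n" if rI: "r \<in> I" for r
    proof -
      obtain l u p where r: "r = comb l u p" using left_idealD(1)[OF I rI] by (auto simp: alg_def supp_in_def)
      have "\<exists>r1 r2. r1 \<in> alg \<and> r2 \<in> alg \<and> E (p m) * bas m = r1 * E [:- \<alpha>, 1:] + r2 * bas n"
        if m: "m \<in> {l..u}" for m
      proof -
        obtain r1 c where r1: "r1 \<in> alg" "E (p m) * bas m = r1 * E [:- \<alpha>, 1:] + E [:c:] * bas m"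
          "c = 0 \<or> bas m \<in> I" using in_I[of l u p m] rI r m by auto
        show ?thesis
        proof (cases "c = 0")
          case True
          then show ?thesis using r1 alg_closed(1) by (intro exI[of _ r1] exI[of _ 0]) (simp add: E_zero)
        next
          case False
          then obtain t where t: "t \<in> alg" "bas m = t * bas n" using r1(3) bas_mult_n by blast
          then show ?thesis using r1 alg_closed(4)[OF alg_closed(5) t(1), of "[:c:]"]
            by (intro exI[of _ r1] exI[of _ "E [:c:] * t"]) (simp add: mult.assoc)
        qed
      qed
      then obtain s1 s2 where s: "\<And>m. m \<in> {l..u} \<Longrightarrow> s1 m \<in> alg \<and> s2 m \<in> alg \<and>
          E (p m) * bas m = s1 m * E [:- \<alpha>, 1:] + s2 m * bas n" by metis
      have "r = (\<Sum>m=l..u. s1 m) * E [:- \<alpha>, 1:] + (\<Sum>m=l..u. s2 m) * bas n"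
        unfolding r comb_def sum_distrib_right sum.distrib[symmetric] by (rule sum.cong) (use s in auto)
      moreover have "(\<Sum>m=l..u. s1 m) \<in> alg" "(\<Sum>m=l..u. s2 m) \<in> alg" using s by (auto intro: alg_sum)
      ultimately show ?thesis by blast
    qed
    \<comment> \<open>Since the roots are simple, \<open>h - \<alpha>\<close> and \<open>B\<close> are coprime.  The maps \<open>r \<mapsto> r (h - \<alpha>)\<close> and
      \<open>r \<mapsto> r bas(-n) W\<^sup>-\<^sup>1 bas n = r B\<close> then combine to the identity.\<close>
    obtain B where B: "gam n = [:- \<alpha>, 1:] * B" "poly B \<alpha> \<noteq> 0"
      using gam_simple_zero[OF simple gap root[OF n(1)]] by blast
    define \<beta> where "\<beta> = poly B \<alpha>"
    obtain w where w: "B = [:\<beta>:] + [:- \<alpha>, 1:] * w" unfolding \<beta>_def using poly_split_at by blast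
    define W where "W = shift_poly (- of_int n) [:- \<alpha>, 1:]"
    note sh = W_def[symmetric]
    have wz: "E W \<noteq> 0" by (rule E_nonzero) (simp add: W_def)
    have ex: "\<exists>s\<in>alg. s * E W = r * bas (- n)" if rI: "r \<in> I" for r
    proof -
      obtain r1 r2 where r: "r1 \<in> alg" "r2 \<in> alg" "r = r1 * E [:- \<alpha>, 1:] + r2 * bas n" using gen[OF rI] by blast
      have 1: "E [:- \<alpha>, 1:] * bas (- n) = bas (- n) * E W"
        by (subst E_bas) (simp add: W_def)
      have 2: "bas n * bas (- n) = E (shift_poly (- of_int n) B) * E W"
        unfolding bas_gam' B(1) shift_poly_simps(3) sh E_mult by (rule E_commute)
      have "(r1 * bas (- n) + r2 * E (shift_poly (- of_int n) B)) * E W = r * bas (- n)"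
        unfolding r(3) distrib_right by (simp add: mult.assoc 1 2)
      moreover have "r1 * bas (- n) + r2 * E (shift_poly (- of_int n) B) \<in> alg"
        using r alg_closed by auto
      ultimately show ?thesis by blast
    qed
    obtain \<phi> where \<phi>: "\<And>r. r \<in> I \<Longrightarrow> \<phi> r \<in> alg"
      "\<And>r. r \<in> I \<Longrightarrow> \<phi> r * E W = r * bas (- n)"
      "\<And>r s. r \<in> I \<Longrightarrow> s \<in> I \<Longrightarrow> \<phi> (r + s) = \<phi> r + \<phi> s"
      "\<And>t r. t \<in> alg \<Longrightarrow> r \<in> I \<Longrightarrow> \<phi> (t * r) = t * \<phi> r"
      using right_fraction[OF I alg_closed(6) alg_closed(5) wz ex] by metis
    have \<phi>B: "\<phi> r * bas n = r * E B" if rI: "r \<in> I" for r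
    proof (rule alg_cancel_right[OF _ _ alg_closed(5) hz])
      show "\<phi> r * bas n \<in> alg" "r * E B \<in> alg" using \<phi>(1) rI left_idealD(1)[OF I] alg_closed by auto
      have "\<phi> r * bas n * E [:- \<alpha>, 1:] = \<phi> r * E W * bas n"
        by (simp add: mult.assoc bas_E sh)
      also have "\<dots> = r * E (gam n)" by (simp add: \<phi>(2)[OF rI] mult.assoc bas_gam)
      also have "\<dots> = r * E B * E [:- \<alpha>, 1:]" by (simp only: B(1) mult.assoc E_mult E_commute[of B])
      finally show "\<phi> r * bas n * E [:- \<alpha>, 1:] = r * E B * E [:- \<alpha>, 1:]" .
    qed
    let ?q = "- Polynomial.smult (1 / \<beta>) w"
    have id: "B * [:1 / \<beta>:] + ?q * [:- \<alpha>, 1:] = 1"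
    proof (rule complex_poly_eqI)
      fix z show "poly (B * [:1 / \<beta>:] + ?q * [:- \<alpha>, 1:]) z = poly 1 z"
        using B(2) by (subst w) (simp add: \<beta>_def field_simps)
    qed
    have "dual_basis I [(\<phi>, E [:1 / \<beta>:] * bas n), (\<lambda>r. r * E ?q, E [:- \<alpha>, 1:])]"
    proof -
      have "\<phi> r * (E [:1 / \<beta>:] * bas n) + r * E ?q * E [:- \<alpha>, 1:] = r" if rI: "r \<in> I" for r
      proof -
        have "E [:1 / \<beta>:] * bas n = bas n * E [:1 / \<beta>:]" by (simp add: bas_E)
        then have "\<phi> r * (E [:1 / \<beta>:] * bas n) = r * E B * E [:1 / \<beta>:]"
          by (simp add: mult.assoc[symmetric] \<phi>B[OF rI])
        then have "\<phi> r * (E [:1 / \<beta>:] * bas n) + r * E ?q * E [:- \<alpha>, 1:]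
            = r * E (B * [:1 / \<beta>:] + ?q * [:- \<alpha>, 1:])"
          by (simp only: E_add E_mult distrib_left mult.assoc)
        then show ?thesis by (simp only: id E_one mult_1_right)
      qed
      moreover have "E [:1 / \<beta>:] * bas n \<in> I" using left_idealD(4)[OF I alg_closed(5) n(1)] .
      ultimately show ?thesis
        using h \<phi>(1,3,4) left_idealD(1)[OF I] alg_closed(4)[OF _ alg_closed(5)]
        by (simp add: dual_basis_def distrib_right mult.assoc)
    qed
    then show ?thesis by blast
  qed
qed

text \<open>With \<open>c = (h - \<alpha>) c'\<close>, the ideal \<open>J = I + A c'\<close> and \<open>I\<^sub>2 = {s. s c' \<in> I}\<close> fit into
  \<open>0 \<rightarrow> I\<^sub>2 \<rightarrow> I \<oplus> A \<rightarrow> J \<rightarrow> 0\<close>, which splits.\<close>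

lemma polynomial_left_ideal_dual_basis:
  assumes simple: "simple_roots a" and gap: "integral_gap_free a"
    and "left_ideal I" "E c \<in> I" "c \<noteq> 0"
  shows "\<exists>L. dual_basis I L"
  using assms(3-)
proof (induction "degree c" arbitrary: I c)
  case 0
  then obtain d where "c = [:d:]" by (metis degree_eq_zeroE)
  then have d: "c = [:d:]" "d \<noteq> 0" using 0 by auto
  have "E [:1 / d:] * E c \<in> I" using left_idealD(4)[OF 0(2) alg_closed(5) 0(3)] .
  then have "1 \<in> I" using d E_one by (simp add: E_mult[symmetric] one_pCons)
  then show ?case using dual_basis_unit_ideal[OF 0(2)] by blast
next
  case (Suc d)
  note I = Suc.prems(1)
  obtain \<alpha> where "poly c \<alpha> = 0" using alg_closed_imp_poly_has_root[of c] Suc.hyps(2) by auto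
  then obtain c' where c': "c = [:- \<alpha>, 1:] * c'" by (auto simp: poly_eq_0_iff_dvd elim!: dvdE)
  then have c'0: "c' \<noteq> 0" using Suc.prems by auto
  have deg: "d = degree c'"
    using Suc.hyps(2) c' c'0 by (simp add: degree_mult_eq del: mult_pCons_left)
  define J where "J = {i + s * E c' | i s. i \<in> I \<and> s \<in> alg}"
  have J: "left_ideal J"
    unfolding left_ideal_def
  proof (intro conjI ballI)
    show "J \<subseteq> alg" using left_idealD(1)[OF I] alg_closed by (auto simp: J_def)
    show "0 \<in> J" unfolding J_def using left_idealD(2)[OF I] alg_closed(1) by force
  next
    fix r s assume "r \<in> J" "s \<in> J"
    then obtain i t i' t' where "i \<in> I" "t \<in> alg" "r = i + t * E c'" "i' \<in> I" "t' \<in> alg" "s = i' + t' * E c'"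
      unfolding J_def by blast
    then have "r + s = (i + i') + (t + t') * E c'" "i + i' \<in> I" "t + t' \<in> alg"
      using left_idealD(3)[OF I] alg_closed(3) by (auto simp: distrib_right)
    then show "r + s \<in> J" unfolding J_def by blast
  next
    fix r s assume "r \<in> alg" "s \<in> J"
    then obtain i t where it: "i \<in> I" "t \<in> alg" "s = i + t * E c'" unfolding J_def by blast
    then have "r * s = r * i + (r * t) * E c'" "r * i \<in> I" "r * t \<in> alg"
      using left_idealD(4)[OF I \<open>r \<in> alg\<close>] alg_closed(4)[OF \<open>r \<in> alg\<close>] by (auto simp: distrib_left mult.assoc)
    then show "r * s \<in> J" unfolding J_def by blast
  qed
  have IJ: "i \<in> J" if "i \<in> I" for i
  proof -
    have "i = i + 0 * E c'" by simp
    then show ?thesis unfolding J_def using that alg_closed(1) by blast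
  qed
  have "0 + 1 * E c' \<in> J" unfolding J_def using left_idealD(2)[OF I] alg_closed(2) by blast
  then have "E c' \<in> J" by simp
  then obtain LJ where LJ: "dual_basis J LJ" using Suc.hyps(1)[OF deg J _ c'0] by blast
  define I2 where "I2 = {s \<in> alg. s * E c' \<in> I}"
  have I2: "left_ideal I2"
    unfolding left_ideal_def I2_def
    using alg_closed left_idealD(2,3)[OF I] left_idealD(4)[OF I]
    by (auto simp: distrib_right mult.assoc)
  have "E [:- \<alpha>, 1:] \<in> I2" using Suc.prems(2) alg_closed(5) by (simp add: I2_def c' E_mult[symmetric])
  then obtain L2 where L2: "dual_basis I2 L2" using linear_left_ideal_dual_basis[OF simple gap I2] by blast
  have "\<forall>j\<in>J. \<exists>x. fst x \<in> I \<and> snd x \<in> alg \<and> j = fst x + snd x * E c'" unfolding J_def by force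
  then obtain dec where dec: "\<And>j. j \<in> J \<Longrightarrow> fst (dec j) \<in> I \<and> snd (dec j) \<in> alg \<and> j = fst (dec j) + snd (dec j) * E c'"
    by metis
  \<comment> \<open>Since \<open>J\<close> is projective, \<open>r \<mapsto> (\<tau> r, \<sigma> r)\<close> splits \<open>I \<oplus> A \<rightarrow> J\<close>; on \<open>I\<close> the second part lands in \<open>I\<^sub>2\<close>.\<close>
  define \<sigma> where "\<sigma> r = (\<Sum>(\<phi>, j)\<leftarrow>LJ. \<phi> r * snd (dec j))" for r
  define \<tau> where "\<tau> r = (\<Sum>(\<phi>, j)\<leftarrow>LJ. \<phi> r * fst (dec j))" for r
  have split: "\<tau> r + \<sigma> r * E c' = r" if "r \<in> J" for r
  proof -
    have "set L \<subseteq> set LJ \<Longrightarrow> (\<Sum>(\<phi>, j)\<leftarrow>L. \<phi> r * fst (dec j)) + (\<Sum>(\<phi>, j)\<leftarrow>L. \<phi> r * snd (dec j)) * E c'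
        = (\<Sum>(\<phi>, j)\<leftarrow>L. \<phi> r * j)" for L
    proof (induction L)
      case (Cons x L)
      obtain \<phi> j where x: "x = (\<phi>, j)" by (cases x)
      have "j \<in> J" using dual_basisD(1)[OF LJ] Cons.prems x by auto
      then have "\<phi> r * j = \<phi> r * fst (dec j) + \<phi> r * snd (dec j) * E c'"
        using dec[of j] by (metis distrib_left mult.assoc)
      then show ?case using Cons by (simp add: x distrib_right add.assoc)
    qed simp
    then show ?thesis using dual_basisD(5)[OF LJ that] by (simp add: \<sigma>_def \<tau>_def)
  qed
  have \<tau>I: "\<tau> r \<in> I" and \<sigma>alg: "\<sigma> r \<in> alg" if r: "r \<in> J" for r
  proof -
    have "set L \<subseteq> set LJ \<Longrightarrow> (\<Sum>(\<phi>, j)\<leftarrow>L. \<phi> r * fst (dec j)) \<in> I \<and> (\<Sum>(\<phi>, j)\<leftarrow>L. \<phi> r * snd (dec j)) \<in> alg" for L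
    proof (induction L)
      case Nil
      then show ?case using left_idealD(2)[OF I] alg_closed(1) by simp
    next
      case (Cons x L)
      obtain \<phi> j where x: "x = (\<phi>, j)" by (cases x)
      have m: "(\<phi>, j) \<in> set LJ" using Cons.prems x by simp
      have d: "fst (dec j) \<in> I" "snd (dec j) \<in> alg" using dec dual_basisD(1)[OF LJ m] by blast+
      have "\<phi> r \<in> alg" by (rule dual_basisD(2)[OF LJ m r])
      then show ?case using Cons d left_idealD(3,4)[OF I] alg_closed(3,4) by (simp add: x)
    qed
    then show "\<tau> r \<in> I" "\<sigma> r \<in> alg" unfolding \<sigma>_def \<tau>_def by auto
  qed
  have \<sigma>I2: "\<sigma> r \<in> I2" if "r \<in> I" for r
  proof -
    have "\<sigma> r * E c' = r - \<tau> r" using split[OF IJ[OF that]] by (metis add_diff_cancel_left')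
    then show ?thesis using left_idealD(5)[OF I that \<tau>I[OF IJ[OF that]]] \<sigma>alg[OF IJ[OF that]]
      by (simp add: I2_def)
  qed
  have \<sigma>add: "\<sigma> (r + s) = \<sigma> r + \<sigma> s" if rs: "r \<in> J" "s \<in> J" for r s
  proof -
    have "set L \<subseteq> set LJ \<Longrightarrow> (\<Sum>(\<phi>, j)\<leftarrow>L. \<phi> (r + s) * snd (dec j))
        = (\<Sum>(\<phi>, j)\<leftarrow>L. \<phi> r * snd (dec j)) + (\<Sum>(\<phi>, j)\<leftarrow>L. \<phi> s * snd (dec j))" for L
    proof (induction L)
      case (Cons x L)
      obtain \<phi> j where x: "x = (\<phi>, j)" by (cases x)
      then have "(\<phi>, j) \<in> set LJ" using Cons.prems by simp
      then have "\<phi> (r + s) = \<phi> r + \<phi> s" using dual_basisD(3)[OF LJ] rs by blast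
      then show ?case using Cons by (simp add: x distrib_right)
    qed simp
    then show ?thesis unfolding \<sigma>_def by blast
  qed
  have \<sigma>mult: "\<sigma> (t * r) = t * \<sigma> r" if tr: "t \<in> alg" "r \<in> J" for t r
  proof -
    have "set L \<subseteq> set LJ \<Longrightarrow> (\<Sum>(\<phi>, j)\<leftarrow>L. \<phi> (t * r) * snd (dec j))
        = t * (\<Sum>(\<phi>, j)\<leftarrow>L. \<phi> r * snd (dec j))" for L
    proof (induction L)
      case (Cons x L)
      obtain \<phi> j where x: "x = (\<phi>, j)" by (cases x)
      then have "(\<phi>, j) \<in> set LJ" using Cons.prems by simp
      then have "\<phi> (t * r) = t * \<phi> r" using dual_basisD(4)[OF LJ] tr by blast
      then show ?case using Cons by (simp add: x distrib_left mult.assoc)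
    qed simp
    then show ?thesis unfolding \<sigma>_def by blast
  qed
  let ?L = "map (\<lambda>(\<phi>, j). (\<phi>, fst (dec j))) LJ @ map (\<lambda>(\<chi>', e). (\<lambda>r. \<chi>' (\<sigma> r), e * E c')) L2"
  have "dual_basis I ?L"
    unfolding dual_basis_def
  proof (intro conjI ballI)
    fix x assume "x \<in> set ?L"
    then consider \<phi> j where "(\<phi>, j) \<in> set LJ" "x = (\<phi>, fst (dec j))"
      | \<psi> e where "(\<psi>, e) \<in> set L2" "x = (\<lambda>r. \<psi> (\<sigma> r), e * E c')" by auto
    then show "case x of (\<phi>, e) \<Rightarrow> e \<in> I \<and> (\<forall>r\<in>I. \<phi> r \<in> alg) \<and> (\<forall>r\<in>I. \<forall>s\<in>I. \<phi> (r + s) = \<phi> r + \<phi> s) \<and>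
        (\<forall>t\<in>alg. \<forall>r\<in>I. \<phi> (t * r) = t * \<phi> r)"
    proof cases
      case 1
      then show ?thesis
        using dual_basisD(1-4)[OF LJ 1(1)] IJ dec by auto
    next
      case 2
      have "e \<in> I2" using dual_basisD(1)[OF L2 2(1)] .
      then show ?thesis
        using dual_basisD(2-4)[OF L2 2(1)] \<sigma>I2 \<sigma>add[OF IJ IJ] \<sigma>mult[OF _ IJ] 2(2) by (auto simp: I2_def)
    qed
  next
    fix r assume r: "r \<in> I"
    have "(\<Sum>(\<phi>, e)\<leftarrow>map (\<lambda>(\<phi>, j). (\<phi>, fst (dec j))) L. \<phi> r * e) = (\<Sum>(\<phi>, j)\<leftarrow>L. \<phi> r * fst (dec j))" for L
      by (induction L) auto
    then have 1: "(\<Sum>(\<phi>, e)\<leftarrow>map (\<lambda>(\<phi>, j). (\<phi>, fst (dec j))) LJ. \<phi> r * e) = \<tau> r" by (simp add: \<tau>_def)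
    have "(\<Sum>(\<phi>, e)\<leftarrow>map (\<lambda>(\<chi>', e). (\<lambda>r. \<chi>' (\<sigma> r), e * E c')) L. \<phi> r * e) = (\<Sum>(\<phi>, e)\<leftarrow>L. \<phi> (\<sigma> r) * e) * E c'" for L
      by (induction L) (auto simp: distrib_right mult.assoc)
    then have 2: "(\<Sum>(\<phi>, e)\<leftarrow>map (\<lambda>(\<chi>', e). (\<lambda>r. \<chi>' (\<sigma> r), e * E c')) L2. \<phi> r * e) = \<sigma> r * E c'"
      using dual_basisD(5)[OF L2 \<sigma>I2[OF r]] by simp
    show "(\<Sum>(\<phi>, e)\<leftarrow>?L. \<phi> r * e) = r"
      unfolding map_append sum_list.append using 1 2 split[OF IJ[OF r]] by simp
  qed
  then show ?case by blast
qed

end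

section \<open>Arbitrary left ideals\<close>

context gwa_model
begin

lemma supp_in_top:
  assumes "i \<in> supp_in l u" "l \<le> u"
  obtains s where "i - E s * bas u \<in> supp_in l (u - 1)"
proof -
  obtain p where "i = comb l u p" using assms(1) by (auto simp: supp_in_def)
  then show thesis using that[of "p u"] comb_top_split[OF assms(2)] by simp
qed

lemma supp_in_empty: "u < l \<Longrightarrow> supp_in l u = {0}"
  by (auto simp: supp_in_def comb_def)

text \<open>Among all leading coefficients in degrees \<open>\<ge> 0\<close> one of minimal polynomial degree divides,
  after a shift, every leading coefficient in higher degree; so multiples of a single element
  of the ideal remove all large positive degrees.\<close>

lemma bounded_above:
  assumes I: "left_ideal I" and nz: "i0 \<in> I" "i0 \<noteq> 0"
  shows "\<exists>j\<in>I. \<exists>n l0. \<forall>i\<in>I. \<forall>l u. i \<in> supp_in l u \<longrightarrow> (\<exists>q\<in>alg. i - q * j \<in> supp_in (min l l0) n)"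
proof -
  define T where "T = (\<lambda>(i, n, l, t). i \<in> I \<and> n \<ge> 0 \<and> t \<noteq> 0 \<and> i - E t * bas n \<in> supp_in l (n - 1))"
  have "\<exists>x. T x"
  proof -
    obtain l u p where p: "l \<le> u" "i0 = comb l u p" "p u \<noteq> 0"
      using left_idealD(1)[OF I nz(1)] nz(2) by (auto simp: alg_def elim!: exact_support)
    have "i0 - E (p u) * bas u \<in> supp_in l (u - 1)" using comb_top_split p by blast
    from bas_top_mult[OF this, of "\<bar>u\<bar>"] obtain g where g: "g \<noteq> 0"
      "bas \<bar>u\<bar> * i0 - E (shift_poly (- of_int \<bar>u\<bar>) (p u) * g) * bas (\<bar>u\<bar> + u) \<in> supp_in (l + \<bar>u\<bar>) (u + \<bar>u\<bar> - 1)"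
      by blast
    have "T (bas \<bar>u\<bar> * i0, \<bar>u\<bar> + u, l + \<bar>u\<bar>, shift_poly (- of_int \<bar>u\<bar>) (p u) * g)"
      unfolding T_def using g p(3) left_idealD(4)[OF I alg_closed(6) nz(1)] by (simp add: add.commute)
    then show ?thesis by blast
  qed
  then obtain x where x: "T x" and x_min: "\<And>y. T y \<Longrightarrow> degree (snd (snd (snd x))) \<le> degree (snd (snd (snd y)))"
    using ex_has_least_nat[of T _ "\<lambda>x. degree (snd (snd (snd x)))"] by blast
  obtain j n l1 t where xx: "x = (j, n, l1, t)" by (cases x)
  define l0 where "l0 = min l1 n"
  have l0: "l0 \<le> n" by (simp add: l0_def)
  have j: "j \<in> I" "n \<ge> 0" "t \<noteq> 0" "j - E t * bas n \<in> supp_in l0 (n - 1)"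
    using x supp_in_mono[of l0 l1 "n - 1" "n - 1"] by (auto simp: xx T_def l0_def)
  have min: "degree t \<le> degree t'" if "T (i, m, l, t')" for i m l t' using x_min[OF that] by (simp add: xx)
  have red: "\<exists>q\<in>alg. i - q * j \<in> supp_in (min l l0) n"
    if "i \<in> I" "i \<in> supp_in l (n + int k)" for i l k
    using that
  proof (induction k arbitrary: i l)
    case 0
    then show ?case using supp_in_mono[of "min l l0" l n n] alg_closed(1) by (intro bexI[of _ 0]) auto
  next
    case (Suc k)
    define u where "u = n + int (Suc k)"
    define m where "m = min l l0"
    have u: "u > n" "u - 1 = n + int k" by (auto simp: u_def)
    have "i \<in> supp_in m u" using Suc.prems supp_in_mono[of m l u u] by (auto simp: u_def m_def)
    then obtain s where s: "i - E s * bas u \<in> supp_in m (u - 1)"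
      by (rule supp_in_top) (use u l0 in \<open>simp add: m_def\<close>)
    define t' where "t' = shift_poly (- of_int (u - n)) t"
    have t': "t' \<noteq> 0" "degree t' = degree t" using j(3) by (auto simp: t'_def)
    have "bas (u - n) * (E t * bas n) = E t' * bas u"
      using u j(2) by (simp add: mult.assoc[symmetric] bas_E t'_def)
         (simp add: mult.assoc bas_add_nonneg)
    then have "bas (u - n) * j - E t' * bas u = bas (u - n) * (j - E t * bas n)"
      by (simp add: right_diff_distrib)
    then have bj: "bas (u - n) * j - E t' * bas u \<in> supp_in (l0 + (u - n)) (u - 1)"
      using bas_supp_in[OF j(4), of "u - n"] by (simp add: algebra_simps)
    have m_le: "m \<le> l0 + (u - n)" using u by (simp add: m_def)
    define i' where "i' = i - E (s div t') * (bas (u - n) * j)"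
    have i'I: "i' \<in> I"
      unfolding i'_def
      by (rule left_idealD(5)[OF I Suc.prems(1) left_idealD(4)[OF I alg_closed(5) left_idealD(4)[OF I alg_closed(6) j(1)]]])
    have "i' - E (s mod t') * bas u = (i - E s * bas u) - E (s div t') * (bas (u - n) * j - E t' * bas u)"
    proof -
      have "E s = E (s div t') * E t' + E (s mod t')" by (simp add: E_mult[symmetric] E_add[symmetric])
      then show ?thesis by (simp add: i'_def right_diff_distrib distrib_right mult.assoc)
    qed
    moreover have "E (s div t') * (bas (u - n) * j - E t' * bas u) \<in> supp_in m (u - 1)"
      using supp_in_closed(4)[OF bj] supp_in_mono[OF m_le, of "u - 1" "u - 1"] by auto
    ultimately have i': "i' - E (s mod t') * bas u \<in> supp_in m (u - 1)" using supp_in_closed(3)[OF s] by simp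
    have "s mod t' = 0"
    proof (rule ccontr)
      assume ne: "s mod t' \<noteq> 0"
      then have "T (i', u, m, s mod t')" using i'I i' u j(2) by (simp add: T_def)
      then have "degree t \<le> degree (s mod t')" by (rule min)
      then show False using degree_mod_less[OF t'(1), of s] ne t'(2) by simp
    qed
    then have "i' \<in> supp_in m (n + int k)" using i' u(2) by (simp add: E_zero)
    then obtain q where q: "q \<in> alg" "i' - q * j \<in> supp_in (min m l0) n" using Suc.IH[OF i'I] by blast
    have "i' - q * j \<in> supp_in (min l l0) n" using q(2) by (simp add: m_def min.assoc)
    moreover have "i' - q * j = i - (E (s div t') * bas (u - n) + q) * j"
      by (simp add: i'_def distrib_right mult.assoc diff_diff_eq)
    moreover have "E (s div t') * bas (u - n) + q \<in> alg" using q(1) alg_closed by auto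
    ultimately show ?case by metis
  qed
  have "\<exists>q\<in>alg. i - q * j \<in> supp_in (min l l0) n" if "i \<in> I" "i \<in> supp_in l u" for i l u
  proof -
    have "i \<in> supp_in l (n + int (nat (u - n)))"
      using that(2) supp_in_mono[of l l u "n + int (nat (u - n))"] by auto
    then show ?thesis using red[OF that(1)] by blast
  qed
  then show ?thesis using j(1) by blast
qed

lemma bounded_below:
  assumes I: "left_ideal I" and nz: "i0 \<in> I" "i0 \<noteq> 0"
  shows "\<exists>j\<in>I. \<exists>n u0. \<forall>i\<in>I. \<forall>l u. i \<in> supp_in l u \<longrightarrow> (\<exists>q\<in>alg. i - q * j \<in> supp_in n (max u u0))"
proof -
  interpret S: gwa_model "\<lambda>p. E (pcompose p [:0, -1:])" Y X "pcompose a [:-1, -1:]" by (rule swap_model)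
  have "S.left_ideal I" using I by (simp add: S.left_ideal_def left_ideal_def swap_alg)
  from S.bounded_above[OF this nz] obtain j n l0 where j: "j \<in> I"
    "\<And>i l u. i \<in> I \<Longrightarrow> i \<in> S.supp_in l u \<Longrightarrow> \<exists>q\<in>alg. i - q * j \<in> S.supp_in (min l l0) n"
    unfolding swap_alg by blast
  have "\<exists>q\<in>alg. i - q * j \<in> supp_in (- n) (max u (- l0))" if "i \<in> I" "i \<in> supp_in l u" for i l u
  proof -
    have "i \<in> S.supp_in (- u) (- l)" using that(2) by (simp add: swap_supp_in)
    from j(2)[OF that(1) this] show ?thesis by (simp add: swap_supp_in minus_min_eq_max)
  qed
  then show ?thesis using j(1) by blast
qed

text \<open>Subtracting multiples of one element cuts off the large positive degrees and of another one the large
  negative degrees, so the elements of some bounded support generate the ideal.\<close>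

lemma bounded_generation:
  assumes I: "left_ideal I"
  obtains N where "\<And>J. left_ideal J \<Longrightarrow> (\<And>v. v \<in> I \<Longrightarrow> v \<in> supp_in (- N) N \<Longrightarrow> v \<in> J) \<Longrightarrow> I \<subseteq> J"
proof (cases "\<exists>i0\<in>I. i0 \<noteq> 0")
  case False
  then have "I \<subseteq> J" if "left_ideal J" for J using left_idealD(2)[OF that] by auto
  then show thesis using that[of 0] by blast
next
  case True
  then obtain i0 where i0: "i0 \<in> I" "i0 \<noteq> 0" by blast
  obtain j n l0 where j: "j \<in> I"
    "\<And>i l u. i \<in> I \<Longrightarrow> i \<in> supp_in l u \<Longrightarrow> \<exists>q\<in>alg. i - q * j \<in> supp_in (min l l0) n"
    using bounded_above[OF I i0] by blast
  obtain j' n' u0 where j': "j' \<in> I"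
    "\<And>i l u. i \<in> I \<Longrightarrow> i \<in> supp_in l u \<Longrightarrow> \<exists>q\<in>alg. i - q * j' \<in> supp_in n' (max u u0)"
    using bounded_below[OF I i0] by blast
  obtain l1 u1 where s1: "j \<in> supp_in l1 u1" using left_idealD(1)[OF I j(1)] by (auto simp: alg_def)
  obtain l2 u2 where s2: "j' \<in> supp_in l2 u2" using left_idealD(1)[OF I j'(1)] by (auto simp: alg_def)
  define N where "N = Max {n, u0, - n', - l1, u1, - l2, u2}"
  have NN: "n \<le> N" "u0 \<le> N" "- n' \<le> N" "- l1 \<le> N" "u1 \<le> N" "- l2 \<le> N" "u2 \<le> N"
    unfolding N_def by (rule Max_ge; simp)+
  have N: "j \<in> supp_in (- N) N" "j' \<in> supp_in (- N) N"
    by (rule subsetD[OF supp_in_mono, OF _ _ s1] subsetD[OF supp_in_mono, OF _ _ s2]; use NN in linarith)+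
  have "I \<subseteq> J" if J: "left_ideal J" and sub: "\<And>v. v \<in> I \<Longrightarrow> v \<in> supp_in (- N) N \<Longrightarrow> v \<in> J" for J
  proof
    fix i assume i: "i \<in> I"
    then have "i \<in> alg" by (rule left_idealD(1)[OF I])
    then obtain l u where "i \<in> supp_in l u" by (auto simp: alg_def)
    then obtain q where q: "q \<in> alg" "i - q * j \<in> supp_in (min l l0) n" using j(2)[OF i] by blast
    have i1: "i - q * j \<in> I" using left_idealD(5)[OF I i left_idealD(4)[OF I q(1) j(1)]] .
    then obtain q' where q': "q' \<in> alg" "i - q * j - q' * j' \<in> supp_in n' (max n u0)" using j'(2) q(2) by blast
    have i2: "i - q * j - q' * j' \<in> I" using left_idealD(5)[OF I i1 left_idealD(4)[OF I q'(1) j'(1)]] .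
    have "i - q * j - q' * j' \<in> supp_in (- N) N"
      by (rule subsetD[OF supp_in_mono, OF _ _ q'(2)]) (use NN in linarith)+
    then have "i - q * j - q' * j' \<in> J" "j \<in> J" "j' \<in> J" using sub i2 j(1) j'(1) N by auto
    then have "(i - q * j - q' * j') + (q * j + q' * j') \<in> J"
      by (intro left_idealD(3)[OF J] left_idealD(4)[OF J] q(1) q'(1))
    then show "i \<in> J" by simp
  qed
  then show thesis using that[of N] by blast
qed

text \<open>The Ore condition for polynomials with one \<open>c\<close> for all elements of bounded support: moving \<open>c\<close> past
  degree \<open>n\<close> shifts it by \<open>n\<close>, so the product of finitely many shifts of \<open>f\<close> works.\<close>

lemma ore_polynomial:
  assumes "f \<noteq> 0"
  obtains c where "c \<noteq> 0" "\<forall>r\<in>supp_in l u. \<exists>s\<in>supp_in l u. r * E c = E f * s"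
proof -
  define c where "c = (\<Prod>n=l..u. shift_poly (of_int n) f)"
  have "\<exists>s\<in>supp_in l u. r * E c = E f * s" if r: "r \<in> supp_in l u" for r
  proof -
    obtain p where p: "r = comb l u p" using r by (auto simp: supp_in_def)
    have "f dvd shift_poly (- of_int n) c" if n: "n \<in> {l..u}" for n
    proof -
      have "shift_poly (of_int n) f dvd c" unfolding c_def using n by (intro dvd_prodI) auto
      then obtain g where "c = shift_poly (of_int n) f * g" by (auto elim!: dvdE)
      then show ?thesis by simp
    qed
    then have "\<forall>n\<in>{l..u}. \<exists>g. shift_poly (- of_int n) c = f * g" unfolding dvd_def by blast
    then obtain g where g: "\<And>n. n \<in> {l..u} \<Longrightarrow> shift_poly (- of_int n) c = f * g n" by metis
    have "r * E c = comb l u (\<lambda>n. f * (p n * g n))"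
      unfolding p comb_E by (rule comb_cong) (simp add: g mult.left_commute)
    then have "r * E c = E f * comb l u (\<lambda>n. p n * g n)" by (simp add: E_comb)
    then show ?thesis using supp_inI by blast
  qed
  moreover have "c \<noteq> 0" using assms by (simp add: c_def)
  ultimately show thesis using that by blast
qed

text \<open>Division by \<open>i\<^sub>0\<close> removes the top coefficient in every step, after multiplication with a polynomial
  denominator.  Because \<open>i\<^sub>0\<close> has minimal width, the support does not grow at the lower end, so the
  division leaves no remainder.\<close>

lemma pseudo_division:
  assumes I: "left_ideal I" and i0: "i0 \<in> I" "i0 = comb l0 u0 p0" "l0 \<le> u0" "p0 u0 \<noteq> 0"
    and min: "\<And>i l u. i \<in> I \<Longrightarrow> i \<noteq> 0 \<Longrightarrow> i \<in> supp_in l u \<Longrightarrow> u0 - l0 \<le> u - l"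
  shows "\<exists>f K. f \<noteq> 0 \<and> (\<forall>i\<in>I. i \<in> supp_in L (L + int k - 1) \<longrightarrow> (\<exists>r\<in>supp_in (- K) K. E f * i = r * i0))"
proof (induction k)
  case 0
  show ?case by (intro exI[of _ 1] exI[of _ 0]) (auto simp: supp_in_empty intro: bexI[of _ 0] supp_in_closed)
next
  case (Suc k)
  then obtain f K where f: "f \<noteq> 0"
    "\<And>i. i \<in> I \<Longrightarrow> i \<in> supp_in L (L + int k - 1) \<Longrightarrow> \<exists>r\<in>supp_in (- K) K. E f * i = r * i0" by blast
  define n where "n = L + int k"
  define m where "m = n - u0"
  have top0: "i0 - E (p0 u0) * bas u0 \<in> supp_in l0 (u0 - 1)" using comb_top_split i0 by blast
  obtain g where g: "g \<noteq> 0"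
    "bas m * i0 - E (shift_poly (- of_int m) (p0 u0) * g) * bas (m + u0) \<in> supp_in (l0 + m) (u0 + m - 1)"
    using bas_top_mult[OF top0] by blast
  define t where "t = shift_poly (- of_int m) (p0 u0) * g"
  have t: "t \<noteq> 0" using g(1) i0(4) by (simp add: t_def)
  have bt: "bas m * i0 - E t * bas n \<in> supp_in (l0 + m) (n - 1)"
    using g(2) by (simp add: t_def m_def add.commute)
  have "\<exists>r\<in>supp_in (- (max \<bar>K\<bar> \<bar>m\<bar>)) (max \<bar>K\<bar> \<bar>m\<bar>). E (f * t) * i = r * i0"
    if i: "i \<in> I" "i \<in> supp_in L n" for i
  proof -
    have "L \<le> n" by (simp add: n_def)
    then obtain s where s: "i - E s * bas n \<in> supp_in L (n - 1)" using supp_in_top i(2) by blast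
    define i' where "i' = E t * i - E s * (bas m * i0)"
    have i'I: "i' \<in> I"
      unfolding i'_def
      by (rule left_idealD(5)[OF I left_idealD(4)[OF I alg_closed(5) i(1)]
            left_idealD(4)[OF I alg_closed(5) left_idealD(4)[OF I alg_closed(6) i0(1)]]])
    have "i' \<in> supp_in L (n - 1)"
    proof (cases "s = 0")
      case True
      then show ?thesis using supp_in_closed(4)[OF s, of t] by (simp add: i'_def E_zero)
    next
      case False
      have "i \<noteq> 0"
      proof
        assume "i = 0"
        then have "E (- s) * bas n \<in> supp_in L (n - 1)" using s by (simp add: E_minus)
        from top_coeff_unique[OF this, of s] show False using False by (simp add: E_minus)
      qed
      then have "u0 - l0 \<le> n - L" using min i by blast
      then have "L \<le> l0 + m" by (simp add: m_def)
      then have b: "bas m * i0 - E t * bas n \<in> supp_in L (n - 1)"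
        using bt supp_in_mono[of L "l0 + m" "n - 1" "n - 1"] by auto
      have "i' = E t * (i - E s * bas n) - E s * (bas m * i0 - E t * bas n)"
        by (simp add: i'_def right_diff_distrib mult.assoc[symmetric] E_commute[of t s])
      then show ?thesis using supp_in_closed(3)[OF supp_in_closed(4)[OF s] supp_in_closed(4)[OF b]] by simp
    qed
    then obtain r where r: "r \<in> supp_in (- K) K" "E f * i' = r * i0"
      using f(2)[OF i'I] by (auto simp: n_def)
    have "E (f * t) * i = E f * i' + E f * (E s * (bas m * i0))"
      by (simp add: i'_def right_diff_distrib E_mult mult.assoc)
    also have "\<dots> = (r + E (f * s) * bas m) * i0"
      by (simp add: r(2) distrib_right E_mult mult.assoc)
    finally have "E (f * t) * i = (r + E (f * s) * bas m) * i0" .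
    moreover have "r \<in> supp_in (- (max \<bar>K\<bar> \<bar>m\<bar>)) (max \<bar>K\<bar> \<bar>m\<bar>)"
      by (rule subsetD[OF supp_in_mono, OF _ _ r(1)]) arith+
    moreover have "E (f * s) * bas m \<in> supp_in (- (max \<bar>K\<bar> \<bar>m\<bar>)) (max \<bar>K\<bar> \<bar>m\<bar>)"
      by (rule supp_in_bas) auto
    ultimately show ?thesis using supp_in_closed(2) by blast
  qed
  then show ?case using f(1) t
    by (intro exI[of _ "f * t"] exI[of _ "max \<bar>K\<bar> \<bar>m\<bar>"]) (auto simp: n_def)
qed

lemma left_ideal_minimal_width:
  assumes I: "left_ideal I" and nz: "i \<in> I" "i \<noteq> 0"
  obtains i0 l0 u0 p0 where "i0 \<in> I" "i0 \<noteq> 0" "i0 = comb l0 u0 p0" "l0 \<le> u0" "p0 u0 \<noteq> 0"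
    "\<And>i l u. i \<in> I \<Longrightarrow> i \<noteq> 0 \<Longrightarrow> i \<in> supp_in l u \<Longrightarrow> u0 - l0 \<le> u - l"
proof -
  define T where "T = (\<lambda>(i, l, u). i \<in> I \<and> i \<noteq> 0 \<and> i \<in> supp_in l u)"
  have "\<exists>x. T x" using nz left_idealD(1)[OF I nz(1)] unfolding T_def alg_def by blast
  then obtain x where x: "T x" "\<And>y. T y \<Longrightarrow> nat (snd (snd x) - fst (snd x)) \<le> nat (snd (snd y) - fst (snd y))"
    using ex_has_least_nat[of T _ "\<lambda>x. nat (snd (snd x) - fst (snd x))"] by blast
  obtain i0 l u where xx: "x = (i0, l, u)" by (cases x)
  have i0: "i0 \<in> I" "i0 \<noteq> 0" "i0 \<in> supp_in l u" using x(1) by (auto simp: xx T_def)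
  obtain l0 u0 p0 where p: "l \<le> l0" "l0 \<le> u0" "u0 \<le> u" "i0 = comb l0 u0 p0" "p0 u0 \<noteq> 0"
    using exact_support[OF i0(3,2)] by metis
  have "u0 - l0 \<le> u' - l'" if "i' \<in> I" "i' \<noteq> 0" "i' \<in> supp_in l' u'" for i' l' u'
  proof -
    have "l' \<le> u'" using that supp_in_empty[of u' l'] by force
    moreover have "nat (u - l) \<le> nat (u' - l')" using x(2)[of "(i', l', u')"] that by (simp add: T_def xx)
    ultimately show ?thesis using p by linarith
  qed
  then show thesis using that[of i0 l0 u0 p0] i0 p by blast
qed

text \<open>Every nonzero left ideal \<open>I\<close> is isomorphic to one containing a nonzero polynomial \<open>c\<close>, namely
  \<open>I i\<^sub>0\<^sup>-\<^sup>1 c\<close> with \<open>i\<^sub>0\<close> of minimal width; the right fraction \<open>i\<^sub>0\<^sup>-\<^sup>1 c\<close> is written as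
  \<open>w v\<^sup>-\<^sup>1\<close> with \<open>i\<^sub>0 w = c v\<close>.\<close>

theorem left_ideal_dual_basis:
  assumes simple: "simple_roots a" and gap: "integral_gap_free a" and I: "left_ideal I"
  shows "\<exists>L. dual_basis I L"
proof (cases "\<exists>i\<in>I. i \<noteq> 0")
  case False
  then have "dual_basis I []" by (auto simp: dual_basis_def)
  then show ?thesis by blast
next
  case True
  then obtain i0 l0 u0 p0 where i0: "i0 \<in> I" "i0 \<noteq> 0" "i0 = comb l0 u0 p0" "l0 \<le> u0" "p0 u0 \<noteq> 0"
    and min: "\<And>i l u. i \<in> I \<Longrightarrow> i \<noteq> 0 \<Longrightarrow> i \<in> supp_in l u \<Longrightarrow> u0 - l0 \<le> u - l"
    using left_ideal_minimal_width[OF I] by metis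
  obtain N where N: "\<And>J. left_ideal J \<Longrightarrow> (\<And>v. v \<in> I \<Longrightarrow> v \<in> supp_in (- N) N \<Longrightarrow> v \<in> J) \<Longrightarrow> I \<subseteq> J"
    using bounded_generation[OF I] by blast
  obtain f K where f: "f \<noteq> 0"
    "\<And>i. i \<in> I \<Longrightarrow> i \<in> supp_in (- N) (- N + int (nat (2 * N + 1)) - 1) \<Longrightarrow> \<exists>r\<in>supp_in (- K) K. E f * i = r * i0"
  proof -
    have "\<exists>f K. f \<noteq> 0 \<and> (\<forall>i\<in>I. i \<in> supp_in (- N) (- N + int (nat (2 * N + 1)) - 1) \<longrightarrow>
        (\<exists>r\<in>supp_in (- K) K. E f * i = r * i0))"
      by (rule pseudo_division[OF I i0(1,3-5)]) (rule min)
    then obtain f K where "f \<noteq> 0 \<and> (\<forall>i\<in>I. i \<in> supp_in (- N) (- N + int (nat (2 * N + 1)) - 1) \<longrightarrow>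
        (\<exists>r\<in>supp_in (- K) K. E f * i = r * i0))" by (elim exE)
    then show thesis by (intro that[of f K]) simp_all
  qed
  have fN: "\<exists>r\<in>supp_in (- K) K. E f * i = r * i0" if "i \<in> I" "i \<in> supp_in (- N) N" for i
  proof -
    have "i \<in> supp_in (- N) (- N + int (nat (2 * N + 1)) - 1)"
      using that(2) supp_in_mono[of "- N" "- N" N "- N + int (nat (2 * N + 1)) - 1"] by auto
    then show ?thesis using f(2) that(1) by blast
  qed
  obtain c where c: "c \<noteq> 0" "\<forall>r\<in>supp_in (- K) K. \<exists>s\<in>supp_in (- K) K. r * E c = E f * s"
    by (rule ore_polynomial[OF f(1), of "- K" K])
  obtain w where w: "w \<noteq> 0" "\<forall>r\<in>supp_in l0 u0. \<exists>s\<in>supp_in l0 u0. r * E w = E c * s"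
    by (rule ore_polynomial[OF c(1), of l0 u0])
  have i0s: "i0 \<in> supp_in l0 u0" by (simp add: i0(3) supp_inI)
  obtain v where v: "v \<in> supp_in l0 u0" "i0 * E w = E c * v" using bspec[OF w(2) i0s] by blast
  have va: "v \<in> alg" using v(1) supp_in_alg by blast
  have v0: "v \<noteq> 0"
    using v(2) alg_domain[OF left_idealD(1)[OF I i0(1)] alg_closed(5) i0(2) E_nonzero[OF w(1)]] by auto
  define D where "D = {i \<in> alg. \<exists>s\<in>alg. s * v = i * E w}"
  have D: "left_ideal D"
    unfolding left_ideal_def D_def
  proof (intro conjI ballI)
    show "0 \<in> {i \<in> alg. \<exists>s\<in>alg. s * v = i * E w}" using alg_closed(1) by force
  next
    fix r s assume "r \<in> {i \<in> alg. \<exists>s\<in>alg. s * v = i * E w}" "s \<in> {i \<in> alg. \<exists>s\<in>alg. s * v = i * E w}"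
    then obtain r' s' where rs: "r \<in> alg" "s \<in> alg" "r' \<in> alg" "s' \<in> alg" "r' * v = r * E w" "s' * v = s * E w"
      by blast
    then have "(r' + s') * v = (r + s) * E w" by (simp add: distrib_right)
    then show "r + s \<in> {i \<in> alg. \<exists>s\<in>alg. s * v = i * E w}" using rs alg_closed(3) by blast
  next
    fix r s assume r: "r \<in> alg" and "s \<in> {i \<in> alg. \<exists>s\<in>alg. s * v = i * E w}"
    then obtain s' where rs: "s \<in> alg" "s' \<in> alg" "s' * v = s * E w" by blast
    then have "(r * s') * v = (r * s) * E w" by (simp add: mult.assoc)
    then show "r * s \<in> {i \<in> alg. \<exists>s\<in>alg. s * v = i * E w}" using r rs alg_closed(4) by blast
  qed blast
  have "I \<subseteq> D"
  proof (rule N[OF D])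
    fix i assume i: "i \<in> I" "i \<in> supp_in (- N) N"
    obtain r where r: "r \<in> supp_in (- K) K" "E f * i = r * i0" using fN[OF i] by (elim bexE)
    obtain s where s: "s \<in> supp_in (- K) K" "r * E c = E f * s" using bspec[OF c(2) r(1)] by blast
    have sa: "s \<in> alg" using s(1) supp_in_alg by blast
    have ia: "i \<in> alg" using left_idealD(1)[OF I i(1)] .
    have "E f * (i * E w) = r * (i0 * E w)" using r(2) by (simp add: mult.assoc[symmetric])
    also have "\<dots> = (r * E c) * v" by (simp only: v(2) mult.assoc)
    also have "\<dots> = E f * (s * v)" by (simp only: s(2) mult.assoc)
    finally have "i * E w = s * v"
      by (rule alg_cancel_left[OF alg_closed(4)[OF ia alg_closed(5)] alg_closed(4)[OF sa va]
            alg_closed(5) E_nonzero[OF f(1)]])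
    then show "i \<in> D" using ia sa by (auto simp: D_def)
  qed
  then have ex: "\<exists>s\<in>alg. s * v = r * E w" if "r \<in> I" for r using that by (auto simp: D_def)
  obtain \<psi> where \<psi>: "\<And>r. r \<in> I \<Longrightarrow> \<psi> r \<in> alg" "\<And>r. r \<in> I \<Longrightarrow> \<psi> r * v = r * E w"
    "\<And>r s. r \<in> I \<Longrightarrow> s \<in> I \<Longrightarrow> \<psi> (r + s) = \<psi> r + \<psi> s"
    "\<And>t r. t \<in> alg \<Longrightarrow> r \<in> I \<Longrightarrow> \<psi> (t * r) = t * \<psi> r"
    using right_fraction[OF I alg_closed(5) va v0 ex] by metis
  have \<psi>_inj: "r = s" if "r \<in> I" "s \<in> I" "\<psi> r = \<psi> s" for r s
    by (rule alg_cancel_right[OF _ _ alg_closed(5) E_nonzero[OF w(1)]])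
       (use that \<psi>(2)[of r] \<psi>(2)[of s] left_idealD(1)[OF I] in auto)
  have \<psi>0: "\<psi> 0 = 0" using \<psi>(3)[OF left_idealD(2)[OF I] left_idealD(2)[OF I]] by simp
  define I' where "I' = \<psi> ` I"
  have I': "left_ideal I'"
    unfolding left_ideal_def I'_def
  proof (intro conjI ballI)
    show "\<psi> ` I \<subseteq> alg" using \<psi>(1) by blast
    show "0 \<in> \<psi> ` I" using \<psi>0 left_idealD(2)[OF I] by (metis imageI)
    fix r s assume "s \<in> \<psi> ` I"
    then obtain s' where s': "s' \<in> I" "s = \<psi> s'" by blast
    show "r + s \<in> \<psi> ` I" if r: "r \<in> \<psi> ` I"
    proof -
      obtain r' where r': "r' \<in> I" "r = \<psi> r'" using r by blast
      then have "\<psi> (r' + s') = r + s" using \<psi>(3) s' by simp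
      then show ?thesis using left_idealD(3)[OF I r'(1) s'(1)] by (metis imageI)
    qed
    show "r * s \<in> \<psi> ` I" if r: "r \<in> alg"
      using \<psi>(4)[OF r s'(1)] left_idealD(4)[OF I r s'(1)] s'(2) by (metis imageI)
  qed
  have "\<psi> i0 = E c"
    by (rule alg_cancel_right[OF \<psi>(1)[OF i0(1)] alg_closed(5) va v0]) (simp add: \<psi>(2)[OF i0(1)] v(2))
  then have "E c \<in> I'" using i0(1) unfolding I'_def by (metis imageI)
  then obtain L where L: "dual_basis I' L"
    using polynomial_left_ideal_dual_basis[OF simple gap I' _ c(1)] by blast
  define \<theta> where "\<theta> = inv_into I \<psi>"
  have \<theta>: "\<theta> e \<in> I \<and> \<psi> (\<theta> e) = e" if "e \<in> I'" for e
    using that by (simp add: \<theta>_def I'_def inv_into_into f_inv_into_f)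
  let ?L = "map (\<lambda>(\<phi>, e). (\<lambda>r. \<phi> (\<psi> r), \<theta> e)) L"
  have \<psi>I': "\<psi> r \<in> I'" if "r \<in> I" for r using that by (simp add: I'_def)
  have "dual_basis I ?L"
    unfolding dual_basis_def
  proof (intro conjI ballI)
    fix x assume "x \<in> set ?L"
    then obtain \<phi> e where x: "(\<phi>, e) \<in> set L" "x = (\<lambda>r. \<phi> (\<psi> r), \<theta> e)" by auto
    show "case x of (\<phi>, e) \<Rightarrow> e \<in> I \<and> (\<forall>r\<in>I. \<phi> r \<in> alg) \<and> (\<forall>r\<in>I. \<forall>s\<in>I. \<phi> (r + s) = \<phi> r + \<phi> s) \<and>
        (\<forall>t\<in>alg. \<forall>r\<in>I. \<phi> (t * r) = t * \<phi> r)"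
      using dual_basisD(1-4)[OF L x(1)] x(2) \<theta> \<psi>(3,4) \<psi>I' by simp
  next
    fix r assume r: "r \<in> I"
    have "set M \<subseteq> set L \<Longrightarrow> (\<Sum>(\<phi>, e)\<leftarrow>map (\<lambda>(\<phi>, e). (\<lambda>r. \<phi> (\<psi> r), \<theta> e)) M. \<phi> r * e) \<in> I \<and>
        \<psi> (\<Sum>(\<phi>, e)\<leftarrow>map (\<lambda>(\<phi>, e). (\<lambda>r. \<phi> (\<psi> r), \<theta> e)) M. \<phi> r * e) = (\<Sum>(\<phi>, e)\<leftarrow>M. \<phi> (\<psi> r) * e)" for M
    proof (induction M)
      case Nil
      then show ?case using \<psi>0 left_idealD(2)[OF I] by simp
    next
      case (Cons x M)
      obtain \<phi> e where x: "x = (\<phi>, e)" by (cases x)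
      then have xs: "(\<phi>, e) \<in> set L" using Cons.prems by simp
      have e: "\<theta> e \<in> I" "\<psi> (\<theta> e) = e" using \<theta> dual_basisD(1)[OF L xs] by auto
      have p: "\<phi> (\<psi> r) \<in> alg" using dual_basisD(2)[OF L xs \<psi>I'[OF r]] .
      show ?case using Cons e \<psi>(3) \<psi>(4)[OF p e(1)] left_idealD(3)[OF I] left_idealD(4)[OF I p e(1)]
        by (simp add: x)
    qed
    from this[of L] show "(\<Sum>(\<phi>, e)\<leftarrow>?L. \<phi> r * e) = r"
      using \<psi>_inj[OF _ r] dual_basisD(5)[OF L \<psi>I'[OF r]] by simp
  qed
  then show ?thesis by blast
qed

end

section \<open>Homomorphisms between modules in different universes\<close>

text \<open>Test modules are most naturally built on a type of their own, whereas the projective module is given in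
  the universe; these are the homomorphisms between modules on different types.\<close>

definition raw_hom :: "(complex, 'a) module \<Rightarrow> ('a, 'u) module \<Rightarrow> ('a, 'v) module \<Rightarrow> ('u \<Rightarrow> 'v) \<Rightarrow> bool" where
  "raw_hom A M N f \<longleftrightarrow> (\<forall>m\<in>carrier M. f m \<in> carrier N) \<and>
     (\<forall>m\<in>carrier M. \<forall>n\<in>carrier M. f (m \<oplus>\<^bsub>M\<^esub> n) = f m \<oplus>\<^bsub>N\<^esub> f n) \<and>
     (\<forall>r\<in>carrier A. \<forall>m\<in>carrier M. f (r \<odot>\<^bsub>M\<^esub> m) = r \<odot>\<^bsub>N\<^esub> f m)"

lemma raw_homD:
  assumes "raw_hom A M N f"
  shows "m \<in> carrier M \<Longrightarrow> f m \<in> carrier N"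
    "m \<in> carrier M \<Longrightarrow> n \<in> carrier M \<Longrightarrow> f (m \<oplus>\<^bsub>M\<^esub> n) = f m \<oplus>\<^bsub>N\<^esub> f n"
    "r \<in> carrier A \<Longrightarrow> m \<in> carrier M \<Longrightarrow> f (r \<odot>\<^bsub>M\<^esub> m) = r \<odot>\<^bsub>N\<^esub> f m"
  using assms by (auto simp: raw_hom_def)

lemma lmod_hom_raw: "f \<in> lmod_hom A M N \<Longrightarrow> raw_hom A M N f"
  by (auto simp: raw_hom_def lmod_homD)

lemma raw_lmod_hom: "left_module A M \<Longrightarrow> raw_hom A M N f \<Longrightarrow> restrict f (carrier M) \<in> lmod_hom A M N"
  by (rule lmod_hom_restrictI) (auto simp: raw_homD)

lemma raw_hom_compose:
  "raw_hom A L M f \<Longrightarrow> raw_hom A M N g \<Longrightarrow> raw_hom A L N (\<lambda>x. g (f x))"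
  by (auto simp: raw_hom_def)

lemma image_module_raw:
  assumes "left_module A W" "inj_on e (carrier W)"
  shows "left_module A (image_module W e)" "raw_hom A W (image_module W e) e"
    "raw_hom A (image_module W e) W (inv_into (carrier W) e)"
    "m \<in> carrier (image_module W e) \<Longrightarrow> e (inv_into (carrier W) e m) = m"
    "w \<in> carrier W \<Longrightarrow> inv_into (carrier W) e (e w) = w"
proof -
  note im = image_module[OF assms(1) lmod_congruence_inj[OF assms(2)]]
  interpret W: abelian_group W by (rule left_moduleD(2)[OF assms(1)])
  show "left_module A (image_module W e)" by (rule im(1))
  show "raw_hom A W (image_module W e) e" by (simp add: raw_hom_def im)
  show i: "inv_into (carrier W) e (e w) = w" if "w \<in> carrier W" for w using that assms(2) by simp
  show "raw_hom A (image_module W e) W (inv_into (carrier W) e)"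
    unfolding raw_hom_def im(2) by (auto simp: i im(4,5) left_moduleD(3)[OF assms(1)])
  show "e (inv_into (carrier W) e m) = m" if "m \<in> carrier (image_module W e)"
    using that im(2) by (simp add: f_inv_into_f)
qed

lemma projective_raw_lift:
  fixes P :: "('a, 'u) module" and W :: "('a, 'v) module" and V :: "('a, 'v) module"
  assumes P: "lmod_projective A P" and W: "left_module A W" and V: "left_module A V"
    and e: "inj (e :: 'v \<Rightarrow> 'u)"
    and g: "raw_hom A W V g" "g ` carrier W = carrier V" and f: "raw_hom A P V f"
  obtains l where "raw_hom A P W l" "\<And>p. p \<in> carrier P \<Longrightarrow> g (l p) = f p"
proof -
  have eW: "inj_on e (carrier W)" and eV: "inj_on e (carrier V)" using e by (auto intro: inj_on_subset)
  note iW = image_module_raw[OF W eW] and iV = image_module_raw[OF V eV]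
  let ?W = "image_module W e" and ?V = "image_module V e"
  let ?dW = "inv_into (carrier W) e" and ?dV = "inv_into (carrier V) e"
  have Pm: "left_module A P" using P by (simp add: lmod_projective_def)
  let ?g = "restrict (\<lambda>x. e (g (?dW x))) (carrier ?W)"
  let ?f = "restrict (\<lambda>x. e (f x)) (carrier P)"
  have gh: "?g \<in> lmod_hom A ?W ?V"
    by (rule raw_lmod_hom[OF iW(1)]) (rule raw_hom_compose[OF raw_hom_compose[OF iW(3) g(1)] iV(2)])
  have fh: "?f \<in> lmod_hom A P ?V"
    by (rule raw_lmod_hom[OF Pm]) (rule raw_hom_compose[OF f iV(2)])
  have "?g ` carrier ?W = carrier ?V"
  proof (rule subset_antisym)
    show "?g ` carrier ?W \<subseteq> carrier ?V" using lmod_homD(1)[OF gh] by blast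
    show "carrier ?V \<subseteq> ?g ` carrier ?W"
    proof
      fix y assume "y \<in> carrier ?V"
      then obtain v where v: "v \<in> carrier V" "y = e v"
        using image_module(2)[OF V lmod_congruence_inj[OF eV]] by auto
      then obtain w where w: "w \<in> carrier W" "v = g w" using g(2) by blast
      have "e w \<in> carrier ?W" using raw_homD(1)[OF iW(2) w(1)] .
      moreover have "?g (e w) = y" using w v iW(5)[OF w(1)] raw_homD(1)[OF iW(2) w(1)] by simp
      ultimately show "y \<in> ?g ` carrier ?W" by (metis image_eqI)
    qed
  qed
  then have "lmod_epi A ?W ?V ?g" by (rule surj_imp_lmod_epi[OF gh])
  then obtain l where l: "l \<in> lmod_hom A P ?W" "compose (carrier P) ?g l = ?f"
    using P iW(1) iV(1) fh unfolding lmod_projective_def by blast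
  have "raw_hom A P W (\<lambda>x. ?dW (l x))" by (rule raw_hom_compose[OF lmod_hom_raw[OF l(1)] iW(3)])
  moreover have "g (?dW (l p)) = f p" if p: "p \<in> carrier P" for p
  proof -
    have "e (g (?dW (l p))) = e (f p)"
      using fun_cong[OF l(2), of p] p lmod_homD(1)[OF l(1) p] by (simp add: compose_def)
    then show ?thesis using e by (simp add: inj_eq)
  qed
  ultimately show thesis using that by blast
qed

lemma separator_raw_nonzero:
  fixes P :: "('a, 'u) module" and W :: "('a, 'v) module"
  assumes P: "lmod_separator A P" "left_module A P" and W: "left_module A W"
    and e: "inj (e :: 'v \<Rightarrow> 'u)" and w: "w \<in> carrier W" "w \<noteq> \<zero>\<^bsub>W\<^esub>"
  obtains p x where "raw_hom A P W p" "x \<in> carrier P" "p x \<noteq> \<zero>\<^bsub>W\<^esub>"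
proof -
  interpret W: abelian_group W by (rule left_moduleD(2)[OF W])
  have eW: "inj_on e (carrier W)" using e by (auto intro: inj_on_subset)
  note iW = image_module_raw[OF W eW]
  let ?W = "image_module W e"
  interpret I: abelian_group ?W by (rule left_moduleD(2)[OF iW(1)])
  let ?z = "restrict (\<lambda>_. \<zero>\<^bsub>?W\<^esub>) (carrier ?W)"
  have z: "?z \<in> lmod_hom A ?W ?W"
    by (rule lmod_hom_restrictI[OF iW(1)]) (auto simp: left_module_smult_zero[OF iW(1)])
  have zero: "\<zero>\<^bsub>?W\<^esub> = e \<zero>\<^bsub>W\<^esub>" using image_module(3)[OF W lmod_congruence_inj[OF eW]] .
  have "e w \<noteq> e \<zero>\<^bsub>W\<^esub>" using w e by (simp add: inj_eq)
  then have "lmod_id ?W \<noteq> ?z"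
    using raw_homD(1)[OF iW(2) w(1)] zero by (auto simp: lmod_id_def fun_eq_iff intro!: exI[of _ "e w"])
  then obtain p where p: "p \<in> lmod_hom A P ?W" "compose (carrier P) (lmod_id ?W) p \<noteq> compose (carrier P) ?z p"
    using P(1) iW(1) lmod_id_hom[OF iW(1)] z unfolding lmod_separator_def by blast
  then have "p \<noteq> compose (carrier P) ?z p" using lmod_id_left[OF p(1)] by simp
  then obtain x where x: "x \<in> carrier P" "p x \<noteq> \<zero>\<^bsub>?W\<^esub>"
    using lmod_homD(1,4)[OF p(1)] by (auto simp: fun_eq_iff compose_def extensional_def split: if_splits)
  have "inv_into (carrier W) e (p x) \<noteq> \<zero>\<^bsub>W\<^esub>"
    using x(2) iW(4)[OF lmod_homD(1)[OF p(1) x(1)]] zero by metis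
  then show thesis
    using that[OF raw_hom_compose[OF lmod_hom_raw[OF p(1)] iW(3)] x(1)] by blast
qed

section \<open>Heredity for simple roots\<close>

definition lsum :: "('a, 'u) module \<Rightarrow> ('x \<Rightarrow> 'u) \<Rightarrow> 'x list \<Rightarrow> 'u" where
  "lsum M F L = foldr (\<lambda>x s. F x \<oplus>\<^bsub>M\<^esub> s) L \<zero>\<^bsub>M\<^esub>"

lemma lsum_simps [simp]: "lsum M F [] = \<zero>\<^bsub>M\<^esub>" "lsum M F (x # L) = F x \<oplus>\<^bsub>M\<^esub> lsum M F L"
  by (simp_all add: lsum_def)

lemma lsum_closed:
  assumes "left_module A M" "\<And>x. x \<in> set L \<Longrightarrow> F x \<in> carrier M"
  shows "lsum M F L \<in> carrier M"
proof -
  interpret M: abelian_group M by (rule left_moduleD(2)[OF assms(1)])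
  show ?thesis using assms(2) by (induction L) auto
qed

lemma lsum_cong: "(\<And>x. x \<in> set L \<Longrightarrow> F x = G x) \<Longrightarrow> lsum M F L = lsum M G L"
  by (induction L) auto

lemma lsum_add:
  assumes "left_module A M" "\<And>x. x \<in> set L \<Longrightarrow> F x \<in> carrier M" "\<And>x. x \<in> set L \<Longrightarrow> G x \<in> carrier M"
  shows "lsum M (\<lambda>x. F x \<oplus>\<^bsub>M\<^esub> G x) L = lsum M F L \<oplus>\<^bsub>M\<^esub> lsum M G L"
proof -
  interpret M: abelian_group M by (rule left_moduleD(2)[OF assms(1)])
  show ?thesis using assms(2,3)
  proof (induction L)
    case (Cons x L)
    have "lsum M F L \<in> carrier M" "lsum M G L \<in> carrier M"
      using Cons.prems by (auto intro: lsum_closed[OF assms(1)])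
    then show ?case using Cons by (simp add: M.a_ac)
  qed simp
qed

lemma lsum_smult:
  assumes "left_module A M" "\<And>x. x \<in> set L \<Longrightarrow> F x \<in> carrier M" "r \<in> carrier A"
  shows "r \<odot>\<^bsub>M\<^esub> lsum M F L = lsum M (\<lambda>x. r \<odot>\<^bsub>M\<^esub> F x) L"
  using assms(2)
proof (induction L)
  case Nil
  then show ?case using left_module_smult_zero[OF assms(1,3)] by simp
next
  case (Cons x L)
  have "lsum M F L \<in> carrier M" using Cons.prems by (auto intro: lsum_closed[OF assms(1)])
  then show ?case using Cons left_moduleD(5)[OF assms(1,3)] by simp
qed

lemma lsum_hom:
  assumes "left_module A M" "left_module A N" "g \<in> lmod_hom A M N" "\<And>x. x \<in> set L \<Longrightarrow> F x \<in> carrier M"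
  shows "g (lsum M F L) = lsum N (\<lambda>x. g (F x)) L"
  using assms(4)
proof (induction L)
  case Nil
  then show ?case using lmod_hom_zero[OF assms(3,1,2)] by simp
next
  case (Cons x L)
  have "lsum M F L \<in> carrier M" using Cons.prems by (auto intro: lsum_closed[OF assms(1)])
  then show ?case using Cons lmod_homD(2)[OF assms(3)] by simp
qed

context gwa_model
begin

text \<open>The inverse of \<open>rho\<close> on its image.\<close>

definition sec :: "'r \<Rightarrow> free_alg set" where
  "sec r = inv_into (carrier (gwa a)) rho r"

lemma sec: "r \<in> alg \<Longrightarrow> sec r \<in> carrier (gwa a)" "r \<in> alg \<Longrightarrow> rho (sec r) = r"
  unfolding sec_def rho_image[symmetric] by (auto simp: inv_into_into f_inv_into_f simp del: gwa_simps)

lemma sec_rho: "u \<in> carrier (gwa a) \<Longrightarrow> sec (rho u) = u"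
  unfolding sec_def using rho_inj by simp

lemma sec_add: "r \<in> alg \<Longrightarrow> s \<in> alg \<Longrightarrow> sec (r + s) = sec r \<oplus>\<^bsub>gwa a\<^esub> sec s"
proof -
  interpret G: ring "gwa a" by (rule ring_gwa)
  assume "r \<in> alg" "s \<in> alg"
  then show ?thesis using sec rho_hom(1) sec_rho[OF G.a_closed[OF sec(1) sec(1)]] by metis
qed

lemma sec_mult: "r \<in> alg \<Longrightarrow> s \<in> alg \<Longrightarrow> sec (r * s) = sec r \<otimes>\<^bsub>gwa a\<^esub> sec s"
proof -
  interpret G: ring "gwa a" by (rule ring_gwa)
  assume "r \<in> alg" "s \<in> alg"
  then show ?thesis using sec rho_hom(2) sec_rho[OF G.m_closed[OF sec(1) sec(1)]] by metis
qed

lemma sec_one: "sec 1 = \<one>\<^bsub>gwa a\<^esub>"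
proof -
  interpret G: ring "gwa a" by (rule ring_gwa)
  show ?thesis using sec_rho[OF G.one_closed] by (simp add: rho_hom(3) del: gwa_simps)
qed

definition regular_module :: "(free_alg set, 'r) module" where
  "regular_module = \<lparr>carrier = alg, mult = undefined, one = undefined, zero = 0, add = (+),
     smult = (\<lambda>u r. rho u * r)\<rparr>"

lemma regular_simps:
  "carrier regular_module = alg" "zero regular_module = 0" "add regular_module = (+)"
  "smult regular_module = (\<lambda>u r. rho u * r)"
  by (simp_all add: regular_module_def)

lemma regular_left_module: "left_module (gwa a) regular_module"
proof -
  have rho_alg: "rho u \<in> alg" if "u \<in> carrier (gwa a)" for u using rho_image that by blast
  have "abelian_group regular_module"
  proof (rule abelian_groupI)
    fix x assume "x \<in> carrier regular_module"
    then show "\<exists>y\<in>carrier regular_module. y \<oplus>\<^bsub>regular_module\<^esub> x = \<zero>\<^bsub>regular_module\<^esub>"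
      by (intro bexI[of _ "- x"]) (auto simp: regular_simps alg_closed)
  qed (auto simp: regular_simps alg_closed add.assoc add.commute)
  then show ?thesis
    unfolding left_module_def
    using ring_gwa rho_alg alg_closed
    by (auto simp: regular_simps rho_hom distrib_left distrib_right mult.assoc simp del: gwa_simps)
qed

text \<open>A subobject of the regular module is a left ideal, and a dual basis \<open>(\<phi>\<^sub>i, e\<^sub>i)\<close> lifts a
  morphism \<open>f\<close> through an epimorphism by \<open>q \<mapsto> \<Sum> \<phi>\<^sub>i(q) m\<^sub>i\<close> with \<open>m\<^sub>i\<close> over \<open>f(e\<^sub>i)\<close>.
  The regular module is projective as the subobject of itself, and it separates because a morphism
  from it can send \<open>1\<close> to any element.\<close>

theorem gwa_hereditary_separator:
  assumes simple: "simple_roots a" and gap: "integral_gap_free a"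
    and e: "inj_on (e :: 'r \<Rightarrow> 'u) alg"
  shows "hereditary_separator (gwa a) (image_module regular_module e)"
proof -
  let ?A = "gwa a" and ?P = "image_module regular_module e"
  interpret A: ring ?A by (rule ring_gwa)
  have e': "inj_on e (carrier regular_module)" using e by (simp add: regular_simps)
  note iP = image_module_raw[OF regular_left_module e', unfolded regular_simps]
  define dec where "dec = inv_into alg e"
  note P = iP(1)
  have dec: "raw_hom ?A ?P regular_module dec" using iP(3) by (simp add: dec_def)
  have e_dec: "m \<in> carrier ?P \<Longrightarrow> e (dec m) = m" and dec_e: "r \<in> alg \<Longrightarrow> dec (e r) = r" for m r
    using iP(4,5) by (auto simp: dec_def)
  have eP: "e r \<in> carrier ?P" if "r \<in> alg" for r
    using raw_homD(1)[OF iP(2)] that by (simp add: regular_simps)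
  have dec_add: "dec (m \<oplus>\<^bsub>?P\<^esub> n) = dec m + dec n" if "m \<in> carrier ?P" "n \<in> carrier ?P" for m n
    using raw_homD(2)[OF dec that] by (simp add: regular_simps)
  have dec_smult: "dec (u \<odot>\<^bsub>?P\<^esub> m) = rho u * dec m" if "u \<in> carrier ?A" "m \<in> carrier ?P" for u m
    using raw_homD(3)[OF dec that] by (simp add: regular_simps)
  have dec_alg: "dec m \<in> alg" if "m \<in> carrier ?P" for m
    using raw_homD(1)[OF dec that] by (simp add: regular_simps)
  have proj: "lmod_projective ?A Q" if Q: "left_module ?A Q" and j: "lmod_mono ?A Q ?P j"
    for Q :: "(free_alg set, 'u) module" and j
    unfolding lmod_projective_def
  proof (intro conjI allI impI Q, elim conjE)
    fix M N :: "(free_alg set, 'u) module" and g f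
    assume M: "left_module ?A M" and N: "left_module ?A N" and g: "lmod_epi ?A M N g"
      and f: "f \<in> lmod_hom ?A Q N"
    have gh: "g \<in> lmod_hom ?A M N" using g by (simp add: lmod_epi_def)
    have gsurj: "g ` carrier M = carrier N" by (rule lmod_epi_surj[OF g M N])
    have jh: "j \<in> lmod_hom ?A Q ?P" using j by (simp add: lmod_mono_def)
    have jinj: "inj_on j (carrier Q)" by (rule lmod_mono_inj[OF j Q P])
    define \<iota> where "\<iota> q = dec (j q)" for q
    have \<iota>: "\<iota> q \<in> alg" "e (\<iota> q) = j q" if "q \<in> carrier Q" for q
      using that lmod_homD(1)[OF jh that] dec_alg e_dec by (auto simp: \<iota>_def)
    have \<iota>_inj: "q = q'" if "q \<in> carrier Q" "q' \<in> carrier Q" "\<iota> q = \<iota> q'" for q q'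
      using that \<iota>(2) jinj by (metis inj_onD)
    have \<iota>_add: "\<iota> (q \<oplus>\<^bsub>Q\<^esub> q') = \<iota> q + \<iota> q'" if "q \<in> carrier Q" "q' \<in> carrier Q" for q q'
      using that by (simp add: \<iota>_def lmod_homD[OF jh] dec_add)
    have \<iota>_smult: "\<iota> (u \<odot>\<^bsub>Q\<^esub> q) = rho u * \<iota> q" if "u \<in> carrier ?A" "q \<in> carrier Q" for u q
      using that by (simp add: \<iota>_def lmod_homD[OF jh] dec_smult del: gwa_simps)
    interpret Q: abelian_group Q by (rule left_moduleD(2)[OF Q])
    have \<iota>_zero: "\<iota> \<zero>\<^bsub>Q\<^esub> = 0" using \<iota>_add[of "\<zero>\<^bsub>Q\<^esub>" "\<zero>\<^bsub>Q\<^esub>"] by simp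
    define I where "I = \<iota> ` carrier Q"
    have I: "left_ideal I"
      unfolding left_ideal_def I_def
    proof (intro conjI ballI)
      show "\<iota> ` carrier Q \<subseteq> alg" using \<iota>(1) by blast
      show "0 \<in> \<iota> ` carrier Q" using \<iota>_zero Q.zero_closed by (metis imageI)
      fix r s assume "s \<in> \<iota> ` carrier Q"
      then obtain q where q: "q \<in> carrier Q" "s = \<iota> q" by blast
      show "r + s \<in> \<iota> ` carrier Q" if r: "r \<in> \<iota> ` carrier Q"
      proof -
        obtain q' where q': "q' \<in> carrier Q" "r = \<iota> q'" using r by blast
        then have "\<iota> (q' \<oplus>\<^bsub>Q\<^esub> q) = r + s" using \<iota>_add q by simp
        then show ?thesis using Q.a_closed[OF q'(1) q(1)] by (metis imageI)
      qed
      show "r * s \<in> \<iota> ` carrier Q" if r: "r \<in> alg"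
      proof -
        have "\<iota> (sec r \<odot>\<^bsub>Q\<^esub> q) = r * s" using \<iota>_smult[OF sec(1)[OF r] q(1)] sec(2)[OF r] q(2) by simp
        then show ?thesis using left_moduleD(3)[OF Q sec(1)[OF r] q(1)] by (metis imageI)
      qed
    qed
    obtain L where L: "dual_basis I L" using left_ideal_dual_basis[OF simple gap I] by blast
    define gen where "gen x = inv_into (carrier Q) \<iota> (snd x)" for x :: "('r \<Rightarrow> 'r) \<times> 'r"
    have gen: "gen x \<in> carrier Q" "\<iota> (gen x) = snd x" if "x \<in> set L" for x
      using that dual_basisD(1)[OF L, of "fst x" "snd x"]
      by (auto simp: gen_def I_def inv_into_into f_inv_into_f)
    define lif where "lif x = inv_into (carrier M) g (f (gen x))" for x
    have lif: "lif x \<in> carrier M" "g (lif x) = f (gen x)" if "x \<in> set L" for x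
      using gsurj lmod_homD(1)[OF f gen(1)[OF that]]
      by (auto simp: lif_def inv_into_into f_inv_into_f)
    have co: "fst x (\<iota> q) \<in> alg" if "x \<in> set L" "q \<in> carrier Q" for x q
      using dual_basisD(2)[OF L, of "fst x" "snd x" "\<iota> q"] that by (auto simp: I_def)
    define l where "l = (\<lambda>q\<in>carrier Q. lsum M (\<lambda>x. sec (fst x (\<iota> q)) \<odot>\<^bsub>M\<^esub> lif x) L)"
    have lin: "sec (fst x (\<iota> q)) \<odot>\<^bsub>M\<^esub> lif x \<in> carrier M" if "x \<in> set L" "q \<in> carrier Q" for x q
      using left_moduleD(3)[OF M sec(1)[OF co[OF that]] lif(1)[OF that(1)]] .
    have l: "l \<in> lmod_hom ?A Q M"
      unfolding l_def
    proof (rule lmod_hom_restrictI[OF Q])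
      fix q assume q: "q \<in> carrier Q"
      show "lsum M (\<lambda>x. sec (fst x (\<iota> q)) \<odot>\<^bsub>M\<^esub> lif x) L \<in> carrier M"
        by (rule lsum_closed[OF M lin[OF _ q]])
      fix q' assume q': "q' \<in> carrier Q"
      have "lsum M (\<lambda>x. sec (fst x (\<iota> (q \<oplus>\<^bsub>Q\<^esub> q'))) \<odot>\<^bsub>M\<^esub> lif x) L
          = lsum M (\<lambda>x. sec (fst x (\<iota> q)) \<odot>\<^bsub>M\<^esub> lif x \<oplus>\<^bsub>M\<^esub> sec (fst x (\<iota> q')) \<odot>\<^bsub>M\<^esub> lif x) L"
      proof (rule lsum_cong)
        fix x assume x: "x \<in> set L"
        have "fst x (\<iota> q + \<iota> q') = fst x (\<iota> q) + fst x (\<iota> q')"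
          using dual_basisD(3)[OF L, of "fst x" "snd x"] x q q' by (simp add: I_def)
        then show "sec (fst x (\<iota> (q \<oplus>\<^bsub>Q\<^esub> q'))) \<odot>\<^bsub>M\<^esub> lif x
            = sec (fst x (\<iota> q)) \<odot>\<^bsub>M\<^esub> lif x \<oplus>\<^bsub>M\<^esub> sec (fst x (\<iota> q')) \<odot>\<^bsub>M\<^esub> lif x"
          using left_moduleD(4)[OF M sec(1)[OF co[OF x q]] sec(1)[OF co[OF x q']] lif(1)[OF x]]
          by (simp only: \<iota>_add[OF q q'] sec_add[OF co[OF x q] co[OF x q']])
      qed
      then show "lsum M (\<lambda>x. sec (fst x (\<iota> (q \<oplus>\<^bsub>Q\<^esub> q'))) \<odot>\<^bsub>M\<^esub> lif x) L
          = lsum M (\<lambda>x. sec (fst x (\<iota> q)) \<odot>\<^bsub>M\<^esub> lif x) L \<oplus>\<^bsub>M\<^esub> lsum M (\<lambda>x. sec (fst x (\<iota> q')) \<odot>\<^bsub>M\<^esub> lif x) L"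
        using lsum_add[OF M, of L] lin q q' by simp
    next
      fix u q assume u: "u \<in> carrier ?A" and q: "q \<in> carrier Q"
      have ru: "rho u \<in> alg" using rho_image u by blast
      have "lsum M (\<lambda>x. sec (fst x (\<iota> (u \<odot>\<^bsub>Q\<^esub> q))) \<odot>\<^bsub>M\<^esub> lif x) L
          = lsum M (\<lambda>x. u \<odot>\<^bsub>M\<^esub> (sec (fst x (\<iota> q)) \<odot>\<^bsub>M\<^esub> lif x)) L"
      proof (rule lsum_cong)
        fix x assume x: "x \<in> set L"
        have "fst x (rho u * \<iota> q) = rho u * fst x (\<iota> q)"
          using dual_basisD(4)[OF L, of "fst x" "snd x"] x q ru by (simp add: I_def)
        then have "sec (fst x (\<iota> (u \<odot>\<^bsub>Q\<^esub> q))) = u \<otimes>\<^bsub>?A\<^esub> sec (fst x (\<iota> q))"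
          by (simp only: \<iota>_smult[OF u q] sec_mult[OF ru co[OF x q]] sec_rho[OF u])
        then show "sec (fst x (\<iota> (u \<odot>\<^bsub>Q\<^esub> q))) \<odot>\<^bsub>M\<^esub> lif x = u \<odot>\<^bsub>M\<^esub> (sec (fst x (\<iota> q)) \<odot>\<^bsub>M\<^esub> lif x)"
          using left_moduleD(6)[OF M u sec(1)[OF co[OF x q]] lif(1)[OF x]] by simp
      qed
      then show "lsum M (\<lambda>x. sec (fst x (\<iota> (u \<odot>\<^bsub>Q\<^esub> q))) \<odot>\<^bsub>M\<^esub> lif x) L
          = u \<odot>\<^bsub>M\<^esub> lsum M (\<lambda>x. sec (fst x (\<iota> q)) \<odot>\<^bsub>M\<^esub> lif x) L"
        using lsum_smult[OF M lin[OF _ q] u, of L] by simp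
    qed
    have "g (l q) = f q" if q: "q \<in> carrier Q" for q
    proof -
      have genQ: "sec (fst x (\<iota> q)) \<odot>\<^bsub>Q\<^esub> gen x \<in> carrier Q" if "x \<in> set L" for x
        using left_moduleD(3)[OF Q sec(1)[OF co[OF that q]] gen(1)[OF that]] .
      have "g (l q) = lsum N (\<lambda>x. g (sec (fst x (\<iota> q)) \<odot>\<^bsub>M\<^esub> lif x)) L"
        using q lsum_hom[OF M N gh lin[OF _ q], of L] by (simp add: l_def)
      also have "\<dots> = lsum N (\<lambda>x. f (sec (fst x (\<iota> q)) \<odot>\<^bsub>Q\<^esub> gen x)) L"
        by (rule lsum_cong)
           (use lmod_homD(3)[OF gh sec(1)[OF co[OF _ q]]] lmod_homD(3)[OF f sec(1)[OF co[OF _ q]]] lif gen in simp)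
      also have "\<dots> = f (lsum Q (\<lambda>x. sec (fst x (\<iota> q)) \<odot>\<^bsub>Q\<^esub> gen x) L)"
        using lsum_hom[OF Q N f genQ, of L] by simp
      also have "lsum Q (\<lambda>x. sec (fst x (\<iota> q)) \<odot>\<^bsub>Q\<^esub> gen x) L = q"
      proof (rule \<iota>_inj[OF lsum_closed[OF Q genQ] q])
        have "set K \<subseteq> set L \<Longrightarrow> lsum Q (\<lambda>x. sec (fst x (\<iota> q)) \<odot>\<^bsub>Q\<^esub> gen x) K \<in> carrier Q \<and>
            \<iota> (lsum Q (\<lambda>x. sec (fst x (\<iota> q)) \<odot>\<^bsub>Q\<^esub> gen x) K) = (\<Sum>(\<phi>, d)\<leftarrow>K. \<phi> (\<iota> q) * d)" for K
        proof (induction K)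
          case (Cons x K)
          then have x: "x \<in> set L" by simp
          have "\<iota> (sec (fst x (\<iota> q)) \<odot>\<^bsub>Q\<^esub> gen x) = fst x (\<iota> q) * snd x"
            using \<iota>_smult[OF sec(1)[OF co[OF x q]] gen(1)[OF x]] gen(2)[OF x] sec(2)[OF co[OF x q]] by simp
          then show ?case using Cons genQ[OF x] by (simp add: \<iota>_add case_prod_beta)
        qed (simp add: \<iota>_zero)
        then show "\<iota> (lsum Q (\<lambda>x. sec (fst x (\<iota> q)) \<odot>\<^bsub>Q\<^esub> gen x) L) = \<iota> q"
          using dual_basisD(5)[OF L, of "\<iota> q"] q by (auto simp: I_def)
      qed
      finally show ?thesis .
    qed
    then have "compose (carrier Q) g l = f"
      using lmod_homD(4)[OF f] by (intro extensionalityI[of _ "carrier Q"]) (auto simp: compose_def)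
    then show "\<exists>l\<in>lmod_hom ?A Q M. compose (carrier Q) g l = f" using l by blast
  qed
  have "lmod_mono ?A ?P ?P (lmod_id ?P)"
    by (rule inj_imp_lmod_mono[OF lmod_id_hom[OF P]]) (auto simp: lmod_id_def inj_on_def)
  then have "lmod_projective ?A ?P" by (rule proj[OF P])
  moreover have "lmod_separator ?A ?P"
    unfolding lmod_separator_def
  proof (intro allI impI, elim conjE)
    fix M N :: "(free_alg set, 'u) module" and u v
    assume M: "left_module ?A M" and N: "left_module ?A N" and u: "u \<in> lmod_hom ?A M N"
      and v: "v \<in> lmod_hom ?A M N" and "u \<noteq> v"
    then obtain m where m: "m \<in> carrier M" "u m \<noteq> v m" using lmod_hom_ext[OF u v] by blast
    let ?p = "\<lambda>x\<in>carrier ?P. sec (dec x) \<odot>\<^bsub>M\<^esub> m"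
    have "?p \<in> lmod_hom ?A ?P M"
    proof (rule lmod_hom_restrictI[OF P])
      fix x assume x: "x \<in> carrier ?P"
      show "sec (dec x) \<odot>\<^bsub>M\<^esub> m \<in> carrier M" by (rule left_moduleD(3)[OF M sec(1)[OF dec_alg[OF x]] m(1)])
      fix y assume y: "y \<in> carrier ?P"
      show "sec (dec (x \<oplus>\<^bsub>?P\<^esub> y)) \<odot>\<^bsub>M\<^esub> m = sec (dec x) \<odot>\<^bsub>M\<^esub> m \<oplus>\<^bsub>M\<^esub> sec (dec y) \<odot>\<^bsub>M\<^esub> m"
        unfolding dec_add[OF x y] sec_add[OF dec_alg[OF x] dec_alg[OF y]]
        by (rule left_moduleD(4)[OF M sec(1)[OF dec_alg[OF x]] sec(1)[OF dec_alg[OF y]] m(1)])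
    next
      fix w x assume w: "w \<in> carrier ?A" and x: "x \<in> carrier ?P"
      have rw: "rho w \<in> alg" using rho_image w by blast
      show "sec (dec (w \<odot>\<^bsub>?P\<^esub> x)) \<odot>\<^bsub>M\<^esub> m = w \<odot>\<^bsub>M\<^esub> (sec (dec x) \<odot>\<^bsub>M\<^esub> m)"
        unfolding dec_smult[OF w x] sec_mult[OF rw dec_alg[OF x]] sec_rho[OF w]
        by (rule left_moduleD(6)[OF M w sec(1)[OF dec_alg[OF x]] m(1)])
    qed
    moreover have "compose (carrier ?P) u ?p (e 1) \<noteq> compose (carrier ?P) v ?p (e 1)"
      using m eP[OF alg_closed(2)] dec_e[OF alg_closed(2)] left_moduleD(7)[OF M m(1)]
      by (simp add: compose_def sec_one del: gwa_simps)
    ultimately show "\<exists>p\<in>lmod_hom ?A ?P M. compose (carrier ?P) u p \<noteq> compose (carrier ?P) v p" by metis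
  qed
  ultimately show ?thesis unfolding hereditary_separator_def using proj by blast
qed

end

section \<open>Additive operators on functions\<close>

text \<open>A ring in which representations by operators on functions take place.\<close>

typedef 'p fop = "{T :: ('p \<Rightarrow> complex) \<Rightarrow> 'p \<Rightarrow> complex. \<forall>f g. T (\<lambda>z. f z + g z) = (\<lambda>z. T f z + T g z)}"
  morphisms app Fop
  by (rule exI[of _ "\<lambda>f. f"]) simp

setup_lifting type_definition_fop

lemma app_add: "app T (\<lambda>z. f z + g z) = (\<lambda>z. app T f z + app T g z)"
  using app[of T] by simp

instantiation fop :: (type) ring_1
begin

lift_definition zero_fop :: "'a fop" is "\<lambda>f z. 0" by simp
lift_definition one_fop :: "'a fop" is "\<lambda>f. f" by simp
lift_definition plus_fop :: "'a fop \<Rightarrow> 'a fop \<Rightarrow> 'a fop" is "\<lambda>S T f z. S f z + T f z"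
  by (auto simp: fun_eq_iff)
lift_definition uminus_fop :: "'a fop \<Rightarrow> 'a fop" is "\<lambda>S f z. - S f z" by (auto simp: fun_eq_iff)
lift_definition minus_fop :: "'a fop \<Rightarrow> 'a fop \<Rightarrow> 'a fop" is "\<lambda>S T f z. S f z - T f z"
  by (auto simp: fun_eq_iff)
lift_definition times_fop :: "'a fop \<Rightarrow> 'a fop \<Rightarrow> 'a fop" is "\<lambda>S T f. S (T f)" by simp

instance
proof
  show "(0::'a fop) \<noteq> 1"
  proof
    assume "(0::'a fop) = 1"
    then have "app 0 (\<lambda>_. 1) = app (1::'a fop) (\<lambda>_. 1)" by simp
    then show False by (simp add: zero_fop.rep_eq one_fop.rep_eq fun_eq_iff)
  qed
qed (transfer, simp add: fun_eq_iff algebra_simps)+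

end

lemmas fop_apply = zero_fop.rep_eq one_fop.rep_eq plus_fop.rep_eq uminus_fop.rep_eq
  minus_fop.rep_eq times_fop.rep_eq

lemma fop_eqI: "(\<And>f z. app S f z = app T f z) \<Longrightarrow> S = T"
  by (metis app_inject ext)

lift_definition mult_op :: "('p \<Rightarrow> complex) \<Rightarrow> 'p fop" is "\<lambda>k f z. k z * f z"
  by (simp add: distrib_left)

lift_definition subst_op :: "('p \<Rightarrow> 'p) \<Rightarrow> 'p fop" is "\<lambda>s f z. f (s z)"
  by simp

section \<open>Weight modules\<close>

text \<open>A formal sum of weight vectors \<open>v\<^sub>n\<close> of weight \<open>\<mu> + n\<close> is the function of its coefficients;
  \<open>x v\<^sub>n = \<xi>\<^sub>n v\<^sub>n\<^sub>+\<^sub>1\<close> and \<open>y v\<^sub>n\<^sub>+\<^sub>1 = \<eta>\<^sub>n v\<^sub>n\<close>.\<close>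

definition wE :: "complex \<Rightarrow> complex poly \<Rightarrow> int fop" where
  "wE \<mu> p = mult_op (\<lambda>n. poly p (\<mu> + of_int n))"

definition wX :: "(int \<Rightarrow> complex) \<Rightarrow> int fop" where
  "wX \<xi> = subst_op (\<lambda>n. n - 1) * mult_op \<xi>"

definition wY :: "(int \<Rightarrow> complex) \<Rightarrow> int fop" where
  "wY \<eta> = mult_op \<eta> * subst_op (\<lambda>n. n + 1)"

lemma weight_apply [simp]:
  "app (wE \<mu> p) f n = poly p (\<mu> + of_int n) * f n"
  "app (wX \<xi>) f n = \<xi> (n - 1) * f (n - 1)" "app (wY \<eta>) f n = \<eta> n * f (n + 1)"
  by (simp_all add: wE_def wX_def wY_def mult_op.rep_eq subst_op.rep_eq fop_apply)

lemma weight_rep: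
  assumes "\<And>n. \<xi> n * \<eta> n = poly a (\<mu> + of_int n)"
  shows "gwa_rep (wE \<mu>) (wX \<xi>) (wY \<eta>) a"
proof
  show "wX \<xi> * wY \<eta> = wE \<mu> (shift_poly (- 1) a)"
  proof (rule fop_eqI)
    fix f n
    have "app (wX \<xi> * wY \<eta>) f n = (\<xi> (n - 1) * \<eta> (n - 1)) * f n" by (simp add: fop_apply)
    also have "\<dots> = poly a (\<mu> + of_int n - 1) * f n" unfolding assms by (simp add: add_diff_eq)
    finally show "app (wX \<xi> * wY \<eta>) f n = app (wE \<mu> (shift_poly (- 1) a)) f n" by simp
  qed
  show "wY \<eta> * wX \<xi> = wE \<mu> a"
  proof (rule fop_eqI)
    fix f n
    have "app (wY \<eta> * wX \<xi>) f n = (\<xi> n * \<eta> n) * f n" by (simp add: fop_apply)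
    then show "app (wY \<eta> * wX \<xi>) f n = app (wE \<mu> a) f n" by (simp add: assms)
  qed
qed (rule fop_eqI; simp add: fop_apply algebra_simps)+

definition op_module :: "(free_alg set \<Rightarrow> 'p fop) \<Rightarrow> ('p \<Rightarrow> complex) set \<Rightarrow> (free_alg set, 'p \<Rightarrow> complex) module"
  where "op_module rh C = \<lparr>carrier = C, mult = undefined, one = undefined, zero = (\<lambda>n. 0),
    add = (\<lambda>f g n. f n + g n), smult = (\<lambda>u. app (rh u))\<rparr>"

lemma op_module_simps:
  "carrier (op_module rh C) = C" "zero (op_module rh C) = (\<lambda>n. 0)"
  "add (op_module rh C) = (\<lambda>f g n. f n + g n)" "smult (op_module rh C) = (\<lambda>u. app (rh u))"
  by (simp_all add: op_module_def)

lemma ev_free_preserves: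
  fixes E :: "complex poly \<Rightarrow> 'p fop"
  assumes "gwa_rep E X Y a"
    and C: "(\<lambda>n. 0) \<in> C" "\<And>f g. f \<in> C \<Longrightarrow> g \<in> C \<Longrightarrow> (\<lambda>n. f n + g n) \<in> C"
      "\<And>p f. f \<in> C \<Longrightarrow> app (E p) f \<in> C" "\<And>f. f \<in> C \<Longrightarrow> app X f \<in> C" "\<And>f. f \<in> C \<Longrightarrow> app Y f \<in> C"
    and f: "f \<in> C"
  shows "app (gwa_rep.ev_free E X Y z) f \<in> C"
proof -
  interpret gwa_rep E X Y a by fact
  show ?thesis
  proof (induction z rule: free_alg_induct)
    case (letter l z)
    then show ?case using C by (cases l) (simp_all add: ev_free_letter_mult fop_apply)
  qed (use C f in \<open>simp_all add: ev_free_zero ev_free_one ev_free_add ev_free_const_mult fop_apply\<close>)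
qed

lemma op_left_module:
  fixes E :: "complex poly \<Rightarrow> 'p fop"
  assumes "gwa_rep E X Y a"
    and C: "(\<lambda>n. 0) \<in> C" "\<And>f g. f \<in> C \<Longrightarrow> g \<in> C \<Longrightarrow> (\<lambda>n. f n + g n) \<in> C"
      "\<And>p f. f \<in> C \<Longrightarrow> app (E p) f \<in> C" "\<And>f. f \<in> C \<Longrightarrow> app X f \<in> C" "\<And>f. f \<in> C \<Longrightarrow> app Y f \<in> C"
  shows "left_module (gwa a) (op_module (gwa_rep.rho E X Y a) C)"
proof -
  interpret gwa_rep E X Y a by fact
  have cl: "app (rho u) f \<in> C" if u: "u \<in> carrier (gwa a)" and f: "f \<in> C" for u f
  proof -
    obtain z where z: "u = gwa_pi a z" using u unfolding gwa_pi_simps by (elim rangeE)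
    show ?thesis unfolding z rho_pi by (rule ev_free_preserves[OF assms f])
  qed
  let ?M = "op_module rho C"
  have "abelian_group ?M"
  proof (rule abelian_groupI)
    fix x assume "x \<in> carrier ?M"
    then have x: "x \<in> C" by (simp add: op_module_simps)
    have "E [:-1:] = - 1" using E_minus[of 1] E_one by (simp add: one_pCons)
    then have "(\<lambda>n. - x n) \<in> C" using C(3)[OF x, of "[:-1:]"] by (simp add: fop_apply)
    then show "\<exists>y\<in>carrier ?M. y \<oplus>\<^bsub>?M\<^esub> x = \<zero>\<^bsub>?M\<^esub>"
      by (intro bexI[of _ "\<lambda>n. - x n"]) (auto simp: op_module_simps)
  qed (auto simp: op_module_simps C add.assoc add.commute)
  then show ?thesis
    unfolding left_module_def op_module_simps
  proof (intro conjI ballI ring_gwa cl)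
    fix u f g assume "u \<in> carrier (gwa a)"
    show "app (rho u) (\<lambda>n. f n + g n) = (\<lambda>n. app (rho u) f n + app (rho u) g n)" by (rule app_add)
  next
    fix u v f assume uv: "u \<in> carrier (gwa a)" "v \<in> carrier (gwa a)"
    show "app (rho (u \<oplus>\<^bsub>gwa a\<^esub> v)) f = (\<lambda>n. app (rho u) f n + app (rho v) f n)"
      unfolding rho_hom(1)[OF uv] plus_fop.rep_eq ..
    show "app (rho (u \<otimes>\<^bsub>gwa a\<^esub> v)) f = app (rho u) (app (rho v) f)"
      unfolding rho_hom(2)[OF uv] times_fop.rep_eq ..
  next
    fix f show "app (rho \<one>\<^bsub>gwa a\<^esub>) f = f" unfolding rho_hom(3) one_fop.rep_eq ..
  qed
qed

lemma op_module_raw_hom: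
  fixes E :: "complex poly \<Rightarrow> 'p fop" and E' :: "complex poly \<Rightarrow> 'q fop"
  assumes R: "gwa_rep E X Y a" and R': "gwa_rep E' X' Y' a"
    and C: "(\<lambda>n. 0) \<in> C" "\<And>f g. f \<in> C \<Longrightarrow> g \<in> C \<Longrightarrow> (\<lambda>n. f n + g n) \<in> C"
      "\<And>p f. f \<in> C \<Longrightarrow> app (E p) f \<in> C" "\<And>f. f \<in> C \<Longrightarrow> app X f \<in> C" "\<And>f. f \<in> C \<Longrightarrow> app Y f \<in> C"
    and T: "\<And>f. f \<in> C \<Longrightarrow> T f \<in> C'" "\<And>f g. f \<in> C \<Longrightarrow> g \<in> C \<Longrightarrow> T (\<lambda>n. f n + g n) = (\<lambda>n. T f n + T g n)"
      "\<And>p f. f \<in> C \<Longrightarrow> T (app (E p) f) = app (E' p) (T f)"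
      "\<And>f. f \<in> C \<Longrightarrow> T (app X f) = app X' (T f)" "\<And>f. f \<in> C \<Longrightarrow> T (app Y f) = app Y' (T f)"
  shows "raw_hom (gwa a) (op_module (gwa_rep.rho E X Y a) C) (op_module (gwa_rep.rho E' X' Y' a) C') T"
proof -
  interpret R: gwa_rep E X Y a by fact
  interpret R': gwa_rep E' X' Y' a by fact
  have T0: "T (\<lambda>n. 0) = (\<lambda>n. 0)"
    using T(2)[OF C(1) C(1)] by (simp add: fun_eq_iff)
  have ev: "T (app (R.ev_free z) f) = app (R'.ev_free z) (T f)" if f: "f \<in> C" for z f
  proof (induction z rule: free_alg_induct)
    case (add z w)
    show ?case
      by (simp only: R.ev_free_add R'.ev_free_add plus_fop.rep_eq
          T(2)[OF ev_free_preserves[OF R C f] ev_free_preserves[OF R C f]] add)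
  next
    case (const c z)
    show ?case
      by (simp only: R.ev_free_const_mult R'.ev_free_const_mult times_fop.rep_eq
          T(3)[OF ev_free_preserves[OF R C f]] const)
  next
    case (letter l z)
    show ?case
      by (cases l) (simp_all only: R.ev_free_letter_mult R'.ev_free_letter_mult times_fop.rep_eq
          R.letter.simps R'.letter.simps T(3-5)[OF ev_free_preserves[OF R C f]] letter)
  qed (simp_all add: R.ev_free_zero R'.ev_free_zero R.ev_free_one R'.ev_free_one fop_apply T0)
  show ?thesis
    unfolding raw_hom_def op_module_simps
  proof (intro conjI ballI T(1,2))
    fix u f assume "u \<in> carrier (gwa a)" and f: "f \<in> C"
    then obtain z where z: "u = gwa_pi a z" unfolding gwa_pi_simps by (elim rangeE)
    show "T (app (R.rho u) f) = app (R'.rho u) (T f)" unfolding z R.rho_pi R'.rho_pi by (rule ev[OF f])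
  qed
qed

text \<open>Finite sums of the \<open>v\<^sub>n\<close> with \<open>n\<close> in \<open>J\<close>.\<close>

definition fin_funs :: "int set \<Rightarrow> (int \<Rightarrow> complex) set" where
  "fin_funs J = {f. finite {n. f n \<noteq> 0} \<and> (\<forall>n. n \<notin> J \<longrightarrow> f n = 0)}"

lemma fin_funs_closed:
  "(\<lambda>n. 0) \<in> fin_funs J" "f \<in> fin_funs J \<Longrightarrow> g \<in> fin_funs J \<Longrightarrow> (\<lambda>n. f n + g n) \<in> fin_funs J"
  "f \<in> fin_funs J \<Longrightarrow> app (wE \<mu> p) f \<in> fin_funs J"
  "f \<in> fin_funs J \<Longrightarrow> (\<And>n. n \<in> J \<Longrightarrow> n + 1 \<notin> J \<Longrightarrow> \<xi> n = 0) \<Longrightarrow> app (wX \<xi>) f \<in> fin_funs J"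
  "f \<in> fin_funs J \<Longrightarrow> (\<And>n. n \<notin> J \<Longrightarrow> n + 1 \<in> J \<Longrightarrow> \<eta> n = 0) \<Longrightarrow> app (wY \<eta>) f \<in> fin_funs J"
proof -
  show "(\<lambda>n. 0) \<in> fin_funs J" by (simp add: fin_funs_def)
  assume f: "f \<in> fin_funs J"
  have fin: "finite {n. f n \<noteq> 0}" using f by (simp add: fin_funs_def)
  show "(\<lambda>n. f n + g n) \<in> fin_funs J" if g: "g \<in> fin_funs J"
  proof -
    have "finite ({n. f n \<noteq> 0} \<union> {n. g n \<noteq> 0})" using fin g by (simp add: fin_funs_def)
    then have "finite {n. f n + g n \<noteq> 0}" by (rule rev_finite_subset) auto
    then show ?thesis using f g by (auto simp: fin_funs_def)
  qed
  have "finite {n. poly p (\<mu> + of_int n) * f n \<noteq> 0}" by (rule finite_subset[OF _ fin]) auto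
  then show "app (wE \<mu> p) f \<in> fin_funs J" using f by (auto simp: fin_funs_def)
  show "app (wX \<xi>) f \<in> fin_funs J" if "\<And>n. n \<in> J \<Longrightarrow> n + 1 \<notin> J \<Longrightarrow> \<xi> n = 0"
  proof -
    have "{n. \<xi> (n - 1) * f (n - 1) \<noteq> 0} \<subseteq> (\<lambda>n. n + 1) ` {n. f n \<noteq> 0}" by (force simp: image_iff)
    then have "finite {n. \<xi> (n - 1) * f (n - 1) \<noteq> 0}" using fin finite_subset by blast
    moreover have "\<xi> (n - 1) * f (n - 1) = 0" if "n \<notin> J" for n
      using f \<open>\<And>n. n \<in> J \<Longrightarrow> n + 1 \<notin> J \<Longrightarrow> \<xi> n = 0\<close>[of "n - 1"] that
      by (cases "n - 1 \<in> J") (auto simp: fin_funs_def)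
    ultimately show ?thesis by (simp add: fin_funs_def)
  qed
  show "app (wY \<eta>) f \<in> fin_funs J" if "\<And>n. n \<notin> J \<Longrightarrow> n + 1 \<in> J \<Longrightarrow> \<eta> n = 0"
  proof -
    have "{n. \<eta> n * f (n + 1) \<noteq> 0} \<subseteq> (\<lambda>n. n - 1) ` {n. f n \<noteq> 0}" by (force simp: image_iff)
    then have "finite {n. \<eta> n * f (n + 1) \<noteq> 0}" using fin finite_subset by blast
    moreover have "\<eta> n * f (n + 1) = 0" if "n \<notin> J" for n
      using f \<open>\<And>n. n \<notin> J \<Longrightarrow> n + 1 \<in> J \<Longrightarrow> \<eta> n = 0\<close>[of n] that
      by (cases "n + 1 \<in> J") (auto simp: fin_funs_def)
    ultimately show ?thesis by (simp add: fin_funs_def)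
  qed
qed

definition weight_module ::
  "complex poly \<Rightarrow> complex \<Rightarrow> (int \<Rightarrow> complex) \<Rightarrow> (int \<Rightarrow> complex) \<Rightarrow> int set \<Rightarrow> (free_alg set, int \<Rightarrow> complex) module"
  where "weight_module a \<mu> \<xi> \<eta> J = op_module (gwa_rep.rho (wE \<mu>) (wX \<xi>) (wY \<eta>) a) (fin_funs J)"

lemma weight_left_module:
  assumes "\<And>n. \<xi> n * \<eta> n = poly a (\<mu> + of_int n)"
    "\<And>n. n \<in> J \<Longrightarrow> n + 1 \<notin> J \<Longrightarrow> \<xi> n = 0" "\<And>n. n \<notin> J \<Longrightarrow> n + 1 \<in> J \<Longrightarrow> \<eta> n = 0"
  shows "left_module (gwa a) (weight_module a \<mu> \<xi> \<eta> J)"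
  unfolding weight_module_def
  by (rule op_left_module[OF weight_rep[OF assms(1)]]) (use assms(2,3) in \<open>auto intro: fin_funs_closed\<close>)

text \<open>Truncation of coefficients covers the inclusion of a submodule (\<open>J \<subseteq> J'\<close>) as well as the projection to
  a quotient (\<open>J' \<subseteq> J\<close>).\<close>

lemma weight_raw_hom:
  assumes r: "\<And>n. \<xi> n * \<eta> n = poly a (\<mu> + of_int n)"
    "\<And>n. n \<in> J \<Longrightarrow> n + 1 \<notin> J \<Longrightarrow> \<xi> n = 0" "\<And>n. n \<notin> J \<Longrightarrow> n + 1 \<in> J \<Longrightarrow> \<eta> n = 0"
    and r': "\<And>n. \<xi>' n * \<eta>' n = poly a (\<mu> + of_int n)"
    and X: "\<And>n. n \<in> J \<Longrightarrow> n + 1 \<in> J' \<Longrightarrow> \<xi> n = (if n \<in> J' then \<xi>' n else 0)"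
      "\<And>n. n \<in> J \<Longrightarrow> n + 1 \<notin> J' \<Longrightarrow> n \<in> J' \<Longrightarrow> \<xi>' n = 0"
    and Y: "\<And>n. n + 1 \<in> J \<Longrightarrow> n \<in> J' \<Longrightarrow> \<eta> n = (if n + 1 \<in> J' then \<eta>' n else 0)"
      "\<And>n. n + 1 \<in> J \<Longrightarrow> n \<notin> J' \<Longrightarrow> n + 1 \<in> J' \<Longrightarrow> \<eta>' n = 0"
  shows "raw_hom (gwa a) (weight_module a \<mu> \<xi> \<eta> J) (weight_module a \<mu> \<xi>' \<eta>' J')
    (\<lambda>f n. if n \<in> J' then f n else 0)"
  unfolding weight_module_def
proof (rule op_module_raw_hom[OF weight_rep[OF r(1)] weight_rep[OF r'(1)]])
  fix f assume f: "f \<in> fin_funs J"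
  have out: "f n = 0" if "n \<notin> J" for n using f that by (simp add: fin_funs_def)
  have "finite {n. f n \<noteq> 0}" using f by (simp add: fin_funs_def)
  then have "finite {n. (if n \<in> J' then f n else 0) \<noteq> 0}" by (rule rev_finite_subset) auto
  then show "(\<lambda>n. if n \<in> J' then f n else 0) \<in> fin_funs J'" by (simp add: fin_funs_def)
  show "(\<lambda>n. if n \<in> J' then app (wE \<mu> p) f n else 0) = app (wE \<mu> p) (\<lambda>n. if n \<in> J' then f n else 0)" for p
    by (auto simp: fun_eq_iff)
  show "(\<lambda>n. if n \<in> J' then app (wX \<xi>) f n else 0) = app (wX \<xi>') (\<lambda>n. if n \<in> J' then f n else 0)"
  proof
    fix n show "(if n \<in> J' then app (wX \<xi>) f n else 0) = app (wX \<xi>') (\<lambda>n. if n \<in> J' then f n else 0) n"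
      using X[of "n - 1"] out[of "n - 1"] by (cases "n - 1 \<in> J") auto
  qed
  show "(\<lambda>n. if n \<in> J' then app (wY \<eta>) f n else 0) = app (wY \<eta>') (\<lambda>n. if n \<in> J' then f n else 0)"
  proof
    fix n show "(if n \<in> J' then app (wY \<eta>) f n else 0) = app (wY \<eta>') (\<lambda>n. if n \<in> J' then f n else 0) n"
      using Y[of n] out[of "n + 1"] by (cases "n + 1 \<in> J") auto
  qed
qed (use r in \<open>auto simp: fun_eq_iff intro: fin_funs_closed\<close>)

section \<open>A double root obstructs heredity\<close>

text \<open>Let \<open>S\<close> have the weights \<open>\<dots>, \<mu> - 1, \<mu>\<close> and \<open>K\<close> the weights \<open>\<mu> + 1, \<mu> + 2, \<dots>\<close>.  In the
  extension \<open>E\<^sub>2\<close> of \<open>S\<close> by \<open>K\<close> the element \<open>x\<close> moves weight \<open>\<mu>\<close> to \<open>\<mu> + 1\<close>, in the extension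
  \<open>E\<^sub>1\<close> of \<open>K\<close> by \<open>S\<close> the element \<open>y\<close> moves it back.  If submodules of \<open>P\<close> were projective, a
  map \<open>P \<rightarrow> S\<close> would lift to \<open>c : P \<rightarrow> E\<^sub>2\<close>, and the restriction of \<open>c\<close> to the kernel, which maps to \<open>K\<close>,
  would lift to \<open>d\<close> with values in \<open>E\<^sub>1\<close>.  For \<open>s\<close> in \<open>P\<close> over the vector of weight \<open>\<mu>\<close>, the
  element \<open>y x s\<close> would then be sent by \<open>d\<close> to something with nonzero coefficient in weight \<open>\<mu>\<close>.
  However, \<open>y x s = a(h) s = b(h) (h - \<mu>) ((h - \<mu>) s)\<close>, where \<open>(h - \<mu>) s\<close> already lies in the kernel, and
  the second factor \<open>h - \<mu>\<close> kills weight \<open>\<mu>\<close>.\<close>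

lemma double_root_no_hereditary_separator:
  assumes a: "a = [:- \<mu>, 1:] * [:- \<mu>, 1:] * b"
    and below: "\<And>k. poly a (\<mu> - of_nat (Suc k)) \<noteq> 0"
    and univ: "\<exists>e :: (int \<Rightarrow> complex) \<Rightarrow> 'u. inj e"
  shows "\<not> hereditary_separator (gwa a) (P :: (free_alg set, 'u) module)"
proof
  assume H: "hereditary_separator (gwa a) P"
  obtain e :: "(int \<Rightarrow> complex) \<Rightarrow> 'u" where e: "inj e" using univ by blast
  let ?A = "gwa a"
  have P: "lmod_projective ?A P" "lmod_separator ?A P" "left_module ?A P"
    using H by (auto simp: hereditary_separator_def lmod_projective_def)
  interpret P: abelian_group P by (rule left_moduleD(2)[OF P(3)])
  define \<alpha> where "\<alpha> n = poly a (\<mu> + of_int n)" for n :: int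
  have \<alpha>0: "\<alpha> 0 = 0" by (simp add: \<alpha>_def a)
  have \<alpha>neg: "\<alpha> n \<noteq> 0" if n: "n < 0" for n
  proof -
    have "n = - int (Suc (nat (- n - 1)))" using n by simp
    then show ?thesis using below[of "nat (- n - 1)"] by (metis \<alpha>_def of_int_minus of_int_of_nat_eq add_uminus_conv_diff)
  qed
  let ?one = "\<lambda>_::int. 1 :: complex"
  let ?S = "weight_module a \<mu> \<alpha> ?one {..0}" and ?K = "weight_module a \<mu> \<alpha> (?one(0 := 0)) {1..}"
  let ?E1 = "weight_module a \<mu> \<alpha> ?one UNIV"
  let ?E2 = "weight_module a \<mu> (\<alpha>(0 := 1)) (?one(0 := 0)) UNIV"
  have last: "\<alpha> n = 0" if "n \<in> {..0}" "n + 1 \<notin> {..0}" for n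
  proof -
    have "n = 0" using that by simp
    then show ?thesis by (simp add: \<alpha>0)
  qed
  have S: "left_module ?A ?S"
  proof (rule weight_left_module)
    show "\<alpha> n * ?one n = poly a (\<mu> + of_int n)" for n by (simp add: \<alpha>_def)
  qed (rule last, auto)
  have K: "left_module ?A ?K" by (rule weight_left_module) (auto simp: \<alpha>_def[symmetric] \<alpha>0)
  have E1: "left_module ?A ?E1" by (rule weight_left_module) (auto simp: \<alpha>_def[symmetric] \<alpha>0)
  have E2: "left_module ?A ?E2" by (rule weight_left_module) (auto simp: \<alpha>_def[symmetric] \<alpha>0)
  let ?tS = "\<lambda>f n. if n \<in> {..0::int} then f n else (0::complex)"
  let ?tK = "\<lambda>f n. if n \<in> {1::int..} then f n else (0::complex)"
  have last': "\<alpha> n = 0" if "\<not> n + 1 \<le> 0" "n \<le> 0" for n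
    by (rule last) (use that in auto)
  have last'': "\<alpha> n = 0" if "0 \<le> n" "\<not> 1 \<le> n" for n
    by (rule last) (use that in auto)
  have hS: "raw_hom ?A ?E2 ?S ?tS"
    by (rule weight_raw_hom) (auto simp: \<alpha>_def[symmetric] \<alpha>0 last')
  have hK: "raw_hom ?A ?E1 ?K ?tK"
    by (rule weight_raw_hom) (auto simp: \<alpha>_def[symmetric] \<alpha>0 last'')

  have iK: "raw_hom ?A ?K ?E2 (\<lambda>f n. if n \<in> UNIV then f n else 0)"
    by (rule weight_raw_hom) (auto simp: \<alpha>_def[symmetric] \<alpha>0)
  have car: "carrier (weight_module a \<mu> \<xi> \<eta> J) = fin_funs J" "zero (weight_module a \<mu> \<xi> \<eta> J) = (\<lambda>n. 0)"
    for \<xi> \<eta> J by (simp_all add: weight_module_def op_module_simps)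
  have fin_sub: "fin_funs J \<subseteq> fin_funs UNIV" for J by (auto simp: fin_funs_def)
  have surjS: "?tS ` carrier ?E2 = carrier ?S"
  proof (rule subset_antisym)
    show "?tS ` carrier ?E2 \<subseteq> carrier ?S" using raw_homD(1)[OF hS] by blast
    show "carrier ?S \<subseteq> ?tS ` carrier ?E2"
    proof
      fix f assume f: "f \<in> carrier ?S"
      then have "?tS f = f" by (auto simp: car fin_funs_def)
      moreover have "f \<in> carrier ?E2" using f fin_sub by (auto simp: car)
      ultimately show "f \<in> ?tS ` carrier ?E2" by (intro image_eqI[of f ?tS f]) simp_all
    qed
  qed
  have surjK: "?tK ` carrier ?E1 = carrier ?K"
  proof (rule subset_antisym)
    show "?tK ` carrier ?E1 \<subseteq> carrier ?K" using raw_homD(1)[OF hK] by blast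
    show "carrier ?K \<subseteq> ?tK ` carrier ?E1"
    proof
      fix f assume f: "f \<in> carrier ?K"
      then have "?tK f = f" by (auto simp: car fin_funs_def)
      moreover have "f \<in> carrier ?E1" using f fin_sub by (auto simp: car)
      ultimately show "f \<in> ?tK ` carrier ?E1" by (intro image_eqI[of f ?tK f]) simp_all
    qed
  qed
  define \<delta> where "\<delta> = (\<lambda>n::int. if n = 0 then 1 else (0::complex))"
  have \<delta>: "\<delta> \<in> carrier ?S" by (auto simp: car fin_funs_def \<delta>_def)
  have "\<delta> \<noteq> \<zero>\<^bsub>?S\<^esub>" by (auto simp: car \<delta>_def fun_eq_iff)
  from separator_raw_nonzero[OF P(2,3) S e \<delta> this] obtain \<pi> x0 where
    \<pi>: "raw_hom ?A P ?S \<pi>" and x0: "x0 \<in> carrier P" "\<pi> x0 \<noteq> \<zero>\<^bsub>?S\<^esub>" by metis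
  interpret R0: gwa_rep "wE \<mu>" "wX \<alpha>" "wY ?one" a by (rule weight_rep) (simp add: \<alpha>_def)
  interpret R2: gwa_rep "wE \<mu>" "wX (\<alpha>(0 := 1))" "wY (?one(0 := 0))" a
    by (rule weight_rep) (auto simp: \<alpha>_def[symmetric] \<alpha>0)
  have smS: "gwa_pi a z \<odot>\<^bsub>?S\<^esub> f = app (R0.ev_free z) f" "gwa_pi a z \<odot>\<^bsub>?E1\<^esub> f = app (R0.ev_free z) f" for z f
    by (simp_all add: weight_module_def op_module_simps R0.rho_pi)
  have sm2: "gwa_pi a z \<odot>\<^bsub>?E2\<^esub> f = app (R2.ev_free z) f" for z f
    by (simp add: weight_module_def op_module_simps R2.rho_pi)
  note piA = gwa_pi_simps(2)[of a]
  \<comment> \<open>\<open>S\<close> is simple: raising the lowest coefficient leads to a multiple of \<open>\<delta>\<close>.\<close>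
  have reach: "\<exists>z. app (R0.ev_free z) w = \<delta>"
    if "w \<in> fin_funs {..0}" "w \<noteq> (\<lambda>n. 0)" "\<And>n. n < - int k \<Longrightarrow> w n = 0" for w k
    using that
  proof (induction k arbitrary: w)
    case 0
    have w: "w n = (if n = 0 then w 0 else 0)" for n
      using 0(1,3) by (cases n "0::int" rule: linorder_cases) (auto simp: fin_funs_def)
    have w0: "w 0 \<noteq> 0"
    proof
      assume "w 0 = 0"
      then have "w n = 0" for n using w[of n] by (simp split: if_splits)
      then show False using 0(2) by auto
    qed
    have "app (R0.ev_free (free_const (1 / w 0))) w = \<delta>"
    proof
      fix n show "app (R0.ev_free (free_const (1 / w 0))) w n = \<delta> n"
        using w[of n] w0 by (simp add: R0.ev_free_const \<delta>_def split: if_splits)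
    qed
    then show ?case by blast
  next
    case (Suc k)
    show ?case
    proof (cases "w (- int (Suc k)) = 0")
      case True
      have "w n = 0" if "n < - int k" for n
        using that True Suc.prems(3)[of n] by (cases "n = - int (Suc k)") auto
      then show ?thesis using Suc.IH[OF Suc.prems(1,2)] by blast
    next
      case False
      let ?w = "app (wX \<alpha>) w"
      have "?w \<in> fin_funs {..0}" by (rule fin_funs_closed(4)[OF Suc.prems(1) last])
      moreover have "?w (- int k) \<noteq> 0"
      proof -
        have "- int (Suc k) = - int k - 1" by simp
        then show ?thesis using False \<alpha>neg[of "- int k - 1"] by (simp only: weight_apply) simp
      qed
      moreover have "?w n = 0" if "n < - int k" for n using Suc.prems(3)[of "n - 1"] that by simp
      ultimately obtain z where z: "app (R0.ev_free z) ?w = \<delta>" using Suc.IH[of ?w] by fastforce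
      have "app (R0.ev_free (z * fx)) w = \<delta>"
        using z by (simp add: R0.ev_free_mult R0.ev_free_gen times_fop.rep_eq)
      then show ?thesis by blast
    qed
  qed
  have w: "\<pi> x0 \<in> fin_funs {..0}" using raw_homD(1)[OF \<pi> x0(1)] by (simp add: car)
  have "\<exists>k. \<forall>n. n < - int k \<longrightarrow> \<pi> x0 n = 0"
  proof -
    have "finite {n. \<pi> x0 n \<noteq> 0}" using w by (simp add: fin_funs_def)
    then obtain m where m: "abs ` {n. \<pi> x0 n \<noteq> 0} \<subseteq> {..m}" using finite_int_iff_bounded_le by blast
    have "\<pi> x0 n = 0" if n: "n < - int (nat m)" for n
    proof (rule ccontr)
      assume "\<pi> x0 n \<noteq> 0"
      then have "\<bar>n\<bar> \<le> m" using m by auto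
      then show False using n by linarith
    qed
    then show ?thesis by blast
  qed
  then obtain z0 where z0: "app (R0.ev_free z0) (\<pi> x0) = \<delta>" using reach[OF w] x0(2) by (auto simp: car)
  define s where "s = gwa_pi a z0 \<odot>\<^bsub>P\<^esub> x0"
  have s: "s \<in> carrier P" unfolding s_def by (rule left_moduleD(3)[OF P(3) piA x0(1)])
  have \<pi>s: "\<pi> s = \<delta>" unfolding s_def using raw_homD(3)[OF \<pi> piA x0(1)] z0 smS by simp
  obtain c where c: "raw_hom ?A P ?E2 c" "\<And>p. p \<in> carrier P \<Longrightarrow> ?tS (c p) = \<pi> p"
    using projective_raw_lift[OF P(1) E2 S e hS surjS \<pi>] by blast
  have cs: "c s 0 = 1"
    using fun_cong[OF c(2)[OF s], of 0] by (simp add: \<pi>s \<delta>_def)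
  let ?Ker = "{p \<in> carrier P. \<pi> p = (\<lambda>n. 0)}"
  have \<pi>zero: "\<pi> \<zero>\<^bsub>P\<^esub> = (\<lambda>n. 0)"
    using raw_homD(2)[OF \<pi> P.zero_closed P.zero_closed] by (simp add: weight_module_def op_module_simps fun_eq_iff)
  have K0: "left_module ?A (submodule_on P ?Ker)"
    "restrict (\<lambda>m. m) ?Ker \<in> lmod_hom ?A (submodule_on P ?Ker) P"
  proof -
    have add: "\<pi> (m \<oplus>\<^bsub>P\<^esub> n) = (\<lambda>k. \<pi> m k + \<pi> n k)" if "m \<in> carrier P" "n \<in> carrier P" for m n
      using raw_homD(2)[OF \<pi> that] by (simp add: weight_module_def op_module_simps)
    have smu: "\<pi> (r \<odot>\<^bsub>P\<^esub> m) = (\<lambda>k. 0)" if "r \<in> carrier ?A" "m \<in> carrier P" "\<pi> m = (\<lambda>k. 0)" for r m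
      using raw_homD(3)[OF \<pi> that(1,2)] that(3) left_module_smult_zero[OF S that(1)] by (simp add: car)
    have conds: "?Ker \<subseteq> carrier P" "\<zero>\<^bsub>P\<^esub> \<in> ?Ker"
      "\<And>m n. m \<in> ?Ker \<Longrightarrow> n \<in> ?Ker \<Longrightarrow> m \<oplus>\<^bsub>P\<^esub> n \<in> ?Ker"
      "\<And>r m. r \<in> carrier ?A \<Longrightarrow> m \<in> ?Ker \<Longrightarrow> r \<odot>\<^bsub>P\<^esub> m \<in> ?Ker"
      using \<pi>zero add smu left_moduleD(3)[OF P(3)] by (auto simp del: gwa_simps)
    show "left_module ?A (submodule_on P ?Ker)"
      "restrict (\<lambda>m. m) ?Ker \<in> lmod_hom ?A (submodule_on P ?Ker) P"
      using submodule_on[OF P(3) conds] by auto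
  qed
  have carK0: "carrier (submodule_on P ?Ker) = ?Ker" by (simp add: submodule_on_def)
  have "lmod_mono ?A (submodule_on P ?Ker) P (restrict (\<lambda>m. m) ?Ker)"
    by (rule inj_imp_lmod_mono[OF K0(2)]) (auto simp: carK0 inj_on_def)
  then have projK: "lmod_projective ?A (submodule_on P ?Ker)"
    using H K0(1) unfolding hereditary_separator_def by blast
  have cK: "c p \<in> carrier ?K" if "p \<in> ?Ker" for p
  proof -
    have "c p \<in> fin_funs UNIV" using raw_homD(1)[OF c(1)] that by (simp add: car)
    moreover have "c p n = 0" if "n \<le> 0" for n
      using fun_cong[OF c(2)[of p], of n] \<open>p \<in> ?Ker\<close> that by simp
    ultimately show ?thesis by (auto simp: car fin_funs_def)
  qed
  have "raw_hom ?A (submodule_on P ?Ker) ?K c"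
    unfolding raw_hom_def
  proof (intro conjI ballI)
    fix m assume "m \<in> carrier (submodule_on P ?Ker)"
    then have m: "m \<in> ?Ker" "m \<in> carrier P" by (simp_all add: carK0)
    show "c m \<in> carrier ?K" by (rule cK[OF m(1)])
    show "c (m \<oplus>\<^bsub>submodule_on P ?Ker\<^esub> n) = c m \<oplus>\<^bsub>?K\<^esub> c n" if "n \<in> carrier (submodule_on P ?Ker)" for n
      using raw_homD(2)[OF c(1) m(2), of n] that
      by (simp add: carK0 submodule_on_def weight_module_def op_module_simps)
  next
    fix r m assume r: "r \<in> carrier ?A" and "m \<in> carrier (submodule_on P ?Ker)"
    then have m: "m \<in> ?Ker" "m \<in> carrier P" by (simp_all add: carK0)
    have "c (r \<odot>\<^bsub>P\<^esub> m) = r \<odot>\<^bsub>?E2\<^esub> c m" by (rule raw_homD(3)[OF c(1) r m(2)])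
    also have "\<dots> = r \<odot>\<^bsub>?K\<^esub> c m" using raw_homD(3)[OF iK r cK[OF m(1)]] by simp
    finally show "c (r \<odot>\<^bsub>submodule_on P ?Ker\<^esub> m) = r \<odot>\<^bsub>?K\<^esub> c m" by (simp add: submodule_on_def)
  qed
  then obtain d where d: "raw_hom ?A (submodule_on P ?Ker) ?E1 d"
    "\<And>p. p \<in> carrier (submodule_on P ?Ker) \<Longrightarrow> ?tK (d p) = c p"
    using projective_raw_lift[OF projK E1 K e hK surjK] by blast
  have d_smult: "d (gwa_pi a z \<odot>\<^bsub>P\<^esub> p) = app (R0.ev_free z) (d p)" if "p \<in> ?Ker" for z p
    using raw_homD(3)[OF d(1) piA, of p z] that by (simp add: carK0 smS) (simp add: submodule_on_def)
  have smP: "gwa_pi a z \<odot>\<^bsub>P\<^esub> p \<in> carrier P" if "p \<in> carrier P" for z p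
    by (rule left_moduleD(3)[OF P(3) piA that])
  have assoc: "gwa_pi a z \<odot>\<^bsub>P\<^esub> (gwa_pi a z' \<odot>\<^bsub>P\<^esub> p) = gwa_pi a (z * z') \<odot>\<^bsub>P\<^esub> p" if "p \<in> carrier P" for z z' p
    using left_moduleD(6)[OF P(3) piA piA that, of z z'] by (simp only: gwa_pi_simps(4))
  \<comment> \<open>\<open>y (x s)\<close> and \<open>b(h) (h - \<mu>) ((h - \<mu>) s)\<close> are the same element.\<close>
  let ?l = "free_eval [:- \<mu>, 1:] fh"
  let ?xs = "gwa_pi a fx \<odot>\<^bsub>P\<^esub> s" and ?ls = "gwa_pi a ?l \<odot>\<^bsub>P\<^esub> s"
  have xs: "?xs \<in> ?Ker"
  proof -
    have "\<pi> ?xs = app (wX \<alpha>) \<delta>"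
      using raw_homD(3)[OF \<pi> piA s, of fx] by (simp add: \<pi>s smS R0.ev_free_gen)
    also have "\<dots> = (\<lambda>n. 0)" by (auto simp: fun_eq_iff \<delta>_def \<alpha>0)
    finally show ?thesis using smP[OF s] by simp
  qed
  have ls: "?ls \<in> ?Ker"
  proof -
    have "\<pi> ?ls = app (wE \<mu> [:- \<mu>, 1:]) \<delta>"
      using raw_homD(3)[OF \<pi> piA s, of ?l] by (simp only: \<pi>s smS R0.ev_free_eval)
    also have "\<dots> = (\<lambda>n. 0)" by (auto simp: fun_eq_iff \<delta>_def)
    finally show ?thesis using smP[OF s] by simp
  qed
  have "gwa_pi a fy \<odot>\<^bsub>P\<^esub> ?xs = gwa_pi a (free_eval (b * [:- \<mu>, 1:]) fh) \<odot>\<^bsub>P\<^esub> ?ls"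
  proof -
    have "gwa_pi a (fy * fx) = gwa_pi a (free_eval a fh)"
      using gwa_relations_in_ideal(3) by (simp add: gwa_pi_eq_iff)
    also have "free_eval a fh = free_eval (b * [:- \<mu>, 1:]) fh * ?l"
      by (simp only: a free_eval_mult[symmetric]) (simp only: mult.commute mult.left_commute)
    finally show ?thesis unfolding assoc[OF s] by (simp only:)
  qed
  then have "app (wY ?one) (d ?xs) = app (wE \<mu> (b * [:- \<mu>, 1:])) (d ?ls)"
    using d_smult[OF xs, of fy] d_smult[OF ls, of "free_eval (b * [:- \<mu>, 1:]) fh"]
    by (simp only: R0.ev_free_gen R0.letter.simps R0.ev_free_eval)
  from fun_cong[OF this, of 0] have "d ?xs 1 = 0" by simp
  moreover have "d ?xs 1 = c ?xs 1"
    using fun_cong[OF d(2)[of ?xs], of 1] xs by (simp add: carK0)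
  moreover have "c ?xs = app (wX (\<alpha>(0 := 1))) (c s)"
    using raw_homD(3)[OF c(1) piA s, of fx] by (simp add: sm2 R2.ev_free_gen)
  ultimately show False using cs by simp
qed

section \<open>Difference operators\<close>

definition dE :: "complex poly \<Rightarrow> complex fop" where
  "dE p = mult_op (poly p)"

definition dS :: "int \<Rightarrow> complex fop" where
  "dS n = subst_op (\<lambda>z. z - of_int n)"

lemma dE_dS_apply: "app (dE p) f z = poly p z * f z" "app (dS n) f z = f (z - of_int n)"
  by (simp_all add: dE_def dS_def mult_op.rep_eq subst_op.rep_eq)

lemma dE_simps: "dE (p + q) = dE p + dE q" "dE (p * q) = dE p * dE q" "dE 1 = 1" "dE 0 = 0"
  by (rule fop_eqI; simp add: fop_apply dE_dS_apply algebra_simps)+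

lemma dS_dE: "dS n * dE p = dE (shift_poly (- of_int n) p) * dS n"
  by (rule fop_eqI) (simp add: fop_apply dE_dS_apply)

lemma dS_mult: "dS m * dS n = dS (m + n)" "dS 0 = 1"
  by (rule fop_eqI; simp add: fop_apply dE_dS_apply algebra_simps)+

lemma shift_rep: "gwa_rep dE (dS 1 * dE a) (dS (- 1)) a"
proof
  show "dS 1 * dE a * dE p = dE (shift_poly (- 1) p) * (dS 1 * dE a)" for p
    by (simp add: dS_dE mult.assoc) (simp add: mult.assoc[symmetric] dE_simps(2)[symmetric] mult.commute)
  show "dS (- 1) * dE p = dE (shift_poly 1 p) * dS (- 1)" for p by (simp add: dS_dE)
  show "dS (- 1) * (dS 1 * dE a) = dE a" by (simp add: mult.assoc[symmetric] dS_mult)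
  show "dS 1 * dE a * dS (- 1) = dE (shift_poly (- 1) a)" by (simp add: dS_dE mult.assoc dS_mult)
qed (simp_all add: dE_simps)

text \<open>The coefficient of \<open>(S a)\<^sup>n\<close>, where \<open>S\<close> is the shift, once all shifts are moved to the right; in negative degrees
  the basis consists of pure shifts and the factor is \<open>1\<close>.\<close>

definition shift_factor :: "complex poly \<Rightarrow> int \<Rightarrow> complex poly" where
  "shift_factor a n = (\<Prod>j<nat n. shift_poly (- of_nat (Suc j)) a)"

lemma shift_bas: "gwa_rep.bas (dS 1 * dE a) (dS (- 1)) n = dE (shift_factor a n) * dS n"
proof -
  interpret gwa_rep dE "dS 1 * dE a" "dS (- 1)" a by (rule shift_rep)
  have x: "(dS 1 * dE a) ^ k = dE (shift_factor a (int k)) * dS (int k)" for k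
  proof (induction k)
    case (Suc k)
    have sp: "shift_poly (- 1) (\<Prod>j<k. shift_poly (- of_nat (Suc j)) a)
        = (\<Prod>j<k. shift_poly (- of_nat (Suc (Suc j))) a)"
      by (induction k) simp_all
    have "(dS 1 * dE a) ^ Suc k = dS 1 * dE (a * shift_factor a (int k)) * dS (int k)"
      by (simp only: power_Suc Suc.IH dE_simps(2) mult.assoc)
    also have "\<dots> = dE (shift_poly (- 1) (a * shift_factor a (int k))) * (dS 1 * dS (int k))"
      by (simp only: dS_dE mult.assoc of_int_1)
    also have "shift_poly (- 1) (a * shift_factor a (int k)) = shift_factor a (int (Suc k))"
      unfolding shift_factor_def nat_int shift_poly_simps(3) sp prod.lessThan_Suc_shift by simp
    finally show ?case by (simp add: dS_mult)
  qed (simp add: shift_factor_def dE_simps dS_mult)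
  have y: "dS (- 1) ^ k = dS (- int k)" for k
    by (induction k) (simp_all add: dS_mult)
  show ?thesis using x[of "nat n"] y[of "nat (- n)"]
    by (auto simp: bas_def shift_factor_def dE_simps)
qed

text \<open>A difference operator is determined by its values on point masses.\<close>

lemma shift_model:
  assumes "a \<noteq> 0"
  shows "gwa_model dE (dS 1 * dE a) (dS (- 1)) a"
proof -
  interpret gwa_rep dE "dS 1 * dE a" "dS (- 1)" a by (rule shift_rep)
  have app_sum: "app (sum T S) f z = (\<Sum>i\<in>S. app (T i) f z)" for T :: "int \<Rightarrow> complex fop" and S f z
    by (induction S rule: infinite_finite_induct) (simp_all add: fop_apply)
  show ?thesis
  proof
    fix l u p n assume 0: "comb l u p = 0" and n: "l \<le> n" "n \<le> u"
    have "poly (p n * shift_factor a n) z = poly 0 z" for z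
    proof -
      let ?f = "\<lambda>w. if w = z - of_int n then 1 else (0::complex)"
      have "app (comb l u p) ?f z = (\<Sum>m=l..u. if m = n then poly (p n * shift_factor a n) z else 0)"
        unfolding comb_def app_sum by (rule sum.cong) (auto simp: shift_bas fop_apply dE_dS_apply)
      then show ?thesis using n 0 by (simp add: fop_apply)
    qed
    then have "p n * shift_factor a n = 0" by (rule complex_poly_eqI)
    then show "p n = 0" using assms by (auto simp: shift_factor_def)
  qed (rule assms)
qed

section \<open>Lattices of difference operators\<close>

text \<open>Heuristically \<open>latt N N'\<close> consists of the operators with polynomial coefficients that map functions
  vanishing to order \<open>N'\<close> to functions vanishing to order \<open>N\<close>.  The truncated difference of
  orders means that a negative difference imposes no condition and admits no pole.\<close>

definition vanishing :: "(complex \<Rightarrow> nat) \<Rightarrow> (complex \<Rightarrow> nat) \<Rightarrow> int \<Rightarrow> complex poly \<Rightarrow> bool" where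
  "vanishing N N' n q \<longleftrightarrow> (\<forall>z. [:- z, 1:] ^ (N z - N' (z - of_int n)) dvd q)"

definition latt :: "(complex \<Rightarrow> nat) \<Rightarrow> (complex \<Rightarrow> nat) \<Rightarrow> complex fop set" where
  "latt N N' = {\<Sum>n=l..u. dE (q n) * dS n | l u q. \<forall>n. vanishing N N' n (q n)}"

lemma vanishing_0: "vanishing N N' n 0" by (simp add: vanishing_def)

lemma lattI: "(\<And>n. vanishing N N' n (q n)) \<Longrightarrow> (\<Sum>n=l..u. dE (q n) * dS n) \<in> latt N N'"
  unfolding latt_def by blast

lemma latt_single: "vanishing N N' n q \<Longrightarrow> dE q * dS n \<in> latt N N'"
proof -
  assume q: "vanishing N N' n q"
  have "(\<Sum>m=n..n. dE (if m = n then q else 0) * dS m) \<in> latt N N'"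
    by (rule lattI) (use q vanishing_0 in auto)
  then show ?thesis by simp
qed

lemma latt_add:
  assumes "r \<in> latt N N'" "s \<in> latt N N'"
  shows "r + s \<in> latt N N'"
proof -
  obtain l u q where r: "r = (\<Sum>n=l..u. dE (q n) * dS n)" "\<And>n. vanishing N N' n (q n)"
    using assms(1) unfolding latt_def by blast
  obtain l' u' q' where s: "s = (\<Sum>n=l'..u'. dE (q' n) * dS n)" "\<And>n. vanishing N N' n (q' n)"
    using assms(2) unfolding latt_def by blast
  let ?l = "min l l'" and ?u = "max u u'"
  let ?q = "\<lambda>n. if n \<in> {l..u} then q n else 0" and ?q' = "\<lambda>n. if n \<in> {l'..u'} then q' n else 0"
  have "r = (\<Sum>n=?l..?u. dE (?q n) * dS n)" "s = (\<Sum>n=?l..?u. dE (?q' n) * dS n)"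
    unfolding r(1) s(1)
    by (rule sum_int_interval_extend[of "\<lambda>p n. dE p * dS n"]; simp add: dE_simps)+
  then have eq: "r + s = (\<Sum>n=?l..?u. dE (?q n + ?q' n) * dS n)"
    by (simp only: dE_simps distrib_right sum.distrib)
  have "vanishing N N' n (?q n + ?q' n)" for n
    using r(2)[of n] s(2)[of n] by (auto simp: vanishing_def)
  then show ?thesis unfolding eq by (rule lattI)
qed

lemma latt_zero: "0 \<in> latt N N'"
  using latt_single[OF vanishing_0] by (simp add: dE_simps)

lemma latt_sum: "(\<And>i. i \<in> I \<Longrightarrow> f i \<in> latt N N') \<Longrightarrow> sum f I \<in> latt N N'"
  by (induction I rule: infinite_finite_induct) (auto intro: latt_zero latt_add)

lemma shift_poly_linear_power: "shift_poly c ([:- z, 1:] ^ k) = [:- (z - c), 1:] ^ k"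
  by (rule complex_poly_eqI) (simp add: poly_power algebra_simps)

lemma vanishing_mult:
  assumes "vanishing N N' n q" "vanishing N' N'' m q'"
  shows "vanishing N N'' (n + m) (q * shift_poly (- of_int n) q')"
  unfolding vanishing_def
proof
  fix z
  let ?i = "N z - N' (z - of_int n)" and ?j = "N' (z - of_int n) - N'' (z - of_int n - of_int m)"
  have 1: "[:- z, 1:] ^ ?i dvd q" using assms(1) by (simp add: vanishing_def)
  have "[:- (z - of_int n), 1:] ^ ?j dvd q'"
    using assms(2) unfolding vanishing_def by blast
  then obtain g where g: "q' = [:- (z - of_int n), 1:] ^ ?j * g" by (auto elim!: dvdE)
  have "shift_poly (- of_int n) ([:- (z - of_int n), 1:] ^ ?j) = [:- z, 1:] ^ ?j"
    by (subst shift_poly_linear_power) simp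
  then have "shift_poly (- of_int n) q' = [:- z, 1:] ^ ?j * shift_poly (- of_int n) g"
    by (subst g) (simp only: shift_poly_simps(3))
  then have 2: "[:- z, 1:] ^ ?j dvd shift_poly (- of_int n) q'" by simp
  have "[:- z, 1:] ^ (?i + ?j) dvd q * shift_poly (- of_int n) q'"
    using mult_dvd_mono[OF 1 2] by (simp add: power_add)
  then show "[:- z, 1:] ^ (N z - N'' (z - of_int (n + m))) dvd q * shift_poly (- of_int n) q'"
    by (rule power_le_dvd) (simp add: diff_diff_eq)
qed

lemma latt_mult:
  assumes "r \<in> latt N N'" "s \<in> latt N' N''"
  shows "r * s \<in> latt N N''"
proof -
  obtain l u q where r: "r = (\<Sum>n=l..u. dE (q n) * dS n)" "\<And>n. vanishing N N' n (q n)"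
    using assms(1) unfolding latt_def by blast
  obtain l' u' q' where s: "s = (\<Sum>n=l'..u'. dE (q' n) * dS n)" "\<And>n. vanishing N' N'' n (q' n)"
    using assms(2) unfolding latt_def by blast
  have "dE (q n) * dS n * (dE (q' m) * dS m) = dE (q n * shift_poly (- of_int n) (q' m)) * dS (n + m)" for n m
  proof -
    have "dE (q n) * dS n * (dE (q' m) * dS m) = dE (q n) * (dS n * dE (q' m)) * dS m"
      by (simp add: mult.assoc)
    also have "\<dots> = dE (q n) * dE (shift_poly (- of_int n) (q' m)) * (dS n * dS m)"
      by (simp only: dS_dE mult.assoc)
    finally show ?thesis by (simp only: dE_simps(2) dS_mult)
  qed
  then have "r * s = (\<Sum>n=l..u. \<Sum>m=l'..u'. dE (q n * shift_poly (- of_int n) (q' m)) * dS (n + m))"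
    unfolding r(1) s(1) by (simp only: sum_product)
  also have "\<dots> \<in> latt N N''"
    by (intro latt_sum latt_single vanishing_mult[OF r(2) s(2)])
  finally show ?thesis .
qed

section \<open>Orders of vanishing along a progression\<close>

lemma dvd_if_order_le:
  assumes "(p :: complex poly) \<noteq> 0" "\<And>z. Polynomial.order z p \<le> Polynomial.order z q"
  shows "p dvd q"
  using assms
proof (induction "degree p" arbitrary: p q)
  case 0
  then have "is_unit p" by (metis degree_eq_zeroE is_unit_const_poly_iff not_is_unit_0 pCons_eq_0_iff dvd_field_iff)
  then show ?case by (rule unit_imp_dvd)
next
  case (Suc d)
  show ?case
  proof (cases "q = 0")
    case False
    obtain z where z: "poly p z = 0" using alg_closed_imp_poly_has_root[of p] Suc.hyps(2) by auto
    then have "Polynomial.order z p \<noteq> 0" using Suc.prems(1) by (simp add: order_root)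
    then have "poly q z = 0" using Suc.prems(2)[of z] False by (simp add: order_root)
    then obtain q1 where q1: "q = [:- z, 1:] * q1" by (auto simp: poly_eq_0_iff_dvd elim!: dvdE)
    obtain p1 where p1: "p = [:- z, 1:] * p1" using z by (auto simp: poly_eq_0_iff_dvd elim!: dvdE)
    have nz: "p1 \<noteq> 0" "q1 \<noteq> 0" using p1 q1 Suc.prems(1) False by auto
    have "d = degree p1" using Suc.hyps(2) p1 nz by (simp add: degree_mult_eq del: mult_pCons_left)
    moreover have "Polynomial.order w p1 \<le> Polynomial.order w q1" for w
      using Suc.prems(2)[of w] Suc.prems(1) False unfolding p1 q1 by (simp add: order_mult del: mult_pCons_left)
    ultimately have "p1 dvd q1" using Suc.hyps(1) nz(1) by blast
    then show ?thesis unfolding p1 q1 by (rule mult_dvd_mono[OF dvd_refl])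
  qed simp
qed

definition root_poly :: "complex list \<Rightarrow> complex poly" where
  "root_poly L = (\<Prod>l\<leftarrow>L. [:- l, 1:])"

lemma root_poly_simps [simp]: "root_poly [] = 1" "root_poly (l # L) = [:- l, 1:] * root_poly L"
  by (simp_all add: root_poly_def)

lemma root_poly_nonzero: "root_poly L \<noteq> 0"
  by (induction L) (simp_all del: mult_pCons_left)

text \<open>The number of roots, with multiplicity, that lie strictly below \<open>z\<close> in the same progression of step one.\<close>

definition above :: "complex list \<Rightarrow> complex \<Rightarrow> nat" where
  "above L z = (\<Sum>l\<leftarrow>L. of_bool (\<exists>k::nat. z = l + of_nat (Suc k)))"

definition between :: "complex list \<Rightarrow> nat \<Rightarrow> complex \<Rightarrow> nat" where
  "between L n z = (\<Sum>l\<leftarrow>L. of_bool (\<exists>k<n. z = l + of_nat (Suc k)))"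

lemma above_shift: "above L z = above L (z - of_nat n) + between L n z"
proof (induction L)
  case (Cons l L)
  have "(of_bool (\<exists>k::nat. z = l + of_nat (Suc k)) :: nat)
      = of_bool (\<exists>k::nat. z - of_nat n = l + of_nat (Suc k)) + of_bool (\<exists>k<n. z = l + of_nat (Suc k))"
  proof (cases "\<exists>k::nat. z = l + of_nat (Suc k)")
    case True
    then obtain k :: nat where k: "z = l + of_nat (Suc k)" by blast
    have u: "z = l + of_nat (Suc j) \<longleftrightarrow> j = k" for j by (auto simp: k simp del: of_nat_Suc)
    have "(\<exists>j::nat. z - of_nat n = l + of_nat (Suc j)) \<longleftrightarrow> \<not> k < n"
    proof
      assume "\<exists>j::nat. z - of_nat n = l + of_nat (Suc j)"
      then obtain j :: nat where "z - of_nat n = l + of_nat (Suc j)" by blast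
      then have "z = l + of_nat (Suc (j + n))" by (simp add: algebra_simps)
      then show "\<not> k < n" using u[of "j + n"] by simp
    next
      assume "\<not> k < n"
      then have "z - of_nat n = l + of_nat (Suc (k - n))" by (simp add: k of_nat_diff algebra_simps)
      then show "\<exists>j::nat. z - of_nat n = l + of_nat (Suc j)" by blast
    qed
    then show ?thesis using True u by auto
  next
    case False
    have "\<not> (\<exists>k::nat. z - of_nat n = l + of_nat (Suc k))"
    proof
      assume "\<exists>k::nat. z - of_nat n = l + of_nat (Suc k)"
      then obtain k :: nat where "z - of_nat n = l + of_nat (Suc k)" by blast
      then have "z = l + of_nat (Suc (k + n))" by (simp add: algebra_simps)
      then show False using False by blast
    qed
    then show ?thesis using False by auto
  qed
  then show ?case using Cons by (simp add: above_def between_def)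
qed (simp add: above_def between_def)

lemma order_linear: "Polynomial.order z [:- l, 1:] = of_bool (z = (l::complex))"
proof (cases "z = l")
  case True
  then show ?thesis using order_power_n_n[of l 1] by simp
next
  case False
  then show ?thesis by (simp add: order_0I)
qed

lemma order_shift_factor:
  assumes "c \<noteq> 0"
  shows "Polynomial.order z (shift_factor (Polynomial.smult c (root_poly L)) (int n)) = between L n z"
proof -
  have lin: "Polynomial.order z (shift_poly (- of_nat (Suc j)) (root_poly L))
      = (\<Sum>l\<leftarrow>L. of_bool (z = l + of_nat (Suc j)))" for j
  proof (induction L)
    case (Cons l L)
    have e: "shift_poly (- of_nat (Suc j)) (root_poly (l # L))
        = [:- (l + of_nat (Suc j)), 1:] * shift_poly (- of_nat (Suc j)) (root_poly L)"
      by (rule complex_poly_eqI) (simp add: algebra_simps)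
    have "[:- (l + of_nat (Suc j)), 1:] * shift_poly (- of_nat (Suc j)) (root_poly L) \<noteq> 0"
      using root_poly_nonzero[of L] by (simp del: mult_pCons_left of_nat_Suc)
    then show ?case
      unfolding e by (subst order_mult) (simp_all only: order_linear Cons list.map sum_list.Cons not_False_eq_True)
  qed simp
  have sm: "shift_poly d (Polynomial.smult c (root_poly L)) = Polynomial.smult c (shift_poly d (root_poly L))" for d
    by (rule complex_poly_eqI) simp
  have "Polynomial.order z (\<Prod>j<n. shift_poly (- of_nat (Suc j)) (Polynomial.smult c (root_poly L)))
      = (\<Sum>j<n. \<Sum>l\<leftarrow>L. of_bool (z = l + of_nat (Suc j)))"
  proof (induction n)
    case (Suc n)
    then show ?case using assms root_poly_nonzero[of L]
      by (simp add: order_mult sm order_smult lin del: of_nat_Suc)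
  qed simp
  also have "\<dots> = between L n z"
    unfolding between_def
  proof (induction L)
    case (Cons l L)
    have "(\<Sum>j<n. of_bool (z = l + of_nat (Suc j)) :: nat) = of_bool (\<exists>k<n. z = l + of_nat (Suc k))"
    proof (cases "\<exists>k<n. z = l + of_nat (Suc k)")
      case True
      then obtain k where k: "k < n" "z = l + of_nat (Suc k)" by blast
      then have "of_bool (z = l + of_nat (Suc j)) = (if j = k then 1 else 0 :: nat)" for j
        by (auto simp del: of_nat_Suc)
      then show ?thesis using True k(1) by simp
    qed auto
    then show ?case using Cons by (simp add: sum.distrib del: of_nat_Suc)
  qed simp
  finally show ?thesis by (simp add: shift_factor_def)
qed

text \<open>Along a progression \<open>above L\<close> is nondecreasing, and its increase over \<open>n\<close> steps counts the roots in between,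
  which is the order of the shift factor.\<close>

lemma vanishing_shift_factor_iff:
  assumes "c \<noteq> 0"
  shows "vanishing (above L) (above L) n q \<longleftrightarrow> shift_factor (Polynomial.smult c (root_poly L)) n dvd q"
proof (cases "n \<ge> 0")
  case True
  then obtain k where k: "n = int k" by (metis nonneg_int_cases)
  let ?U = "shift_factor (Polynomial.smult c (root_poly L)) n"
  have U0: "?U \<noteq> 0" using assms root_poly_nonzero[of L] by (auto simp: shift_factor_def)
  have ord: "above L z - above L (z - of_int n) = Polynomial.order z ?U" for z
    using above_shift[of L z k] order_shift_factor[OF assms, of z L k] by (simp add: k)
  show ?thesis
  proof
    assume "vanishing (above L) (above L) n q"
    then have "Polynomial.order z ?U \<le> Polynomial.order z q" if "q \<noteq> 0" for z
      using that by (auto simp: vanishing_def ord order_divides)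
    then show "?U dvd q" using dvd_if_order_le[OF U0] by (cases "q = 0") auto
  next
    assume "?U dvd q"
    then show "vanishing (above L) (above L) n q"
      unfolding vanishing_def ord by (meson dvd_trans order_1)
  qed
next
  case False
  then obtain k where k: "n = - int k" by (metis int_cases2 of_nat_0_le_iff)
  have "above L z \<le> above L (z - of_int n)" for z
    using above_shift[of L "z - of_int n" k] by (simp add: k)
  then have "above L z - above L (z - of_int n) = 0" for z by simp
  then show ?thesis using False by (simp add: vanishing_def shift_factor_def)
qed

lemma shift_alg_latt:
  assumes "c \<noteq> 0" and a: "a = Polynomial.smult c (root_poly L)"
  shows "gwa_rep.alg dE (dS 1 * dE a) (dS (- 1)) = latt (above L) (above L)"
proof -
  interpret gwa_rep dE "dS 1 * dE a" "dS (- 1)" a by (rule shift_rep)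
  have c: "comb l u p = (\<Sum>n=l..u. dE (p n * shift_factor a n) * dS n)" for l u p
    unfolding comb_def shift_bas dE_simps(2) mult.assoc ..
  note v = vanishing_shift_factor_iff[OF assms(1), of L, folded a]
  show ?thesis
  proof (rule subset_antisym)
    show "alg \<subseteq> latt (above L) (above L)"
    proof
      fix r assume "r \<in> alg"
      then obtain l u p where "r = comb l u p" by (auto simp: alg_def supp_in_def)
      moreover have "vanishing (above L) (above L) n (p n * shift_factor a n)" for n by (simp add: v)
      ultimately show "r \<in> latt (above L) (above L)" unfolding c by (simp add: lattI)
    qed
    show "latt (above L) (above L) \<subseteq> alg"
    proof
      fix r assume "r \<in> latt (above L) (above L)"
      then obtain l u q where r: "r = (\<Sum>n=l..u. dE (q n) * dS n)"
        and q: "\<And>n. vanishing (above L) (above L) n (q n)" unfolding latt_def by blast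
      have "\<forall>n. \<exists>g. q n = g * shift_factor a n" using q v by (metis dvd_def mult.commute)
      then obtain p where "\<And>n. q n = p n * shift_factor a n" by metis
      then have "r = comb l u p" by (simp add: r c)
      then show "r \<in> alg" using supp_inI supp_in_alg by blast
    qed
  qed
qed

text \<open>Moving a root \<open>l\<close> by at most \<open>K\<close> changes the count of \<open>above\<close> only at \<open>l + 1, \<dots>, l + K\<close> when it
  decreases, and the shift factor vanishes there.\<close>

lemma vanishing_integral_shift:
  assumes "list_all2 (\<lambda>l m. \<exists>k::int. \<bar>k\<bar> \<le> int K \<and> m = l + of_int k) L M"
  shows "vanishing (above L) (above M) 0 (shift_factor (root_poly L) (int K))"
proof -
  have le: "above L z \<le> above M z + between L K z" for z
    using assms
  proof (induction rule: list_all2_induct)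
    case (Cons l L m M)
    obtain k :: int where k: "\<bar>k\<bar> \<le> int K" "m = l + of_int k" using Cons.hyps(1) by blast
    have "(of_bool (\<exists>j::nat. z = l + of_nat (Suc j)) :: nat)
        \<le> of_bool (\<exists>j::nat. z = m + of_nat (Suc j)) + of_bool (\<exists>j<K. z = l + of_nat (Suc j))"
    proof (cases "\<exists>j::nat. z = l + of_nat (Suc j)")
      case True
      then obtain j :: nat where j: "z = l + of_nat (Suc j)" by blast
      show ?thesis
      proof (cases "j < K")
        case False
        have "int j - k \<ge> 0" using k(1) False by linarith
        then have "of_nat (nat (int j - k)) = (of_nat j - of_int k :: complex)" by simp
        then have "z = m + of_nat (Suc (nat (int j - k)))" by (simp add: j k(2))
        then show ?thesis by auto
      qed (use j in auto)
    qed simp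
    then show ?case using Cons.IH by (simp add: above_def between_def)
  qed (simp add: above_def)
  have "Polynomial.order z (shift_factor (root_poly L) (int K)) = between L K z" for z
    using order_shift_factor[of 1 z L K] by simp
  then have "above L z - above M (z - of_int 0) \<le> Polynomial.order z (shift_factor (root_poly L) (int K))" for z
    using le[of z] by simp
  then show ?thesis unfolding vanishing_def by (simp add: order_divides)
qed

section \<open>Lattices as Morita contexts\<close>

text \<open>The sums of products \<open>p q\<close> form a nonzero two-sided ideal.\<close>

lemma (in gwa_model) trace_ideal_one:
  assumes simple: "simple_algebra (gwa a)"
    and PQ: "\<And>p q. p \<in> P \<Longrightarrow> q \<in> Q \<Longrightarrow> p * q \<in> alg"
    and left: "\<And>r p. r \<in> alg \<Longrightarrow> p \<in> P \<Longrightarrow> r * p \<in> P"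
    and right: "\<And>r q. r \<in> alg \<Longrightarrow> q \<in> Q \<Longrightarrow> q * r \<in> Q"
    and nz: "p0 \<in> P" "q0 \<in> Q" "p0 * q0 \<noteq> 0"
  shows "\<exists>L. set L \<subseteq> P \<times> Q \<and> (\<Sum>(p, q)\<leftarrow>L. p * q) = 1"
proof -
  interpret A: ring "gwa a" by (rule ring_gwa)
  define T where "T = {\<Sum>(p, q)\<leftarrow>L. p * q | L. set L \<subseteq> P \<times> Q}"
  have T_single: "p * q \<in> T" if "p \<in> P" "q \<in> Q" for p q
    unfolding T_def by (rule CollectI, rule exI[of _ "[(p, q)]"]) (use that in simp)
  have T_0: "0 \<in> T" unfolding T_def by (rule CollectI, rule exI[of _ "[]"]) simp
  have T_add: "r + s \<in> T" if rs: "r \<in> T" "s \<in> T" for r s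
  proof -
    obtain L L' where "set L \<subseteq> P \<times> Q" "r = (\<Sum>(p, q)\<leftarrow>L. p * q)"
      "set L' \<subseteq> P \<times> Q" "s = (\<Sum>(p, q)\<leftarrow>L'. p * q)" using rs unfolding T_def by blast
    then show ?thesis unfolding T_def by (intro CollectI exI[of _ "L @ L'"]) simp
  qed
  have T_left: "r * s \<in> T" if r: "r \<in> alg" and s: "s \<in> T" for r s
  proof -
    obtain L where L: "set L \<subseteq> P \<times> Q" "s = (\<Sum>(p, q)\<leftarrow>L. p * q)" using s unfolding T_def by blast
    have "r * (\<Sum>(p, q)\<leftarrow>L. p * q) = (\<Sum>(p, q)\<leftarrow>map (\<lambda>(p, q). (r * p, q)) L. p * q)"
      by (induction L) (auto simp: distrib_left mult.assoc)
    then show ?thesis using L(1) left[OF r] unfolding T_def L(2)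
      by (intro CollectI exI[of _ "map (\<lambda>(p, q). (r * p, q)) L"]) auto
  qed
  have T_right: "s * r \<in> T" if r: "r \<in> alg" and s: "s \<in> T" for r s
  proof -
    obtain L where L: "set L \<subseteq> P \<times> Q" "s = (\<Sum>(p, q)\<leftarrow>L. p * q)" using s unfolding T_def by blast
    have "(\<Sum>(p, q)\<leftarrow>L. p * q) * r = (\<Sum>(p, q)\<leftarrow>map (\<lambda>(p, q). (p, q * r)) L. p * q)"
      by (induction L) (auto simp: distrib_right mult.assoc)
    then show ?thesis using L(1) right[OF r] unfolding T_def L(2)
      by (intro CollectI exI[of _ "map (\<lambda>(p, q). (p, q * r)) L"]) auto
  qed
  have rho_alg: "rho u \<in> alg" if "u \<in> carrier (gwa a)" for u
    using that rho_image by blast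
  let ?I = "{u \<in> carrier (gwa a). rho u \<in> T}"
  have "ideal ?I (gwa a)"
  proof (rule idealI[OF ring_gwa])
    show "subgroup ?I (add_monoid (gwa a))"
    proof (rule subgroup.intro)
      show "?I \<subseteq> carrier (add_monoid (gwa a))" by auto
      show "\<one>\<^bsub>add_monoid (gwa a)\<^esub> \<in> ?I"
        using T_0 A.zero_closed rho_hom(4) by (simp del: gwa_simps)
      fix u assume "u \<in> ?I"
      then have u: "u \<in> carrier (gwa a)" "rho u \<in> T" by (simp_all del: gwa_simps)
      have "rho (\<ominus>\<^bsub>gwa a\<^esub> u) + rho u = 0"
        using rho_hom(1)[of "\<ominus>\<^bsub>gwa a\<^esub> u" u] A.l_neg[OF u(1)] A.a_inv_closed[OF u(1)] u(1) rho_hom(4)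
        by (simp del: gwa_simps)
      then have "rho (\<ominus>\<^bsub>gwa a\<^esub> u) = (- 1) * rho u" by (simp add: eq_neg_iff_add_eq_0)
      also have "\<dots> \<in> T" by (intro T_left u alg_closed)
      finally show "inv\<^bsub>add_monoid (gwa a)\<^esub> u \<in> ?I"
        using A.a_inv_closed[OF u(1)] by (simp add: a_inv_def[symmetric] del: gwa_simps)
      fix v assume "v \<in> ?I"
      then have v: "v \<in> carrier (gwa a)" "rho v \<in> T" by (simp_all del: gwa_simps)
      show "u \<otimes>\<^bsub>add_monoid (gwa a)\<^esub> v \<in> ?I"
        using A.a_closed[OF u(1) v(1)] rho_hom(1)[OF u(1) v(1)] T_add[OF u(2) v(2)]
        by (simp del: gwa_simps)
    qed
    fix u v assume "u \<in> ?I" and v: "v \<in> carrier (gwa a)"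
    then have u: "u \<in> carrier (gwa a)" "rho u \<in> T" by (simp_all del: gwa_simps)
    show "v \<otimes>\<^bsub>gwa a\<^esub> u \<in> ?I"
      using A.m_closed[OF v u(1)] rho_hom(2)[OF v u(1)] T_left[OF rho_alg[OF v] u(2)] by (simp del: gwa_simps)
    show "u \<otimes>\<^bsub>gwa a\<^esub> v \<in> ?I"
      using A.m_closed[OF u(1) v] rho_hom(2)[OF u(1) v] T_right[OF rho_alg[OF v] u(2)] by (simp del: gwa_simps)
  qed
  then have alt: "?I = {\<zero>\<^bsub>gwa a\<^esub>} \<or> ?I = carrier (gwa a)"
    using simple unfolding simple_algebra_def by blast
  obtain u where u: "u \<in> carrier (gwa a)" "rho u = p0 * q0"
    using PQ[OF nz(1,2)] rho_image by (metis imageE)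
  have "u \<in> ?I" using u T_single[OF nz(1,2)] by (simp del: gwa_simps)
  moreover have "u \<noteq> \<zero>\<^bsub>gwa a\<^esub>" using u(2) nz(3) rho_hom(4) by metis
  ultimately have "?I \<noteq> {\<zero>\<^bsub>gwa a\<^esub>}" by (metis singletonD)
  with alt have "?I = carrier (gwa a)" by (elim disjE) (erule notE, assumption, assumption)
  then have "\<one>\<^bsub>gwa a\<^esub> \<in> ?I" by (rule ssubst) (rule A.one_closed)
  then have "1 \<in> T" by (simp add: rho_hom(3) del: gwa_simps)
  then obtain L where "1 = (\<Sum>(p, q)\<leftarrow>L. p * q)" "set L \<subseteq> P \<times> Q" unfolding T_def by blast
  then show ?thesis by (intro exI[of _ L]) simp
qed

lemma dE_const_central: "r \<in> latt N N' \<Longrightarrow> dE [:c:] * r = r * dE [:c:]"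
proof -
  assume "r \<in> latt N N'"
  then obtain l u q where r: "r = (\<Sum>n=l..u. dE (q n) * dS n)" unfolding latt_def by blast
  have "dE [:c:] * (dE p * dS n) = dE p * dS n * dE [:c:]" for p n
  proof -
    have "shift_poly (- of_int n) [:c:] = [:c:]" by simp
    then have "dE p * dS n * dE [:c:] = dE (p * [:c:]) * dS n"
      by (simp only: mult.assoc dS_dE dE_simps(2))
    then show ?thesis by (simp only: mult.assoc[symmetric] dE_simps(2)[symmetric] mult.commute[of "[:c:]"])
  qed
  then show ?thesis unfolding r sum_distrib_left sum_distrib_right by (intro sum.cong refl)
qed

lemma latt_morita:
  assumes A: "gwa_model EA XA YA a" "gwa_rep.alg EA XA YA = latt N N" "\<And>c. EA [:c:] = dE [:c:]"
    and B: "gwa_model EB XB YB b" "gwa_rep.alg EB XB YB = latt N' N'" "\<And>c. EB [:c:] = dE [:c:]"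
    and simple: "simple_algebra (gwa a)" "simple_algebra (gwa b)"
    and p: "vanishing N N' 0 p" "p \<noteq> 0" and q: "vanishing N' N 0 q" "q \<noteq> 0"
  shows "morita_equivalent (U :: 'u itself) (gwa a) (gwa b)"
proof -
  interpret A: gwa_model EA XA YA a by (rule A(1))
  interpret B: gwa_model EB XB YB b by (rule B(1))
  interpret D: gwa_model dE "dS 1 * dE 1" "dS (- 1)" 1 by (rule shift_model) simp
  have pq: "dE p \<in> latt N N'" "dE q \<in> latt N' N"
    using latt_single[OF p(1)] latt_single[OF q(1)] by (simp_all add: dS_mult)
  have nz: "dE p * dE q \<noteq> 0" "dE q * dE p \<noteq> 0"
    using p(2) q(2) D.E_nonzero[of "p * q"] D.E_nonzero[of "q * p"] by (simp_all add: dE_simps(2)[symmetric])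
  have rho: "A.rho u \<in> latt N N" if "u \<in> carrier (gwa a)" for u
    using that A.rho_image A(2) by blast
  have rho': "B.rho u \<in> latt N' N'" if "u \<in> carrier (gwa b)" for u
    using that B.rho_image B(2) by blast
  interpret morita_context "gwa a" "gwa b" A.rho B.rho "latt N N'" "latt N' N"
  proof (rule morita_context.intro)
    show "\<exists>L. set L \<subseteq> latt N N' \<times> latt N' N \<and> (\<Sum>(p, q)\<leftarrow>L. p * q) = 1"
      by (rule A.trace_ideal_one[OF simple(1) _ _ _ pq nz(1)]) (auto simp: A(2) intro: latt_mult)
    show "\<exists>L. set L \<subseteq> latt N' N \<times> latt N N' \<and> (\<Sum>(p, q)\<leftarrow>L. p * q) = 1"
      by (rule B.trace_ideal_one[OF simple(2) _ _ _ pq(2,1) nz(2)]) (auto simp: B(2) intro: latt_mult)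
    show "r * s \<in> A.rho ` carrier (gwa a)" if "r \<in> latt N N'" "s \<in> latt N' N" for r s
      using latt_mult[OF that] by (simp only: A.rho_image A(2))
    show "s * r \<in> B.rho ` carrier (gwa b)" if "r \<in> latt N N'" "s \<in> latt N' N" for r s
      using latt_mult[OF that(2,1)] by (simp only: B.rho_image B(2))
    show "A.rho ((c + d) \<odot>\<^bsub>gwa a\<^esub> \<one>\<^bsub>gwa a\<^esub>) = A.rho (c \<odot>\<^bsub>gwa a\<^esub> \<one>\<^bsub>gwa a\<^esub>) + A.rho (d \<odot>\<^bsub>gwa a\<^esub> \<one>\<^bsub>gwa a\<^esub>)" for c d
      unfolding A.rho_hom(5) A.E_add[symmetric] by simp
    show "A.rho ((c * d) \<odot>\<^bsub>gwa a\<^esub> \<one>\<^bsub>gwa a\<^esub>) = A.rho (c \<odot>\<^bsub>gwa a\<^esub> \<one>\<^bsub>gwa a\<^esub>) * A.rho (d \<odot>\<^bsub>gwa a\<^esub> \<one>\<^bsub>gwa a\<^esub>)" for c d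
      unfolding A.rho_hom(5) A.E_mult[symmetric] by (simp add: mult.commute)
    show "A.rho (1 \<odot>\<^bsub>gwa a\<^esub> \<one>\<^bsub>gwa a\<^esub>) = 1"
      unfolding A.rho_hom(5) using A.E_one by (simp add: one_pCons)
    show "A.rho (c \<odot>\<^bsub>gwa a\<^esub> \<one>\<^bsub>gwa a\<^esub>) * r = r * A.rho (c \<odot>\<^bsub>gwa a\<^esub> \<one>\<^bsub>gwa a\<^esub>)"
      if "r \<in> latt N N' \<union> latt N' N" for c r
      unfolding A.rho_hom(5) A(3) using that dE_const_central by blast
    show "A.rho (c \<odot>\<^bsub>gwa a\<^esub> \<one>\<^bsub>gwa a\<^esub>) = B.rho (c \<odot>\<^bsub>gwa b\<^esub> \<one>\<^bsub>gwa b\<^esub>)" for c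
      unfolding A.rho_hom(5) B.rho_hom(5) A(3) B(3) ..
  qed (rule ring_gwa A.rho_inj B.rho_inj A.rho_hom B.rho_hom latt_zero latt_add latt_mult rho rho' | assumption)+
  show ?thesis by (rule morita)
qed

section \<open>Symmetries of the parameter\<close>

text \<open>The substitution of \<open>h + d\<close> for \<open>h\<close>.\<close>

lemma (in gwa_rep) translate_rep:
  "gwa_rep (\<lambda>p. E (shift_poly d p)) X Y (shift_poly (- d) a)"
proof
  have c: "shift_poly d (shift_poly k p) = shift_poly k (shift_poly d p)" for k p
    by (rule complex_poly_eqI) (simp add: algebra_simps)
  have i: "shift_poly d (shift_poly (- d) p) = p" for p by (rule complex_poly_eqI) simp
  show "X * E (shift_poly d p) = E (shift_poly d (shift_poly (- 1) p)) * X" for p by (simp only: c X_E)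
  show "Y * E (shift_poly d p) = E (shift_poly d (shift_poly 1 p)) * Y" for p by (simp only: c Y_E)
  show "Y * X = E (shift_poly d (shift_poly (- d) a))" by (simp only: i YX)
  show "X * Y = E (shift_poly d (shift_poly (- 1) (shift_poly (- d) a)))" by (simp only: c[of "- 1"] i XY)
qed (simp_all add: E_add E_mult E_one)

lemma (in gwa_rep) translate_comb:
  "gwa_rep.comb (\<lambda>p. E (shift_poly d p)) X Y l u p = comb l u (\<lambda>n. shift_poly d (p n))"
proof -
  interpret S: gwa_rep "\<lambda>p. E (shift_poly d p)" X Y "shift_poly (- d) a" by (rule translate_rep)
  show ?thesis by (simp add: S.comb_def comb_def S.bas_def bas_def)
qed

lemma (in gwa_rep) translate_alg: "gwa_rep.alg (\<lambda>p. E (shift_poly d p)) X Y = alg"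
proof -
  interpret S: gwa_rep "\<lambda>p. E (shift_poly d p)" X Y "shift_poly (- d) a" by (rule translate_rep)
  have "shift_poly d (shift_poly (- d) p) = p" for p by (rule complex_poly_eqI) simp
  then have "comb l u p = S.comb l u (\<lambda>n. shift_poly (- d) (p n))" for l u p
    by (simp add: translate_comb)
  then have "comb l u p \<in> S.alg" for l u p unfolding S.alg_def S.supp_in_def by blast
  then have "alg \<subseteq> S.alg" unfolding alg_def supp_in_def by blast
  moreover have "S.alg \<subseteq> alg"
    unfolding S.alg_def S.supp_in_def alg_def supp_in_def by (auto simp: translate_comb)
  ultimately show ?thesis by simp
qed

lemma (in gwa_model) translate_model:
  "gwa_model (\<lambda>p. E (shift_poly d p)) X Y (shift_poly (- d) a)"
proof -
  interpret S: gwa_rep "\<lambda>p. E (shift_poly d p)" X Y "shift_poly (- d) a" by (rule translate_rep)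
  show ?thesis
  proof
    show "shift_poly (- d) a \<noteq> 0" using a_nonzero by simp
    fix l u p n assume "S.comb l u p = 0" "l \<le> n" "n \<le> u"
    then have "shift_poly d (p n) = 0"
      using indep[of l u "\<lambda>n. shift_poly d (p n)" n] by (simp add: translate_comb)
    then show "p n = 0" by simp
  qed
qed

lemma translated_roots_model:
  "\<exists>E X Y. gwa_model E X Y (root_poly (map (\<lambda>l. l + c) L)) \<and>
     gwa_rep.alg E X Y = latt (above L) (above L) \<and> (\<forall>k. E [:k:] = dE [:k:])"
proof -
  let ?a = "Polynomial.smult 1 (root_poly L)"
  interpret gwa_model dE "dS 1 * dE ?a" "dS (- 1)" ?a
    by (rule shift_model) (simp add: root_poly_nonzero)
  have r: "shift_poly (- c) ?a = root_poly (map (\<lambda>l. l + c) L)"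
    by (rule complex_poly_eqI, induction L) (simp_all add: algebra_simps)
  have "alg = latt (above L) (above L)" by (rule shift_alg_latt[OF _ refl]) simp
  then show ?thesis
    using translate_model[of c] translate_alg[of c] unfolding r
    by (intro exI[of _ "\<lambda>p. dE (shift_poly c p)"] exI[of _ "dS 1 * dE ?a"] exI[of _ "dS (- 1)"]) simp
qed

lemma reflected_roots_model:
  "\<exists>E X Y. gwa_model E X Y (root_poly (map (\<lambda>l. c - l) L)) \<and>
     gwa_rep.alg E X Y = latt (above L) (above L) \<and> (\<forall>k. E [:k:] = dE [:k:])"
proof -
  let ?a = "Polynomial.smult ((- 1) ^ length L) (root_poly L)"
  interpret gwa_model dE "dS 1 * dE ?a" "dS (- 1)" ?a
    by (rule shift_model) (simp add: root_poly_nonzero)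
  interpret S: gwa_model "\<lambda>p. dE (pcompose p [:0, -1:])" "dS (- 1)" "dS 1 * dE ?a" "pcompose ?a [:-1, -1:]"
    by (rule swap_model)
  have r: "shift_poly (- (c + 1)) (pcompose ?a [:-1, -1:]) = root_poly (map (\<lambda>l. c - l) L)"
    by (rule complex_poly_eqI, induction L) (simp_all add: poly_pcompose algebra_simps)
  have "alg = latt (above L) (above L)" by (rule shift_alg_latt[OF _ refl]) simp
  then show ?thesis
    using S.translate_model[of "c + 1"] S.translate_alg[of "c + 1"] swap_alg unfolding r
    by (intro exI[of _ "\<lambda>p. dE (pcompose (shift_poly (c + 1) p) [:0, -1:])"]
        exI[of _ "dS (- 1)"] exI[of _ "dS 1 * dE ?a"]) simp
qed

text \<open>The affine map is realised by changing the presentation of the same ring of operators, and the roots that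
  differ by integers give lattices that contain polynomial multiples of one another.\<close>

theorem affine_roots_morita:
  assumes simple: "simple_algebra (gwa (root_poly (map \<sigma> L)))" "simple_algebra (gwa (root_poly M))"
    and shift: "list_all2 (\<lambda>l m. \<exists>k::int. m = l + of_int k) L M"
    and \<sigma>: "(\<exists>c. \<sigma> = (\<lambda>l. l + c)) \<or> (\<exists>c. \<sigma> = (\<lambda>l. c - l))"
  shows "morita_equivalent (U :: 'u itself) (gwa (root_poly (map \<sigma> L))) (gwa (root_poly M))"
proof -
  have "\<exists>K. list_all2 (\<lambda>l m. \<exists>k::int. \<bar>k\<bar> \<le> int K \<and> m = l + of_int k) L M"
    using shift
  proof (induction rule: list_all2_induct)
    case (Cons l L m M)
    then obtain k K where k: "m = l + of_int k" and K: "list_all2 (\<lambda>l m. \<exists>k::int. \<bar>k\<bar> \<le> int K \<and> m = l + of_int k) L M"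
      by blast
    have "list_all2 (\<lambda>l m. \<exists>j::int. \<bar>j\<bar> \<le> int (K + nat \<bar>k\<bar>) \<and> m = l + of_int j) L M"
      using K by (rule list_all2_mono) force
    moreover have "\<exists>j::int. \<bar>j\<bar> \<le> int (K + nat \<bar>k\<bar>) \<and> m = l + of_int j"
      using k by (intro exI[of _ k]) simp
    ultimately show ?case by (intro exI[of _ "K + nat \<bar>k\<bar>"]) (simp only: list_all2_Cons simp_thms)
  qed simp
  then obtain K where K: "list_all2 (\<lambda>l m. \<exists>k::int. \<bar>k\<bar> \<le> int K \<and> m = l + of_int k) L M" by blast
  have "list_all2 (\<lambda>m l. \<exists>k::int. \<bar>k\<bar> \<le> int K \<and> l = m + of_int k) M L"
  proof -
    have "\<exists>k::int. \<bar>k\<bar> \<le> int K \<and> l = m + of_int k" if lm: "\<exists>k::int. \<bar>k\<bar> \<le> int K \<and> m = l + of_int k" for l m :: complex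
    proof -
      obtain k :: int where "\<bar>k\<bar> \<le> int K" "m = l + of_int k" using lm by blast
      then show ?thesis by (intro exI[of _ "- k"]) simp
    qed
    then show ?thesis using K by (auto simp: list_all2_conv_all_nth)
  qed
  note v = vanishing_integral_shift[OF K] vanishing_integral_shift[OF this]
  have nz: "shift_factor (root_poly L') (int K) \<noteq> 0" for L'
    by (simp add: shift_factor_def root_poly_nonzero)
  obtain E X Y where A: "gwa_model E X Y (root_poly (map \<sigma> L))"
    "gwa_rep.alg E X Y = latt (above L) (above L)" "\<And>k. E [:k:] = dE [:k:]"
    using \<sigma> translated_roots_model[of _ L] reflected_roots_model[of _ L] by metis
  have "map (\<lambda>l. l + 0) M = M" by simp
  then obtain E' X' Y' where B: "gwa_model E' X' Y' (root_poly M)"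
    "gwa_rep.alg E' X' Y' = latt (above M) (above M)" "\<And>k. E' [:k:] = dE [:k:]"
    using translated_roots_model[of 0 M] by metis
  show ?thesis by (rule latt_morita[OF A B simple v(1) nz v(2) nz])
qed

section \<open>Cardinality of the universe\<close>

text \<open>A complex number is determined by the rationals below its real and imaginary parts, so a countable
  family of them is a set of natural numbers up to coding, and there are only continuum many such sets.\<close>

lemma countable_family_encoding:
  assumes "\<exists>f :: complex \<Rightarrow> 'u. inj f"
  shows "\<exists>e :: ('c::countable \<Rightarrow> complex) \<Rightarrow> 'u. inj e"
proof -
  define T :: "('c \<Rightarrow> complex) \<Rightarrow> nat set" where
    "T f = to_nat ` {(n, b, q). (of_rat q :: real) < (if b then Re (f n) else Im (f n))}" for f
  have part: "x \<le> y" if "\<And>q :: rat. (of_rat q :: real) < x \<Longrightarrow> of_rat q < y" for x y :: real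
  proof (rule ccontr)
    assume "\<not> x \<le> y"
    then obtain q :: rat where "y < of_rat q" "of_rat q < x" using of_rat_dense[of y x] by auto
    then show False using that[of q] by simp
  qed
  have le: "Re (f n) \<le> Re (g n) \<and> Im (f n) \<le> Im (g n)" if T: "T f = T g" for f g n
  proof -
    have "{(n, b, q). (of_rat q :: real) < (if b then Re (f n) else Im (f n))}
        = {(n, b, q). (of_rat q :: real) < (if b then Re (g n) else Im (g n))}"
      using T unfolding T_def by (simp only: inj_image_eq_iff[OF inj_to_nat])
    then have "(n, b, q) \<in> {(n, b, q). (of_rat q :: real) < (if b then Re (f n) else Im (f n))}
        \<longleftrightarrow> (n, b, q) \<in> {(n, b, q). (of_rat q :: real) < (if b then Re (g n) else Im (g n))}" for b q
      by (simp only:)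
    from this[of True] this[of False] show ?thesis by (auto intro!: part)
  qed
  have "inj T"
  proof (rule injI, rule ext, rule complex_eqI)
    fix f g n assume "T f = T g"
    then show "Re (f n) = Re (g n)" "Im (f n) = Im (g n)" using le[of f g n] le[of g f n] by auto
  qed
  moreover obtain r :: "nat set \<Rightarrow> real" where "inj r"
    using nat_sets_lepoll_reals01 unfolding lepoll_def by blast
  moreover obtain f :: "complex \<Rightarrow> 'u" where "inj f" using assms by blast
  ultimately have "inj (f \<circ> complex_of_real \<circ> r \<circ> T)"
    by (intro inj_compose) (auto simp: inj_def)
  then show ?thesis by blast
qed

text \<open>An element is given by a family of coefficients indexed by a countable set.\<close>

lemma (in gwa_rep) alg_encoding:
  assumes "\<exists>f :: complex \<Rightarrow> 'u. inj f"
  shows "\<exists>e :: 'r \<Rightarrow> 'u. inj_on e alg"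
proof -
  define F :: "int \<times> int \<times> (int \<Rightarrow> complex poly) \<Rightarrow> bool + int \<times> nat \<Rightarrow> complex" where
    "F = (\<lambda>(l, u, p) x. case x of Inl b \<Rightarrow> of_int (if b then l else u) | Inr (n, k) \<Rightarrow> coeff (p n) k)"
  have F: "inj F"
  proof (rule injI)
    fix t t' assume eq: "F t = F t'"
    obtain l u p l' u' p' where t: "t = (l, u, p)" "t' = (l', u', p')" by (metis prod.exhaust)
    have "l = l'" "u = u'" using fun_cong[OF eq, of "Inl True"] fun_cong[OF eq, of "Inl False"]
      by (simp_all add: t F_def)
    moreover have "p n = p' n" for n
      by (rule poly_eqI) (use fun_cong[OF eq, of "Inr (n, _)"] in \<open>simp add: t F_def\<close>)
    ultimately show "t = t'" by (auto simp: t)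
  qed
  obtain e :: "(bool + int \<times> nat \<Rightarrow> complex) \<Rightarrow> 'u" where e: "inj e"
    using countable_family_encoding[OF assms] by blast
  define c where "c r = (SOME (l, u, p). r = comb l u p)" for r
  have c: "r = (case c r of (l, u, p) \<Rightarrow> comb l u p)" if "r \<in> alg" for r
  proof -
    have "\<exists>t. case t of (l, u, p) \<Rightarrow> r = comb l u p"
      using that by (auto simp: alg_def supp_in_def)
    from someI_ex[OF this] show ?thesis unfolding c_def by (auto split: prod.splits)
  qed
  then have "inj_on c alg" by (metis inj_onI)
  then have "inj_on (e \<circ> F \<circ> c) alg"
    using e F by (intro comp_inj_on) (auto intro: inj_on_subset)
  then show ?thesis by blast
qed

section \<open>Double roots are visible in the module category\<close>

lemma root_poly_zero_iff: "poly (root_poly L) z = 0 \<longleftrightarrow> z \<in> set L"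
  by (induction L) (auto simp del: mult_pCons_left)

lemma root_poly_mset: "mset L = mset M \<Longrightarrow> root_poly L = root_poly M"
  unfolding root_poly_def by (metis mset_map prod_mset_prod_list)

lemma imaginary_roots_gap_free:
  assumes "\<And>l. l \<in> set L \<Longrightarrow> Re l = 0"
  shows "integral_gap_free (root_poly L)"
  unfolding integral_gap_free_def root_poly_zero_iff
proof (intro allI impI notI)
  fix z and k :: nat assume "z \<in> set L" "z + of_nat (Suc k) \<in> set L"
  then have "Re z = 0" "Re (z + of_nat (Suc k)) = 0" using assms by blast+
  then show False by simp
qed

lemma distinct_roots_simple:
  assumes "distinct L"
  shows "simple_roots (root_poly L)"
  unfolding simple_roots_def root_poly_zero_iff
proof (intro allI impI)
  fix z assume z: "z \<in> set L"
  have "root_poly L = root_poly (z # remove1 z L)" by (rule root_poly_mset) (use z in simp)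
  then show "\<exists>g. root_poly L = [:- z, 1:] * g \<and> poly g z \<noteq> 0"
    using assms by (intro exI[of _ "root_poly (remove1 z L)"]) (simp add: root_poly_zero_iff del: mult_pCons_left)
qed

text \<open>Imaginary roots cannot differ by a nonzero integer, so the only difference between the two algebras is
  the multiplicity of a root, which heredity detects.\<close>

theorem double_root_not_morita:
  assumes universe: "\<exists>f :: complex \<Rightarrow> 'u. inj f"
    and L: "\<not> distinct L" "\<And>l. l \<in> set L \<Longrightarrow> Re l = 0"
    and M: "distinct M" "\<And>l. l \<in> set M \<Longrightarrow> Re l = 0"
  shows "\<not> morita_equivalent (U :: 'u itself) (gwa (root_poly L)) (gwa (root_poly M))"
proof
  let ?a = "root_poly L" and ?b = "root_poly M"
  assume "morita_equivalent U (gwa ?a) (gwa ?b)"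
  then have eq: "morita_equivalent U (gwa ?b) (gwa ?a)"
    unfolding morita_equivalent_def by blast
  interpret B: gwa_model dE "dS 1 * dE ?b" "dS (- 1)" ?b by (rule shift_model[OF root_poly_nonzero])
  obtain e :: "complex fop \<Rightarrow> 'u" where "inj_on e B.alg" using B.alg_encoding[OF universe] by blast
  from B.gwa_hereditary_separator[OF distinct_roots_simple[OF M(1)] imaginary_roots_gap_free[OF M(2)] this]
  obtain P :: "(free_alg set, 'u) module" where P: "hereditary_separator (gwa ?a) P"
    using hereditary_separator_morita[OF eq] by blast
  obtain xs ys zs \<mu> where "L = xs @ [\<mu>] @ ys @ [\<mu>] @ zs" using not_distinct_decomp[OF L(1)] by blast
  then have "mset L = mset (\<mu> # \<mu> # xs @ ys @ zs)" and \<mu>: "\<mu> \<in> set L" by simp_all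
  then have a: "?a = [:- \<mu>, 1:] * [:- \<mu>, 1:] * root_poly (xs @ ys @ zs)"
    using root_poly_mset[of L] by (simp only: root_poly_simps mult.assoc)
  have gap: "poly ?a (\<mu> - of_nat (Suc k)) \<noteq> 0" for k
  proof
    assume "poly ?a (\<mu> - of_nat (Suc k)) = 0"
    then have "Re (\<mu> - of_nat (Suc k)) = 0" "Re \<mu> = 0" using L(2) \<mu> unfolding root_poly_zero_iff by blast+
    then show False by simp
  qed
  have "\<exists>e :: (int \<Rightarrow> complex) \<Rightarrow> 'u. inj e" by (rule countable_family_encoding[OF universe])
  from double_root_no_hereditary_separator[OF a gap this] P show False by blast
qed

section \<open>The six matrices\<close>

text \<open>The entries of \<open>1\<close>, \<open>M\<close>, \<open>M\<^sup>2\<close> and their negatives, where \<open>M = N\<^sub>1 N\<^sub>2\<close> has order three.\<close>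

definition six_entries :: "(int \<times> int \<times> int \<times> int) set" where
  "six_entries = {(1, 0, 0, 1), (0, -1, 1, -1), (-1, 1, -1, 0), (-1, 0, 0, -1), (0, 1, -1, 1), (1, -1, 1, 0)}"

abbreviation entries :: "int ^ 2 ^ 2 \<Rightarrow> int \<times> int \<times> int \<times> int" where
  "entries N \<equiv> (N$1$1, N$1$2, N$2$1, N$2$2)"

lemma entries_eq_iff: "N = N' \<longleftrightarrow> entries N = entries N'"
  by (auto simp: vec_eq_iff forall_2)

lemma entries_mult:
  fixes N N' :: "int ^ 2 ^ 2"
  shows "entries (N ** N') = (N$1$1 * N'$1$1 + N$1$2 * N'$2$1, N$1$1 * N'$1$2 + N$1$2 * N'$2$2,
     N$2$1 * N'$1$1 + N$2$2 * N'$2$1, N$2$1 * N'$1$2 + N$2$2 * N'$2$2)"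
  by (simp add: matrix_matrix_mult_def sum_2)

lemma entries_simps:
  "entries (mat 1) = (1, 0, 0, 1)" "entries (- mat 1) = (-1, 0, 0, -1)"
  "entries (vector [vector [p, q], vector [r, s]]) = (p, q, r, s)"
  by (simp_all add: mat_def)

lemma six_entries_mult:
  assumes "(p, q, r, s) \<in> six_entries" "(p', q', r', s') \<in> six_entries"
  shows "(p * p' + q * r', p * q' + q * s', r * p' + s * r', r * q' + s * s') \<in> six_entries"
  using assms unfolding six_entries_def by (elim insertE emptyE; simp)

lemma generate_six:
  assumes M: "entries M = (0, -1, 1, -1)"
  shows "generate SL2Z {M, - mat 1} = {N. entries N \<in> six_entries}"
proof (rule Set.set_eqI, unfold mem_Collect_eq, rule iffI)
  let ?H = "{M, - mat 1} :: (int ^ 2 ^ 2) set"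
  interpret group SL2Z by (rule group_SL2Z)
  have S: "mult SL2Z = (**)" "one SL2Z = mat 1" "carrier SL2Z = {N. N$1$1 * N$2$2 - N$1$2 * N$2$1 = 1}"
    by (simp_all add: SL2Z_def det_2)
  have M': "M$1$1 = 0" "M$1$2 = -1" "M$2$1 = 1" "M$2$2 = -1" using M by simp_all
  have I: "(- mat 1 :: int^2^2)$1$1 = -1" "(- mat 1 :: int^2^2)$1$2 = 0" "(- mat 1 :: int^2^2)$2$1 = 0" "(- mat 1 :: int^2^2)$2$2 = -1"
    "(mat 1 :: int^2^2)$1$1 = 1" "(mat 1 :: int^2^2)$1$2 = 0" "(mat 1 :: int^2^2)$2$1 = 0" "(mat 1 :: int^2^2)$2$2 = 1"
    by (simp_all add: mat_def)
  note Q = entries_mult[unfolded prod.inject, THEN conjunct1]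
    entries_mult[unfolded prod.inject, THEN conjunct2, THEN conjunct1]
    entries_mult[unfolded prod.inject, THEN conjunct2, THEN conjunct2, THEN conjunct1]
    entries_mult[unfolded prod.inject, THEN conjunct2, THEN conjunct2, THEN conjunct2]
  have MM: "inv\<^bsub>SL2Z\<^esub> M = M ** M"
    by (rule inv_equality) (simp_all only: S entries_eq_iff Q M' I mem_Collect_eq, simp_all)
  have II: "inv\<^bsub>SL2Z\<^esub> (- mat 1) = - mat 1"
    by (rule inv_equality) (simp_all only: S entries_eq_iff Q M' I mem_Collect_eq, simp_all)
  fix N :: "int ^ 2 ^ 2"
  show "entries N \<in> six_entries" if "N \<in> generate SL2Z ?H"
    using that
  proof (induction rule: generate.induct)
    case one
    then show ?case by (simp only: S I) (simp add: six_entries_def)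
  next
    case (incl h)
    then consider "h = M" | "h = - mat 1" by blast
    then show ?case by cases (simp_all only: M' I, simp_all add: six_entries_def)
  next
    case (inv h)
    then consider "h = M" | "h = - mat 1" by blast
    then show ?case by cases (simp_all only: MM II Q M' I, simp_all add: six_entries_def)
  next
    case (eng h k)
    show ?case unfolding S Q by (rule six_entries_mult[OF eng.IH])
  qed
  assume N: "entries N \<in> six_entries"
  note g = generate.one[of SL2Z ?H] generate.incl[of M ?H SL2Z] generate.incl[of "- mat 1" ?H SL2Z]
  note g' = g(1)[unfolded S(2)] g(2)[OF insertI1] g(3)[OF insertI2[OF singletonI]]
  note e = generate.eng[of _ SL2Z ?H, unfolded S(1)]
  have "mat 1 \<in> generate SL2Z ?H" "M \<in> generate SL2Z ?H" "M ** M \<in> generate SL2Z ?H"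
    "- mat 1 \<in> generate SL2Z ?H" "M ** - mat 1 \<in> generate SL2Z ?H" "M ** M ** - mat 1 \<in> generate SL2Z ?H"
    by (intro g' e)+
  moreover have "N = mat 1 \<or> N = M \<or> N = M ** M \<or> N = - mat 1 \<or> N = M ** - mat 1 \<or> N = M ** M ** - mat 1"
    using N unfolding entries_eq_iff Q M' I six_entries_def insert_iff empty_iff prod.inject
    by simp
  ultimately show "N \<in> generate SL2Z ?H" by metis
qed

text \<open>Two of the numbers \<open>u\<close>, \<open>v\<close> and \<open>0\<close> coincide; for \<open>u\<close> and \<open>v\<close> differences of roots from a third
  root, this is the presence of a multiple root.\<close>

definition wall :: "int \<Rightarrow> int \<Rightarrow> bool" where
  "wall u v \<longleftrightarrow> u = 0 \<or> v = 0 \<or> u = v"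

text \<open>The images of \<open>(1, 0)\<close>, \<open>(0, 1)\<close> and \<open>(1, 1)\<close> are primitive vectors on the walls, hence up to sign again among
  these three; since the third is the sum of the other two, only finitely many matrices are left.\<close>

lemma wall_preserving_six:
  assumes det: "p * s - q * r = 1" and walls: "wall p r" "wall q s" "wall (p + q) (r + s)"
  shows "(p, q, r, s) \<in> six_entries"
proof -
  have unit: "x = 1 \<and> y = 1 \<or> x = -1 \<and> y = -1" if "x * y = 1" for x y :: int
    using that by (simp add: zmult_eq_1_iff)
  consider "p = 0" | "r = 0" | "p = r" using walls(1) by (auto simp: wall_def)
  then show ?thesis
  proof cases
    case 1
    then have "(- q) * r = 1" using det by simp
    from unit[OF this] show ?thesis using walls 1
      unfolding wall_def six_entries_def insert_iff empty_iff prod.inject by presburger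
  next
    case 2
    then have "p * s = 1" using det by simp
    from unit[OF this] show ?thesis using walls 2
      unfolding wall_def six_entries_def insert_iff empty_iff prod.inject by presburger
  next
    case 3
    then have "p * (s - q) = 1" using det by (simp add: algebra_simps)
    from unit[OF this] show ?thesis using walls 3
      unfolding wall_def six_entries_def insert_iff empty_iff prod.inject by presburger
  qed
qed

text \<open>The matrix \<open>M\<close> of order three permutes the differences of the three roots cyclically, and \<open>-1\<close>
  reverses their signs; a common summand \<open>c\<close> restores the roots from the differences.\<close>

lemma six_entries_affine:
  fixes l1 l2 l3 x1 x2 x3 :: complex
  assumes six: "(p, q, r, s) \<in> six_entries"
    and x1: "x1 = x3 - ((- l1 + l3) * of_int p + (- l2 + l3) * of_int q)"
    and x2: "x2 = x3 - ((- l1 + l3) * of_int r + (- l2 + l3) * of_int s)"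
  shows "\<exists>\<sigma>. ((\<exists>c. \<sigma> = (\<lambda>x. x + c)) \<or> (\<exists>c. \<sigma> = (\<lambda>x. c - x))) \<and> mset (map \<sigma> [x1, x2, x3]) = mset [l1, l2, l3]"
proof -
  have plus: ?thesis if "mset [x1 + c, x2 + c, x3 + c] = mset [l1, l2, l3]" for c
    using that by (intro exI[of _ "\<lambda>x. x + c"]) auto
  have minus: ?thesis if "mset [c - x1, c - x2, c - x3] = mset [l1, l2, l3]" for c
    using that by (intro exI[of _ "\<lambda>x. c - x"]) auto
  show ?thesis
    using six unfolding six_entries_def
  proof (elim insertE emptyE)
    assume "(p, q, r, s) = (1, 0, 0, 1)"
    then show ?thesis by (intro plus[of "l3 - x3"]) (simp add: x1 x2 algebra_simps)
  next
    assume "(p, q, r, s) = (0, -1, 1, -1)"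
    then show ?thesis by (intro plus[of "l2 - x3"]) (simp add: x1 x2 algebra_simps add_mset_commute)
  next
    assume "(p, q, r, s) = (-1, 1, -1, 0)"
    then show ?thesis by (intro plus[of "l1 - x3"]) (simp add: x1 x2 algebra_simps add_mset_commute)
  next
    assume "(p, q, r, s) = (-1, 0, 0, -1)"
    then show ?thesis by (intro minus[of "l3 + x3"]) (simp add: x1 x2 algebra_simps)
  next
    assume "(p, q, r, s) = (0, 1, -1, 1)"
    then show ?thesis by (intro minus[of "l2 + x3"]) (simp add: x1 x2 algebra_simps add_mset_commute)
  next
    assume "(p, q, r, s) = (1, -1, 1, 0)"
    then show ?thesis by (intro minus[of "l1 + x3"]) (simp add: x1 x2 algebra_simps add_mset_commute)
  qed
qed

section \<open>The group\<close>

theorem proposition3p3p1: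
  fixes U :: "'u itself"
    and N1 N2 :: "int ^ 2 ^ 2"
    and G6 G :: "(int ^ 2 ^ 2) set"
  assumes universe: "\<exists>f :: complex \<Rightarrow> 'u. inj f"
    and N1: "N1 = vector [vector [0, 1], vector [1, 0]]"
    and N2: "N2 = vector [vector [1, -1], vector [0, -1]]"
    and G6: "G6 = generate SL2Z {N1 ** N2, - mat 1}"
    and G: "G = {N \<in> carrier SL2Z.
      \<forall>(l1 :: complex) l2 l3 (m1 :: complex) m2 m3.
        let a = [:- l1, 1:] * [:- l2, 1:] * [:- l3, 1:];
            b = [:- m1, 1:] * [:- m2, 1:] * [:- m3, 1:]
        in simple_algebra (gwa a) \<and> simple_algebra (gwa b) \<and>
           (\<exists>k1 k2 :: int.
              (- l1 + l3) * of_int (N$1$1) + (- l2 + l3) * of_int (N$1$2)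
                = of_int k1 + (- m1 + m3) \<and>
              (- l1 + l3) * of_int (N$2$1) + (- l2 + l3) * of_int (N$2$2)
                = of_int k2 + (- m2 + m3))
           \<longrightarrow> morita_equivalent U (gwa a) (gwa b)}"
  shows "G = G6"
proof -
  have rp: "[:- l1, 1:] * [:- l2, 1:] * [:- l3, 1:] = root_poly [l1, l2, l3]" for l1 l2 l3
    by (simp only: root_poly_simps mult.assoc mult_1_right)
  have G6': "G6 = {N. entries N \<in> six_entries}"
    unfolding G6 N1 N2 N1_N2_product by (rule generate_six) (rule entries_simps)
  have sl: "N \<in> carrier SL2Z \<longleftrightarrow> N$1$1 * N$2$2 - N$1$2 * N$2$1 = 1" for N
    by (simp add: SL2Z_def det_2)
  show ?thesis
  proof (rule Set.set_eqI, rule iffI)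
    fix N assume "N \<in> G6"
    then have six: "entries N \<in> six_entries" by (simp add: G6')
    then have "N \<in> carrier SL2Z" unfolding sl by (auto simp: six_entries_def)
    moreover have "morita_equivalent U (gwa (root_poly [l1, l2, l3])) (gwa (root_poly [m1, m2, m3]))"
      if simple: "simple_algebra (gwa (root_poly [l1, l2, l3]))" "simple_algebra (gwa (root_poly [m1, m2, m3]))"
        and k: "(- l1 + l3) * of_int (N$1$1) + (- l2 + l3) * of_int (N$1$2) = of_int k1 + (- m1 + m3)"
          "(- l1 + l3) * of_int (N$2$1) + (- l2 + l3) * of_int (N$2$2) = of_int k2 + (- m2 + m3)"
      for l1 l2 l3 m1 m2 m3 and k1 k2 :: int
    proof -
      let ?x1 = "m1 - of_int k1" and ?x2 = "m2 - of_int k2"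
      have "?x1 = m3 - ((- l1 + l3) * of_int (N$1$1) + (- l2 + l3) * of_int (N$1$2))"
        "?x2 = m3 - ((- l1 + l3) * of_int (N$2$1) + (- l2 + l3) * of_int (N$2$2))"
        unfolding k by simp_all
      from six_entries_affine[OF six this] obtain \<sigma> where
        \<sigma>: "(\<exists>c. \<sigma> = (\<lambda>x. x + c)) \<or> (\<exists>c. \<sigma> = (\<lambda>x. c - x))"
          "mset (map \<sigma> [?x1, ?x2, m3]) = mset [l1, l2, l3]" by blast
      note eq = root_poly_mset[OF \<sigma>(2)]
      have "list_all2 (\<lambda>l m. \<exists>k::int. m = l + of_int k) [?x1, ?x2, m3] [m1, m2, m3]"
        by (auto intro: exI[of _ k1] exI[of _ k2] exI[of _ 0])
      from affine_roots_morita[OF simple[folded eq] this \<sigma>(1)] show ?thesis unfolding eq .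
    qed
    ultimately show "N \<in> G" unfolding G Let_def rp by blast
  next
    fix N assume NG: "N \<in> G"
    then have N: "N$1$1 * N$2$2 - N$1$2 * N$2$1 = 1" unfolding G by (simp add: sl)
    have wall: "wall (N$1$1 * w1 + N$1$2 * w2) (N$2$1 * w1 + N$2$2 * w2)" if w: "wall w1 w2" for w1 w2 :: int
    proof (rule ccontr)
      let ?e1 = "N$1$1 * w1 + N$1$2 * w2" and ?e2 = "N$2$1 * w1 + N$2$2 * w2"
      \<comment> \<open>The factor \<open>\<i>\<close> keeps nonzero integers out of the differences of roots.\<close>
      let ?L = "\<lambda>u v :: int. [- \<i> * of_int u, - \<i> * of_int v, 0]"
      assume "\<not> wall ?e1 ?e2"
      then have M: "distinct (?L ?e1 ?e2)" by (auto simp: wall_def simp del: of_int_add of_int_mult)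
      have L: "\<not> distinct (?L w1 w2)" using w by (auto simp: wall_def)
      have im: "Re l = 0" if "l \<in> set (?L u v)" for l u v using that by auto
      have simple: "simple_algebra (gwa (root_poly (?L u v)))" for u v
        by (rule gwa_model.gwa_simple[OF shift_model[OF root_poly_nonzero] imaginary_roots_gap_free[OF im]])
      have "morita_equivalent U (gwa (root_poly (?L w1 w2))) (gwa (root_poly (?L ?e1 ?e2)))"
      proof -
        have "\<exists>k1 k2 :: int.
          (- (- \<i> * of_int w1) + 0) * of_int (N$1$1) + (- (- \<i> * of_int w2) + 0) * of_int (N$1$2)
            = of_int k1 + (- (- \<i> * of_int ?e1) + 0) \<and>
          (- (- \<i> * of_int w1) + 0) * of_int (N$2$1) + (- (- \<i> * of_int w2) + 0) * of_int (N$2$2)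
            = of_int k2 + (- (- \<i> * of_int ?e2) + 0)"
          by (intro exI[of _ 0]) (simp add: algebra_simps)
        then show ?thesis using NG simple unfolding G Let_def rp by blast
      qed
      then show False using double_root_not_morita[OF universe L im[of _ w1 w2] M im[of _ ?e1 ?e2]] by simp
    qed
    have "entries N \<in> six_entries"
      using wall_preserving_six[OF N] wall[of 1 0] wall[of 0 1] wall[of 1 1] by (simp add: wall_def)
    then show "N \<in> G6" by (simp add: G6')
  qed
qed

end
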